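(* For any $\Pi^1_1$-sound extension $T$ of $\mathsf{ACA}_0^+$, $|T|_{\mathsf{ACA}_0}=|T|_{\mathsf{WO}}$.
   Context: A theory $T$ in the language of second-order arithmetic is a recursively enumerable theory, given intensionally by a $\Sigma_1$ formula $\mathsf{Ax}_T(x)$ that defines, in the standard model, the set of Gödel numbers of the axioms of $T$; $\mathsf{Pr}_T$ is its $\Sigma_1$ provability predicate. $T$ is $\Pi^1_1$-sound if every $\Pi^1_1$ theorem of $T$ is true. $\mathsf{RFN}_{\Pi^1_1}(T)$ is the sentence expressing the $\Pi^1_1$-soundness of $T$: $\forall\varphi\in\Pi^1_1\,(\mathsf{Pr}_T(\varphi)\to\mathsf{Tr}_{\Pi^1_1}(\varphi))$, with $\mathsf{Tr}_{\Pi^1_1}$ a partial truth definition for $\Pi^1_1$ formulas over $\mathsf{ACA}_0$. Write $T\prec_{\Pi^1_1}U$ if $U\vdash\mathsf{RFN}_{\Pi^1_1}(T)$. The reflection rank $|T|_{\mathsf{ACA}_0}$ of a $\Pi^1_1$-sound extension $T$ of $\mathsf{ACA}_0$ is the rank of $T$ in the (well-founded) relation $\prec_{\Pi^1_1}$ restricted to $\Pi^1_1$-sound extensions of $\mathsf{ACA}_0$, where rank is defined by $\rho(T)=\sup\{\rho(S)+1: S\prec_{\Pi^1_1}T\}$. The proof-theoretic ordinal $|T|_{\mathsf{WO}}$ is the supremum of the order types of $T$-provably well-founded primitive recursive linear orders. $\mathsf{ACA}_0^+$ is axiomatized over $\mathsf{ACA}_0$ by the statement ``for every $X$, the $\omega^{\mathrm{th}}$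 jump of $X$ exists''. *)

theory Defs
  imports Main
begin

section \<open>The language of second-order arithmetic\<close>

text \<open>
  Formulas are in de Bruijn style, with separate index spaces for number variables
  (bound by \<open>AllN\<close>) and set variables (bound by \<open>AllS\<close>).
\<close>

datatype tm = Var nat | Zero | One | Plus tm tm | Times tm tm

datatype fm =
    Eq tm tm | Less tm tm | Mem tm nat | Fls | Imp fm fm | AllN fm | AllS fm

instantiation tm :: "{zero, one, plus, times}"
begin
definition "0 = Zero"
definition "1 = One"
definition "s + t = Plus s t"
definition "s * t = Times s t"
instance ..
end

definition Neg :: "fm \<Rightarrow> fm" where "Neg p = Imp p Fls"
definition Conj :: "fm \<Rightarrow> fm \<Rightarrow> fm" where "Conj p q = Neg (Imp p (Neg q))"
definition Disj :: "fm \<Rightarrow> fm \<Rightarrow> fm" where "Disj p q = Imp (Neg p) q"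
definition Iff :: "fm \<Rightarrow> fm \<Rightarrow> fm" where "Iff p q = Conj (Imp p q) (Imp q p)"
definition ExN :: "fm \<Rightarrow> fm" where "ExN p = Neg (AllN (Neg p))"
definition ExS :: "fm \<Rightarrow> fm" where "ExS p = Neg (AllS (Neg p))"

primrec lift_tm :: "nat \<Rightarrow> tm \<Rightarrow> tm" where
  "lift_tm k (Var n) = (if n < k then Var n else Var (Suc n))"
| "lift_tm k Zero = Zero"
| "lift_tm k One = One"
| "lift_tm k (Plus s t) = Plus (lift_tm k s) (lift_tm k t)"
| "lift_tm k (Times s t) = Times (lift_tm k s) (lift_tm k t)"

primrec subst_tm :: "nat \<Rightarrow> tm \<Rightarrow> tm \<Rightarrow> tm" where
  "subst_tm k u (Var n) = (if n < k then Var n else if n = k then u else Var (n - 1))"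
| "subst_tm k u Zero = Zero"
| "subst_tm k u One = One"
| "subst_tm k u (Plus s t) = Plus (subst_tm k u s) (subst_tm k u t)"
| "subst_tm k u (Times s t) = Times (subst_tm k u s) (subst_tm k u t)"

fun lift :: "nat \<Rightarrow> fm \<Rightarrow> fm" where
  "lift k (Eq s t) = Eq (lift_tm k s) (lift_tm k t)"
| "lift k (Less s t) = Less (lift_tm k s) (lift_tm k t)"
| "lift k (Mem s n) = Mem (lift_tm k s) n"
| "lift k Fls = Fls"
| "lift k (Imp p q) = Imp (lift k p) (lift k q)"
| "lift k (AllN p) = AllN (lift (k + 1) p)"
| "lift k (AllS p) = AllS (lift k p)"

fun subst :: "nat \<Rightarrow> tm \<Rightarrow> fm \<Rightarrow> fm" where
  "subst k u (Eq s t) = Eq (subst_tm k u s) (subst_tm k u t)"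
| "subst k u (Less s t) = Less (subst_tm k u s) (subst_tm k u t)"
| "subst k u (Mem s n) = Mem (subst_tm k u s) n"
| "subst k u Fls = Fls"
| "subst k u (Imp p q) = Imp (subst k u p) (subst k u q)"
| "subst k u (AllN p) = AllN (subst (k + 1) (lift_tm 0 u) p)"
| "subst k u (AllS p) = AllS (subst k u p)"

fun liftS :: "nat \<Rightarrow> fm \<Rightarrow> fm" where
  "liftS k (Eq s t) = Eq s t"
| "liftS k (Less s t) = Less s t"
| "liftS k (Mem s n) = Mem s (if n < k then n else n + 1)"
| "liftS k Fls = Fls"
| "liftS k (Imp p q) = Imp (liftS k p) (liftS k q)"
| "liftS k (AllN p) = AllN (liftS k p)"
| "liftS k (AllS p) = AllS (liftS (k + 1) p)"

text \<open>\<open>substS k m p\<close> replaces the set variable \<open>k\<close> by the set variable \<open>m\<close>.\<close>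

fun substS :: "nat \<Rightarrow> nat \<Rightarrow> fm \<Rightarrow> fm" where
  "substS k m (Eq s t) = Eq s t"
| "substS k m (Less s t) = Less s t"
| "substS k m (Mem s n) = Mem s (if n < k then n else if n = k then m else n - 1)"
| "substS k m Fls = Fls"
| "substS k m (Imp p q) = Imp (substS k m p) (substS k m q)"
| "substS k m (AllN p) = AllN (substS k m p)"
| "substS k m (AllS p) = AllS (substS (k + 1) (m + 1) p)"

text \<open>\<open>closed m s p\<close>: the free number variables of \<open>p\<close> are below \<open>m\<close>, its free set variables below \<open>s\<close>.\<close>

primrec closed_tm :: "nat \<Rightarrow> tm \<Rightarrow> bool" where
  "closed_tm m (Var n) = (n < m)"
| "closed_tm m Zero = True"
| "closed_tm m One = True"
| "closed_tm m (Plus s t) = (closed_tm m s \<and> closed_tm m t)"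
| "closed_tm m (Times s t) = (closed_tm m s \<and> closed_tm m t)"

fun closed :: "nat \<Rightarrow> nat \<Rightarrow> fm \<Rightarrow> bool" where
  "closed m s (Eq t u) = (closed_tm m t \<and> closed_tm m u)"
| "closed m s (Less t u) = (closed_tm m t \<and> closed_tm m u)"
| "closed m s (Mem t n) = (closed_tm m t \<and> n < s)"
| "closed m s Fls = True"
| "closed m s (Imp p q) = (closed m s p \<and> closed m s q)"
| "closed m s (AllN p) = closed (m + 1) s p"
| "closed m s (AllS p) = closed m (s + 1) p"

abbreviation sentence :: "fm \<Rightarrow> bool" where "sentence p \<equiv> closed 0 0 p"

primrec arithmetical :: "fm \<Rightarrow> bool" where
  "arithmetical (Eq s t) = True"
| "arithmetical (Less s t) = True"
| "arithmetical (Mem s n) = True"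
| "arithmetical Fls = True"
| "arithmetical (Imp p q) = (arithmetical p \<and> arithmetical q)"
| "arithmetical (AllN p) = arithmetical p"
| "arithmetical (AllS p) = False"

definition Pi11 :: "fm \<Rightarrow> bool" where
  "Pi11 p \<longleftrightarrow> (\<exists>q. arithmetical q \<and> p = AllS q)"

text \<open>Bounded quantifiers; the bound \<open>t\<close> lives outside the scope of the quantifier.\<close>

definition AllB :: "tm \<Rightarrow> fm \<Rightarrow> fm" where
  "AllB t p = AllN (Imp (Less (Var 0) (lift_tm 0 t)) p)"
definition ExB :: "tm \<Rightarrow> fm \<Rightarrow> fm" where
  "ExB t p = Neg (AllB t (Neg p))"

inductive Delta0 :: "fm \<Rightarrow> bool" where
  "Delta0 (Eq s t)"
| "Delta0 (Less s t)"
| "Delta0 (Mem s n)"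
| "Delta0 Fls"
| "Delta0 p \<Longrightarrow> Delta0 q \<Longrightarrow> Delta0 (Imp p q)"
| "Delta0 p \<Longrightarrow> Delta0 (AllB t p)"

definition Sigma1 :: "fm \<Rightarrow> bool" where
  "Sigma1 p \<longleftrightarrow> (\<exists>q. Delta0 q \<and> p = ExN q)"

subsection \<open>Truth in the standard model\<close>

primrec tval :: "(nat \<Rightarrow> nat) \<Rightarrow> tm \<Rightarrow> nat" where
  "tval e (Var n) = e n"
| "tval e Zero = 0"
| "tval e One = 1"
| "tval e (Plus s t) = tval e s + tval e t"
| "tval e (Times s t) = tval e s * tval e t"

fun sat :: "(nat \<Rightarrow> nat) \<Rightarrow> (nat \<Rightarrow> nat set) \<Rightarrow> fm \<Rightarrow> bool" where
  "sat e E (Eq s t) = (tval e s = tval e t)"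
| "sat e E (Less s t) = (tval e s < tval e t)"
| "sat e E (Mem s n) = (tval e s \<in> E n)"
| "sat e E Fls = False"
| "sat e E (Imp p q) = (sat e E p \<longrightarrow> sat e E q)"
| "sat e E (AllN p) = (\<forall>x. sat (case_nat x e) E p)"
| "sat e E (AllS p) = (\<forall>X. sat e (case_nat X E) p)"

definition true_sentence :: "fm \<Rightarrow> bool" where
  "true_sentence p \<longleftrightarrow> sat (\<lambda>_. 0) (\<lambda>_. {}) p"

subsection \<open>A Hilbert calculus\<close>

inductive deriv :: "fm set \<Rightarrow> fm \<Rightarrow> bool" (infix \<open>\<turnstile>\<close> 50) for A where
  Ax: "p \<in> A \<Longrightarrow> A \<turnstile> p"
| K: "A \<turnstile> Imp p (Imp q p)"
| S: "A \<turnstile> Imp (Imp p (Imp q r)) (Imp (Imp p q) (Imp p r))"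
| DN: "A \<turnstile> Imp (Imp (Imp p Fls) Fls) p"
| ElimN: "A \<turnstile> Imp (AllN p) (subst 0 t p)"
| DistN: "A \<turnstile> Imp (AllN (Imp p q)) (Imp (AllN p) (AllN q))"
| VacN: "A \<turnstile> Imp p (AllN (lift 0 p))"
| ElimS: "A \<turnstile> Imp (AllS p) (substS 0 m p)"
| DistS: "A \<turnstile> Imp (AllS (Imp p q)) (Imp (AllS p) (AllS q))"
| VacS: "A \<turnstile> Imp p (AllS (liftS 0 p))"
| Refl: "A \<turnstile> Eq t t"
| Leibniz: "A \<turnstile> Imp (Eq s t) (Imp (subst 0 s p) (subst 0 t p))"
| MP: "A \<turnstile> Imp p q \<Longrightarrow> A \<turnstile> p \<Longrightarrow> A \<turnstile> q"
| GenN: "A \<turnstile> p \<Longrightarrow> A \<turnstile> AllN p"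
| GenS: "A \<turnstile> p \<Longrightarrow> A \<turnstile> AllS p"

section \<open>Coding\<close>

text \<open>
  The coding operations are polynomials. They are declared polymorphically, so that each of them
  is at once an operation on natural numbers and the operation on terms of the object language
  which denotes it.
\<close>

primrec cst :: "nat \<Rightarrow> 'a :: {zero, one, plus}" where
  "cst 0 = 0"
| "cst (Suc n) = cst n + 1"

definition pair :: "'a \<Rightarrow> 'a \<Rightarrow> 'a :: {plus, times}" where
  "pair x y = (x + y) * (x + y) + x"

definition tag :: "nat \<Rightarrow> 'a \<Rightarrow> 'a :: {zero, one, plus, times}" where
  "tag k x = pair (cst k) x"

definition cNil :: "'a :: {zero, one, plus, times}" where "cNil = 0"
definition cCons :: "'a \<Rightarrow> 'a \<Rightarrow> 'a :: {zero, one, plus, times}" where "cCons x l = pair x l + 1"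

definition cVar :: "'a \<Rightarrow> 'a :: {zero, one, plus, times}" where "cVar n = tag 1 n"
definition cZero :: "'a :: {zero, one, plus, times}" where "cZero = tag 2 0"
definition cOne :: "'a :: {zero, one, plus, times}" where "cOne = tag 3 0"
definition cPlus :: "'a \<Rightarrow> 'a \<Rightarrow> 'a :: {zero, one, plus, times}" where "cPlus x y = tag 4 (pair x y)"
definition cTimes :: "'a \<Rightarrow> 'a \<Rightarrow> 'a :: {zero, one, plus, times}" where "cTimes x y = tag 5 (pair x y)"
definition cEq :: "'a \<Rightarrow> 'a \<Rightarrow> 'a :: {zero, one, plus, times}" where "cEq x y = tag 6 (pair x y)"
definition cLess :: "'a \<Rightarrow> 'a \<Rightarrow> 'a :: {zero, one, plus, times}" where "cLess x y = tag 7 (pair x y)"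
definition cMem :: "'a \<Rightarrow> 'a \<Rightarrow> 'a :: {zero, one, plus, times}" where "cMem x n = tag 8 (pair x n)"
definition cFls :: "'a :: {zero, one, plus, times}" where "cFls = tag 9 0"
definition cImp :: "'a \<Rightarrow> 'a \<Rightarrow> 'a :: {zero, one, plus, times}" where "cImp x y = tag 10 (pair x y)"
definition cAllN :: "'a \<Rightarrow> 'a :: {zero, one, plus, times}" where "cAllN x = tag 11 x"
definition cAllS :: "'a \<Rightarrow> 'a :: {zero, one, plus, times}" where "cAllS x = tag 12 x"

primrec code_tm :: "tm \<Rightarrow> nat" where
  "code_tm (Var n) = cVar n"
| "code_tm Zero = cZero"
| "code_tm One = cOne"
| "code_tm (Plus s t) = cPlus (code_tm s) (code_tm t)"
| "code_tm (Times s t) = cTimes (code_tm s) (code_tm t)"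

primrec code :: "fm \<Rightarrow> nat" where
  "code (Eq s t) = cEq (code_tm s) (code_tm t)"
| "code (Less s t) = cLess (code_tm s) (code_tm t)"
| "code (Mem s n) = cMem (code_tm s) n"
| "code Fls = cFls"
| "code (Imp p q) = cImp (code p) (code q)"
| "code (AllN p) = cAllN (code p)"
| "code (AllS p) = cAllS (code p)"

section \<open>Derivability in finite systems of rules, as a \<open>\<Sigma>\<^sub>1\<close> formula\<close>

text \<open>
  A rule has the shape: from the numbers denoted by the terms \<open>ps\<close>, and the side condition
  \<open>sd\<close>, infer the number denoted by the term \<open>c\<close>. The variables \<open>Var 0, \<dots>, Var 7\<close> are the
  parameters of the rule. The side condition may contain a free set variable (an oracle).
\<close>

datatype rule = Rule (prems: "tm list") (side: fm) (concl: tm)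

definition infer :: "tm list \<Rightarrow> tm \<Rightarrow> rule" (infix \<open>\<leadsto>\<close> 40) where
  "(ps \<leadsto> c) = Rule ps (Imp Fls Fls) c"

definition infer_if :: "fm \<Rightarrow> tm list \<Rightarrow> tm \<Rightarrow> rule" where
  "infer_if sd ps c = Rule ps sd c"

primrec conjs :: "fm list \<Rightarrow> fm" where
  "conjs [] = Imp Fls Fls"
| "conjs (p # ps) = Conj p (conjs ps)"

primrec disjs :: "fm list \<Rightarrow> fm" where
  "disjs [] = Fls"
| "disjs (p # ps) = Disj p (disjs ps)"

definition up :: "nat \<Rightarrow> tm \<Rightarrow> tm" where "up n t = (lift_tm 0 ^^ n) t"

text \<open>Goedel's beta function: \<open>y\<close> is the remainder of \<open>a\<close> modulo \<open>1 + (i + 1) * b\<close>.\<close>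

definition beta :: "tm \<Rightarrow> tm \<Rightarrow> tm \<Rightarrow> tm \<Rightarrow> fm" where
  "beta a b i y = Conj (Less y (1 + (i + 1) * b))
     (ExB (a + 1) (Eq (up 1 a) (Var 0 * (1 + (up 1 i + 1) * up 1 b) + up 1 y)))"

text \<open>\<open>n\<close> nested bounded quantifiers with the same bound \<open>t\<close>.\<close>

primrec ExBs :: "nat \<Rightarrow> tm \<Rightarrow> fm \<Rightarrow> fm" where
  "ExBs 0 t p = p"
| "ExBs (Suc n) t p = ExB t (ExBs n (up 1 t) p)"

text \<open>
  \<open>step r\<close> says that the entry with index \<open>Var 0\<close> of the sequence coded by \<open>Var 3\<close> and \<open>Var 2\<close>
  follows from previous entries by the rule \<open>r\<close>, with parameters below \<open>Var 4\<close>.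
  Underneath the eight parameters, these variables are \<open>Var 8\<close>, \<open>Var 11\<close>, \<open>Var 10\<close>.
\<close>

definition step :: "rule \<Rightarrow> fm" where
  "step r = ExBs 8 (Var 4)
     (Conj (side r)
       (Conj (beta (Var 11) (Var 10) (Var 8) (concl r))
         (conjs (map (\<lambda>p. ExB (Var 8) (beta (Var 12) (Var 11) (Var 0) (up 1 p))) (prems r)))))"

text \<open>
  There are \<open>w\<close> and \<open>a, b, n < w\<close> such that the sequence of length \<open>n\<close> coded by \<open>a, b\<close> contains \<open>x\<close>
  and each of its entries follows from previous ones by one of the rules.
\<close>

definition Der :: "rule list \<Rightarrow> tm \<Rightarrow> fm" where
  "Der R x = ExN (ExB (Var 0) (ExB (Var 1) (ExB (Var 2)
     (Conj (ExB (Var 0) (beta (Var 3) (Var 2) (Var 0) (up 5 x)))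
           (AllB (Var 0) (disjs (map step R)))))))"

section \<open>Theories, provability predicates, reflection\<close>

text \<open>A theory is identified with the formula \<open>Ax\<^sub>T\<close>, whose only free variable is \<open>Var 0\<close>.\<close>

definition is_axiom :: "fm \<Rightarrow> nat \<Rightarrow> bool" where
  "is_axiom T n \<longleftrightarrow> sat (case_nat n (\<lambda>_. 0)) (\<lambda>_. {}) T"

definition re_theory :: "fm \<Rightarrow> bool" where
  "re_theory T \<longleftrightarrow> Sigma1 T \<and> closed 1 0 T \<and> (\<forall>n. is_axiom T n \<longrightarrow> (\<exists>p. sentence p \<and> n = code p))"

definition axioms :: "fm \<Rightarrow> fm set" where
  "axioms T = {p. sentence p \<and> is_axiom T (code p)}"

definition proves :: "fm \<Rightarrow> fm \<Rightarrow> bool" where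
  "proves T p \<longleftrightarrow> axioms T \<turnstile> p"

text \<open>The rules below derive (codes of) the following judgements:\<close>

definition jTm :: "'a \<Rightarrow> 'a \<Rightarrow> 'a :: {zero, one, plus, times}"
  where \<comment> \<open>\<open>t\<close> is a term with variables below \<open>m\<close>\<close>
  "jTm m t = tag 1 (pair m t)"
definition jFm :: "'a \<Rightarrow> 'a \<Rightarrow> 'a \<Rightarrow> 'a \<Rightarrow> 'a :: {zero, one, plus, times}"
  where \<comment> \<open>\<open>closed m s p\<close>, and \<open>q = 1\<close>, or \<open>q = 0\<close> and \<open>p\<close> is arithmetical\<close>
  "jFm q m s p = tag 2 (pair q (pair m (pair s p)))"
definition jLiftT :: "'a \<Rightarrow> 'a \<Rightarrow> 'a \<Rightarrow> 'a :: {zero, one, plus, times}"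
  where \<comment> \<open>\<open>lift_tm k t = t'\<close>\<close>
  "jLiftT k t t' = tag 3 (pair k (pair t t'))"
definition jSubstT :: "'a \<Rightarrow> 'a \<Rightarrow> 'a \<Rightarrow> 'a \<Rightarrow> 'a :: {zero, one, plus, times}"
  where \<comment> \<open>\<open>subst_tm k u t = t'\<close>\<close>
  "jSubstT k u t t' = tag 4 (pair k (pair u (pair t t')))"
definition jLift :: "'a \<Rightarrow> 'a \<Rightarrow> 'a \<Rightarrow> 'a :: {zero, one, plus, times}"
  where \<comment> \<open>\<open>lift k p = p'\<close>\<close>
  "jLift k p p' = tag 5 (pair k (pair p p'))"
definition jSubst :: "'a \<Rightarrow> 'a \<Rightarrow> 'a \<Rightarrow> 'a \<Rightarrow> 'a :: {zero, one, plus, times}"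
  where \<comment> \<open>\<open>subst k u p = p'\<close>\<close>
  "jSubst k u p p' = tag 6 (pair k (pair u (pair p p')))"
definition jLiftS :: "'a \<Rightarrow> 'a \<Rightarrow> 'a \<Rightarrow> 'a :: {zero, one, plus, times}"
  where \<comment> \<open>\<open>liftS k p = p'\<close>\<close>
  "jLiftS k p p' = tag 7 (pair k (pair p p'))"
definition jSubstS :: "'a \<Rightarrow> 'a \<Rightarrow> 'a \<Rightarrow> 'a \<Rightarrow> 'a :: {zero, one, plus, times}"
  where \<comment> \<open>\<open>substS k m p = p'\<close>\<close>
  "jSubstS k m p p' = tag 8 (pair k (pair m (pair p p')))"
definition jPr :: "'a \<Rightarrow> 'a :: {zero, one, plus, times}"
  where \<comment> \<open>\<open>p\<close> is provable\<close>
  "jPr p = tag 9 p"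

definition syntax_rules :: "rule list" where
  "syntax_rules =
    (let q = Var 0; m = Var 1; s = Var 2; n = Var 3; x = Var 4; y = Var 5 in
     [infer_if (Less n m) [] (jTm m (cVar n)),
      [] \<leadsto> jTm m cZero,
      [] \<leadsto> jTm m cOne,
      [jTm m x, jTm m y] \<leadsto> jTm m (cPlus x y),
      [jTm m x, jTm m y] \<leadsto> jTm m (cTimes x y),
      [jTm m x, jTm m y] \<leadsto> jFm q m s (cEq x y),
      [jTm m x, jTm m y] \<leadsto> jFm q m s (cLess x y),
      infer_if (Less n s) [jTm m x] (jFm q m s (cMem x n)),
      [] \<leadsto> jFm q m s cFls,
      [jFm q m s x, jFm q m s y] \<leadsto> jFm q m s (cImp x y),
      [jFm q (m + 1) s x] \<leadsto> jFm q m s (cAllN x),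
      [jFm 1 m (s + 1) x] \<leadsto> jFm 1 m s (cAllS x)])"

definition lift_subst_rules :: "rule list" where
  "lift_subst_rules =
    (let k = Var 0; u = Var 1; n = Var 2; x = Var 3; y = Var 4; x' = Var 5; y' = Var 6; u' = Var 7 in
     [infer_if (Less n k) [] (jLiftT k (cVar n) (cVar n)),
      infer_if (Neg (Less n k)) [] (jLiftT k (cVar n) (cVar (n + 1))),
      [] \<leadsto> jLiftT k cZero cZero,
      [] \<leadsto> jLiftT k cOne cOne,
      [jLiftT k x x', jLiftT k y y'] \<leadsto> jLiftT k (cPlus x y) (cPlus x' y'),
      [jLiftT k x x', jLiftT k y y'] \<leadsto> jLiftT k (cTimes x y) (cTimes x' y'),

      infer_if (Less n k) [] (jSubstT k u (cVar n) (cVar n)),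
      [] \<leadsto> jSubstT k u (cVar k) u,
      infer_if (Less k (n + 1)) [] (jSubstT k u (cVar (n + 1)) (cVar n)),
      [] \<leadsto> jSubstT k u cZero cZero,
      [] \<leadsto> jSubstT k u cOne cOne,
      [jSubstT k u x x', jSubstT k u y y'] \<leadsto> jSubstT k u (cPlus x y) (cPlus x' y'),
      [jSubstT k u x x', jSubstT k u y y'] \<leadsto> jSubstT k u (cTimes x y) (cTimes x' y'),

      [jLiftT k x x', jLiftT k y y'] \<leadsto> jLift k (cEq x y) (cEq x' y'),
      [jLiftT k x x', jLiftT k y y'] \<leadsto> jLift k (cLess x y) (cLess x' y'),
      [jLiftT k x x'] \<leadsto> jLift k (cMem x n) (cMem x' n),
      [] \<leadsto> jLift k cFls cFls,
      [jLift k x x', jLift k y y'] \<leadsto> jLift k (cImp x y) (cImp x' y'),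
      [jLift (k + 1) x x'] \<leadsto> jLift k (cAllN x) (cAllN x'),
      [jLift k x x'] \<leadsto> jLift k (cAllS x) (cAllS x'),

      [jSubstT k u x x', jSubstT k u y y'] \<leadsto> jSubst k u (cEq x y) (cEq x' y'),
      [jSubstT k u x x', jSubstT k u y y'] \<leadsto> jSubst k u (cLess x y) (cLess x' y'),
      [jSubstT k u x x'] \<leadsto> jSubst k u (cMem x n) (cMem x' n),
      [] \<leadsto> jSubst k u cFls cFls,
      [jSubst k u x x', jSubst k u y y'] \<leadsto> jSubst k u (cImp x y) (cImp x' y'),
      [jLiftT 0 u u', jSubst (k + 1) u' x x'] \<leadsto> jSubst k u (cAllN x) (cAllN x'),
      [jSubst k u x x'] \<leadsto> jSubst k u (cAllS x) (cAllS x')])"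

definition set_lift_subst_rules :: "rule list" where
  "set_lift_subst_rules =
    (let k = Var 0; m = Var 1; n = Var 2; x = Var 3; y = Var 4; x' = Var 5; y' = Var 6 in
     [[] \<leadsto> jLiftS k (cEq x y) (cEq x y),
      [] \<leadsto> jLiftS k (cLess x y) (cLess x y),
      infer_if (Less n k) [] (jLiftS k (cMem x n) (cMem x n)),
      infer_if (Neg (Less n k)) [] (jLiftS k (cMem x n) (cMem x (n + 1))),
      [] \<leadsto> jLiftS k cFls cFls,
      [jLiftS k x x', jLiftS k y y'] \<leadsto> jLiftS k (cImp x y) (cImp x' y'),
      [jLiftS k x x'] \<leadsto> jLiftS k (cAllN x) (cAllN x'),
      [jLiftS (k + 1) x x'] \<leadsto> jLiftS k (cAllS x) (cAllS x'),

      [] \<leadsto> jSubstS k m (cEq x y) (cEq x y),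
      [] \<leadsto> jSubstS k m (cLess x y) (cLess x y),
      infer_if (Less n k) [] (jSubstS k m (cMem x n) (cMem x n)),
      [] \<leadsto> jSubstS k m (cMem x k) (cMem x m),
      infer_if (Less k (n + 1)) [] (jSubstS k m (cMem x (n + 1)) (cMem x n)),
      [] \<leadsto> jSubstS k m cFls cFls,
      [jSubstS k m x x', jSubstS k m y y'] \<leadsto> jSubstS k m (cImp x y) (cImp x' y'),
      [jSubstS k m x x'] \<leadsto> jSubstS k m (cAllN x) (cAllN x'),
      [jSubstS (k + 1) (m + 1) x x'] \<leadsto> jSubstS k m (cAllS x) (cAllS x')])"

fun matrix :: "fm \<Rightarrow> fm" where
  "matrix (Imp (AllN (Imp q Fls)) Fls) = q"
| "matrix p = p"

lemma matrix_ExN [simp]: "matrix (ExN q) = q"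
  by (simp add: ExN_def Neg_def)

text \<open>
  In the first rule, \<open>matrix T\<close> is the bounded formula \<open>\<delta>\<close> with \<open>T = \<exists>v. \<delta>(v, z)\<close>; its variables
  \<open>Var 0\<close> and \<open>Var 1\<close> are \<open>v\<close> and \<open>z\<close>.
\<close>

definition proof_rules :: "fm \<Rightarrow> rule list" where
  "proof_rules T =
    (let z = Var 1; x = Var 2; y = Var 3; t = Var 4; u = Var 5; m = Var 6; s = Var 7 in
     [infer_if (matrix T) [jFm 1 0 0 z] (jPr z),
      [jFm 1 m s x, jFm 1 m s y] \<leadsto> jPr (cImp x (cImp y x)),
      [jFm 1 m s x, jFm 1 m s y, jFm 1 m s z]
        \<leadsto> jPr (cImp (cImp x (cImp y z)) (cImp (cImp x y) (cImp x z))),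
      [jFm 1 m s x] \<leadsto> jPr (cImp (cImp (cImp x cFls) cFls) x),
      [jFm 1 m s x, jTm m t, jSubst 0 t x y] \<leadsto> jPr (cImp (cAllN x) y),
      [jFm 1 m s x, jFm 1 m s y] \<leadsto> jPr (cImp (cAllN (cImp x y)) (cImp (cAllN x) (cAllN y))),
      [jFm 1 m s x, jLift 0 x y] \<leadsto> jPr (cImp x (cAllN y)),
      [jFm 1 m s x, jSubstS 0 t x y] \<leadsto> jPr (cImp (cAllS x) y),
      [jFm 1 m s x, jFm 1 m s y] \<leadsto> jPr (cImp (cAllS (cImp x y)) (cImp (cAllS x) (cAllS y))),
      [jFm 1 m s x, jLiftS 0 x y] \<leadsto> jPr (cImp x (cAllS y)),
      [jTm m t] \<leadsto> jPr (cEq t t),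
      [jFm 1 m s x, jTm m t, jTm m u, jSubst 0 t x y, jSubst 0 u x z]
        \<leadsto> jPr (cImp (cEq t u) (cImp y z)),
      [jPr (cImp x y), jPr x] \<leadsto> jPr y,
      [jPr x] \<leadsto> jPr (cAllN x),
      [jPr x] \<leadsto> jPr (cAllS x)])"

text \<open>The provability predicate \<open>Pr\<^sub>T(x)\<close>.\<close>

definition Prov :: "fm \<Rightarrow> tm \<Rightarrow> fm" where
  "Prov T x = Der (syntax_rules @ lift_subst_rules @ set_lift_subst_rules @ proof_rules T) (jPr x)"

text \<open>\<open>x\<close> is the code of a \<open>\<Pi>\<^sup>1\<^sub>1\<close> sentence.\<close>

definition Pi11_code :: "tm \<Rightarrow> fm" where
  "Pi11_code x = ExN (Conj (Eq (up 1 x) (cAllS (Var 0))) (Der syntax_rules (jFm 0 0 1 (Var 0))))"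

subsection \<open>A partial truth definition for \<open>\<Pi>\<^sup>1\<^sub>1\<close> sentences\<close>

text \<open>
  \<open>jLook l n v\<close>: the entry with index \<open>n\<close> of the list \<open>l\<close> is \<open>v\<close>.
  \<open>jVal l t v\<close>: \<open>v\<close> is the value of the term \<open>t\<close> in the environment \<open>l\<close>.
\<close>

definition jLook :: "'a \<Rightarrow> 'a \<Rightarrow> 'a \<Rightarrow> 'a :: {zero, one, plus, times}" where
  "jLook l n v = tag 1 (pair l (pair n v))"
definition jVal :: "'a \<Rightarrow> 'a \<Rightarrow> 'a \<Rightarrow> 'a :: {zero, one, plus, times}" where
  "jVal l t v = tag 2 (pair l (pair t v))"

definition val_rules :: "rule list" where
  "val_rules =
    (let l = Var 0; n = Var 1; u = Var 2; v = Var 3; x = Var 4; y = Var 5 in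
     [[] \<leadsto> jLook (cCons v l) 0 v,
      [jLook l n v] \<leadsto> jLook (cCons u l) (n + 1) v,
      [jLook l n v] \<leadsto> jVal l (cVar n) v,
      [] \<leadsto> jVal l cZero 0,
      [] \<leadsto> jVal l cOne 1,
      [jVal l x u, jVal l y v] \<leadsto> jVal l (cPlus x y) (u + v),
      [jVal l x u, jVal l y v] \<leadsto> jVal l (cTimes x y) (u * v)])"

definition Val :: "tm \<Rightarrow> tm \<Rightarrow> tm \<Rightarrow> fm" where
  "Val l t v = Der val_rules (jVal l t v)"

text \<open>
  In the following formula the set variables 2, 1, 0 are \<open>X\<close>, \<open>D\<close>, \<open>S\<close>. It says that the set \<open>D\<close>
  of formulas is closed under immediate subformulas (of formulas other than set quantifications),
  and that \<open>S\<close>, as a set of pairs of formulas and environments, satisfies the Tarski conditions for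
  these formulas in \<open>D\<close>, the free set variable being interpreted by \<open>X\<close>.
\<close>

definition Tarski :: fm where
  "Tarski = conjs [
     AllN (AllN (Imp (Mem (cEq (Var 1) (Var 0)) 1)
       (AllN (Iff (Mem (pair (cEq (Var 2) (Var 1)) (Var 0)) 0)
          (ExN (Conj (Val (Var 1) (Var 3) (Var 0)) (Val (Var 1) (Var 2) (Var 0)))))))),
     AllN (AllN (Imp (Mem (cLess (Var 1) (Var 0)) 1)
       (AllN (Iff (Mem (pair (cLess (Var 2) (Var 1)) (Var 0)) 0)
          (ExN (ExN (Conj (Less (Var 1) (Var 0))
             (Conj (Val (Var 2) (Var 4) (Var 1)) (Val (Var 2) (Var 3) (Var 0)))))))))),
     AllN (AllN (Imp (Mem (cMem (Var 1) (Var 0)) 1)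
       (AllN (Iff (Mem (pair (cMem (Var 2) (Var 1)) (Var 0)) 0)
          (ExN (Conj (Mem (Var 0) 2) (Val (Var 1) (Var 3) (Var 0)))))))),
     Imp (Mem cFls 1) (AllN (Neg (Mem (pair cFls (Var 0)) 0))),
     AllN (AllN (Imp (Mem (cImp (Var 1) (Var 0)) 1)
       (Conj (Conj (Mem (Var 1) 1) (Mem (Var 0) 1))
       (AllN (Iff (Mem (pair (cImp (Var 2) (Var 1)) (Var 0)) 0)
          (Imp (Mem (pair (Var 2) (Var 0)) 0) (Mem (pair (Var 1) (Var 0)) 0))))))),
     AllN (Imp (Mem (cAllN (Var 0)) 1)
       (Conj (Mem (Var 0) 1)
       (AllN (Iff (Mem (pair (cAllN (Var 1)) (Var 0)) 0)
          (AllN (Mem (pair (Var 2) (cCons (Var 0) (Var 1))) 0))))))]"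

text \<open>
  If \<open>x\<close> is the code of \<open>\<forall>X. \<theta>\<close>, then \<open>\<theta>\<close> is satisfied in the empty environment, for all \<open>X\<close> and
  for every satisfaction class \<open>S\<close> on a set \<open>D\<close> as above that contains \<open>\<theta>\<close>. (For every
  standard arithmetical \<open>\<theta>\<close>, the existence and uniqueness of the satisfaction class on the
  subformulas of \<open>\<theta>\<close> are provable in \<open>ACA\<^sub>0\<close>.)
\<close>

definition Tr :: "tm \<Rightarrow> fm" where
  "Tr x = AllN (Imp (Eq (up 1 x) (cAllS (Var 0)))
     (AllS (AllS (AllS (Imp (Conj (Mem (Var 0) 1) Tarski) (Mem (pair (Var 0) cNil) 0))))))"

definition RFN :: "fm \<Rightarrow> fm" where
  "RFN T = AllN (Imp (Pi11_code (Var 0)) (Imp (Prov T (Var 0)) (Tr (Var 0))))"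

section \<open>Recursive functions\<close>

datatype prim_fun = PZ | PS | PId nat | PCn prim_fun "prim_fun list" | PPr prim_fun prim_fun

fun peval :: "prim_fun \<Rightarrow> nat list \<Rightarrow> nat" where
  "peval PZ l = 0"
| "peval PS l = Suc (hd l)"
| "peval (PId i) l = l ! i"
| "peval (PCn g fs) l = peval g (map (\<lambda>f. peval f l) fs)"
| "peval (PPr f g) l = rec_nat (peval f (tl l)) (\<lambda>x r. peval g (x # r # tl l)) (hd l)"

inductive arity :: "nat \<Rightarrow> prim_fun \<Rightarrow> bool" where
  "arity n PZ"
| "arity 1 PS"
| "i < n \<Longrightarrow> arity n (PId i)"
| "arity (length fs) g \<Longrightarrow> (\<And>f. f \<in> set fs \<Longrightarrow> arity n f) \<Longrightarrow> arity n (PCn g fs)"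
| "arity n f \<Longrightarrow> arity (n + 2) g \<Longrightarrow> arity (n + 1) (PPr f g)"

text \<open>
  Codes of algorithms. \<open>cMu\<close> and \<open>cOracle\<close> (unbounded search and the characteristic function of
  the oracle) are used in the definition of the Turing jump, but not for primitive recursive
  functions.
\<close>

definition cZ :: "'a :: {zero, one, plus, times}" where "cZ = tag 1 0"
definition cS :: "'a :: {zero, one, plus, times}" where "cS = tag 2 0"
definition cId :: "'a \<Rightarrow> 'a :: {zero, one, plus, times}" where "cId i = tag 3 i"
definition cCn :: "'a \<Rightarrow> 'a \<Rightarrow> 'a :: {zero, one, plus, times}" where "cCn g fs = tag 4 (pair g fs)"
definition cPr :: "'a \<Rightarrow> 'a \<Rightarrow> 'a :: {zero, one, plus, times}" where "cPr f g = tag 5 (pair f g)"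
definition cMu :: "'a \<Rightarrow> 'a :: {zero, one, plus, times}" where "cMu f = tag 6 f"
definition cOracle :: "'a :: {zero, one, plus, times}" where "cOracle = tag 7 0"

primrec code_prim :: "prim_fun \<Rightarrow> nat" where
  "code_prim PZ = cZ"
| "code_prim PS = cS"
| "code_prim (PId i) = cId i"
| "code_prim (PCn g fs) = cCn (code_prim g) (foldr cCons (map code_prim fs) cNil)"
| "code_prim (PPr f g) = cPr (code_prim f) (code_prim g)"

text \<open>
  \<open>jEv f l v\<close>: the algorithm \<open>f\<close> with the list of arguments \<open>l\<close> halts with output \<open>v\<close>.
  \<open>jEvs fs l vs\<close>: the same for a list of algorithms.
  \<open>jPos f l n\<close>: for all \<open>y < n\<close>, \<open>f\<close> with arguments \<open>y # l\<close> halts with a positive output.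
\<close>

definition jEv :: "'a \<Rightarrow> 'a \<Rightarrow> 'a \<Rightarrow> 'a :: {zero, one, plus, times}" where
  "jEv f l v = tag 1 (pair f (pair l v))"
definition jEvs :: "'a \<Rightarrow> 'a \<Rightarrow> 'a \<Rightarrow> 'a :: {zero, one, plus, times}" where
  "jEvs fs l vs = tag 2 (pair fs (pair l vs))"
definition jPos :: "'a \<Rightarrow> 'a \<Rightarrow> 'a \<Rightarrow> 'a :: {zero, one, plus, times}" where
  "jPos f l n = tag 3 (pair f (pair l n))"

definition pr_rules :: "rule list" where
  "pr_rules =
    (let f = Var 0; g = Var 1; l = Var 2; x = Var 3; v = Var 4; fs = Var 5; vs = Var 6; i = Var 7 in
     [[] \<leadsto> jEv cZ l 0,
      [] \<leadsto> jEv cS (cCons x l) (x + 1),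
      [] \<leadsto> jEv (cId 0) (cCons x l) x,
      [jEv (cId i) l v] \<leadsto> jEv (cId (i + 1)) (cCons x l) v,
      [jEvs fs l vs, jEv g vs v] \<leadsto> jEv (cCn g fs) l v,
      [] \<leadsto> jEvs cNil l cNil,
      [jEv f l v, jEvs fs l vs] \<leadsto> jEvs (cCons f fs) l (cCons v vs),
      [jEv f l v] \<leadsto> jEv (cPr f g) (cCons 0 l) v,
      [jEv (cPr f g) (cCons x l) i, jEv g (cCons x (cCons i l)) v]
        \<leadsto> jEv (cPr f g) (cCons (x + 1) l) v])"

text \<open>The oracle is the set variable 0.\<close>

definition mu_rules :: "rule list" where
  "mu_rules =
    (let f = Var 0; l = Var 1; x = Var 2; v = Var 3 in
     [infer_if (Mem x 0) [] (jEv cOracle (cCons x l) 1),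
      infer_if (Neg (Mem x 0)) [] (jEv cOracle (cCons x l) 0),
      [] \<leadsto> jPos f l 0,
      [jPos f l x, jEv f (cCons x l) (v + 1)] \<leadsto> jPos f l (x + 1),
      [jPos f l x, jEv f (cCons x l) 0] \<leadsto> jEv (cMu f) l x])"

subsection \<open>Primitive recursive linear orders\<close>

text \<open>The reflexive relation with characteristic function \<open>e\<close>; its domain is its field.\<close>

definition pr_rel :: "prim_fun \<Rightarrow> nat rel" where
  "pr_rel e = {(x, y). peval e [x, y] = 1}"

definition pr_linear_order :: "prim_fun \<Rightarrow> bool" where
  "pr_linear_order e \<longleftrightarrow> arity 2 e \<and> Linear_order (pr_rel e)"

definition pr_le :: "prim_fun \<Rightarrow> tm \<Rightarrow> tm \<Rightarrow> fm" where
  "pr_le e x y = Der pr_rules (jEv (cst (code_prim e)) (cCons x (cCons y cNil)) 1)"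

text \<open>Every nonempty set has a minimal element.\<close>

definition WF :: "prim_fun \<Rightarrow> fm" where
  "WF e = AllS (Imp (ExN (Mem (Var 0) 0))
     (ExN (Conj (Mem (Var 0) 0)
       (AllN (Imp (Mem (Var 0) 0) (Imp (pr_le e (Var 0) (Var 1)) (Eq (Var 0) (Var 1))))))))"

section \<open>The systems \<open>ACA\<^sub>0\<close> and \<open>ACA\<^sub>0\<^sup>+\<close>\<close>

text \<open>
  Open formulas are used as axioms; because of the rules \<open>GenN\<close> and \<open>GenS\<close>, this amounts to their
  universal closures. In particular the comprehension axioms are for formulas with
  number and set parameters.
\<close>

definition basic_axioms :: "fm set" where
  "basic_axioms = (let m = Var 0; n = Var 1 in
     {Neg (Eq (n + 1) 0),
      Imp (Eq (m + 1) (n + 1)) (Eq m n),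
      Eq (m + 0) m,
      Eq (m + (n + 1)) ((m + n) + 1),
      Eq (m * 0) 0,
      Eq (m * (n + 1)) (m * n + m),
      Neg (Less m 0),
      Iff (Less m (n + 1)) (Disj (Less m n) (Eq m n))})"

definition induction_axiom :: fm where
  "induction_axiom = AllS (Imp (Conj (Mem 0 0) (AllN (Imp (Mem (Var 0) 0) (Mem (Var 0 + 1) 0))))
     (AllN (Mem (Var 0) 0)))"

definition comprehension :: "fm \<Rightarrow> fm" where
  "comprehension p = ExS (AllN (Iff (Mem (Var 0) 0) (liftS 0 p)))"

definition ACA0 :: "fm set" where
  "ACA0 = basic_axioms \<union> {induction_axiom} \<union> {comprehension p | p. arithmetical p}"

text \<open>\<open>x\<close> belongs to the Turing jump of the set variable 0: the algorithm \<open>x\<close> halts on input \<open>x\<close>.\<close>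

definition jump :: "tm \<Rightarrow> fm" where
  "jump x = ExN (Der (pr_rules @ mu_rules) (jEv (up 1 x) (cCons (up 1 x) cNil) (Var 0)))"

text \<open>
  For all \<open>X\<close> there is \<open>Y\<close> such that the section of \<open>Y\<close> at 0 is \<open>X\<close>, and for all \<open>n\<close> and \<open>Z\<close>, if \<open>Z\<close> is the
  section of \<open>Y\<close> at \<open>n\<close>, then the section of \<open>Y\<close> at \<open>n + 1\<close> is the jump of \<open>Z\<close>.
\<close>

definition omega_jump_axiom :: fm where
  "omega_jump_axiom = AllS (ExS (Conj
     (AllN (Iff (Mem (pair 0 (Var 0)) 0) (Mem (Var 0) 1)))
     (AllN (AllS (Imp (AllN (Iff (Mem (Var 0) 0) (Mem (pair (Var 1) (Var 0)) 1)))
       (AllN (Iff (Mem (pair (Var 1 + 1) (Var 0)) 1) (jump (Var 0)))))))))"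

definition ACA0_plus :: "fm set" where
  "ACA0_plus = ACA0 \<union> {omega_jump_axiom}"

definition extension_of :: "fm \<Rightarrow> fm set \<Rightarrow> bool" where
  "extension_of T A \<longleftrightarrow> re_theory T \<and> (\<forall>p \<in> A. proves T p)"

definition Pi11_sound :: "fm \<Rightarrow> bool" where
  "Pi11_sound T \<longleftrightarrow> (\<forall>p. sentence p \<and> Pi11 p \<and> proves T p \<longrightarrow> true_sentence p)"

section \<open>Countable ordinals\<close>

text \<open>Isomorphism types of well-orders of sets of natural numbers.\<close>

quotient_type cord = "nat rel" / partial: "\<lambda>r s. (r, s) \<in> ordIso"
proof (rule part_equivpI)
  have "Well_order ({} :: nat rel)"
    by (simp add: well_order_on_def linear_order_on_def partial_order_on_def preorder_on_def
        refl_on_def trans_def antisym_def total_on_def)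
  then show "\<exists>r :: nat rel. (r, r) \<in> ordIso"
    using ordIso_reflexive by blast
  show "symp (\<lambda>r s :: nat rel. (r, s) \<in> ordIso)"
    by (auto intro: sympI ordIso_symmetric)
  show "transp (\<lambda>r s :: nat rel. (r, s) \<in> ordIso)"
    by (auto intro: transpI ordIso_transitive)
qed

definition order_type :: "nat rel \<Rightarrow> cord" where
  "order_type = abs_cord"

instantiation cord :: wellorder
begin

lift_definition less_eq_cord :: "cord \<Rightarrow> cord \<Rightarrow> bool" is "\<lambda>r s. (r, s) \<in> ordLeq"
  by (meson ordIso_iff_ordLeq ordLeq_transitive)

lift_definition less_cord :: "cord \<Rightarrow> cord \<Rightarrow> bool" is "\<lambda>r s. (r, s) \<in> ordLess"
  by (meson ordIso_ordLess_trans ordIso_symmetric ordLess_ordIso_trans)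

instance
proof
  fix a b c :: cord
  show "a < b \<longleftrightarrow> a \<le> b \<and> \<not> b \<le> a"
    by transfer (meson not_ordLeq_ordLess not_ordLess_iff_ordLeq ordIso_iff_ordLeq ordLeq_Well_order_simp ordLess_imp_ordLeq)
  show "a \<le> a"
    by transfer (simp add: ordIso_imp_ordLeq)
  show "a \<le> b \<Longrightarrow> b \<le> c \<Longrightarrow> a \<le> c"
    by transfer (rule ordLeq_transitive)
  show "a \<le> b \<Longrightarrow> b \<le> a \<Longrightarrow> a = b"
    by transfer (simp add: ordIso_iff_ordLeq)
  show "a \<le> b \<or> b \<le> a"
    by transfer (meson ordLeq_total ordIso_imp_ordLeq ordLeq_Well_order_simp)
next
  fix P :: "cord \<Rightarrow> bool" and a :: cord
  assume step: "\<And>x. (\<And>y. y < x \<Longrightarrow> P y) \<Longrightarrow> P x"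
  have "wf {(a, b :: cord). a < b}"
  proof (rule wf_subset)
    show "wf (inv_image ordLess rep_cord)"
      by (simp add: wf_ordLess)
    show "{(a, b). a < b} \<subseteq> inv_image ordLess rep_cord"
      by (auto simp: less_cord.rep_eq)
  qed
  then show "P a"
    by (induct a rule: wf_induct_rule) (auto intro: step)
qed

end

definition osuc :: "cord \<Rightarrow> cord" where
  "osuc a = (LEAST b. a < b)"

definition osup :: "cord set \<Rightarrow> cord" where
  "osup A = (LEAST b. \<forall>a \<in> A. a \<le> b)"

text \<open>\<open>rank R\<close> is meant for well-founded relations \<open>R\<close> with countable sets of predecessors.\<close>

definition rank :: "('a \<times> 'a) set \<Rightarrow> 'a \<Rightarrow> cord" where
  "rank R = wfrec R (\<lambda>\<rho> x. osup {osuc (\<rho> y) | y. (y, x) \<in> R})"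

definition reflection_order :: "(fm \<times> fm) set" where
  "reflection_order = {(S, T). extension_of S ACA0 \<and> Pi11_sound S \<and>
     extension_of T ACA0 \<and> Pi11_sound T \<and> proves T (RFN S)}"

definition reflection_rank :: "fm \<Rightarrow> cord" where
  "reflection_rank = rank reflection_order"

definition WO_ordinal :: "fm \<Rightarrow> cord" where
  "WO_ordinal T = osup {order_type (pr_rel e) | e. pr_linear_order e \<and> proves T (WF e)}"

end

theory Submission
  imports Defs "HOL-Library.Countable"
begin

text \<open>
  Derivability in \<open>ACA\<^sub>0\<close> is established semantically: a sentence that holds in all Henkin models of \<open>ACA\<^sub>0\<close> is
  derivable, by completeness.

  If \<open>T\<close> proves \<open>RFN S\<close>, then \<open>T\<close> proves the well-foundedness of one primitive recursive order, namely of the sum of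
  all orders that \<open>S\<close> proves to be well-founded, indexed by proofs in \<open>S\<close>, with a greatest element on top. Hence
  \<open>S \<prec> T\<close> implies \<open>|S| < |T|\<close> for the proof-theoretic ordinals, and the rank of \<open>T\<close> is at most \<open>|T|\<close>.

  Conversely, for an order \<open>e\<close> let \<open>S\<^sub>x\<close> be the theory with axioms \<open>RFN S\<^sub>y\<close> for all \<open>y\<close> below \<open>x\<close>, over a finite
  axiomatization of \<open>ACA\<^sub>0\<close>. In \<open>ACA\<^sub>0\<^sup>+\<close> every set belongs to a countable coded \<open>\<omega>\<close>-model that has a satisfaction
  class, since the latter can be read off an \<open>\<omega>\<close>-jump. If \<open>e\<close> is well-founded, then induction along \<open>e\<close> shows
  that the axioms of every \<open>S\<^sub>x\<close> are true in such a model, and therefore \<open>RFN S\<^sub>x\<close> holds. So if \<open>T\<close> proves that \<open>e\<close> is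
  well-founded, then \<open>S\<^sub>x \<prec> T\<close> for all \<open>x\<close>, while \<open>S\<^sub>x\<close> has at least the rank of \<open>x\<close> in \<open>e\<close>.
\<close>

text \<open>Since derivability is obtained from truth in all models, every argument has to work in
  nonstandard ones, where programs, formulas, derivations and their lengths may be nonstandard
  elements. Induction over them is available only for predicates arithmetical in sets of the model,
  and much of the form of the proof serves to keep predicates visibly of this kind. Induction along
  \<open>e\<close> does not apply to the reflection principles themselves, which quantify over sets.
  Within one coded omega-model with a satisfaction class, the truth of all the axioms becomes a
  condition arithmetical in that class, and the failures form a set to which well-foundedness
  applies. Reflection outside follows because truth is tested on one set at a time, and each set
  lies in some coded model. The finite axiomatization makes the truth of arithmetical comprehension
  in a coded model a matter of one standard sentence and of closure under finitely many operations.
  In the other direction reflection is applied to nonstandard derivations about nonstandard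
  programs, so the truth definition has to be evaluated on formulas with a nonstandard numeral in
  them.\<close>

text \<open>
  Structures are classes, because the coding operations are overloaded: they are then available as operations on
  the elements of a model. The set quantifiers range over \<open>SS\<close>.
\<close>

class so_structure = zero + one + plus + times + ord +
  fixes SS :: "'a set set"

instantiation nat :: so_structure
begin
definition SS_nat :: "nat set set" where "SS_nat = UNIV"
instance ..
end

primrec hval :: "(nat \<Rightarrow> 'a::so_structure) \<Rightarrow> tm \<Rightarrow> 'a" where
  "hval e (Var n) = e n"
| "hval e Zero = 0"
| "hval e One = 1"
| "hval e (Plus s t) = hval e s + hval e t"
| "hval e (Times s t) = hval e s * hval e t"

primrec hsat :: "fm \<Rightarrow> (nat \<Rightarrow> 'a::so_structure) \<Rightarrow> (nat \<Rightarrow> 'a set) \<Rightarrow> bool" where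
  "hsat (Eq s t) e E = (hval e s = hval e t)"
| "hsat (Less s t) e E = (hval e s < hval e t)"
| "hsat (Mem s n) e E = (hval e s \<in> E n)"
| "hsat Fls e E = False"
| "hsat (Imp p q) e E = (hsat p e E \<longrightarrow> hsat q e E)"
| "hsat (AllN p) e E = (\<forall>x. hsat p (case_nat x e) E)"
| "hsat (AllS p) e E = (\<forall>X\<in>SS. hsat p e (case_nat X E))"

lemma hval_nat: "hval e t = tval e t"
  by (induct t) auto

lemma hsat_nat: "hsat p e E = sat e E p"
  by (induct p arbitrary: e E) (auto simp: SS_nat_def hval_nat)

lemma hsat_connectives [simp]:
  "hsat (Neg p) e E = (\<not> hsat p e E)"
  "hsat (Conj p q) e E = (hsat p e E \<and> hsat q e E)"
  "hsat (Disj p q) e E = (hsat p e E \<or> hsat q e E)"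
  "hsat (Iff p q) e E = (hsat p e E = hsat q e E)"
  "hsat (ExN p) e E = (\<exists>x. hsat p (case_nat x e) E)"
  "hsat (ExS p) e E = (\<exists>X\<in>SS. hsat p e (case_nat X E))"
  by (auto simp: Neg_def Conj_def Disj_def Iff_def ExN_def ExS_def)

section \<open>Parallel substitution\<close>

primrec ps_tm :: "(nat \<Rightarrow> tm) \<Rightarrow> tm \<Rightarrow> tm" where
  "ps_tm f (Var n) = f n"
| "ps_tm f Zero = Zero"
| "ps_tm f One = One"
| "ps_tm f (Plus s t) = Plus (ps_tm f s) (ps_tm f t)"
| "ps_tm f (Times s t) = Times (ps_tm f s) (ps_tm f t)"

definition upN :: "(nat \<Rightarrow> tm) \<Rightarrow> nat \<Rightarrow> tm" where
  "upN f = case_nat (Var 0) (\<lambda>n. lift_tm 0 (f n))"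
definition upS :: "(nat \<Rightarrow> nat) \<Rightarrow> nat \<Rightarrow> nat" where
  "upS g = case_nat 0 (\<lambda>n. Suc (g n))"

text \<open>Lifting and substitution, for numbers and for sets, are instances of this simultaneous
  substitution (\<open>lift_ps\<close> to \<open>substS_ps\<close>). Commutation laws then reduce to
  \<open>ps_comp\<close>, and semantic laws to \<open>hsat_ps\<close>.\<close>

primrec ps :: "fm \<Rightarrow> (nat \<Rightarrow> tm) \<Rightarrow> (nat \<Rightarrow> nat) \<Rightarrow> fm" where
  "ps (Eq s t) f g = Eq (ps_tm f s) (ps_tm f t)"
| "ps (Less s t) f g = Less (ps_tm f s) (ps_tm f t)"
| "ps (Mem s n) f g = Mem (ps_tm f s) (g n)"
| "ps Fls f g = Fls"
| "ps (Imp p q) f g = Imp (ps p f g) (ps q f g)"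
| "ps (AllN p) f g = AllN (ps p (upN f) g)"
| "ps (AllS p) f g = AllS (ps p f (upS g))"

lemma upS_id [simp]: "upS (\<lambda>n. n) = (\<lambda>n. n)" by (auto simp: upS_def fun_eq_iff split: nat.splits)

lemma lift_tm_ps: "lift_tm k t = ps_tm (\<lambda>n. if n < k then Var n else Var (Suc n)) t"
  by (induct t) auto

lemma subst_tm_ps: "subst_tm k u t = ps_tm (\<lambda>n. if n < k then Var n else if n = k then u else Var (n - 1)) t"
  by (induct t) auto

lemma lift_ps: "lift k p = ps p (\<lambda>n. if n < k then Var n else Var (Suc n)) id"
proof (induct p arbitrary: k)
  case (AllN p)
  have "upN (\<lambda>n. if n < k then Var n else Var (Suc n)) = (\<lambda>n. if n < Suc k then Var n else Var (Suc n))"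
    by (auto simp: upN_def fun_eq_iff split: nat.splits)
  then show ?case using AllN by simp
qed (auto simp: lift_tm_ps id_def)

lemma subst_ps: "subst k u p = ps p (\<lambda>n. if n < k then Var n else if n = k then u else Var (n - 1)) id"
proof (induct p arbitrary: k u)
  case (AllN p)
  have "upN (\<lambda>n. if n < k then Var n else if n = k then u else Var (n - 1)) =
    (\<lambda>n. if n < Suc k then Var n else if n = Suc k then lift_tm 0 u else Var (n - 1))"
    by (auto simp: upN_def fun_eq_iff split: nat.splits)
  then show ?case using AllN by simp
qed (auto simp: subst_tm_ps id_def)

lemma ps_tm_Var [simp]: "ps_tm Var t = t" by (induct t) auto

lemma upN_Var [simp]: "upN Var = Var" by (auto simp: upN_def fun_eq_iff split: nat.splits)

lemma liftS_ps: "liftS k p = ps p Var (\<lambda>n. if n < k then n else Suc n)"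
proof (induct p arbitrary: k)
  case (AllS p)
  have "upS (\<lambda>n. if n < k then n else Suc n) = (\<lambda>n. if n < Suc k then n else Suc n)"
    by (auto simp: upS_def fun_eq_iff split: nat.splits)
  then show ?case using AllS by simp
qed auto

lemma substS_ps: "substS k m p = ps p Var (\<lambda>n. if n < k then n else if n = k then m else n - 1)"
proof (induct p arbitrary: k m)
  case (AllS p)
  have "upS (\<lambda>n. if n < k then n else if n = k then m else n - 1) =
      (\<lambda>n. if n < Suc k then n else if n = Suc k then Suc m else n - 1)"
    by (auto simp: upS_def fun_eq_iff split: nat.splits)
  then show ?case using AllS by simp
qed auto

lemma ps_tm_comp: "ps_tm f (ps_tm g t) = ps_tm (\<lambda>n. ps_tm f (g n)) t"
  by (induct t) auto

lemma lift_tm0_ps: "lift_tm 0 t = ps_tm (\<lambda>n. Var (Suc n)) t"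
  by (simp add: lift_tm_ps)

lemma upN_comp: "upN (\<lambda>n. ps_tm f (g n)) = (\<lambda>n. ps_tm (upN f) (upN g n))"
  by (auto simp: upN_def fun_eq_iff lift_tm0_ps ps_tm_comp split: nat.splits)

lemma upS_comp: "upS (\<lambda>n. f (g n)) = (\<lambda>n. upS f (upS g n))"
  by (auto simp: upS_def fun_eq_iff split: nat.splits)

lemma ps_comp: "ps (ps p f' g') f g = ps p (\<lambda>n. ps_tm f (f' n)) (\<lambda>n. g (g' n))"
  by (induct p arbitrary: f g f' g') (auto simp: ps_tm_comp upN_comp upS_comp)

lemma ps_tm_cong: "closed_tm m t \<Longrightarrow> (\<And>n. n < m \<Longrightarrow> f n = f' n) \<Longrightarrow> ps_tm f t = ps_tm f' t"
  by (induct t) auto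

lemma ps_cong: "closed m s p \<Longrightarrow> (\<And>n. n < m \<Longrightarrow> f n = f' n) \<Longrightarrow> (\<And>n. n < s \<Longrightarrow> g n = g' n) \<Longrightarrow> ps p f g = ps p f' g'"
proof (induct p arbitrary: m s f f' g g')
  case (AllN p)
  have "ps p (upN f) g = ps p (upN f') g'"
    using AllN.prems by (intro AllN.hyps[of "m+1" s]) (auto simp: upN_def split: nat.splits)
  then show ?case by simp
next
  case (AllS p)
  have "ps p f (upS g) = ps p f' (upS g')"
    using AllS.prems by (intro AllS.hyps[of m "s+1"]) (auto simp: upS_def split: nat.splits)
  then show ?case by simp
next
  case (Imp p q)
  then show ?case using Imp.hyps(1)[of m s f f' g g'] Imp.hyps(2)[of m s f f' g g'] by simp
qed (auto intro: ps_tm_cong)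

lemma ps_id [simp]: "ps p Var (\<lambda>n. n) = p"
  by (induct p) auto

lemma ps_sentence: "sentence p \<Longrightarrow> ps p f g = p"
  using ps_cong[of 0 0 p f Var g "\<lambda>n. n"] by simp

lemma hval_ps_tm: "hval e (ps_tm f t) = hval (\<lambda>n. hval e (f n)) t"
  by (induct t) auto

lemma hsat_ps: "hsat (ps p f g) e E = hsat p (\<lambda>n. hval e (f n)) (\<lambda>n. E (g n))"
proof (induct p arbitrary: f g e E)
  case (AllN p)
  have "(\<lambda>n. hval (case_nat x e) (upN f n)) = case_nat x (\<lambda>n. hval e (f n))" for x
    by (auto simp: upN_def fun_eq_iff lift_tm0_ps hval_ps_tm split: nat.splits)
  then show ?case using AllN by simp
next
  case (AllS p)
  have "(\<lambda>n. (case_nat X E) (upS g n)) = case_nat X (\<lambda>n. E (g n))" for X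
    by (auto simp: upS_def fun_eq_iff split: nat.splits)
  then show ?case using AllS by simp
qed (auto simp: hval_ps_tm)

lemma hval_lift0 [simp]: "hval (case_nat x e) (lift_tm 0 t) = hval e t"
  by (simp add: lift_tm0_ps hval_ps_tm)

lemma hsat_lift0: "hsat (lift 0 p) (case_nat x e) E = hsat p e E"
  by (simp add: lift_ps hsat_ps)
lemma hsat_liftS0: "hsat (liftS 0 p) e (case_nat X E) = hsat p e E"
  by (simp add: liftS_ps hsat_ps)
lemma hsat_subst0: "hsat (subst 0 t p) e E = hsat p (case_nat (hval e t) e) E"
proof -
  have "(\<lambda>n. hval e (if n < 0 then Var n else if n = 0 then t else Var (n - 1))) = case_nat (hval e t) e"
    by (auto simp: fun_eq_iff split: nat.splits)
  then show ?thesis by (simp add: subst_ps hsat_ps)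
qed
lemma hsat_substS0: "hsat (substS 0 m p) e E = hsat p e (case_nat (E m) E)"
proof -
  have "(\<lambda>n. E (if n < 0 then n else if n = 0 then m else n - 1)) = case_nat (E m) E"
    by (auto simp: fun_eq_iff split: nat.splits)
  then show ?thesis by (simp add: substS_ps hsat_ps)
qed

lemma range_case_nat: "range (case_nat X E) \<subseteq> A \<longleftrightarrow> X \<in> A \<and> range E \<subseteq> A"
proof -
  have "range (case_nat X E) = insert X (range E)"
    by (auto split: nat.splits intro: rev_image_eqI[of 0] rev_image_eqI[of "Suc _"])
  then show ?thesis by auto
qed

theorem soundness:
  assumes "A \<turnstile> p" and "\<And>a e E. a \<in> A \<Longrightarrow> range E \<subseteq> SS \<Longrightarrow> hsat a (e :: nat \<Rightarrow> 'a::so_structure) E"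
    and "range E \<subseteq> SS"
  shows "hsat p (e :: nat \<Rightarrow> 'a) E"
  using assms(1,3)
  by (induct arbitrary: e E)
     (auto simp: hsat_lift0 hsat_liftS0 hsat_subst0 hsat_substS0 assms(2) range_case_nat)

section \<open>Completeness\<close>

instance tm :: countable by countable_datatype
instance fm :: countable by countable_datatype

text \<open>Only theorems of \<open>A\<close> may be generalized; the formulas in \<open>H\<close>
  may be open and are combined by modus ponens alone. This is why the deduction theorem
  \<open>ded_imp\<close> holds for them.\<close>

inductive ded :: "fm set \<Rightarrow> fm set \<Rightarrow> fm \<Rightarrow> bool" for A H where
  ded_ax: "A \<turnstile> p \<Longrightarrow> ded A H p"
| ded_hyp: "p \<in> H \<Longrightarrow> ded A H p"
| ded_mp: "ded A H (Imp p q) \<Longrightarrow> ded A H p \<Longrightarrow> ded A H q"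

lemma ded_mono: "ded A H p \<Longrightarrow> H \<subseteq> H' \<Longrightarrow> ded A H' p"
  by (induct rule: ded.induct) (auto intro: ded.intros)

lemma imp_refl: "A \<turnstile> Imp p p"
  by (meson MP K S)

lemma ded_imp: "ded A (insert a H) p \<Longrightarrow> ded A H (Imp a p)"
proof (induct rule: ded.induct)
  case (ded_ax p)
  then show ?case by (meson K MP ded.ded_ax)
next
  case (ded_hyp p)
  then show ?case by (metis K ded.ded_ax ded.ded_hyp ded_mp imp_refl insertE)
next
  case (ded_mp p q)
  then show ?case by (meson S ded.ded_ax ded.ded_mp)
qed

lemma ded_neg: assumes "ded A (insert (Neg p) H) Fls" shows "ded A H p"
  using ded_imp[OF assms] unfolding Neg_def by (meson DN ded.ded_ax ded_mp)

lemma ded_cut: "ded A H q \<Longrightarrow> ded A (insert q H) p \<Longrightarrow> ded A H p"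
  using ded_imp ded_mp by blast

lemma ded_compact: "ded A H p \<Longrightarrow> \<exists>H'. finite H' \<and> H' \<subseteq> H \<and> ded A H' p"
proof (induct rule: ded.induct)
  case (ded_mp p q)
  then obtain H1 H2 where "finite H1" "H1 \<subseteq> H" "ded A H1 (Imp p q)" "finite H2" "H2 \<subseteq> H" "ded A H2 p" by blast
  then show ?case by (intro exI[of _ "H1 \<union> H2"]) (auto intro: ded.ded_mp ded_mono)
next
  case (ded_ax p) then show ?case by (meson ded.ded_ax empty_subsetI finite.emptyI)
next
  case (ded_hyp p) then show ?case by (intro exI[of _ "{p}"]) (auto intro: ded.ded_hyp)
qed

text \<open>A shifted hypothesis does not contain the variable 0, so \<open>VacN\<close> generalizes
  it, and \<open>DistN\<close> carries modus ponens under the quantifier.\<close>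

lemma ded_genN: "ded A (lift 0 ` H) p \<Longrightarrow> ded A H (AllN p)"
proof (induct rule: ded.induct)
  case (ded_hyp p) then show ?case by (metis VacN ded.ded_ax ded.ded_hyp ded_mp imageE)
qed (meson GenN DistN ded.intros)+

lemma ded_genS: "ded A (liftS 0 ` H) p \<Longrightarrow> ded A H (AllS p)"
proof (induct rule: ded.induct)
  case (ded_hyp p) then show ?case by (metis VacS ded.ded_ax ded.ded_hyp ded_mp imageE)
qed (meson GenS DistS ded.intros)+

text \<open>The axiom schemes are stable under substitution, and a sentence is unchanged by it. This
  makes it possible to rename a fresh variable into the one that a quantifier binds.\<close>

lemma deriv_ps:
  assumes "A \<turnstile> p" "\<forall>a\<in>A. sentence a" shows "A \<turnstile> ps p f g"
  using assms(1)
proof (induct arbitrary: f g)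
  case (Ax p) then show ?case using assms(2) ps_sentence by (simp add: deriv.Ax)
next
  case (ElimN p t)
  have "ps (subst 0 t p) f g = subst 0 (ps_tm f t) (ps p (upN f) g)"
    unfolding subst_ps ps_comp
    by (rule arg_cong2[where f="ps p"])
      (auto simp: fun_eq_iff upN_def lift_tm0_ps ps_tm_comp split: nat.splits)
  then show ?case by (simp add: deriv.ElimN)
next
  case (VacN p)
  have "ps (lift 0 p) (upN f) g = lift 0 (ps p f g)"
    unfolding lift_ps ps_comp
    by (rule arg_cong2[where f="ps p"]) (auto simp: fun_eq_iff upN_def lift_tm0_ps)
  then show ?case by (simp add: deriv.VacN)
next
  case (ElimS p m)
  have "ps (substS 0 m p) f g = substS 0 (g m) (ps p f (upS g))"
    unfolding substS_ps ps_comp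
    by (rule arg_cong2[where f="ps p"]) (auto simp: fun_eq_iff upS_def split: nat.splits)
  then show ?case by (simp add: deriv.ElimS)
next
  case (VacS p)
  have "ps (liftS 0 p) f (upS g) = liftS 0 (ps p f g)"
    unfolding liftS_ps ps_comp
    by (rule arg_cong2[where f="ps p"]) (auto simp: fun_eq_iff upS_def)
  then show ?case by (simp add: deriv.VacS)
next
  case (Leibniz s t p)
  have "ps (subst 0 t p) f g = subst 0 (ps_tm f t) (ps p (upN f) g)" for t
    unfolding subst_ps ps_comp
    by (rule arg_cong2[where f="ps p"])
      (auto simp: fun_eq_iff upN_def lift_tm0_ps ps_tm_comp split: nat.splits)
  then show ?case by (simp add: deriv.Leibniz)
next
  case (MP p q)
  then show ?case using deriv.MP by fastforce
qed (auto intro: K S DN DistN DistS Refl GenN GenS)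

lemma ded_ps:
  assumes "ded A H p" "\<forall>a\<in>A. sentence a" shows "ded A ((\<lambda>h. ps h f g) ` H) (ps p f g)"
  using assms(1) 
proof induct
  case (ded_mp p q)
  then show ?case using ded.ded_mp by fastforce
qed (auto intro: ded_ax ded_hyp deriv_ps[OF _ assms(2)])

lemma closed_tm_mono: "closed_tm m t \<Longrightarrow> m \<le> m' \<Longrightarrow> closed_tm m' t"
  by (induct t) auto
lemma closed_mono: "closed m s p \<Longrightarrow> m \<le> m' \<Longrightarrow> s \<le> s' \<Longrightarrow> closed m' s' p"
  by (induct p arbitrary: m s m' s') (auto intro: closed_tm_mono)

lemma closed_tm_ex: "\<exists>m. closed_tm m t"
proof (induct t)
  case (Var x) then show ?case by (auto intro: exI[of _ "Suc x"])
next
  case (Plus t1 t2) then show ?case using closed_tm_mono max.cobounded1 max.cobounded2 by (metis closed_tm.simps(4))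
next
  case (Times t1 t2) then show ?case using closed_tm_mono max.cobounded1 max.cobounded2 by (metis closed_tm.simps(5))
qed auto

lemma closed_ex: "\<exists>m. closed m m p"
proof (induct p)
  case (Eq s t)
  obtain a b where "closed_tm a s" "closed_tm b t" using closed_tm_ex by blast
  then show ?case by (auto intro!: exI[of _ "max a b"] elim: closed_tm_mono)
next
  case (Less s t)
  obtain a b where "closed_tm a s" "closed_tm b t" using closed_tm_ex by blast
  then show ?case by (auto intro!: exI[of _ "max a b"] elim: closed_tm_mono)
next
  case (Mem s n)
  obtain a where "closed_tm a s" using closed_tm_ex by blast
  then show ?case by (auto intro!: exI[of _ "max a (Suc n)"] elim: closed_tm_mono)
next
  case (Imp p q)
  then obtain a b where "closed a a p" "closed b b q" by blast
  then show ?case by (auto intro!: exI[of _ "max a b"] elim: closed_mono)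
next
  case (AllN p) then obtain a where "closed a a p" by blast
  then show ?case by (auto intro!: exI[of _ a] elim: closed_mono)
next
  case (AllS p) then obtain a where "closed a a p" by blast
  then show ?case by (auto intro!: exI[of _ a] elim: closed_mono)
qed auto

lemma closed_ex_set: "finite H \<Longrightarrow> \<exists>m. \<forall>p\<in>H. closed m m p"
proof (induct rule: finite_induct)
  case (insert x F)
  then obtain m where "\<forall>p\<in>F. closed m m p" by blast
  moreover obtain m' where "closed m' m' x" using closed_ex by blast
  ultimately have "\<forall>p\<in>insert x F. closed (max m m') (max m m') p"
    using closed_mono[of m m _ "max m m'" "max m m'"] closed_mono[of m' m' _ "max m m'" "max m m'"] by auto
  then show ?case by blast
qed auto

text \<open>A variable beyond all variables of \<open>H\<close> and \<open>p\<close> is a generic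
  element: a derivation of the instance at this variable would turn, by renaming, into a derivation
  of \<open>AllN p\<close>.\<close>

lemma freshN:
  assumes "finite H" "\<forall>a\<in>A. sentence a" and nd: "\<not> ded A H (AllN p)"
  shows "\<exists>v. \<not> ded A H (subst 0 (Var v) p)"
proof -
  obtain m where m: "\<forall>h\<in>insert p H. closed m m h" using closed_ex_set[of "insert p H"] assms(1) by blast
  \<comment> \<open>The inverse of the instantiation: \<open>m\<close> becomes the variable bound by
    the quantifier, and every other variable is shifted.\<close>
  let ?f = "\<lambda>n. if n = m then Var 0 else Var (Suc n)"
  have "ded A H (AllN p)" if d: "ded A H (subst 0 (Var m) p)"
  proof -
    have 1: "ps h ?f (\<lambda>n. n) = lift 0 h" if "h \<in> H" for h
      unfolding lift_ps using m that by (intro ps_cong[of m m]) auto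
    have 2: "ps (subst 0 (Var m) p) ?f (\<lambda>n. n) = p"
      unfolding subst_ps ps_comp
      by (rule trans[OF ps_cong[of m m] ps_id]) (use m in \<open>auto\<close>)
    from ded_ps[OF d assms(2), of ?f "\<lambda>n. n"] have "ded A (lift 0 ` H) p"
      by (simp add: 1 2 cong: image_cong)
    then show ?thesis by (rule ded_genN)
  qed
  with nd show ?thesis by blast
qed

lemma freshS:
  assumes "finite H" "\<forall>a\<in>A. sentence a" and nd: "\<not> ded A H (AllS p)"
  shows "\<exists>v. \<not> ded A H (substS 0 v p)"
proof -
  obtain m where m: "\<forall>h\<in>insert p H. closed m m h" using closed_ex_set[of "insert p H"] assms(1) by blast
  let ?f = "\<lambda>n. if n = m then 0 else Suc n"
  have "ded A H (AllS p)" if d: "ded A H (substS 0 m p)"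
  proof -
    have 1: "ps h Var ?f = liftS 0 h" if "h \<in> H" for h
      unfolding liftS_ps using m that by (intro ps_cong[of m m]) auto
    have 2: "ps (substS 0 m p) Var ?f = p"
      unfolding substS_ps ps_comp
      by (rule trans[OF ps_cong[of m m] ps_id]) (use m in \<open>auto\<close>)
    from ded_ps[OF d assms(2), of Var ?f] have "ded A (liftS 0 ` H) p"
      by (simp add: 1 2 cong: image_cong)
    then show ?thesis by (rule ded_genS)
  qed
  with nd show ?thesis by blast
qed

text \<open>Variables take the place of Henkin constants: a universal formula belongs to
  \<open>G\<close> as soon as all its instances by variables do. The language stays the same, and
  the model will consist of the original terms.\<close>

definition henkin :: "fm set \<Rightarrow> fm set \<Rightarrow> bool" where
  "henkin A G \<longleftrightarrow> (\<forall>p. A \<turnstile> p \<longrightarrow> p \<in> G) \<and> (\<forall>p q. Imp p q \<in> G \<longrightarrow> p \<in> G \<longrightarrow> q \<in> G) \<and> Fls \<notin> G \<and>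
    (\<forall>p. p \<in> G \<or> Neg p \<in> G) \<and> (\<forall>p. (\<forall>v. subst 0 (Var v) p \<in> G) \<longrightarrow> AllN p \<in> G) \<and>
    (\<forall>p. (\<forall>v. substS 0 v p \<in> G) \<longrightarrow> AllS p \<in> G)"

text \<open>Each stage is a finite set, so a variable outside it is always left to witness the
  failure of a universal formula that has just been refuted.\<close>

theorem henkin_exists:
  assumes A: "\<forall>a\<in>A. sentence a" and np: "\<not> A \<turnstile> p0"
  shows "\<exists>G. henkin A G \<and> p0 \<notin> G"
proof -
  let ?con = "\<lambda>H. finite H \<and> \<not> ded A H Fls"
  have neg_con: "\<not> ded A (insert (Neg p) H) Fls" if "\<not> ded A H p" for H p
    using that ded_neg by blast
  define ok where "ok p H H' \<longleftrightarrow> ?con H' \<and> H \<subseteq> H' \<and> (p \<in> H' \<or> Neg p \<in> H' \<and>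
     (\<forall>q. p = AllN q \<longrightarrow> (\<exists>v. Neg (subst 0 (Var v) q) \<in> H')) \<and>
     (\<forall>q. p = AllS q \<longrightarrow> (\<exists>v. Neg (substS 0 v q) \<in> H')))" for p H H'
  have ok_ex: "\<exists>H'. ok p H H'" if "?con H" for p H
  proof (cases "ded A H p")
    case True
    then have "ok p H (insert p H)" using that ded_cut unfolding ok_def by auto
    then show ?thesis by blast
  next
    case False
    let ?K = "insert (Neg p) H"
    have K: "?con ?K" using that neg_con[OF False] by simp
    have npK: "\<not> ded A ?K p"
    proof
      assume p: "ded A ?K p"
      have "ded A ?K (Imp p Fls)" by (rule ded_hyp) (simp add: Neg_def)
      from ded_mp[OF this p] show False using K by simp
    qed
    consider q where "p = AllN q" | q where "p = AllS q" | "\<forall>q. p \<noteq> AllN q \<and> p \<noteq> AllS q" by blast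
    then show ?thesis
    proof cases
      case 1
      obtain v where "\<not> ded A ?K (subst 0 (Var v) q)" using freshN[of ?K A q] K npK 1 A by auto
      then have "ok p H (insert (Neg (subst 0 (Var v) q)) ?K)"
        unfolding ok_def using K neg_con 1 by auto
      then show ?thesis by blast
    next
      case 2
      obtain v where "\<not> ded A ?K (substS 0 v q)" using freshS[of ?K A q] K npK 2 A by auto
      then have "ok p H (insert (Neg (substS 0 v q)) ?K)"
        unfolding ok_def using K neg_con 2 by auto
      then show ?thesis by blast
    next
      case 3
      then have "ok p H ?K" unfolding ok_def using K by auto
      then show ?thesis by blast
    qed
  qed
  define stp where "stp n H = (SOME H'. ok (from_nat n) H H')" for n H
  define Q where "Q = rec_nat {Neg p0} stp"
  have Q0: "Q 0 = {Neg p0}" and QS: "Q (Suc n) = stp n (Q n)" for n by (auto simp: Q_def)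
  have "ded A {} p \<Longrightarrow> A \<turnstile> p" for p by (induct rule: ded.induct) (auto intro: deriv.MP)
  then have "\<not> ded A {} p0" using np by blast
  then have con0: "?con (Q 0)" using neg_con[of "{}" p0] by (simp add: Q0)
  have con: "?con (Q n) \<and> ok (from_nat n) (Q n) (Q (Suc n))" for n
  proof (induct n)
    case 0 then show ?case unfolding QS stp_def using con0 someI_ex[OF ok_ex] by blast
  next
    case (Suc n)
    then have "?con (Q (Suc n))" unfolding ok_def by blast
    then show ?case unfolding QS[of "Suc n"] stp_def using someI_ex[OF ok_ex] by blast
  qed
  define G where "G = (\<Union>n. Q n)"
  have mono: "n \<le> m \<Longrightarrow> Q n \<subseteq> Q m" for n m
  proof (induct rule: dec_induct)
    case (step k)
    have "Q k \<subseteq> Q (Suc k)" using con[of k] by (simp add: ok_def)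
    with step show ?case by blast
  qed simp
  have fin: "\<exists>n. H \<subseteq> Q n" if "finite H" "H \<subseteq> G" for H
    using that
  proof (induct rule: finite_induct)
    case (insert x F)
    then obtain n m where "F \<subseteq> Q n" "x \<in> Q m" unfolding G_def by blast
    then have "insert x F \<subseteq> Q (max n m)" using mono[of n "max n m"] mono[of m "max n m"] by auto
    then show ?case by blast
  qed auto
  have conG: "\<not> ded A G Fls"
  proof
    assume "ded A G Fls"
    from ded_compact[OF this] obtain H' where "finite H'" "H' \<subseteq> G" "ded A H' Fls" by blast
    moreover obtain n where "H' \<subseteq> Q n" using fin[OF \<open>finite H'\<close> \<open>H' \<subseteq> G\<close>] by blast
    ultimately have "ded A (Q n) Fls" using ded_mono by metis
    then show False using con[of n] by simp
  qed
  have dec: "p \<in> G \<or> Neg p \<in> G \<and>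
     (\<forall>q. p = AllN q \<longrightarrow> (\<exists>v. Neg (subst 0 (Var v) q) \<in> G)) \<and>
     (\<forall>q. p = AllS q \<longrightarrow> (\<exists>v. Neg (substS 0 v q) \<in> G))" for p
  proof -
    have "ok p (Q (to_nat p)) (Q (Suc (to_nat p)))" using con[of "to_nat p"] by simp
    moreover have "Q (Suc (to_nat p)) \<subseteq> G" unfolding G_def by blast
    ultimately show ?thesis unfolding ok_def by blast
  qed
  have notboth: "\<not> (p \<in> G \<and> Neg p \<in> G)" for p
    using conG ded_hyp[of _ G A] ded_mp[of A G p Fls] unfolding Neg_def by blast
  have ded_in: "p \<in> G" if "ded A G p" for p
  proof (rule ccontr)
    assume "p \<notin> G"
    then have "Imp p Fls \<in> G" using dec Neg_def by metis
    then show False using conG that ded_mp[of A G p Fls] ded_hyp[of "Imp p Fls" G A] by blast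
  qed
  have "henkin A G"
    unfolding henkin_def
  proof (intro conjI allI impI)
    fix p show "p \<in> G \<or> Neg p \<in> G" using dec by blast
  next
    fix p assume "\<forall>v. subst 0 (Var v) p \<in> G" then show "AllN p \<in> G" using dec[of "AllN p"] notboth by blast
  next
    fix p assume "\<forall>v. substS 0 v p \<in> G" then show "AllS p \<in> G" using dec[of "AllS p"] notboth by blast
  next
    fix p assume "A \<turnstile> p" then show "p \<in> G" using ded_in ded_ax by blast
  next
    fix p q assume "Imp p q \<in> G" "p \<in> G" then show "q \<in> G" using ded_in[OF ded_mp[OF ded_hyp ded_hyp]] by blast
  next
    show "Fls \<notin> G" using conG ded_hyp by blast
  qed
  moreover have "p0 \<notin> G" using notboth Q0 unfolding G_def by blast
  ultimately show ?thesis by blast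
qed

section \<open>Term models\<close>

definition teq :: "fm set \<Rightarrow> tm \<Rightarrow> tm \<Rightarrow> bool" where "teq G s t \<longleftrightarrow> Eq s t \<in> G"

context
  fixes A G assumes hk: "henkin A G"
begin

lemma hk_ax: "A \<turnstile> p \<Longrightarrow> p \<in> G" and hk_mp: "Imp p q \<in> G \<Longrightarrow> p \<in> G \<Longrightarrow> q \<in> G" and hk_Fls: "Fls \<notin> G"
  using hk unfolding henkin_def by blast+

lemma hk_Imp: "Imp p q \<in> G \<longleftrightarrow> (p \<in> G \<longrightarrow> q \<in> G)"
proof -
  have "Imp p q \<in> G" if "q \<in> G" using that hk_mp[OF hk_ax[OF K]] by blast
  moreover have "Imp p q \<in> G" if "p \<notin> G"
  proof -
    have "Imp p Fls \<in> G" using that hk unfolding henkin_def Neg_def by blast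
    moreover have "A \<turnstile> Imp Fls q" by (meson DN K MP S)
    ultimately show ?thesis using hk_ax hk_mp K S by meson
  qed
  ultimately show ?thesis using hk_mp by blast
qed

lemma hk_AllN: "AllN p \<in> G \<longleftrightarrow> (\<forall>t. subst 0 t p \<in> G)"
proof
  show "AllN p \<in> G \<Longrightarrow> \<forall>t. subst 0 t p \<in> G" using hk_ax[OF ElimN] hk_mp by blast
  show "\<forall>t. subst 0 t p \<in> G \<Longrightarrow> AllN p \<in> G" using hk unfolding henkin_def by blast
qed

lemma hk_AllS: "AllS p \<in> G \<longleftrightarrow> (\<forall>n. substS 0 n p \<in> G)"
proof
  show "AllS p \<in> G \<Longrightarrow> \<forall>t. substS 0 t p \<in> G" using hk_ax[OF ElimS] hk_mp by blast
  show "\<forall>t. substS 0 t p \<in> G \<Longrightarrow> AllS p \<in> G" using hk unfolding henkin_def by blast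
qed

lemma leib: assumes "Eq s t \<in> G" "subst 0 s p \<in> G" shows "subst 0 t p \<in> G"
  using assms hk_mp hk_ax[OF Leibniz] by metis

lemma sub_lift [simp]: "subst_tm 0 s (lift_tm 0 t) = t"
  by (induct t) auto

lemma teq_equivp: "equivp (teq G)"
proof (rule equivpI)
  show "reflp (teq G)" unfolding reflp_def teq_def using hk_ax[OF Refl] by blast
  show sy: "symp (teq G)" unfolding symp_def teq_def
  proof (intro allI impI)
    fix s t assume "Eq s t \<in> G"
    then show "Eq t s \<in> G" using leib[of s t "Eq (Var 0) (lift_tm 0 s)"] hk_ax[OF Refl] by simp
  qed
  show "transp (teq G)" unfolding transp_def teq_def
  proof (intro allI impI)
    fix s t u assume "Eq s t \<in> G" "Eq t u \<in> G"
    then show "Eq s u \<in> G" using leib[of t u "Eq (lift_tm 0 s) (Var 0)"] by simp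
  qed
qed

lemma teq_cong:
  assumes "teq G s s'" "teq G t t'"
  shows "teq G (Plus s t) (Plus s' t')" "teq G (Times s t) (Times s' t')" "Less s t \<in> G \<Longrightarrow> Less s' t' \<in> G"
    "Mem s n \<in> G \<Longrightarrow> Mem s' n \<in> G"
proof -
  have "Eq (Plus s t) (Plus s' t) \<in> G"
    using leib[of s s' "Eq (lift_tm 0 (Plus s t)) (Plus (Var 0) (lift_tm 0 t))"] assms hk_ax[OF Refl]
    by (simp add: teq_def)
  then show "teq G (Plus s t) (Plus s' t')"
    using leib[of t t' "Eq (lift_tm 0 (Plus s t)) (Plus (lift_tm 0 s') (Var 0))"] assms
    by (simp add: teq_def)
  have "Eq (Times s t) (Times s' t) \<in> G"
    using leib[of s s' "Eq (lift_tm 0 (Times s t)) (Times (Var 0) (lift_tm 0 t))"] assms hk_ax[OF Refl]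
    by (simp add: teq_def)
  then show "teq G (Times s t) (Times s' t')"
    using leib[of t t' "Eq (lift_tm 0 (Times s t)) (Times (lift_tm 0 s') (Var 0))"] assms
    by (simp add: teq_def)
  show "Less s' t' \<in> G" if "Less s t \<in> G"
    using that leib[of s s' "Less (Var 0) (lift_tm 0 t)"] leib[of t t' "Less (lift_tm 0 s') (Var 0)"] assms
    by (simp add: teq_def)
  show "Mem s' n \<in> G" if "Mem s n \<in> G"
    using that leib[of s s' "Mem (Var 0) n"] assms by (simp add: teq_def)
qed

text \<open>The quotient type is formed only later, for one particular \<open>G\<close>; hence the
  quotient map \<open>q\<close> is a parameter. Arbitrary \<open>f\<close> and \<open>g\<close>
  appear because an element bound by a quantifier is represented by an arbitrary term.\<close>

lemma truth_lemma:
  fixes q :: "tm \<Rightarrow> 'a::so_structure"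
  assumes surj: "surj q" and eq: "\<And>s t. q s = q t \<longleftrightarrow> teq G s t"
    and q: "q Zero = 0" "q One = 1" "\<And>s t. q (Plus s t) = q s + q t" "\<And>s t. q (Times s t) = q s * q t"
    "\<And>s t. q s < q t \<longleftrightarrow> Less s t \<in> G"
    and SS: "SS = range (\<lambda>n. {q t | t. Mem t n \<in> G})"
  shows "hsat p (\<lambda>n. q (f n)) (\<lambda>n. {q t | t. Mem t (g n) \<in> G}) \<longleftrightarrow> ps p f g \<in> G"
proof -
  have hv: "hval (\<lambda>n. q (f n)) t = q (ps_tm f t)" for f t by (induct t) (auto simp: q)
  show ?thesis
  proof (induct p arbitrary: f g)
    case (Mem t n)
    have "Mem (ps_tm f t) (g n) \<in> G" if "q (ps_tm f t) = q u" "Mem u (g n) \<in> G" for u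
      using teq_cong(4)[of u "ps_tm f t" u "ps_tm f t"] that eq[of u "ps_tm f t"] by simp
    then show ?case by (auto simp: hv)
  next
    case (AllN p)
    have 1: "case_nat (q t) (\<lambda>n. q (f n)) = (\<lambda>n. q (case_nat t f n))" for t
      by (auto simp: fun_eq_iff split: nat.splits)
    have 2: "subst 0 t (ps p (upN f) g) = ps p (case_nat t f) g" for t
      unfolding subst_ps ps_comp
      by (rule arg_cong2[where f="ps p"])
        (auto simp: fun_eq_iff upN_def lift_tm0_ps ps_tm_comp split: nat.splits)
    have "hsat (AllN p) (\<lambda>n. q (f n)) (\<lambda>n. {q t | t. Mem t (g n) \<in> G}) \<longleftrightarrow> (\<forall>t. ps p (case_nat t f) g \<in> G)"
    proof -
      have "(\<forall>x. P x) \<longleftrightarrow> (\<forall>t. P (q t))" for P using surj by (metis surjD)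
      from this[of "\<lambda>x. hsat p (case_nat x (\<lambda>n. q (f n))) (\<lambda>n. {q t | t. Mem t (g n) \<in> G})"]
      show ?thesis by (simp only: hsat.simps 1 AllN)
    qed
    then show ?case by (simp add: hk_AllN 2)
  next
    case (AllS p)
    have 1: "case_nat {q t | t. Mem t m \<in> G} (\<lambda>n. {q t | t. Mem t (g n) \<in> G}) = (\<lambda>n. {q t | t. Mem t (case_nat m g n) \<in> G})"
        for m
      by (auto simp: fun_eq_iff split: nat.splits)
    have 2: "substS 0 m (ps p f (upS g)) = ps p f (case_nat m g)" for m
      unfolding substS_ps ps_comp
      by (rule arg_cong2[where f="ps p"])
        (auto simp: fun_eq_iff upS_def split: nat.splits)
    have "hsat (AllS p) (\<lambda>n. q (f n)) (\<lambda>n. {q t | t. Mem t (g n) \<in> G}) \<longleftrightarrow>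
        (\<forall>m. hsat p (\<lambda>n. q (f n)) (case_nat {q t | t. Mem t m \<in> G} (\<lambda>n. {q t | t. Mem t (g n) \<in> G})))"
      by (simp only: hsat.simps SS ball_simps)
    also have "\<dots> \<longleftrightarrow> (\<forall>m. ps p f (case_nat m g) \<in> G)" by (simp only: 1 AllS)
    finally show ?case by (simp only: ps.simps hk_AllS 2)
  qed (simp_all add: hv eq teq_def q hk_Imp hk_Fls)
qed

end

text \<open>
  \<open>dt\<close> and \<open>d\<close>: functions and predicates on environments that are definable by terms and by arithmetical formulas with
  parameters. The introduction rules establish definability by unification, without reference to formulas.
\<close>

context so_structure
begin

inductive dt :: "((nat \<Rightarrow> 'a) \<Rightarrow> 'a) \<Rightarrow> bool" where
  dt_var: "dt (\<lambda>e. e n)"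
| dt_const: "dt (\<lambda>e. c)"
| dt_plus: "dt s \<Longrightarrow> dt t \<Longrightarrow> dt (\<lambda>e. s e + t e)"
| dt_times: "dt s \<Longrightarrow> dt t \<Longrightarrow> dt (\<lambda>e. s e * t e)"

inductive d :: "((nat \<Rightarrow> 'a) \<Rightarrow> bool) \<Rightarrow> bool" where
  d_eq: "dt s \<Longrightarrow> dt t \<Longrightarrow> d (\<lambda>e. s e = t e)"
| d_less: "dt s \<Longrightarrow> dt t \<Longrightarrow> d (\<lambda>e. s e < t e)"
| d_mem: "dt s \<Longrightarrow> X \<in> SS \<Longrightarrow> d (\<lambda>e. s e \<in> X)"
| d_False: "d (\<lambda>e. False)"
| d_imp: "d P \<Longrightarrow> d Q \<Longrightarrow> d (\<lambda>e. P e \<longrightarrow> Q e)"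
| d_all0: "d P \<Longrightarrow> d (\<lambda>e. \<forall>x. P (case_nat x e))"

lemma d_all: assumes "d (\<lambda>e. Q (\<lambda>n. e (Suc n)) (e 0))" shows "d (\<lambda>e. \<forall>x. Q e x)"
  using d_all0[OF assms] by simp

lemma d_True: "d (\<lambda>e. True)" using d_imp[OF d_False d_False] by simp
lemma d_not: "d P \<Longrightarrow> d (\<lambda>e. \<not> P e)" using d_imp[OF _ d_False] by simp
lemma d_conj: assumes "d P" "d Q" shows "d (\<lambda>e. P e \<and> Q e)"
  using d_not[OF d_imp[OF assms(1) d_not[OF assms(2)]]] by simp
lemma d_disj: assumes "d P" "d Q" shows "d (\<lambda>e. P e \<or> Q e)"
  using d_imp[OF d_not[OF assms(1)] assms(2)] by (simp add: disj_imp)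
lemma d_iff: assumes "d P" "d Q" shows "d (\<lambda>e. P e = Q e)"
  using d_conj[OF d_imp[OF assms(1) assms(2)] d_imp[OF assms(2) assms(1)]]
  by (simp add: iff_conv_conj_imp)
lemma d_ex: assumes "d (\<lambda>e. Q (\<lambda>n. e (Suc n)) (e 0))" shows "d (\<lambda>e. \<exists>x. Q e x)"
  using d_not[OF d_all[where Q="\<lambda>e x. \<not> Q e x", OF d_not[OF assms]]] by simp
lemma d_const: "d (\<lambda>e. P)" by (cases P) (simp_all add: d_True d_False)
lemma d_bex_list: "(\<And>r. r \<in> set rs \<Longrightarrow> d (\<lambda>e. P e r)) \<Longrightarrow> d (\<lambda>e. \<exists>r\<in>set rs. P e r)"
  by (induct rs) (auto simp: d_False intro: d_disj)

lemma dt_shift: "dt t \<Longrightarrow> dt (\<lambda>e. t (\<lambda>n. e (Suc n)))"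
  by (induct rule: dt.induct) (auto intro: dt.intros)

end

lemmas dt_basic = dt_var dt_const dt_plus dt_times

lemma dt_hval: "(\<And>n. dt (\<lambda>e. r e n)) \<Longrightarrow> dt (\<lambda>e. hval (r e) t)"
  by (induct t) (auto intro: dt_basic)

lemma d_hsat:
  assumes "arithmetical p" "\<And>n. dt (\<lambda>e. r e n)" "\<And>n. E n \<in> SS"
  shows "d (\<lambda>e. hsat p (r e) E)"
  using assms(1,2)
proof (induct p arbitrary: r)
  case (AllN p)
  have "dt (\<lambda>e. case_nat (e 0) (r (\<lambda>n. e (Suc n))) n)" for n
    by (cases n) (auto intro: dt_var dt_shift[OF AllN.prems(2)])
  then have "d (\<lambda>e. hsat p (case_nat (e 0) (r (\<lambda>n. e (Suc n)))) E)" using AllN by simp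
  then show ?case by (simp add: d_all)
qed (simp_all add: dt_hval d_eq d_less d_mem d_False d_imp assms(3))

lemma arithmetical_ps [simp]: "arithmetical (ps p f g) = arithmetical p"
  by (induct p arbitrary: f g) auto

text \<open>Connects the comprehension of the class \<open>aca\<close>, which speaks of
  \<open>d\<close>, with the comprehension scheme for formulas. The number of parameters is not
  bounded in advance, so the even variables stand for the environment and the odd ones for
  parameters.\<close>

lemma d_formula:
  fixes P :: "(nat \<Rightarrow> 'a::so_structure) \<Rightarrow> bool"
  assumes "d P" and ne: "X0 \<in> (SS :: 'a set set)"
  shows "\<exists>p c E. arithmetical p \<and> range E \<subseteq> SS \<and>
    (\<forall>e. P e = hsat p (\<lambda>n. if even n then e (n div 2) else c (n div 2)) E)"
proof -
  define mix :: "(nat \<Rightarrow> 'a) \<Rightarrow> (nat \<Rightarrow> 'a) \<Rightarrow> nat \<Rightarrow> 'a"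
    where "mix c e n = (if even n then e (n div 2) else c (n div 2))" for c e n
  \<comment> \<open>Two formulas are combined by interleaving their parameter sequences:
    \<open>f1\<close> sends the parameter variable \<open>2 k + 1\<close> to \<open>4 k + 1\<close>,
    and \<open>f2\<close> sends it to \<open>4 k + 3\<close>.\<close>
  define f1 where "f1 n = (if even n then Var n else Var (2 * n - 1))" for n :: nat
  define f2 where "f2 n = (if even n then Var n else Var (2 * n + 1))" for n :: nat
  define jn where "jn c c' n = (if even n then c (n div 2) else c' (n div 2))" for c c' :: "nat \<Rightarrow> 'a" and n
  have f1: "(\<lambda>n. hval (mix (jn c c') e) (f1 n)) = mix c e" for c c' e
    by (auto simp: f1_def fun_eq_iff mix_def jn_def elim!: oddE) (drule arg_cong[where f=even], simp)+
  have f2: "(\<lambda>n. hval (mix (jn c c') e) (f2 n)) = mix c' e" for c c' e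
    by (auto simp: f2_def fun_eq_iff mix_def jn_def elim!: oddE)
  have T: "\<exists>u c. \<forall>e. t e = hval (mix c e) u" if "dt t" for t
    using that
  proof induct
    case (dt_var n)
    have "\<forall>e. e n = hval (mix c e) (Var (2 * n))" for c by (simp add: mix_def)
    then show ?case by blast
  next
    case (dt_const c)
    have "\<forall>e. c = hval (mix (\<lambda>_. c) e) (Var 1)" by (simp add: mix_def)
    then show ?case by blast
  next
    case (dt_plus s t)
    then obtain u c u' c' where "\<forall>e. s e = hval (mix c e) u" "\<forall>e. t e = hval (mix c' e) u'" by blast
    then have "\<forall>e. s e + t e = hval (mix (jn c c') e) (Plus (ps_tm f1 u) (ps_tm f2 u'))"
      by (simp add: hval_ps_tm f1 f2)
    then show ?case by blast
  next
    case (dt_times s t)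
    then obtain u c u' c' where "\<forall>e. s e = hval (mix c e) u" "\<forall>e. t e = hval (mix c' e) u'" by blast
    then have "\<forall>e. s e * t e = hval (mix (jn c c') e) (Times (ps_tm f1 u) (ps_tm f2 u'))"
      by (simp add: hval_ps_tm f1 f2)
    then show ?case by blast
  qed
  have T2: "\<exists>u u' c. \<forall>e. s e = hval (mix c e) u \<and> t e = hval (mix c e) u'" if "dt s" "dt t" for s t
  proof -
    from T[OF that(1)] obtain u c where "\<forall>e. s e = hval (mix c e) u" by blast
    moreover from T[OF that(2)] obtain u' c' where "\<forall>e. t e = hval (mix c' e) u'" by blast
    ultimately
    have "\<forall>e. s e = hval (mix (jn c c') e) (ps_tm f1 u) \<and> t e = hval (mix (jn c c') e) (ps_tm f2 u')"
      by (simp add: hval_ps_tm f1 f2)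
    then show ?thesis by blast
  qed
  have "\<exists>p c E. arithmetical p \<and> range E \<subseteq> SS \<and> (\<forall>e. P e = hsat p (mix c e) E)"
    using assms(1)
  proof induct
    case (d_eq s t)
    from T2[OF this] obtain u u' c where "\<forall>e. s e = hval (mix c e) u \<and> t e = hval (mix c e) u'" by blast
    then show ?case by (intro exI[of _ "Eq u u'"] exI[of _ c] exI[of _ "\<lambda>_. X0"]) (use ne in auto)
  next
    case (d_less s t)
    from T2[OF this] obtain u u' c where "\<forall>e. s e = hval (mix c e) u \<and> t e = hval (mix c e) u'" by blast
    then show ?case by (intro exI[of _ "Less u u'"] exI[of _ c] exI[of _ "\<lambda>_. X0"]) (use ne in auto)
  next
    case (d_mem s X)
    from T[OF this(1)] obtain u c where "\<forall>e. s e = hval (mix c e) u" by blast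
    then show ?case by (intro exI[of _ "Mem u 0"] exI[of _ c] exI[of _ "\<lambda>_. X"]) (use d_mem in auto)
  next
    case d_False
    then show ?case by (intro exI[of _ Fls] exI[of _ "\<lambda>_. undefined"] exI[of _ "\<lambda>_. X0"]) (use ne in auto)
  next
    case (d_imp P Q)
    from d_imp(2) obtain p c E where p: "arithmetical p" "range E \<subseteq> SS" "\<forall>e. P e = hsat p (mix c e) E" by blast
    from d_imp(4) obtain p' c' E' where p': "arithmetical p'" "range E' \<subseteq> SS"
      "\<forall>e. Q e = hsat p' (mix c' e) E'" by blast
    note * = p(1) p'(1) p(2) p'(2) p(3) p'(3)
    define F where "F n = (if even n then E (n div 2) else E' (n div 2))" for n
    have F: "range F \<subseteq> SS" "(\<lambda>n. F (2 * n)) = E" "(\<lambda>n. F (2 * n + 1)) = E'" using *(3,4) by (auto simp: F_def image_subset_iff)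
    show ?case
      by (intro exI[of _ "Imp (ps p f1 (\<lambda>n. 2 * n)) (ps p' f2 (\<lambda>n. 2 * n + 1))"] exI[of _ "jn c c'"] exI[of _ F])
        (use * F in \<open>simp add: hsat_ps f1 f2\<close>)
  next
    case (d_all0 P)
    then obtain p c E where *: "arithmetical p" "range E \<subseteq> SS" "\<forall>e. P e = hsat p (mix c e) E" by blast
    \<comment> \<open>Quantification prepends an element to the environment but not to the
      parameters. So an even variable \<open>2 k\<close> with \<open>k > 0\<close> becomes
      \<open>2 k - 1\<close>, whereas a parameter variable is shifted by one under the new
      quantifier.\<close>
    define h where "h n = (if n = 0 then Var 0 else if even n then Var (n - 1) else Var (Suc n))" for n :: nat
    have h: "(\<lambda>n. hval (case_nat x (mix c e)) (h n)) = mix c (case_nat x e)" for x e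
      by (auto simp: h_def fun_eq_iff mix_def split: nat.splits elim!: evenE oddE) (drule arg_cong[where f=even], simp)+
    show ?case
      by (intro exI[of _ "AllN (ps p h (\<lambda>n. n))"] exI[of _ c] exI[of _ E]) (use * in \<open>simp add: hsat_ps h\<close>)
  qed
  then show ?thesis unfolding mix_def .
qed

section \<open>Models of arithmetical comprehension, with induction for definable predicates\<close>

class aca = so_structure +
  assumes suc_neq: "n + 1 \<noteq> 0"
    and suc_inj: "m + 1 = n + 1 \<Longrightarrow> m = n"
    and add_zero: "m + 0 = m"
    and add_suc: "m + (n + 1) = (m + n) + 1"
    and mult_zero: "m * 0 = 0"
    and mult_suc: "m * (n + 1) = m * n + m"
    and less_zero: "\<not> m < 0"
    and less_suc: "m < n + 1 \<longleftrightarrow> m < n \<or> m = n"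
    and le_iff: "m \<le> n \<longleftrightarrow> m < n \<or> m = n"
    and SS_ind: "X \<in> SS \<Longrightarrow> 0 \<in> X \<Longrightarrow> (\<And>x. x \<in> X \<Longrightarrow> x + 1 \<in> X) \<Longrightarrow> x \<in> X"
    and SS_comp: "d P \<Longrightarrow> {x. P (case_nat x e)} \<in> SS"

lemma SS_Collect: fixes P :: "'a::aca \<Rightarrow> bool" assumes "d (\<lambda>e. P (e 0))" shows "{x. P x} \<in> SS"
  using SS_comp[OF assms, of undefined] by simp

lemma ind:
  fixes P :: "'a::aca \<Rightarrow> bool"
  assumes "d (\<lambda>e. P (e 0))" "P 0" "\<And>x. P x \<Longrightarrow> P (x + 1)" shows "P x"
  using SS_ind[OF SS_Collect[OF assms(1)]] assms(2,3) by blast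

lemma d_le: "dt s \<Longrightarrow> dt t \<Longrightarrow> d (\<lambda>e. (s e :: 'a::aca) \<le> t e)"
  unfolding le_iff by (intro d_disj d_less d_eq)

lemmas d_basic = d_eq d_less d_le d_mem d_const d_not d_conj d_disj d_imp d_iff d_all d_ex

section \<open>Semiring laws\<close>

context
  fixes a b c :: "'a::aca"
begin

lemma aca_add_assoc: "(a + b) + c = a + (b + c)"
  by (rule ind[of "\<lambda>c. (a + b) + c = a + (b + c)"], intro d_basic dt_basic) (simp_all add: add_zero add_suc)

lemma aca_add_0_left: "0 + a = a"
  by (rule ind[of "\<lambda>c. 0 + c = c"], intro d_basic dt_basic) (simp_all add: add_zero add_suc)

lemma aca_mult_0_left: "0 * a = 0"
  by (rule ind[of "\<lambda>c. 0 * c = 0"], intro d_basic dt_basic) (simp_all add: add_zero mult_zero mult_suc)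

lemma aca_suc_left: "(a + 1) + b = (a + b) + 1"
  by (rule ind[of "\<lambda>c. (a + 1) + c = (a + c) + 1"], intro d_basic dt_basic) (simp_all add: add_zero add_suc)
end

lemma aca_add_commute: "a + b = b + (a::'a::aca)"
  by (rule ind[of "\<lambda>b. a + b = b + a"], intro d_basic dt_basic)
    (simp_all add: add_zero aca_add_0_left add_suc aca_suc_left)

lemma aca_distrib: "a * (b + c) = a * b + a * (c::'a::aca)"
proof (rule ind[of "\<lambda>c. a * (b + c) = a * b + a * c"], intro d_basic dt_basic)
  fix x assume "a * (b + x) = a * b + a * x"
  then show "a * (b + (x + 1)) = a * b + a * (x + 1)" unfolding add_suc mult_suc by (simp add: aca_add_assoc)
qed (simp_all add: add_zero mult_zero)

lemma aca_mult_1: "a * 1 = (a::'a::aca)"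
  using mult_suc[of a 0] by (simp add: mult_zero aca_add_0_left)

lemma aca_mult_assoc: "(a * b) * c = a * (b * (c::'a::aca))"
  by (rule ind[of "\<lambda>c. (a * b) * c = a * (b * c)"], intro d_basic dt_basic)
    (simp_all add: mult_zero aca_mult_1 aca_distrib)

lemma aca_mult_suc_left: "(a + 1) * b = a * b + (b::'a::aca)"
proof (rule ind[of "\<lambda>b. (a + 1) * b = a * b + b"], intro d_basic dt_basic)
  fix x :: 'a assume "(a + 1) * x = a * x + x"
  then have "(a + 1) * (x + 1) = (a * x + x) + (a + 1)" by (simp add: mult_suc)
  also have "\<dots> = a * x + ((x + a) + 1)" by (simp add: aca_add_assoc)
  also have "\<dots> = (a * x + a) + (x + 1)" by (simp add: aca_add_assoc aca_add_commute[of x a])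
  finally show "(a + 1) * (x + 1) = a * (x + 1) + (x + 1)" by (simp add: mult_suc)
qed (simp_all add: mult_zero add_zero)

lemma aca_mult_commute: "a * b = b * (a::'a::aca)"
  by (rule ind[of "\<lambda>b. a * b = b * a"], intro d_basic dt_basic)
    (simp_all add: mult_zero aca_mult_0_left mult_suc aca_mult_suc_left)

lemma aca_add_cancel: "a + c = b + c \<Longrightarrow> a = (b::'a::aca)"
proof -
  have "a + c = b + c \<longrightarrow> a = b"
    by (rule ind[of "\<lambda>c. a + c = b + c \<longrightarrow> a = b"], intro d_basic dt_basic)
      (auto simp: add_zero add_suc dest: suc_inj)
  then show "a + c = b + c \<Longrightarrow> a = b" by blast
qed

lemma aca_cases: "a = 0 \<or> (\<exists>k. a = k + (1::'a::aca))"
  by (rule ind[of "\<lambda>a. a = 0 \<or> (\<exists>k. a = k + (1::'a::aca))"], intro d_basic dt_basic) auto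

lemma aca_less_iff: "m < n \<longleftrightarrow> (\<exists>k. n = m + (k + (1::'a::aca)))"
proof (rule ind[of "\<lambda>n. m < n \<longleftrightarrow> (\<exists>k. n = m + (k + (1::'a::aca)))"], intro d_basic dt_basic)
  show "m < 0 \<longleftrightarrow> (\<exists>k. 0 = m + (k + (1::'a)))" using suc_neq by (metis less_zero add_suc)
next
  fix n assume IH: "m < n \<longleftrightarrow> (\<exists>k. n = m + (k + (1::'a)))"
  have "(\<exists>k. n + 1 = m + (k + 1)) \<longleftrightarrow> (\<exists>k. n = m + k)" by (metis add_suc suc_inj)
  also have "\<dots> \<longleftrightarrow> m < n \<or> m = n" unfolding IH by (metis add_zero aca_cases)
  finally show "m < n + 1 \<longleftrightarrow> (\<exists>k. n + 1 = m + (k + (1::'a)))" by (simp add: less_suc)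
qed

lemma aca_le_iff: "m \<le> n \<longleftrightarrow> (\<exists>k. n = m + (k::'a::aca))"
proof
  show "m \<le> n \<Longrightarrow> \<exists>k. n = m + k" unfolding le_iff aca_less_iff using add_zero[of m, symmetric] by blast
  assume "\<exists>k. n = m + k"
  then obtain k where "n = m + k" by blast
  then show "m \<le> n" unfolding le_iff aca_less_iff using aca_cases[of k] add_zero[of m] by auto
qed

lemma aca_linear: "m < n \<or> m = n \<or> n < (m::'a::aca)"
proof (rule ind[of "\<lambda>n. m < n \<or> m = n \<or> n < m"], intro d_basic dt_basic)
  show "m < 0 \<or> m = 0 \<or> 0 < m" using aca_cases[of m] by (auto simp: aca_less_iff aca_add_0_left)
next
  fix n :: 'a assume IH: "m < n \<or> m = n \<or> n < m"
  have "m = n + 1 \<or> n + 1 < m" if nm: "n < m"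
  proof -
    obtain k where k: "m = n + (k + 1)" using nm unfolding aca_less_iff by blast
    show ?thesis using aca_cases[of k]
    proof
      assume "k = 0" then show ?thesis using k by (simp add: aca_add_0_left)
    next
      assume "\<exists>j. k = j + 1"
      then obtain j where "k = j + 1" by blast
      then have "m = (n + 1) + (j + 1)" using k by (simp only: aca_suc_left[of n j] add_suc)
      then show ?thesis unfolding aca_less_iff by blast
    qed
  qed
  then show "m < n + 1 \<or> m = n + 1 \<or> n + 1 < m" using IH less_suc by blast
qed

lemma aca_irrefl: "\<not> n < (n::'a::aca)"
proof
  assume "n < n"
  then obtain k where "n = n + (k + 1)" unfolding aca_less_iff by blast
  then have "0 + n = (k + 1) + n" by (metis aca_add_0_left aca_add_commute)
  then show False using aca_add_cancel suc_neq by metis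
qed

lemma aca_trans: "a < b \<Longrightarrow> b < c \<Longrightarrow> a < (c::'a::aca)"
proof -
  assume "a < b" "b < c"
  then obtain k j where "b = a + (k + 1)" "c = b + (j + 1)" unfolding aca_less_iff by blast
  then have "c = a + (((k + 1) + j) + 1)" by (simp add: aca_add_assoc)
  then show "a < c" unfolding aca_less_iff by blast
qed

lemma aca_mult_mono: "a < b \<Longrightarrow> 0 < c \<Longrightarrow> c * a < c * (b::'a::aca)"
proof -
  assume "a < b" "0 < c"
  then obtain k j where "b = a + (k + 1)" "c = j + 1"
    unfolding aca_less_iff aca_add_0_left by blast
  then have "c * b = c * a + ((c * k + j) + 1)" by (simp add: aca_distrib aca_mult_1 aca_add_assoc)
  then show "c * a < c * b" unfolding aca_less_iff by blast
qed

text \<open>Subtraction is truncated; it only serves to obtain an instance of \<open>linordered_semidom\<close>.\<close>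

class arith = aca + linordered_semidom +
  assumes diff_zero: "x \<le> y \<Longrightarrow> x - y = 0"

context arith begin

lemma zero_le [simp]: "0 \<le> x"
  using local.less_zero local.not_less by blast
lemma less_plus1: "x < y + 1 \<longleftrightarrow> x \<le> y"
  by (simp add: local.less_suc local.le_iff)
lemma less_iff_Suc_le: "x < y \<longleftrightarrow> x + 1 \<le> y"
  using less_plus1 local.not_less by blast
lemma zero_or_pos: "x = 0 \<or> 0 < x"
  using local.le_less zero_le by auto
lemma pos_iff: "0 < x \<longleftrightarrow> x \<noteq> 0"
  using zero_or_pos by auto
lemma le_zero [simp]: "x \<le> 0 \<longleftrightarrow> x = 0"
  using zero_le local.order.antisym by blast
lemma le_add_ex: "x \<le> y \<longleftrightarrow> (\<exists>k. y = x + k)"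
  using local.le_add_diff_inverse2 local.add.commute zero_le
  by (metis local.add_0_right local.add_le_cancel_left)
lemma self_le_add [simp]: "x \<le> x + y" "x \<le> y + x" 
  using le_add_ex local.add.commute by blast+
lemma suc_cases: obtains "x = 0" | y where "x = y + 1"
  using zero_or_pos[of x] less_iff_Suc_le[of 0 x] le_add_ex local.add_commute by auto
lemma self_le_mult: "c \<noteq> 0 \<Longrightarrow> x \<le> c * x"
  using local.mult_right_mono[of 1 c x] less_iff_Suc_le[of 0 c] pos_iff[of c] by simp
lemma le_square: "x \<le> x * x"
  using self_le_mult[of x x] by (cases "x = 0") (auto simp: pos_iff)
end

instance nat :: arith
proof
  fix P :: "(nat \<Rightarrow> nat) \<Rightarrow> bool" and e and X :: "nat set" and x :: nat
  show "{x. P (case_nat x e)} \<in> SS" by (simp add: SS_nat_def)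
  show "X \<in> SS \<Longrightarrow> 0 \<in> X \<Longrightarrow> (\<And>x. x \<in> X \<Longrightarrow> x + 1 \<in> X) \<Longrightarrow> x \<in> X" by (induct x) auto
qed auto

lemma dt_subst: "dt t \<Longrightarrow> (\<And>n. dt (\<lambda>e. r e n)) \<Longrightarrow> dt (\<lambda>e. t (r e))"
  by (induct rule: dt.induct) (simp_all add: dt_basic)

lemma d_subst: "d P \<Longrightarrow> (\<And>n. dt (\<lambda>e. r e n)) \<Longrightarrow> d (\<lambda>e. P (r e))"
proof (induct P arbitrary: r rule: d.induct)
  case (d_all0 P)
  have "dt (\<lambda>e. case_nat (e 0) (r (\<lambda>n. e (Suc n))) n)" for n
    by (cases n) (auto intro: dt_var dt_shift[OF d_all0.prems])
  then have "d (\<lambda>e. P (case_nat (e 0) (r (\<lambda>n. e (Suc n)))))" using d_all0 by simp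
  then show ?case by (simp add: d_all)
qed (simp_all add: dt_subst d_eq d_less d_mem d_False d_imp)

lemma d_subst1: assumes "d (\<lambda>e. P (e 0))" "dt s" shows "d (\<lambda>e. P (s e))"
  using d_subst[OF assms(1), of "\<lambda>e n. s e"] assms(2) by simp
lemma d_subst2: assumes "d (\<lambda>e. P (e 0) (e 1))" "dt s" "dt t" shows "d (\<lambda>e. P (s e) (t e))"
proof -
  have "dt (\<lambda>e. case_nat (s e) (\<lambda>_. t e) n)" for n using assms(2,3) by (cases n) auto
  from d_subst[OF assms(1), of "\<lambda>e. case_nat (s e) (\<lambda>_. t e)", OF this] show ?thesis by simp
qed

lemma least:
  fixes P :: "'a::arith \<Rightarrow> bool"
  assumes "d (\<lambda>e. P (e 0))" "P x" shows "\<exists>y. P y \<and> (\<forall>z<y. \<not> P z)"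
proof (rule ccontr)
  assume "\<not> ?thesis"
  then have n: "\<And>y. (\<forall>z<y. \<not> P z) \<Longrightarrow> \<not> P y" by blast
  have "\<forall>z<y. \<not> P z" for y
  proof (rule ind[of "\<lambda>y. \<forall>z<y. \<not> P z"])
    have "d (\<lambda>e. \<not> P (e 0))" using assms(1) by (rule d_not)
    then show "d (\<lambda>e. \<forall>z<e 0. \<not> P z)"
    proof -
      have "d (\<lambda>e. \<forall>z. z < e 0 \<longrightarrow> \<not> P z)"
        by (intro d_all d_imp d_less dt_basic) (rule d_not[OF assms(1)])
      then show ?thesis by simp
    qed
  next
    show "\<forall>z<0. \<not> P z" by (simp add: leD)
  next
    fix x assume "\<forall>z<x. \<not> P z"
    then show "\<forall>z<x + 1. \<not> P z" using n less_suc by blast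
  qed
  then show False using n assms(2) by blast
qed

lemma strong_ind:
  fixes P :: "'a::arith \<Rightarrow> bool"
  assumes "d (\<lambda>e. P (e 0))" "\<And>x. (\<And>y. y < x \<Longrightarrow> P y) \<Longrightarrow> P x" shows "P x"
proof (rule ccontr)
  assume "\<not> P x"
  then obtain y where "\<not> P y" "\<forall>z<y. P z" using least[OF d_not[OF assms(1)]] by blast
  then show False using assms(2) by blast
qed

section \<open>Pairing and codes\<close>

lemma cst_of_nat: "cst n = (of_nat n :: 'a::semiring_1)"
  by (induct n) (auto simp: add.commute)

text \<open>With \<open>s = x + y\<close>, the code is at least \<open>s * s\<close> and less than
  the square of \<open>s + 1\<close>. So it determines \<open>s\<close>, then \<open>x\<close>, then
  \<open>y\<close>.\<close>

lemma pair_inject [simp]: "pair x y = pair x' (y'::'a::arith) \<longleftrightarrow> x = x' \<and> y = y'"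
proof -
  have no: "pair x y \<noteq> pair x' y'" if "x + y < x' + y'" for x y x' y' :: 'a
  proof -
    let ?s = "x + y" let ?t = "x' + y'"
    have "(?s + 1) * (?s + 1) \<le> ?t * ?t" using that less_iff_Suc_le by (intro mult_mono) auto
    moreover have "(?s + 1) * (?s + 1) = ?s * ?s + ?s + ?s + 1" by (simp add: algebra_simps)
    moreover have "?s * ?s + x < ?s * ?s + ?s + ?s + 1"
    proof -
      have "x \<le> ?s" by simp
      then have "x \<le> ?s + ?s" using self_le_add(1) order.trans by blast
      then have "x < ?s + ?s + 1" unfolding less_plus1 .
      then show ?thesis by (simp add: add.assoc)
    qed
    ultimately have "?s * ?s + x < ?t * ?t" by simp
    also have "\<dots> \<le> ?t * ?t + x'" by simp
    finally show ?thesis unfolding pair_def by simp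
  qed
  show ?thesis
  proof
    assume eq: "pair x y = pair x' y'"
    then have "x + y = x' + y'" using no[of x y x' y'] no[of x' y' x y] by (metis linorder_neqE)
    with eq show "x = x' \<and> y = y'" by (auto simp: pair_def)
  qed auto
qed

lemma le_pair: "x \<le> pair x (y::'a::arith)" "y \<le> pair x y"
proof -
  show "x \<le> pair x y" by (simp add: pair_def)
  have "y \<le> x + y" by simp
  also have "\<dots> \<le> (x + y) * (x + y)" by (rule le_square)
  also have "\<dots> \<le> pair x y" by (simp add: pair_def)
  finally show "y \<le> pair x y" .
qed

lemma tag_inject [simp]: "tag k x = tag k' (y::'a::arith) \<longleftrightarrow> k = k' \<and> x = y"
  by (simp add: tag_def cst_of_nat)

text \<open>Components of a code are strictly smaller than the code. This allows
  \<open>strong_ind\<close> in place of structural induction, which nonstandard codes do not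
  admit.\<close>

lemma less_tag: assumes "k \<noteq> 0" shows "x < tag k (x::'a::arith)"
proof -
  have "1 \<le> k" using assms by simp
  then have "1 \<le> (of_nat k :: 'a)" by (metis of_nat_1 of_nat_le_iff)
  from add_right_mono[OF this, of x] have "x + 1 \<le> of_nat k + x" by (simp add: add.commute)
  also have "\<dots> \<le> (of_nat k + x) * (of_nat k + x)" by (rule le_square)
  also have "\<dots> \<le> tag k x" unfolding tag_def pair_def cst_of_nat by (rule self_le_add)
  finally have "x + 1 \<le> tag k x" .
  then show ?thesis by (simp only: less_iff_Suc_le)
qed

lemma cCons_simps [simp]: "cCons x l \<noteq> (cNil::'a::arith)" "cNil \<noteq> cCons x (l::'a)"
  "cCons x l = cCons x' l' \<longleftrightarrow> x = x' \<and> l = (l'::'a)"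
proof -
  show 1: "cCons x l \<noteq> (cNil::'a::arith)" unfolding cCons_def cNil_def by (rule suc_neq)
  show "cNil \<noteq> cCons x (l::'a)" using 1 by metis
  show "cCons x l = cCons x' l' \<longleftrightarrow> x = x' \<and> l = (l'::'a)" unfolding cCons_def by simp
qed

lemma less_cCons: "x < cCons x (l::'a::arith)" "l < cCons x l"
  by (auto simp: cCons_def less_plus1 le_pair)

lemmas code_defs = cVar_def cZero_def cOne_def cPlus_def cTimes_def cEq_def cLess_def cMem_def cFls_def
  cImp_def cAllN_def cAllS_def
lemmas judgement_defs = jTm_def jFm_def jLiftT_def jSubstT_def jLift_def jSubst_def jLiftS_def jSubstS_def jPr_def

lemma hval_ops [simp]:
  "hval e (s + t) = hval e s + hval e t" "hval e (s * t) = hval e s * hval e t" "hval e 0 = 0" "hval e 1 = 1"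
  by (simp_all add: plus_tm_def times_tm_def zero_tm_def one_tm_def)
lemma hval_cst [simp]: "hval e (cst k) = cst k" by (induct k) auto
lemma hval_pair [simp]: "hval e (pair s t) = pair (hval e s) (hval e t)" by (simp add: pair_def)
lemma hval_tag [simp]: "hval e (tag k t) = tag k (hval e t)" by (simp add: tag_def)
lemma hval_cCons [simp]: "hval e (cCons s t) = cCons (hval e s) (hval e t)" by (simp add: cCons_def)
lemma hval_cNil [simp]: "hval e cNil = cNil" by (simp add: cNil_def)

lemma closed_tm_ops [simp]:
  "closed_tm m (s + t) \<longleftrightarrow> closed_tm m s \<and> closed_tm m t" "closed_tm m (s * t) \<longleftrightarrow> closed_tm m s \<and> closed_tm m t"
  "closed_tm m 0" "closed_tm m 1"
  by (simp_all add: plus_tm_def times_tm_def zero_tm_def one_tm_def)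
lemma closed_tm_cst [simp]: "closed_tm m (cst k)" by (induct k) auto
lemma closed_tm_codes [simp]: "closed_tm m (pair s t) \<longleftrightarrow> closed_tm m s \<and> closed_tm m t"
  "closed_tm m (tag k t) \<longleftrightarrow> closed_tm m t" "closed_tm m cNil"
  "closed_tm m (cCons s t) \<longleftrightarrow> closed_tm m s \<and> closed_tm m t"
  by (auto simp: pair_def tag_def cNil_def cCons_def)

lemma dt_pair: "dt s \<Longrightarrow> dt t \<Longrightarrow> dt (\<lambda>e. pair (s e) (t e))" unfolding pair_def by (intro dt_basic)
lemma dt_tag: "dt t \<Longrightarrow> dt (\<lambda>e. tag k (t e))" unfolding tag_def by (intro dt_basic dt_pair)
lemma dt_cCons: "dt s \<Longrightarrow> dt t \<Longrightarrow> dt (\<lambda>e. cCons (s e) (t e))" unfolding cCons_def by (intro dt_basic dt_pair)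
lemmas dts = dt_basic dt_pair dt_tag dt_cCons

section \<open>The beta function\<close>

definition betav :: "'a::arith \<Rightarrow> 'a \<Rightarrow> 'a \<Rightarrow> 'a \<Rightarrow> bool" where
  "betav a b i y \<longleftrightarrow> y < 1 + (i + 1) * b \<and> (\<exists>q. a = q * (1 + (i + 1) * b) + y)"

lemma betav_unique: assumes "betav a b i y" "betav a b i y'" shows "y = y'"
proof -
  let ?m = "1 + (i + 1) * b"
  obtain q q' where q: "a = q * ?m + y" "a = q' * ?m + y'" "y < ?m" "y' < ?m"
    using assms unfolding betav_def by blast
  have no: False if "q < q'" "y < ?m" "q * ?m + y = q' * ?m + y'" for q q' y y' :: 'a
  proof -
    have "(q + 1) * ?m \<le> q' * ?m" using that(1) less_iff_Suc_le by (intro mult_right_mono) auto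
    then have "q * ?m + ?m \<le> q' * ?m + y'" by (simp only: distrib_right mult_1_left) (meson order.trans self_le_add(1))
    then show False using that(2,3) by (metis add_le_cancel_left leD)
  qed
  have "q = q'" using no[of q q' y y'] no[of q' q y' y] q by (metis linorder_neqE)
  with q show ?thesis by simp
qed

text \<open>The product of the positive numbers up to \<open>n\<close> has this property. The
  statement asks only for existence, because recursive definitions become available in a model only
  after sequences have been coded.\<close>

lemma common_multiple: "\<exists>b::'a::arith. b \<noteq> 0 \<and> (\<forall>k. k \<noteq> 0 \<longrightarrow> k \<le> n \<longrightarrow> (\<exists>c. b = k * c))"
proof (rule ind[of "\<lambda>n. \<exists>b::'a::arith. b \<noteq> 0 \<and> (\<forall>k. k \<noteq> 0 \<longrightarrow> k \<le> n \<longrightarrow> (\<exists>c. b = k * c))"], intro d_basic dts)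
  fix n :: 'a assume "\<exists>b. b \<noteq> 0 \<and> (\<forall>k. k \<noteq> 0 \<longrightarrow> k \<le> n \<longrightarrow> (\<exists>c. b = k * c))"
  then obtain b where b: "b \<noteq> 0" "\<And>k. k \<noteq> 0 \<Longrightarrow> k \<le> n \<Longrightarrow> \<exists>c. b = k * c" by blast
  have "\<exists>c. b * (n + 1) = k * c" if "k \<noteq> 0" "k \<le> n + 1" for k
  proof (cases "k \<le> n")
    case True then show ?thesis using b(2)[OF that(1)] by (metis mult.assoc)
  next
    case False then have "k = n + 1" using that(2) less_iff_Suc_le not_le by (metis antisym)
    then show ?thesis by (metis mult.commute)
  qed
  moreover have "b * (n + 1) \<noteq> 0" using b(1) suc_neq by simp
  ultimately show "\<exists>b. b \<noteq> 0 \<and> (\<forall>k. k \<noteq> 0 \<longrightarrow> k \<le> n + 1 \<longrightarrow> (\<exists>c. b = k * c))" by blast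
qed (auto intro: exI[of _ 1])

text \<open>Collection, by induction on the initial segment: the new bound is added to the old one,
  and monotonicity keeps the earlier instances true.\<close>

lemma collect:
  fixes P :: "'a::arith \<Rightarrow> 'a \<Rightarrow> bool"
  assumes "d (\<lambda>e. P (e 0) (e 1))" and mono: "\<And>i w w'. P i w \<Longrightarrow> w \<le> w' \<Longrightarrow> P i w'"
    and ex: "\<And>i. i < n \<Longrightarrow> \<exists>w. P i w"
  shows "\<exists>w. \<forall>i<n. P i w"
proof -
  have "n' \<le> n \<longrightarrow> (\<exists>w. \<forall>i. i < n' \<longrightarrow> P i w)" for n'
  proof (rule ind[of "\<lambda>n'. n' \<le> n \<longrightarrow> (\<exists>w. \<forall>i. i < n' \<longrightarrow> P i w)"], intro d_basic dts)
    show "d (\<lambda>e. P (e 0) (e (Suc 0)))" using assms(1) by simp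
  next
    fix x assume IH: "x \<le> n \<longrightarrow> (\<exists>w. \<forall>i. i < x \<longrightarrow> P i w)"
    show "x + 1 \<le> n \<longrightarrow> (\<exists>w. \<forall>i. i < x + 1 \<longrightarrow> P i w)"
    proof
      assume l: "x + 1 \<le> n"
      then have "x \<le> n" "x < n" by (simp_all only: less_iff_Suc_le[symmetric] less_imp_le)
      then obtain w w' where "\<forall>i. i < x \<longrightarrow> P i w" "P x w'" using IH ex by blast
      then have "\<forall>i. i < x + 1 \<longrightarrow> P i (w + w')" using mono by (metis less_suc self_le_add)
      then show "\<exists>w. \<forall>i. i < x + 1 \<longrightarrow> P i w" by blast
    qed
  qed (simp add: less_zero)
  then show ?thesis by blast
qed

lemma bezout_moduli:
  fixes i j k b c :: "'a::arith"
  assumes "j = i + k" "b = k * c" "c \<noteq> 0"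
  shows "\<exists>x y. x * (1 + (i + 1) * b) = 1 + y * (1 + (j + 1) * b)"
proof -
  \<comment> \<open>\<open>?X * ?m\<close> is congruent to -1 modulo \<open>?m'\<close>: the two
    sides of \<open>eq\<close> differ by \<open>j + 1\<close> times \<open>k * c - b\<close>, which
    is 0. Its square is then congruent to 1, and this can be written without negative
    coefficients.\<close>
  let ?m = "1 + (i + 1) * b" let ?m' = "1 + (j + 1) * b" let ?X = "(j + 1) * (j + 1) * c"
  let ?y = "(j + 1) * (i + 1) * c + 1"
  have eq: "?X * ?m + 1 = ?y * ?m'" unfolding assms(1,2) by (simp add: algebra_simps)
  have "?X * ?m \<noteq> 0" using assms(3) suc_neq[of j] suc_neq[of "(i + 1) * b"] by (simp add: add.commute)
  then obtain t where t: "?X * ?m = t + 1" by (metis suc_cases)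
  have "(?X * ?m) * (?X * ?m) = 1 + t * (?X * ?m + 1)" unfolding t by (simp add: algebra_simps)
  then have "(?X * ?m * ?X) * ?m = 1 + (t * ?y) * ?m'" unfolding eq by (simp only: mult.assoc)
  then show ?thesis by blast
qed

text \<open>Chinese remainders inside the model. As \<open>n\<close> may be nonstandard, the
  induction is on a definable statement; besides the code \<open>a\<close> of the first values it
  carries a common multiple \<open>c\<close> of their moduli that is invertible modulo each later
  one.\<close>

theorem beta_exists:
  fixes f :: "'a::arith \<Rightarrow> 'a"
  assumes df: "d (\<lambda>e. f (e 0) = e 1)"
  shows "\<exists>a b. \<forall>i<n. betav a b i (f i)"
proof -
  have df2: "d (\<lambda>e. f (s e) = t e)" if "dt s" "dt t" for s t
    using d_subst2[of "\<lambda>x y. f x = y", OF df that] .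
  have "d (\<lambda>e. \<forall>v. f (e 0) = v \<longrightarrow> v \<le> e 1)"
    by (intro df2 d_all d_imp d_le dts)
  then have "\<exists>B. \<forall>i<n. \<forall>v. f i = v \<longrightarrow> v \<le> B"
    by (intro collect) (auto intro: order.trans)
  then obtain B where B: "\<And>i. i < n \<Longrightarrow> f i \<le> B" by blast
  obtain b0 where b0: "b0 \<noteq> 0" "\<And>k. k \<noteq> 0 \<Longrightarrow> k \<le> n \<Longrightarrow> \<exists>c. b0 = k * c"
    using common_multiple[of n] by blast
  \<comment> \<open>\<open>b0\<close> is divisible by all differences of indices, which makes the
    moduli coprime; the factor \<open>B + 1\<close> makes them exceed all values.\<close>
  define b where "b = b0 * (B + 1)"
  have b: "\<exists>c. b = k * c" if "k \<noteq> 0" "k \<le> n" for k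
    using b0(2)[OF that] by (metis b_def mult.assoc)
  have bpos: "b \<noteq> 0" using b0(1) suc_neq by (simp add: b_def)
  define m where "m i = 1 + (i + 1) * b" for i
  have fm: "f i < m i" if "i < n" for i
  proof -
    have "f i < B + 1" using B[OF that] less_plus1 by blast
    also have "\<dots> \<le> b" unfolding b_def using b0(1) by (rule self_le_mult)
    also have "\<dots> \<le> (i + 1) * b" using suc_neq by (rule self_le_mult)
    also have "\<dots> \<le> m i" by (simp add: m_def)
    finally show ?thesis .
  qed
  have inv: "\<exists>x y. x * m i = 1 + y * m j" if "i < j" "j < n" for i j
  proof -
    from less_imp_le[OF that(1)] obtain k where k: "j = i + k" unfolding le_add_ex by blast
    have "k \<le> j" unfolding k by (rule self_le_add)
    then have "k \<le> n" using that(2) by simp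
    moreover have "k \<noteq> 0" using that(1) k by auto
    ultimately obtain c where c: "b = k * c" using b[of k] by blast
    then show ?thesis unfolding m_def using bezout_moduli[OF k c] bpos by auto
  qed
  have "n' \<le> n \<longrightarrow> (\<exists>a c. (\<forall>i. i < n' \<longrightarrow> (\<exists>v q. f i = v \<and> a = q * m i + v)) \<and>
     (\<forall>i. i < n' \<longrightarrow> (\<exists>r. c = r * m i)) \<and> (\<forall>j. n' \<le> j \<longrightarrow> j < n \<longrightarrow> (\<exists>x y. x * c = 1 + y * m j)))" for n'
  proof (rule ind[of "\<lambda>n'. n' \<le> n \<longrightarrow> (\<exists>a c. (\<forall>i. i < n' \<longrightarrow> (\<exists>v q. f i = v \<and> a = q * m i + v)) \<and>
     (\<forall>i. i < n' \<longrightarrow> (\<exists>r. c = r * m i)) \<and> (\<forall>j. n' \<le> j \<longrightarrow> j < n \<longrightarrow> (\<exists>x y. x * c = 1 + y * m j)))"],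
     unfold m_def, intro df2 d_all d_imp d_le d_ex d_less d_conj, (intro df2 d_eq dts)+, fold m_def)
    show "0 \<le> n \<longrightarrow> (\<exists>a c. (\<forall>i. i < 0 \<longrightarrow> (\<exists>v q. f i = v \<and> a = q * m i + v)) \<and>
     (\<forall>i. i < 0 \<longrightarrow> (\<exists>r. c = r * m i)) \<and> (\<forall>j. 0 \<le> j \<longrightarrow> j < n \<longrightarrow> (\<exists>x y. x * c = 1 + y * m j)))"
    proof (rule impI, rule exI[of _ 0], rule exI[of _ 1], intro conjI allI impI)
      fix j show "\<exists>x y. x * 1 = 1 + y * m j" by (rule exI[of _ 1], rule exI[of _ 0]) simp
    qed (auto simp: less_zero)
  next
    fix k assume IH: "k \<le> n \<longrightarrow> (\<exists>a c. (\<forall>i. i < k \<longrightarrow> (\<exists>v q. f i = v \<and> a = q * m i + v)) \<and>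
     (\<forall>i. i < k \<longrightarrow> (\<exists>r. c = r * m i)) \<and> (\<forall>j. k \<le> j \<longrightarrow> j < n \<longrightarrow> (\<exists>x y. x * c = 1 + y * m j)))"
    show "k + 1 \<le> n \<longrightarrow> (\<exists>a c. (\<forall>i. i < k + 1 \<longrightarrow> (\<exists>v q. f i = v \<and> a = q * m i + v)) \<and>
     (\<forall>i. i < k + 1 \<longrightarrow> (\<exists>r. c = r * m i)) \<and> (\<forall>j. k + 1 \<le> j \<longrightarrow> j < n \<longrightarrow> (\<exists>x y. x * c = 1 + y * m j)))"
    proof
      assume "k + 1 \<le> n"
      then have kn: "k < n" "k \<le> n" by (simp_all only: less_iff_Suc_le[symmetric] less_imp_le)
      from mp[OF IH kn(2)] obtain a c where a0: "\<forall>i. i < k \<longrightarrow> (\<exists>v q. f i = v \<and> a = q * m i + v)"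
        and c0: "\<forall>i. i < k \<longrightarrow> (\<exists>r. c = r * m i)"
        and j0: "\<forall>j. k \<le> j \<longrightarrow> j < n \<longrightarrow> (\<exists>x y. x * c = 1 + y * m j)" by (elim exE conjE)
      have a: "\<exists>q. a = q * m i + f i" if "i < k" for i using a0 that by auto
      have c: "\<exists>r. c = r * m i" if "i < k" for i using c0 that by simp
      have j: "\<exists>x y. x * c = 1 + y * m j" if "k \<le> j" "j < n" for j using j0 that by simp
      obtain x y where xy: "x * c = 1 + y * m k" using j[OF order.refl kn(1)] by blast
      \<comment> \<open>Modulo \<open>m k\<close>, \<open>x * c\<close> is 1 and \<open>h\<close> is
        -1. So \<open>g\<close> is \<open>f k - a\<close> written without subtraction, and adding
        \<open>x * c * g\<close> corrects the remainder at \<open>k\<close>. The earlier remainders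
        persist, since their moduli divide \<open>c\<close>.\<close>
      define h where "h = (k + 1) * b"
      define g where "g = f k + a * h"
      define a' where "a' = a + (x * c) * g"
      have mk: "m k = 1 + h" by (simp add: m_def h_def)
      have "a' = (a + y * g) * m k + f k" unfolding a'_def xy g_def unfolding mk by (simp add: algebra_simps)
      moreover have "\<exists>q. a' = q * m i + f i" if i: "i < k" for i
      proof -
        obtain q r where "a = q * m i + f i" "c = r * m i" using a[OF i] c[OF i] by blast
        then have "a' = (q + x * r * g) * m i + f i" unfolding a'_def by (simp add: algebra_simps)
        then show ?thesis by blast
      qed
      ultimately have 1: "\<forall>i. i < k + 1 \<longrightarrow> (\<exists>v q. f i = v \<and> a' = q * m i + v)"
        unfolding less_suc by blast
      have "\<exists>r. c * m k = r * m i" if "i < k" for i using c[OF that] by (metis mult.assoc mult.commute)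
      then have 2: "\<forall>i. i < k + 1 \<longrightarrow> (\<exists>r. c * m k = r * m i)" unfolding less_suc by blast
      have 3: "\<exists>x y. x * (c * m k) = 1 + y * m i" if i: "k + 1 \<le> i" "i < n" for i
      proof -
        have ki: "k < i" "k \<le> i" using i(1) by (simp_all only: less_iff_Suc_le[symmetric] less_imp_le)
        obtain x y where 1: "x * c = 1 + y * m i" using j[OF ki(2) i(2)] by blast
        obtain x' y' where 2: "x' * m k = 1 + y' * m i" using inv[OF ki(1) i(2)] by blast
        have "(x * x') * (c * m k) = (x * c) * (x' * m k)" by (simp only: ac_simps)
        also have "\<dots> = 1 + (y + y' + y * m i * y') * m i" unfolding 1 2 by (simp add: algebra_simps)
        finally show ?thesis by blast
      qed
      show "\<exists>a c. (\<forall>i. i < k + 1 \<longrightarrow> (\<exists>v q. f i = v \<and> a = q * m i + v)) \<and>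
     (\<forall>i. i < k + 1 \<longrightarrow> (\<exists>r. c = r * m i)) \<and> (\<forall>j. k + 1 \<le> j \<longrightarrow> j < n \<longrightarrow> (\<exists>x y. x * c = 1 + y * m j))"
        by (rule exI[of _ a'], rule exI[of _ "c * m k"]) (use 1 2 3 in blast)
    qed
  qed
  from this[of n] obtain a where a: "\<forall>i. i < n \<longrightarrow> (\<exists>v q. f i = v \<and> a = q * m i + v)" by auto
  have "betav a b i (f i)" if "i < n" for i
    unfolding betav_def m_def[symmetric] using fm[OF that] a that by auto
  then have "\<forall>i<n. betav a b i (f i)" by blast
  then show ?thesis by blast
qed

section \<open>Meaning of the derivability formulas in a model\<close>

lemma hsat_AllB [simp]: "hsat (AllB t p) e E = (\<forall>x<hval e t. hsat p (case_nat x e) E)"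
  by (simp add: AllB_def)
lemma hsat_ExB [simp]: "hsat (ExB t p) e E = (\<exists>x<hval e t. hsat p (case_nat x e) E)"
  by (simp add: ExB_def)
lemma hsat_conjs [simp]: "hsat (conjs qs) e E = (\<forall>p\<in>set qs. hsat p e E)"
  by (induct qs) auto
lemma hsat_disjs [simp]: "hsat (disjs qs) e E = (\<exists>p\<in>set qs. hsat p e E)"
  by (induct qs) auto

lemma hval_up_0 [simp]: "up 0 t = t" by (simp add: up_def)
lemma hval_up_Suc [simp]: "hval (case_nat x e) (up (Suc n) t) = hval e (up n t)"
  by (simp add: up_def)
lemma hval_up_numeral [simp]: "hval (case_nat x e) (up (numeral k) t) = hval e (up (pred_numeral k) t)"
  by (simp add: numeral_eq_Suc)

lemma hsat_beta [simp]:
  "hsat (beta a b i y) e E = betav (hval e a) (hval e b) (hval e i) (hval (e :: nat \<Rightarrow> 'a::arith) y)"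
proof -
  have "q < a + 1" if "a = q * (1 + (i + 1) * b) + y" for a b i q y :: 'a
  proof -
    have "1 + (i + 1) * b \<noteq> 0" using suc_neq[of "(i + 1) * b"] by (simp add: add.commute)
    then have "q \<le> (1 + (i + 1) * b) * q" by (rule self_le_mult)
    then have "q \<le> a" unfolding that mult.commute[of q] using self_le_add(1) order.trans by metis
    then show ?thesis unfolding less_plus1 .
  qed
  then have "(\<exists>q<a + 1. a = q * (1 + (i + 1) * b) + y) \<longleftrightarrow> (\<exists>q. a = q * (1 + (i + 1) * b) + y)" for a b i y :: 'a
    by metis
  then show ?thesis unfolding beta_def betav_def by simp
qed

lemma hsat_ExBs:
  "hsat (ExBs k t q) e E \<longleftrightarrow>
    (\<exists>p. (\<forall>n<k. p n < hval e t) \<and> hsat q (\<lambda>n. if n < k then p n else e (n - k)) E)"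
proof (induct k arbitrary: t e)
  case (Suc k)
  have eq: "(\<lambda>n. if n < k then p n else case_nat x e (n - k)) =
     (\<lambda>n. if n < Suc k then (p(k := x)) n else e (n - Suc k))" for p x
  proof
    fix n show "(if n < k then p n else case_nat x e (n - k)) = (if n < Suc k then (p(k := x)) n else e (n - Suc k))"
      by (cases "n < k"; cases "n = k") (auto simp: Suc_diff_Suc[symmetric])
  qed
  show ?case
  proof
    assume "hsat (ExBs (Suc k) t q) e E"
    then obtain x p where "x < hval e t" "\<forall>n<k. p n < hval e t"
      "hsat q (\<lambda>n. if n < k then p n else case_nat x e (n - k)) E" by (auto simp: Suc)
    then have "(\<forall>n<Suc k. (p(k := x)) n < hval e t) \<and> hsat q (\<lambda>n. if n < Suc k then (p(k := x)) n else e (n - Suc k)) E"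
      unfolding eq by auto
    then show "\<exists>p. (\<forall>n<Suc k. p n < hval e t) \<and> hsat q (\<lambda>n. if n < Suc k then p n else e (n - Suc k)) E" by blast
  next
    assume "\<exists>p. (\<forall>n<Suc k. p n < hval e t) \<and> hsat q (\<lambda>n. if n < Suc k then p n else e (n - Suc k)) E"
    then obtain p where p: "\<forall>n<Suc k. p n < hval e t" "hsat q (\<lambda>n. if n < Suc k then p n else e (n - Suc k)) E" by blast
    have "hsat q (\<lambda>n. if n < k then p n else case_nat (p k) e (n - k)) E"
      unfolding eq fun_upd_triv using p(2) .
    then have "\<exists>p'. (\<forall>n<k. p' n < hval e t) \<and> hsat q (\<lambda>n. if n < k then p' n else case_nat (p k) e (n - k)) E"
      using p(1) by (intro exI[of _ p]) simp
    then show "hsat (ExBs (Suc k) t q) e E" using p(1) by (simp add: Suc) blast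
  qed
qed simp

lemma hval_cong: "closed_tm m t \<Longrightarrow> (\<And>n. n < m \<Longrightarrow> e n = e' n) \<Longrightarrow> hval e t = hval e' t"
  by (induct t) auto

definition penv :: "(nat \<Rightarrow> 'a::zero) \<Rightarrow> (nat \<Rightarrow> 'a) \<Rightarrow> nat \<Rightarrow> 'a" where
  "penv p e n = (if n < 8 then p n else if n < 13 then 0 else e (n - 13))"

text \<open>
  The eight parameters of a rule are followed by the five variables \<open>8, \<dots>, 12\<close> that \<open>Der\<close> and \<open>step\<close> bind. If a side
  condition does not mention the latter, then it is a condition on the parameters and the free variables only.
\<close>

definition noslot :: "fm \<Rightarrow> bool" where
  "noslot q \<longleftrightarrow> ps q (\<lambda>n. if 8 \<le> n \<and> n < 13 then Zero else Var n) (\<lambda>n. n) = q"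

lemma noslot_closed: "closed 8 s q \<Longrightarrow> noslot q"
  unfolding noslot_def by (rule trans[OF ps_cong ps_id]) auto

definition rule_ok :: "rule \<Rightarrow> bool" where
  "rule_ok r \<longleftrightarrow> noslot (side r) \<and> arithmetical (side r) \<and> closed_tm 8 (concl r) \<and> (\<forall>q\<in>set (prems r). closed_tm 8 q)"

definition rules_ok :: "rule list \<Rightarrow> bool" where "rules_ok R \<longleftrightarrow> (\<forall>r\<in>set R. rule_ok r)"

lemma hsat_step:
  fixes e :: "nat \<Rightarrow> 'a::arith"
  assumes "rule_ok r"
  shows "hsat (step r) (case_nat i (case_nat n (case_nat b (case_nat a (case_nat w e))))) E \<longleftrightarrow>
    (\<exists>p. (\<forall>k<8. p k < w) \<and> hsat (side r) (penv p e) E \<and> betav a b i (hval p (concl r)) \<and>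
      (\<forall>q\<in>set (prems r). \<exists>j<i. betav a b j (hval p q)))"
proof -
  let ?e = "\<lambda>p n'. if n' < 8 then p n' else (case_nat i (case_nat n (case_nat b (case_nat a (case_nat w e))))) (n' - 8)"
  have 1: "hsat (side r) (?e p) E = hsat (side r) (penv p e) E" for p
  proof -
    have ns: "ps (side r) (\<lambda>n. if 8 \<le> n \<and> n < 13 then Zero else Var n) (\<lambda>n. n) = side r"
      using assms by (simp add: rule_ok_def noslot_def)
    have "(\<lambda>n'. hval (?e p) (if 8 \<le> n' \<and> n' < 13 then Zero else Var n')) = penv p e"
    proof
      fix n' :: nat
      have "n' < 8 \<or> n' = 8 \<or> n' = 9 \<or> n' = 10 \<or> n' = 11 \<or> n' = 12 \<or> (\<exists>m. n' = m + 13)"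
        using le_add_diff_inverse2[of 13 n', symmetric] by (cases "n' < 13") (auto simp: numeral_eq_Suc less_Suc_eq)
      then show "hval (?e p) (if 8 \<le> n' \<and> n' < 13 then Zero else Var n') = penv p e n'"
        by (elim disjE exE) (auto simp: penv_def numeral_eq_Suc)
    qed
    moreover have "hsat (side r) (?e p) E = hsat (ps (side r) (\<lambda>n. if 8 \<le> n \<and> n < 13 then Zero else Var n) (\<lambda>n. n)) (?e p) E"
      unfolding ns ..
    ultimately show ?thesis by (simp only: hsat_ps)
  qed
  have 2: "hval (?e p) q = hval p q" if "closed_tm 8 q" for p q
    using that by (rule hval_cong) simp
  have 3: "hval (case_nat x (?e p)) (up 1 q) = hval p q" if "closed_tm 8 q" for p q x
    using 2[OF that] by simp
  show ?thesis unfolding step_def hsat_ExBs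
    using assms by (simp add: 1 2 3 rule_ok_def cong: conj_cong)
qed

definition inst :: "rule list \<Rightarrow> (nat \<Rightarrow> 'a::arith) \<Rightarrow> (nat \<Rightarrow> 'a set) \<Rightarrow> 'a set \<Rightarrow> 'a \<Rightarrow> bool" where
  "inst R e E J z \<longleftrightarrow> (\<exists>r\<in>set R. \<exists>p. hsat (side r) (penv p e) E \<and> z = hval p (concl r) \<and>
     (\<forall>q\<in>set (prems r). hval p q \<in> J))"

lemma inst_mono: "inst R e E J z \<Longrightarrow> (\<And>y. y \<in> J \<Longrightarrow> y \<in> J') \<Longrightarrow> inst R e E J' z"
  unfolding inst_def by blast

definition valid :: "rule list \<Rightarrow> (nat \<Rightarrow> 'a::arith) \<Rightarrow> (nat \<Rightarrow> 'a set) \<Rightarrow> 'a \<Rightarrow> 'a \<Rightarrow> 'a \<Rightarrow> bool" where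
  "valid R e E a b n \<longleftrightarrow> (\<forall>i<n. \<exists>y. betav a b i y \<and> inst R e E {u. \<exists>j<i. betav a b j u} y)"

definition der :: "rule list \<Rightarrow> (nat \<Rightarrow> 'a::arith) \<Rightarrow> (nat \<Rightarrow> 'a set) \<Rightarrow> 'a \<Rightarrow> bool" where
  "der R e E z \<longleftrightarrow> (\<exists>a b n. (\<exists>i<n. betav a b i z) \<and> valid R e E a b n)"

lemma arithmetical_defs [simp]:
  "arithmetical (Neg p) = arithmetical p" "arithmetical (Conj p q) = (arithmetical p \<and> arithmetical q)"
  "arithmetical (Disj p q) = (arithmetical p \<and> arithmetical q)" "arithmetical (Iff p q) = (arithmetical p \<and> arithmetical q)"
  "arithmetical (ExN p) = arithmetical p" "arithmetical (AllB t p) = arithmetical p" "arithmetical (ExB t p) = arithmetical p"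
  by (auto simp: Neg_def Conj_def Disj_def Iff_def ExN_def AllB_def ExB_def)
lemma arithmetical_conjs [simp]: "arithmetical (conjs qs) = (\<forall>p\<in>set qs. arithmetical p)"
  by (induct qs) auto
lemma arithmetical_disjs [simp]: "arithmetical (disjs qs) = (\<forall>p\<in>set qs. arithmetical p)"
  by (induct qs) auto
lemma arithmetical_beta [simp]: "arithmetical (beta a b i y)" by (simp add: beta_def)
lemma arithmetical_ExBs [simp]: "arithmetical (ExBs n t p) = arithmetical p"
  by (induct n arbitrary: t) auto
lemma arithmetical_step: "rule_ok r \<Longrightarrow> arithmetical (step r)"
  by (auto simp: step_def rule_ok_def)
lemma arithmetical_Der [simp]: "rules_ok R \<Longrightarrow> arithmetical (Der R x)"
  by (auto simp: Der_def rules_ok_def arithmetical_step)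

lemma dt_case: "dt s \<Longrightarrow> (\<And>n. dt (\<lambda>e. r e n)) \<Longrightarrow> dt (\<lambda>e. case_nat (s e) (r e) n)"
  by (cases n) auto

text \<open>\<open>Der\<close> bounds the code, the length and the parameters of all steps by one
  \<open>w\<close>. Each step alone has some bound; a common one for a possibly nonstandard number
  of steps comes from \<open>collect\<close>.\<close>

theorem hsat_Der:
  fixes e :: "nat \<Rightarrow> 'a::arith"
  assumes R: "rules_ok R" and E: "\<And>n. E n \<in> SS"
  shows "hsat (Der R x) e E \<longleftrightarrow> der R e E (hval e x)"
proof -
  let ?P = "\<lambda>a b w i. \<exists>r\<in>set R. \<exists>p. (\<forall>k<8. p k < w) \<and> hsat (side r) (penv p e) E \<and> betav a b i (hval p (concl r)) \<and>
      (\<forall>q\<in>set (prems r). \<exists>j<i. betav a b j (hval p q))"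
  have ok: "rule_ok r" if "r \<in> set R" for r using R that unfolding rules_ok_def by blast
  have P: "(\<exists>r\<in>set R. hsat (step r) (case_nat i (case_nat n (case_nat b (case_nat a (case_nat w e))))) E) = ?P a b w i"
      for i n a b w
    using ok by (intro bex_cong refl hsat_step) auto
  have D: "hsat (Der R x) e E \<longleftrightarrow> (\<exists>w. \<exists>a<w. \<exists>b<w. \<exists>n<w. (\<exists>i<n. betav a b i (hval e x)) \<and> (\<forall>i<n. ?P a b w i))"
    by (simp add: Der_def P)
  have V: "valid R e E a b n \<longleftrightarrow> (\<forall>i<n. \<exists>w. ?P a b w i)" for a b n
  proof -
    have "(\<exists>y. betav a b i y \<and> inst R e E {u. \<exists>j<i. betav a b j u} y) \<longleftrightarrow> (\<exists>w. ?P a b w i)" for i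
    proof
      assume "\<exists>y. betav a b i y \<and> inst R e E {u. \<exists>j<i. betav a b j u} y"
      then obtain r p where rp: "r \<in> set R" "hsat (side r) (penv p e) E" "betav a b i (hval p (concl r))"
         "\<forall>q\<in>set (prems r). \<exists>j<i. betav a b j (hval p q)" unfolding inst_def by auto
      have "p k < (\<Sum>j<8. p j) + 1" if "k < 8" for k
        unfolding less_plus1 using that by (intro member_le_sum) auto
      with rp show "\<exists>w. ?P a b w i" by blast
    next
      assume "\<exists>w. ?P a b w i"
      then show "\<exists>y. betav a b i y \<and> inst R e E {u. \<exists>j<i. betav a b j u} y"
        unfolding inst_def mem_Collect_eq by blast
    qed
    then show ?thesis unfolding valid_def by simp
  qed
  have mono: "?P a b w' i" if P: "?P a b w i" and le: "w \<le> w'" for a b w w' i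
  proof -
    from P obtain r p where rp: "r \<in> set R" "\<forall>k<8. p k < w" and
      rest: "hsat (side r) (penv p e) E \<and> betav a b i (hval p (concl r)) \<and>
      (\<forall>q\<in>set (prems r). \<exists>j<i. betav a b j (hval p q))" by blast
    have "\<forall>k<8. p k < w'" using rp(2) le order.strict_trans2 by blast
    with rest show ?thesis by (intro bexI[OF _ rp(1)] exI[of _ p]) simp
  qed
  have C: "\<exists>w. \<forall>i<n. ?P a b w i" if "\<forall>i<n. \<exists>w. ?P a b w i" for a b n
  proof (rule collect)
    have "d (\<lambda>\<epsilon>. \<exists>r\<in>set R. hsat (step r) (case_nat (\<epsilon> 0) (case_nat n (case_nat b (case_nat a (case_nat (\<epsilon> 1) e))))) E)"
    proof (intro d_bex_list d_hsat)
      fix r n' assume "r \<in> set R"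
      show "dt (\<lambda>\<epsilon>. case_nat (\<epsilon> 0) (case_nat n (case_nat b (case_nat a (case_nat (\<epsilon> 1) e)))) n')"
        by (rule dt_case dt_basic)+
    qed (auto simp: E arithmetical_step ok)
    then show "d (\<lambda>\<epsilon>. ?P a b (\<epsilon> 1) (\<epsilon> 0))" unfolding P .
  next
    fix i w w' assume "?P a b w i" "w \<le> (w'::'a)"
    then show "?P a b w' i" by (rule mono)
  next
    show "\<exists>w. ?P a b w i" if "i < n" for i using that \<open>\<forall>i<n. \<exists>w. ?P a b w i\<close> by simp
  qed
  define P0 where "P0 a b w i \<longleftrightarrow> ?P a b w i" for a b w i
  note D' = D[folded P0_def] and V' = V[folded P0_def] and C' = C[folded P0_def] and mono' = mono[folded P0_def]
  show ?thesis
  proof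
    assume "hsat (Der R x) e E"
    then show "der R e E (hval e x)" unfolding D' der_def V' by blast
  next
    assume "der R e E (hval e x)"
    then obtain a b n where 1: "\<exists>i<n. betav a b i (hval e x)" and "\<forall>i<n. \<exists>w. P0 a b w i" unfolding der_def V' by blast
    from C'[OF this(2)] obtain w where w: "\<forall>i<n. P0 a b w i" ..
    let ?w = "w + a + b + n + 1"
    have "a < ?w" "b < ?w" "n < ?w" "w \<le> ?w" unfolding less_plus1
      using self_le_add(1)[of w "a + b + n"] self_le_add(1)[of a "w + b + n"] self_le_add(1)[of b "w + a + n"]
        self_le_add(1)[of n "w + a + b"] self_le_add(1)[of "w + a + b + n" 1]
      by (auto simp: add.commute add.left_commute intro: order.trans)
    moreover have "\<forall>i<n. P0 a b ?w i" using w mono'[OF _ \<open>w \<le> ?w\<close>] by simp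
    ultimately show "hsat (Der R x) e E" unfolding D' using 1 by blast
  qed
qed

section \<open>Closure, induction and inversion for derivability\<close>

text \<open>The free variables of a side condition start at 13. A dummy variable inserted there
  makes room for the derived element among the variables, so that derivability is definable jointly
  in that element and in the parameters (\<open>d_der\<close>).\<close>

definition lift_rules :: "rule list \<Rightarrow> rule list" where
  "lift_rules = map (\<lambda>r. Rule (prems r) (lift 13 (side r)) (concl r))"

lemma rules_ok_lift: assumes "rules_ok R" shows "rules_ok (lift_rules R)"
proof -
  have "noslot (lift 13 q)" if "noslot q" for q
  proof -
    let ?f = "\<lambda>n. if 8 \<le> n \<and> n < 13 then Zero else Var n" let ?g = "\<lambda>n. if n < 13 then Var n else Var (Suc n)"
    have "(\<lambda>n. ps_tm ?f (?g n)) = (\<lambda>n. ps_tm ?g (?f n))" by (auto simp: fun_eq_iff)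
    then have "ps (ps q ?g (\<lambda>n. n)) ?f (\<lambda>n. n) = ps (ps q ?f (\<lambda>n. n)) ?g (\<lambda>n. n)" by (simp add: ps_comp)
    then show ?thesis using that by (simp add: noslot_def lift_ps id_def)
  qed
  then show ?thesis using assms by (auto simp: rules_ok_def rule_ok_def lift_rules_def lift_ps)
qed

lemma der_lift_rules: "der (lift_rules R) (case_nat x e) E = der R e E"
proof -
  have eq: "(\<lambda>n. hval (penv p (case_nat x e)) (if n < 13 then Var n else Var (Suc n))) = penv p e" for p
  proof
    fix n show "hval (penv p (case_nat x e)) (if n < 13 then Var n else Var (Suc n)) = penv p e n"
    proof (cases "n < 13")
      case False
      then have "Suc n - 13 = Suc (n - 13)" by simp
      with False show ?thesis by (simp add: penv_def del: diff_Suc_numeral)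
    qed (simp add: penv_def)
  qed
  have "inst (lift_rules R) (case_nat x e) E J z = inst R e E J z" for J z
    by (auto simp: inst_def lift_rules_def lift_ps hsat_ps eq)
  then show ?thesis by (auto simp: fun_eq_iff der_def valid_def)
qed

lemma d_der:
  assumes "rules_ok R" "\<And>n. E n \<in> SS" "dt z" "\<And>n. dt (\<lambda>\<epsilon>. r \<epsilon> n)"
  shows "d (\<lambda>\<epsilon>. der R (r \<epsilon>) E (z \<epsilon> :: 'a::arith))"
proof -
  have "d (\<lambda>\<epsilon>. hsat (Der (lift_rules R) (Var 0)) (case_nat (z \<epsilon>) (r \<epsilon>)) E)"
    by (intro d_hsat dt_case assms arithmetical_Der rules_ok_lift)
  then show ?thesis by (simp add: hsat_Der rules_ok_lift assms(1,2) der_lift_rules)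
qed

lemma d_subst4:
  assumes "d (\<lambda>e. P (e 0) (e 1) (e 2) (e 3))" "dt s" "dt t" "dt u" "dt v"
  shows "d (\<lambda>e. P (s e) (t e) (u e) (v e))"
  using d_subst[OF assms(1), of "\<lambda>e. case_nat (s e) (case_nat (t e) (case_nat (u e) (\<lambda>_. v e)))"] assms(2-)
  by (simp add: dt_case numeral_eq_Suc)

lemma d_betav: "dt a \<Longrightarrow> dt b \<Longrightarrow> dt i \<Longrightarrow> dt y \<Longrightarrow> d (\<lambda>e. betav (a e) (b e) (i e) (y e))"
proof (rule d_subst4)
  show "d (\<lambda>e. betav (e 0) (e 1) (e 2) (e 3))" unfolding betav_def by (intro d_conj d_less d_ex d_eq dts)
qed

text \<open>Induction on the position in the coded sequence. \<open>P\<close> has to be definable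
  because the sequence may have nonstandard length.\<close>

theorem der_induct:
  fixes z :: "'a::arith"
  assumes dP: "d (\<lambda>\<epsilon>. P (\<epsilon> 0))" and step: "\<And>z. inst R e E {y. der R e E y \<and> P y} z \<Longrightarrow> P z"
    and z: "der R e E z"
  shows "P z"
proof -
  obtain a b n where i: "\<exists>i<n. betav a b i z" and v: "valid R e E a b n" using z unfolding der_def by blast
  have "i < n \<longrightarrow> (\<forall>y. betav a b i y \<longrightarrow> P y)" for i
  proof (rule strong_ind[of "\<lambda>i. i < n \<longrightarrow> (\<forall>y. betav a b i y \<longrightarrow> P y)"])
    show "d (\<lambda>\<epsilon>. \<epsilon> 0 < n \<longrightarrow> (\<forall>y. betav a b (\<epsilon> 0) y \<longrightarrow> P y))"
      by (intro d_imp d_all d_less d_betav dP dts)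
    fix i assume IH: "\<And>j. j < i \<Longrightarrow> j < n \<longrightarrow> (\<forall>y. betav a b j y \<longrightarrow> P y)"
    show "i < n \<longrightarrow> (\<forall>y. betav a b i y \<longrightarrow> P y)"
    proof (intro impI allI)
      fix y assume i: "i < n" and y: "betav a b i y"
      obtain y' where y': "betav a b i y'" "inst R e E {u. \<exists>j<i. betav a b j u} y'"
        using v i unfolding valid_def by blast
      have "P u" "der R e E u" if "j < i" "betav a b j u" for j u
        using IH[OF that(1)] that i v order.strict_trans[OF that(1) i] unfolding der_def by blast+
      then have "inst R e E {y. der R e E y \<and> P y} y'" by (intro inst_mono[OF y'(2)]) blast
      then have "P y'" by (rule step)
      then show "P y" using betav_unique[OF y y'(1)] by simp
    qed
  qed
  then show ?thesis using i by blast
qed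

lemma der_cases: "der R e E z \<Longrightarrow> inst R e E {y. der R e E y} z"
proof -
  assume "der R e E z"
  then obtain a b n i where i: "i < n" "betav a b i z" and v: "valid R e E a b n" unfolding der_def by blast
  then obtain y' where y': "betav a b i y'" "inst R e E {u. \<exists>j<i. betav a b j u} y'" unfolding valid_def by blast
  have "y' = z" using betav_unique[OF y'(1) i(2)] .
  moreover have "der R e E u" if "j < i" "betav a b j u" for j u
    using that v order.strict_trans[OF that(1) i(1)] unfolding der_def by blast
  ultimately show ?thesis using y'(2) by (auto elim!: inst_mono)
qed

text \<open>The default 0 makes this a total function, as \<open>beta_exists\<close>
  demands.\<close>

definition entry :: "'a::arith \<Rightarrow> 'a \<Rightarrow> 'a \<Rightarrow> 'a" where
  "entry a b i = (if \<exists>y. betav a b i y then (THE y. betav a b i y) else 0)"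

lemma entry_eq: "entry a b i = v \<longleftrightarrow> betav a b i v \<or> (\<not> (\<exists>y. betav a b i y) \<and> v = 0)"
proof (cases "\<exists>y. betav a b i y")
  case True
  then have "\<exists>!y. betav a b i y" using betav_unique by blast
  then have "betav a b i (THE y. betav a b i y)" by (rule theI')
  then show ?thesis using True betav_unique by (auto simp: entry_def)
qed (auto simp: entry_def)

lemma d_entry: "dt a \<Longrightarrow> dt b \<Longrightarrow> dt i \<Longrightarrow> dt y \<Longrightarrow> d (\<lambda>e. entry (a e) (b e) (i e) = y e)"
proof (rule d_subst4[of "\<lambda>a b i y. entry a b i = y"])
  show "d (\<lambda>e. entry (e 0) (e 1) (e 2) = e 3)"
    unfolding entry_eq by (intro d_disj d_conj d_not d_ex d_betav d_eq dts)
qed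

declare less_zero [simp]

lemma seq_append:
  "\<exists>a b. (\<forall>i<n1. betav a b i (entry a1 b1 i)) \<and> (\<forall>i<n2. betav a b (n1 + i) (entry a2 b2 i :: 'a::arith))"
proof -
  define f where "f i = (if i < n1 then entry a1 b1 i else entry a2 b2 (i - n1))" for i
  have f: "f i = v \<longleftrightarrow> (i < n1 \<and> entry a1 b1 i = v) \<or> (\<exists>k. i = n1 + k \<and> entry a2 b2 k = v)" for i v
  proof (cases "i < n1")
    case True
    then have "i \<noteq> n1 + k" for k using self_le_add(1)[of n1 k] by auto
    then show ?thesis using True by (simp add: f_def)
  next
    case False
    then obtain k where "i = n1 + k" using le_add_ex[of n1 i] by auto
    then show ?thesis by (auto simp: f_def leD)
  qed
  have "d (\<lambda>e. f (e 0) = e 1)" unfolding f by (intro d_disj d_conj d_less d_ex d_eq d_entry dts)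
  from beta_exists[OF this, of "n1 + n2"] obtain a b where ab: "\<forall>i<n1 + n2. betav a b i (f i)" by blast
  have "betav a b i (entry a1 b1 i)" if "i < n1" for i
    using ab[rule_format, of i] that order.strict_trans2[OF that self_le_add(1), of n2] by (simp add: f_def)
  moreover have "betav a b (n1 + i) (entry a2 b2 i)" if "i < n2" for i
    using ab[rule_format, of "n1 + i"] that by (simp add: f_def)
  ultimately show ?thesis by blast
qed

lemma entry_betav: "betav a b i y \<Longrightarrow> betav a' b' j (entry a b i) \<Longrightarrow> betav a' b' j y"
  by (metis entry_eq)

lemma valid_append:
  assumes "valid R e E a1 b1 n1" "valid R e E a2 b2 n2"
  shows "\<exists>a b. valid R e E a b (n1 + n2) \<and> (\<forall>i<n1. \<forall>y. betav a1 b1 i y \<longrightarrow> betav a b i y) \<and>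
    (\<forall>i<n2. \<forall>y. betav a2 b2 i y \<longrightarrow> betav a b (n1 + i) y)"
proof -
  obtain a b where ab: "\<And>i. i < n1 \<Longrightarrow> betav a b i (entry a1 b1 i)"
      "\<And>i. i < n2 \<Longrightarrow> betav a b (n1 + i) (entry a2 b2 i)"
    using seq_append[of n1 a1 b1 n2 a2 b2] by blast
  have c1: "betav a b i y" if "i < n1" "betav a1 b1 i y" for i y using entry_betav[OF that(2) ab(1)[OF that(1)]] .
  have c2: "betav a b (n1 + i) y" if "i < n2" "betav a2 b2 i y" for i y using entry_betav[OF that(2) ab(2)[OF that(1)]] .
  have "\<exists>y. betav a b i y \<and> inst R e E {u. \<exists>j<i. betav a b j u} y" if "i < n1 + n2" for i
  proof (cases "i < n1")
    case True
    then obtain y where y: "betav a1 b1 i y" "inst R e E {u. \<exists>j<i. betav a1 b1 j u} y"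
      using assms(1) unfolding valid_def by blast
    have "inst R e E {u. \<exists>j<i. betav a b j u} y"
      by (rule inst_mono[OF y(2)]) (use c1 order.strict_trans[OF _ True] in blast)
    then show ?thesis using c1[OF True y(1)] by blast
  next
    case False
    then obtain k where k: "i = n1 + k" using le_add_ex[of n1 i] by auto
    then have k2: "k < n2" using that by simp
    then obtain y where y: "betav a2 b2 k y" "inst R e E {u. \<exists>j<k. betav a2 b2 j u} y"
      using assms(2) unfolding valid_def by blast
    have "inst R e E {u. \<exists>j<i. betav a b j u} y"
    proof (rule inst_mono[OF y(2)])
      fix u assume "u \<in> {u. \<exists>j<k. betav a2 b2 j u}"
      then obtain j where j: "j < k" "betav a2 b2 j u" by blast
      then have "betav a b (n1 + j) u" using c2 k2 order.strict_trans by blast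
      moreover have "n1 + j < i" using j(1) k by simp
      ultimately show "u \<in> {u. \<exists>j<i. betav a b j u}" by blast
    qed
    then show ?thesis using c2[OF k2 y(1)] k by blast
  qed
  then have "valid R e E a b (n1 + n2)" unfolding valid_def by blast
  then show ?thesis using c1 c2 by blast
qed

lemma valid_list:
  assumes "\<forall>u\<in>set us. der R e E u"
  shows "\<exists>a b n. valid R e E a b n \<and> (\<forall>u\<in>set us. \<exists>i<n. betav a b i (u::'a::arith))"
  using assms
proof (induct us)
  case Nil
  have "valid R e E 0 0 0" by (simp add: valid_def less_zero)
  then show ?case by auto
next
  case (Cons u us)
  then obtain a b n where 1: "valid R e E a b n" "\<forall>u\<in>set us. \<exists>i<n. betav a b i u" by auto
  obtain a' b' n' i' where 2: "valid R e E a' b' n'" "i' < n'" "betav a' b' i' u" using Cons.prems unfolding der_def by auto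
  obtain a'' b'' where 3: "valid R e E a'' b'' (n + n')" "\<And>i y. i < n \<Longrightarrow> betav a b i y \<Longrightarrow> betav a'' b'' i y"
     "\<And>i y. i < n' \<Longrightarrow> betav a' b' i y \<Longrightarrow> betav a'' b'' (n + i) y"
    using valid_append[OF 1(1) 2(1)] by blast
  have "\<exists>i<n + n'. betav a'' b'' i v" if v: "v \<in> set us" for v
  proof -
    obtain i where "i < n" "betav a b i v" using 1(2) v by blast
    then show ?thesis using 3(2) order.strict_trans2[OF _ self_le_add(1)] by blast
  qed
  moreover have "\<exists>i<n + n'. betav a'' b'' i u" using 3(3)[OF 2(2,3)] 2(2) by (intro exI[of _ "n + i'"]) simp
  ultimately have "\<forall>u\<in>set (u # us). \<exists>i<n + n'. betav a'' b'' i u" by auto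
  then show ?case using 3(1) by blast
qed

text \<open>The derivations of the premises are concatenated, and the conclusion is appended as the
  entry with index \<open>n\<close>.\<close>

theorem der_rule:
  fixes p :: "nat \<Rightarrow> 'a::arith"
  assumes r: "r \<in> set R" "hsat (side r) (penv p e) E" "\<forall>q\<in>set (prems r). der R e E (hval p q)"
  shows "der R e E (hval p (concl r))"
proof -
  let ?z = "hval p (concl r)"
  have "\<forall>u\<in>set (map (hval p) (prems r)). der R e E u" using r(3) by auto
  from valid_list[OF this] obtain a b n where v: "valid R e E a b n"
    "\<forall>u\<in>set (map (hval p) (prems r)). \<exists>i<n. betav a b i u" by blast
  have "d (\<lambda>e. ?z = e 1)" by (intro d_eq dts)
  from beta_exists[OF this, of 1] obtain a' b' where "\<forall>i<1. betav a' b' i ?z" by blast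
  then have z': "betav a' b' 0 ?z" by simp
  obtain a2 b2 where ab: "\<And>i. i < n \<Longrightarrow> betav a2 b2 i (entry a b i)" "betav a2 b2 (n + 0) (entry a' b' 0)"
    using seq_append[of n a b 1 a' b'] by (metis zero_less_one)
  have c: "betav a2 b2 i y" if "i < n" "betav a b i y" for i y using entry_betav[OF that(2) ab(1)[OF that(1)]] .
  have cz: "betav a2 b2 n ?z" using entry_betav[OF z' ab(2)] by simp
  have "\<exists>y. betav a2 b2 i y \<and> inst R e E {u. \<exists>j<i. betav a2 b2 j u} y" if "i < n + 1" for i
  proof (cases "i < n")
    case True
    then obtain y where y: "betav a b i y" "inst R e E {u. \<exists>j<i. betav a b j u} y"
      using v(1) unfolding valid_def by blast
    have "inst R e E {u. \<exists>j<i. betav a2 b2 j u} y"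
      by (rule inst_mono[OF y(2)]) (use c order.strict_trans[OF _ True] in blast)
    then show ?thesis using c[OF True y(1)] by blast
  next
    case False
    then have i: "i = n" using that by (auto simp: less_suc)
    have "\<forall>q\<in>set (prems r). \<exists>j<n. betav a2 b2 j (hval p q)" using v(2) c by (metis image_eqI list.set_map)
    then have "inst R e E {u. \<exists>j<i. betav a2 b2 j u} ?z" unfolding inst_def i using r(1,2) by blast
    then show ?thesis using cz i by blast
  qed
  then have "valid R e E a2 b2 (n + 1)" unfolding valid_def by blast
  moreover have "n < n + 1" by (simp add: less_plus1)
  ultimately show ?thesis unfolding der_def using cz by blast
qed

section \<open>Dependence on free variables, and inversion of judgements\<close>

lemma hsat_cong:
  "closed m s q \<Longrightarrow> (\<And>n. n < m \<Longrightarrow> e n = e' n) \<Longrightarrow> (\<And>n. n < s \<Longrightarrow> E n = E' n) \<Longrightarrow> hsat q e E = hsat q e' E'"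
proof (induct q arbitrary: m s e e' E E')
  case (Eq t u)
  then show ?case using hval_cong[of m t e e'] hval_cong[of m u e e'] by simp
next
  case (Less t u)
  then show ?case using hval_cong[of m t e e'] hval_cong[of m u e e'] by simp
next
  case (Mem t n)
  then show ?case using hval_cong[of m t e e'] by simp
next
  case (Imp p q)
  then show ?case using Imp.hyps(1)[of m s e e' E E'] Imp.hyps(2)[of m s e e' E E'] by simp
next
  case (AllN p)
  have "hsat p (case_nat x e) E = hsat p (case_nat x e') E'" for x
    using AllN.prems by (intro AllN.hyps[of "Suc m" s]) (auto split: nat.splits)
  then show ?case by simp
next
  case (AllS p)
  have "hsat p e (case_nat X E) = hsat p e' (case_nat X E')" for X
    using AllS.prems by (intro AllS.hyps[of m "Suc s"]) (auto split: nat.splits)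
  then show ?case by simp
qed auto

lemma der_closed:
  assumes "\<forall>r\<in>set R. closed 8 s (side r)" "\<And>n. n < s \<Longrightarrow> E n = E' n"
  shows "der R e E = der R e' E'"
proof -
  have "hsat (side r) (penv p e) E = hsat (side r) (penv p e') E'" if "r \<in> set R" for r p
    using assms that by (intro hsat_cong[of 8 s]) (auto simp: penv_def)
  then have "inst R e E J z = inst R e' E' J z" for J z
    unfolding inst_def by (intro bex_cong refl) simp
  then show ?thesis by (simp add: fun_eq_iff der_def valid_def)
qed

text \<open>The parameters are eight separate variables, so that simplification turns a concrete
  rule into an existential statement about elements of the model. With \<open>der_iff\<close>, this
  inverts judgements.\<close>

definition fires :: "rule \<Rightarrow> (nat \<Rightarrow> 'a::arith) \<Rightarrow> (nat \<Rightarrow> 'a set) \<Rightarrow> 'a set \<Rightarrow> 'a \<Rightarrow> bool" where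
  "fires r e E J z \<longleftrightarrow> (\<exists>x0 x1 x2 x3 x4 x5 x6 x7. let p = nth [x0, x1, x2, x3, x4, x5, x6, x7] in
     hsat (side r) (penv p e) E \<and> z = hval p (concl r) \<and> (\<forall>q\<in>set (prems r). hval p q \<in> J))"

lemma inst_fires: assumes "rules_ok R" shows "inst R e E J z \<longleftrightarrow> (\<exists>r\<in>set R. fires r e E J z)"
proof -
  have "(\<exists>p. hsat (side r) (penv p e) E \<and> z = hval p (concl r) \<and> (\<forall>q\<in>set (prems r). hval p q \<in> J)) \<longleftrightarrow> fires r e E J z"
    (is "(\<exists>p. ?F p) \<longleftrightarrow> _") if "r \<in> set R" for r
  proof
    assume "\<exists>p. ?F p"
    then obtain p where p: "?F p" ..
    let ?p = "nth [p 0, p 1, p 2, p 3, p 4, p 5, p 6, p 7]"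
    have eq: "?p n = p n" if "n < 8" for n
    proof -
      have "n = 0 \<or> n = 1 \<or> n = 2 \<or> n = 3 \<or> n = 4 \<or> n = 5 \<or> n = 6 \<or> n = 7" using that by arith
      then show ?thesis by (elim disjE) simp_all
    qed
    have "penv ?p e = penv p e" using eq by (auto simp: penv_def fun_eq_iff)
    moreover have "hval ?p q = hval p q" if "closed_tm 8 q" for q by (rule hval_cong[OF that eq])
    ultimately have "?F ?p" using p that assms unfolding rules_ok_def rule_ok_def by auto
    then show "fires r e E J z" unfolding fires_def Let_def by blast
  qed (auto simp: fires_def Let_def)
  then show ?thesis unfolding inst_def by (intro bex_cong) auto
qed

lemma der_iff: assumes "rules_ok R" shows "der R e E z \<longleftrightarrow> (\<exists>r\<in>set R. fires r e E {y. der R e E y} z)"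
  unfolding inst_fires[OF assms, symmetric]
proof
  show "der R e E z \<Longrightarrow> inst R e E {y. der R e E y} z" by (rule der_cases)
  assume "inst R e E {y. der R e E y} z"
  then obtain r p where "r \<in> set R" "hsat (side r) (penv p e) E" "z = hval p (concl r)"
    "\<forall>q\<in>set (prems r). der R e E (hval p q)" unfolding inst_def by auto
  then show "der R e E z" using der_rule by blast
qed

lemma fires_infer [simp]: "fires (qs \<leadsto> c) e E J z \<longleftrightarrow> (\<exists>x0 x1 x2 x3 x4 x5 x6 x7.
     z = hval (nth [x0, x1, x2, x3, x4, x5, x6, x7]) c \<and> (\<forall>q\<in>set qs. hval (nth [x0, x1, x2, x3, x4, x5, x6, x7]) q \<in> J))"
  by (simp add: fires_def infer_def Let_def)

lemma fires_infer_if [simp]: "fires (infer_if sd qs c) e E J z \<longleftrightarrow> (\<exists>x0 x1 x2 x3 x4 x5 x6 x7.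
     hsat sd (penv (nth [x0, x1, x2, x3, x4, x5, x6, x7]) e) E \<and>
     z = hval (nth [x0, x1, x2, x3, x4, x5, x6, x7]) c \<and> (\<forall>q\<in>set qs. hval (nth [x0, x1, x2, x3, x4, x5, x6, x7]) q \<in> J))"
  by (simp add: fires_def infer_if_def Let_def)

lemma closed_defs [simp]:
  "closed m s (Neg p) = closed m s p" "closed m s (Conj p q) = (closed m s p \<and> closed m s q)"
  "closed m s (Disj p q) = (closed m s p \<and> closed m s q)" "closed m s (Iff p q) = (closed m s p \<and> closed m s q)"
  "closed m s (ExN p) = closed (Suc m) s p" "closed m s (ExS p) = closed m (Suc s) p"
  by (auto simp: Neg_def Conj_def Disj_def Iff_def ExN_def ExS_def)

lemma rules_ok_simps [simp]:
  "rules_ok []" "rules_ok (r # R) \<longleftrightarrow> rule_ok r \<and> rules_ok R" "rules_ok (R @ R') \<longleftrightarrow> rules_ok R \<and> rules_ok R'"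
  by (auto simp: rules_ok_def)
lemma rule_ok_infer [simp]: "rule_ok (qs \<leadsto> c) \<longleftrightarrow> closed_tm 8 c \<and> (\<forall>q\<in>set qs. closed_tm 8 q)"
  by (auto simp: rule_ok_def infer_def noslot_def)
lemma rule_ok_infer_if: "closed 8 s sd \<Longrightarrow> arithmetical sd \<Longrightarrow> rule_ok (infer_if sd qs c) \<longleftrightarrow>
    closed_tm 8 c \<and> (\<forall>q\<in>set qs. closed_tm 8 q)"
  by (auto simp: rule_ok_def infer_if_def noslot_closed)

lemma rule_ok_if_simps [simp]:
  "rule_ok (infer_if (Less (Var n) (Var m)) qs c) \<longleftrightarrow> n < 8 \<and> m < 8 \<and> closed_tm 8 c \<and> (\<forall>q\<in>set qs. closed_tm 8 q)"
      if "n < 8" "m < 8" for n m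
  using that by (simp add: rule_ok_infer_if[of 0])
lemma rule_ok_if_simps2 [simp]:
  "n < 8 \<Longrightarrow> m < 8 \<Longrightarrow> rule_ok (infer_if (Neg (Less (Var n) (Var m))) qs c) \<longleftrightarrow> closed_tm 8 c \<and> (\<forall>q\<in>set qs. closed_tm 8 q)"
  "n < 8 \<Longrightarrow> m < 8 \<Longrightarrow> rule_ok (infer_if (Less (Var n) (Var m + 1)) qs c) \<longleftrightarrow> closed_tm 8 c \<and> (\<forall>q\<in>set qs. closed_tm 8 q)"
  by (simp_all add: rule_ok_infer_if[of 0])

section \<open>Evaluation of algorithms\<close>

lemmas alg_defs = cZ_def cS_def cId_def cCn_def cPr_def cMu_def cOracle_def
lemmas ev_defs = jEv_def jEvs_def jPos_def

lemma pr_rules_ok: "rules_ok pr_rules"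
  by (simp add: pr_rules_def Let_def alg_defs ev_defs)

lemma mu_rules_ok: "rules_ok mu_rules"
  by (simp add: mu_rules_def Let_def alg_defs ev_defs rule_ok_infer_if[of 1])

definition alg_rules :: "rule list \<Rightarrow> bool" where
  "alg_rules R \<longleftrightarrow> R = pr_rules \<or> R = pr_rules @ mu_rules"

lemma alg_rules_ok: "alg_rules R \<Longrightarrow> rules_ok R"
  by (auto simp: alg_rules_def pr_rules_ok mu_rules_ok)

lemma alg_rules_simps [simp]: "alg_rules pr_rules" "alg_rules (pr_rules @ mu_rules)"
  by (simp_all add: alg_rules_def)

definition ev :: "rule list \<Rightarrow> 'a::arith set \<Rightarrow> 'a \<Rightarrow> 'a \<Rightarrow> 'a \<Rightarrow> bool" where
  "ev R Z c l v \<longleftrightarrow> der R (\<lambda>_. 0) (\<lambda>_. Z) (jEv c l v)"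
definition evs :: "rule list \<Rightarrow> 'a::arith set \<Rightarrow> 'a \<Rightarrow> 'a \<Rightarrow> 'a \<Rightarrow> bool" where
  "evs R Z c l v \<longleftrightarrow> der R (\<lambda>_. 0) (\<lambda>_. Z) (jEvs c l v)"
definition evp :: "rule list \<Rightarrow> 'a::arith set \<Rightarrow> 'a \<Rightarrow> 'a \<Rightarrow> 'a \<Rightarrow> bool" where
  "evp R Z c l v \<longleftrightarrow> der R (\<lambda>_. 0) (\<lambda>_. Z) (jPos c l v)"

lemma d_ev: "alg_rules R \<Longrightarrow> Z \<in> SS \<Longrightarrow> dt c \<Longrightarrow> dt l \<Longrightarrow> dt v \<Longrightarrow> d (\<lambda>e. ev R Z (c e) (l e) (v e))"
  unfolding ev_def jEv_def by (intro d_der alg_rules_ok dts)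
lemma d_evp: "alg_rules R \<Longrightarrow> Z \<in> SS \<Longrightarrow> dt c \<Longrightarrow> dt l \<Longrightarrow> dt v \<Longrightarrow> d (\<lambda>e. evp R Z (c e) (l e) (v e))"
  unfolding evp_def jPos_def by (intro d_der alg_rules_ok dts)

context
  fixes R assumes R: "alg_rules R"
begin

lemma alg_fires:
  obtains b where "\<And>e E (J :: 'a::arith set) z. (\<exists>r\<in>set R. fires r e E J z) \<longleftrightarrow>
    (\<exists>r\<in>set pr_rules. fires r e E J z) \<or> (b \<and> (\<exists>r\<in>set mu_rules. fires r e E J z))"
proof (cases "R = pr_rules")
  case True
  then show ?thesis by (intro that[of False]) simp
next
  case False
  then have "R = pr_rules @ mu_rules" using R by (simp add: alg_rules_def)
  then show ?thesis by (intro that[of True]) auto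
qed

lemma alg_iff:
  obtains b where "\<And>(Z :: 'a::arith set) z. der R (\<lambda>_. 0) (\<lambda>_. Z) z \<longleftrightarrow>
    (\<exists>r\<in>set pr_rules. fires r (\<lambda>_. 0) (\<lambda>_. Z) {y. der R (\<lambda>_. 0) (\<lambda>_. Z) y} z) \<or>
    (b \<and> (\<exists>r\<in>set mu_rules. fires r (\<lambda>_. 0) (\<lambda>_. Z) {y. der R (\<lambda>_. 0) (\<lambda>_. Z) y} z))"
proof -
  obtain b where b: "\<And>e E (J :: 'a::arith set) z. (\<exists>r\<in>set R. fires r e E J z) \<longleftrightarrow>
    (\<exists>r\<in>set pr_rules. fires r e E J z) \<or> (b \<and> (\<exists>r\<in>set mu_rules. fires r e E J z))" by (rule alg_fires) blast
  show ?thesis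
    by (rule that[of b], unfold b[symmetric]) (rule der_iff[OF alg_rules_ok[OF R]])
qed

lemmas ev_expand = pr_rules_def mu_rules_def Let_def alg_defs ev_defs

text \<open>The rules in \<open>mu_rules\<close> conclude only about \<open>cOracle\<close>,
  \<open>cMu\<close> and \<open>jPos\<close>, none of which occurs on the left here. So the
  equations are the same with and without these rules.\<close>

lemma
  fixes Z :: "'a::arith set"
  shows ev_Z: "ev R Z cZ l v \<longleftrightarrow> v = 0"
    and ev_S: "ev R Z cS l v \<longleftrightarrow> (\<exists>x l'. l = cCons x l' \<and> v = x + 1)"
    and ev_Id0: "ev R Z (cId 0) l v \<longleftrightarrow> (\<exists>l'. l = cCons v l')"
    and ev_IdS: "ev R Z (cId (i + 1)) l v \<longleftrightarrow> (\<exists>x l'. l = cCons x l' \<and> ev R Z (cId i) l' v)"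
    and ev_Cn: "ev R Z (cCn g fs) l v \<longleftrightarrow> (\<exists>vs. evs R Z fs l vs \<and> ev R Z g vs v)"
    and evs_Nil: "evs R Z cNil l v \<longleftrightarrow> v = cNil"
    and evs_Cons: "evs R Z (cCons f fs) l w \<longleftrightarrow> (\<exists>v vs. w = cCons v vs \<and> ev R Z f l v \<and> evs R Z fs l vs)"
    and ev_Pr0: "ev R Z (cPr f g) (cCons 0 l) v \<longleftrightarrow> ev R Z f l v"
    and ev_PrS: "ev R Z (cPr f g) (cCons (x + 1) l) v \<longleftrightarrow>
       (\<exists>i. ev R Z (cPr f g) (cCons x l) i \<and> ev R Z g (cCons x (cCons i l)) v)"
proof -
  obtain b where iff: "\<And>Z z. der R (\<lambda>_. 0) (\<lambda>_. Z :: 'a set) z \<longleftrightarrow>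
    (\<exists>r\<in>set pr_rules. fires r (\<lambda>_. 0) (\<lambda>_. Z) {y. der R (\<lambda>_. 0) (\<lambda>_. Z) y} z) \<or>
    (b \<and> (\<exists>r\<in>set mu_rules. fires r (\<lambda>_. 0) (\<lambda>_. Z) {y. der R (\<lambda>_. 0) (\<lambda>_. Z) y} z))" by (rule alg_iff) blast
  note nz = suc_neq suc_neq[symmetric]
  note iff' = iff[of _ "jEv c l' v'" for c l' v'] iff[of _ "jEvs c l' v'" for c l' v']
  show "ev R Z cZ l v \<longleftrightarrow> v = 0"
    unfolding ev_def iff[of _ "jEv cZ l v"] by (auto simp: ev_expand nz)
  show "ev R Z cS l v \<longleftrightarrow> (\<exists>x l'. l = cCons x l' \<and> v = x + 1)"
    unfolding ev_def iff[of _ "jEv cS l v"] by (auto simp: ev_expand nz)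
  show "ev R Z (cId 0) l v \<longleftrightarrow> (\<exists>l'. l = cCons v l')"
    unfolding ev_def iff[of _ "jEv (cId 0) l v"] by (auto simp: ev_expand nz)
  show "ev R Z (cId (i + 1)) l v \<longleftrightarrow> (\<exists>x l'. l = cCons x l' \<and> ev R Z (cId i) l' v)"
    unfolding ev_def iff[of _ "jEv (cId (i + 1)) l v"] by (auto simp: ev_expand nz)
  show "ev R Z (cCn g fs) l v \<longleftrightarrow> (\<exists>vs. evs R Z fs l vs \<and> ev R Z g vs v)"
    unfolding ev_def evs_def iff[of _ "jEv (cCn g fs) l v"] by (auto simp: ev_expand nz)
  show "evs R Z cNil l v \<longleftrightarrow> v = cNil"
    unfolding evs_def iff[of _ "jEvs cNil l v"] by (auto simp: ev_expand nz)
  show "evs R Z (cCons f fs) l w \<longleftrightarrow> (\<exists>v vs. w = cCons v vs \<and> ev R Z f l v \<and> evs R Z fs l vs)"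
    unfolding ev_def evs_def iff[of _ "jEvs (cCons f fs) l w"] by (auto simp: ev_expand nz)
  show "ev R Z (cPr f g) (cCons 0 l) v \<longleftrightarrow> ev R Z f l v"
    unfolding ev_def iff[of _ "jEv (cPr f g) (cCons 0 l) v"] by (auto simp: ev_expand nz)
  show "ev R Z (cPr f g) (cCons (x + 1) l) v \<longleftrightarrow>
       (\<exists>i. ev R Z (cPr f g) (cCons x l) i \<and> ev R Z g (cCons x (cCons i l)) v)"
    unfolding ev_def iff[of _ "jEv (cPr f g) (cCons (x + 1) l) v"] by (auto simp: ev_expand nz)
qed

end

abbreviation "oracle_rules \<equiv> pr_rules @ mu_rules"

lemma
  fixes Z :: "'a::arith set"
  shows ev_Oracle: "ev oracle_rules Z cOracle (cCons x l) v \<longleftrightarrow> v = (if x \<in> Z then 1 else 0)"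
    and evp_0: "evp oracle_rules Z f l 0"
    and evp_S: "evp oracle_rules Z f l (x + 1) \<longleftrightarrow>
      evp oracle_rules Z f l x \<and> (\<exists>v. ev oracle_rules Z f (cCons x l) (v + 1))"
    and ev_Mu: "ev oracle_rules Z (cMu f) l x \<longleftrightarrow>
      evp oracle_rules Z f l x \<and> ev oracle_rules Z f (cCons x l) 0"
proof -
  define D where "D = der oracle_rules (\<lambda>_. 0) (\<lambda>_. Z)"
  have iff: "D z \<longleftrightarrow> (\<exists>r\<in>set pr_rules. fires r (\<lambda>_. 0) (\<lambda>_. Z) {y. D y} z) \<or>
      (\<exists>r\<in>set mu_rules. fires r (\<lambda>_. 0) (\<lambda>_. Z) {y. D y} z)" for z
  proof -
    have "D z \<longleftrightarrow> (\<exists>r\<in>set oracle_rules. fires r (\<lambda>_. 0) (\<lambda>_. Z) {y. D y} z)"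
      unfolding D_def by (rule der_iff[OF alg_rules_ok[OF alg_rules_simps(2)]])
    then show ?thesis by (simp only: set_append bex_Un)
  qed
  have ev: "ev oracle_rules Z c l v = D (jEv c l v)" "evp oracle_rules Z c l v = D (jPos c l v)" for c l v
    by (simp_all add: D_def ev_def evp_def)
  note nz = suc_neq suc_neq[symmetric]
  note ev_expand = pr_rules_def mu_rules_def Let_def alg_defs ev_defs penv_def
  show "ev oracle_rules Z cOracle (cCons x l) v \<longleftrightarrow> v = (if x \<in> Z then 1 else 0)"
    unfolding ev iff[of "jEv cOracle (cCons x l) v"] by (simp add: ev_expand nz)
  show "evp oracle_rules Z f l 0"
    unfolding ev iff[of "jPos f l 0"] by (simp add: ev_expand nz)
  show "evp oracle_rules Z f l (x + 1) \<longleftrightarrow>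
      evp oracle_rules Z f l x \<and> (\<exists>v. ev oracle_rules Z f (cCons x l) (v + 1))"
    unfolding ev iff[of "jPos f l (x + 1)"] by (simp add: ev_expand nz)
  show "ev oracle_rules Z (cMu f) l x \<longleftrightarrow>
      evp oracle_rules Z f l x \<and> ev oracle_rules Z f (cCons x l) 0"
    unfolding ev iff[of "jEv (cMu f) l x"] by (simp add: ev_expand nz)
qed

section \<open>Total programs for the arithmetical operations\<close>

definition lst :: "'a list \<Rightarrow> 'a::{zero,one,plus,times}" where "lst xs = foldr cCons xs cNil"
lemma lst_simps [simp]: "lst [] = cNil" "lst (x # xs) = cCons x (lst xs)" by (simp_all add: lst_def)

definition pid :: "nat \<Rightarrow> 'a::{zero,one,plus,times}" where "pid i = cId (cst i)"

text \<open>An equivalence, so that it contains both termination and uniqueness of the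
  output.\<close>

definition vals :: "rule list \<Rightarrow> 'a::arith set \<Rightarrow> 'a \<Rightarrow> 'a list \<Rightarrow> 'a \<Rightarrow> bool" where
  "vals R Z c xs y \<longleftrightarrow> (\<forall>v. ev R Z c (lst xs) v \<longleftrightarrow> v = y)"

definition tv :: "bool \<Rightarrow> 'a::{zero,one}" where "tv b = (if b then 1 else 0)"

definition pOne :: "'a::{zero,one,plus,times}" where "pOne = cCn cS (lst [cZ])"
definition pAdd :: "'a::{zero,one,plus,times}" where "pAdd = cPr (pid 0) (cCn cS (lst [pid 1]))"
definition pMul :: "'a::{zero,one,plus,times}" where "pMul = cPr cZ (cCn pAdd (lst [pid 1, pid 2]))"
definition pPred :: "'a::{zero,one,plus,times}" where "pPred = cPr cZ (pid 0)"
text \<open>Recursion is on the first argument, so the subtrahend comes first: on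
  \<open>[y, x]\<close> the output is \<open>x - y\<close>.\<close>

definition pSub :: "'a::{zero,one,plus,times}" where "pSub = cPr (pid 0) (cCn pPred (lst [pid 1]))"
definition pIsz :: "'a::{zero,one,plus,times}" where "pIsz = cPr pOne cZ"

context
  fixes R assumes R: "alg_rules R"
begin

lemma vals_pid: "i < length xs \<Longrightarrow> vals R Z (pid i) xs (xs ! i)"
proof (induct i arbitrary: xs)
  case 0 then show ?case by (cases xs) (auto simp: vals_def pid_def ev_Id0[OF R])
next
  case (Suc i) then show ?case by (cases xs) (auto simp: vals_def pid_def ev_IdS[OF R])
qed

lemma vals_Z: "vals R Z cZ xs 0" by (simp add: vals_def ev_Z[OF R])
lemma vals_S: "vals R Z cS (x # xs) (x + 1)" by (auto simp: vals_def ev_S[OF R])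

lemma vals_Cn:
  assumes "list_all2 (\<lambda>f y. vals R Z f xs y) fs ys" "vals R Z g ys y"
  shows "vals R Z (cCn g (lst fs)) xs y"
proof -
  have "evs R Z (lst fs) (lst xs) w \<longleftrightarrow> w = lst ys" for w
    using assms(1) by (induct arbitrary: w rule: list_all2_induct) (auto simp: evs_Nil[OF R] evs_Cons[OF R] vals_def)
  then show ?thesis using assms(2) by (simp add: vals_def ev_Cn[OF R])
qed

text \<open>The induction is on an element of the model, which is why the graph of \<open>F\<close>
  has to be definable.\<close>

lemma vals_Pr:
  assumes Z: "Z \<in> SS" and "d (\<lambda>e. e 1 = F (e 0))" "vals R Z f xs (F 0)" "\<And>x. vals R Z g (x # F x # xs) (F (x + 1))"
  shows "vals R Z (cPr f g) (x # xs) (F x)"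
proof -
  have "\<forall>v. ev R Z (cPr f g) (cCons x (lst xs)) v \<longleftrightarrow> v = F x"
  proof (rule ind[of "\<lambda>x. \<forall>v. ev R Z (cPr f g) (cCons x (lst xs)) v \<longleftrightarrow> v = F x"])
    show "d (\<lambda>e. \<forall>v. ev R Z (cPr f g) (cCons (e 0) (lst xs)) v \<longleftrightarrow> v = F (e 0))"
      by (intro d_all d_iff d_ev R Z dts) (rule d_subst2[of "\<lambda>x y. y = F x", OF assms(2)]; rule dts)
    show "\<forall>v. ev R Z (cPr f g) (cCons 0 (lst xs)) v \<longleftrightarrow> v = F 0"
      using assms(3) by (simp add: vals_def ev_Pr0[OF R])
    fix x assume "\<forall>v. ev R Z (cPr f g) (cCons x (lst xs)) v \<longleftrightarrow> v = F x"
    then show "\<forall>v. ev R Z (cPr f g) (cCons (x + 1) (lst xs)) v \<longleftrightarrow> v = F (x + 1)"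
      using assms(4)[of x] by (simp add: vals_def ev_PrS[OF R])
  qed
  then show ?thesis by (simp add: vals_def)
qed

lemma vals_One: "vals R Z pOne xs 1"
  unfolding pOne_def using vals_Cn[of Z xs "[cZ]" "[0]" cS 1] vals_S[of Z 0 "[]"] by (simp add: vals_Z)

context
  fixes Z :: "'a::arith set" assumes Z: "Z \<in> SS"
begin

lemma vals_Add: "vals R Z pAdd [x, y] (x + y)"
  unfolding pAdd_def
proof (rule vals_Pr[OF Z])
  show "d (\<lambda>e. e 1 = e 0 + y)" by (intro d_eq dts)
  show "vals R Z (pid 0) [y] (0 + y)" using vals_pid[of 0 "[y]" Z] by simp
  fix x show "vals R Z (cCn cS (lst [pid 1])) [x, x + y, y] (x + 1 + y)"
    by (rule vals_Cn[of _ _ _ "[x + y]"])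
      (use vals_pid[of 1 "[x, x + y, y]" Z] vals_S[of Z "x + y" "[]"] in \<open>simp_all add: ac_simps\<close>)
qed

lemma vals_Mul: "vals R Z pMul [x, y] (x * y)"
  unfolding pMul_def
proof (rule vals_Pr[OF Z])
  show "d (\<lambda>e. e 1 = e 0 * y)" by (intro d_eq dts)
  show "vals R Z cZ [y] (0 * y)" by (simp add: vals_Z)
  fix x show "vals R Z (cCn pAdd (lst [pid 1, pid 2])) [x, x * y, y] ((x + 1) * y)"
    by (rule vals_Cn[of _ _ _ "[x * y, y]"])
      (use vals_pid[of 1 "[x, x * y, y]" Z] vals_pid[of 2 "[x, x * y, y]" Z] vals_Add[of "x * y" y] in \<open>simp_all add:
          distrib_right\<close>)
qed

lemma vals_Pred: "vals R Z pPred [x] (x - 1)"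
  unfolding pPred_def
proof (rule vals_Pr[OF Z])
  have "(v = x - 1) \<longleftrightarrow> (x = 0 \<and> v = 0) \<or> x = v + 1" for x v :: 'a
    by (rule suc_cases[of x]) (use diff_zero[of 0 1] suc_neq suc_neq[symmetric] in auto)
  then show "d (\<lambda>e. e 1 = e 0 - (1::'a))" by (simp only:) (intro d_disj d_conj d_eq dts)
  show "vals R Z cZ [] (0 - 1)" using diff_zero[of 0 "1::'a"] by (simp add: vals_Z)
  fix x show "vals R Z (pid 0) [x, x - 1] (x + 1 - 1)" using vals_pid[of 0 "[x, x - 1]" Z] by simp
qed

lemma vals_Sub: "vals R Z pSub [y, x] (x - y)"
  unfolding pSub_def
proof (rule vals_Pr[OF Z])
  have "(v = x - y) \<longleftrightarrow> (x \<le> y \<and> v = 0) \<or> x = v + y" for x y v :: 'a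
  proof (cases "x \<le> y")
    case True
    then have "x = v + y \<Longrightarrow> v = 0" using add_le_cancel_right[of v y 0] by simp
    then show ?thesis using True diff_zero[OF True] by auto
  next
    case False
    then have "x - y + y = x" by simp
    then show ?thesis using False by (metis add_right_cancel)
  qed
  then show "d (\<lambda>e. e 1 = x - e 0)" by (simp only:) (intro d_disj d_conj d_eq d_le dts)
  show "vals R Z (pid 0) [x] (x - 0)" using vals_pid[of 0 "[x]" Z] by simp
  fix y show "vals R Z (cCn pPred (lst [pid 1])) [y, x - y, x] (x - (y + 1))"
    by (rule vals_Cn[of _ _ _ "[x - y]"])
      (use vals_pid[of 1 "[y, x - y, x]" Z] vals_Pred[of "x - y"] in \<open>simp_all add: diff_diff_add\<close>)
qed

lemma vals_Isz: "vals R Z pIsz [x] (tv (x = 0))"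
  unfolding pIsz_def
proof (rule vals_Pr[OF Z])
  have "(v = tv (x = 0)) \<longleftrightarrow> (x = 0 \<and> v = 1) \<or> (x \<noteq> 0 \<and> v = 0)" for x v :: 'a by (auto simp: tv_def)
  then show "d (\<lambda>e. e 1 = (tv (e 0 = 0) :: 'a))" by (simp only:) (intro d_disj d_conj d_not d_eq dts)
  show "vals R Z pOne [] (tv (0 = 0))" by (simp add: tv_def vals_One)
  fix x show "vals R Z cZ [x, tv (x = 0)] (tv (x + 1 = 0))" by (simp add: tv_def vals_Z suc_neq)
qed

end
end

section \<open>Compiling bounded formulas\<close>

text \<open>In \<open>Delta0\<close>, a predicate on formulas, bounded quantifiers are
  abbreviations. Compilation is a recursion on bounded formulas, so they are given a datatype; the
  only set variable is the oracle.\<close>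

datatype bf = BEq tm tm | BLess tm tm | BMem tm | BFls | BImp bf bf | BAll tm bf

primrec bfm :: "bf \<Rightarrow> fm" where
  "bfm (BEq s t) = Eq s t"
| "bfm (BLess s t) = Less s t"
| "bfm (BMem t) = Mem t 0"
| "bfm BFls = Fls"
| "bfm (BImp p q) = Imp (bfm p) (bfm q)"
| "bfm (BAll t p) = AllB t (bfm p)"

primrec memfree :: "bf \<Rightarrow> bool" where
  "memfree (BEq s t) = True"
| "memfree (BLess s t) = True"
| "memfree (BMem t) = False"
| "memfree BFls = True"
| "memfree (BImp p q) = (memfree p \<and> memfree q)"
| "memfree (BAll t p) = memfree p"

primrec bcl :: "bf \<Rightarrow> nat \<Rightarrow> bool" where
  "bcl (BEq s t) k = (closed_tm k s \<and> closed_tm k t)"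
| "bcl (BLess s t) k = (closed_tm k s \<and> closed_tm k t)"
| "bcl (BMem t) k = closed_tm k t"
| "bcl BFls k = True"
| "bcl (BImp p q) k = (bcl p k \<and> bcl q k)"
| "bcl (BAll t p) k = (closed_tm k t \<and> bcl p (Suc k))"

lemma closed_tm_lift0 [simp]: "closed_tm (Suc k) (lift_tm 0 t) = closed_tm k t"
  by (induct t) auto

lemma closed_AllB [simp]: "closed k s (AllB t p) \<longleftrightarrow> closed_tm k t \<and> closed (Suc k) s p"
  by (auto simp: AllB_def)
lemma closed_ExB [simp]: "closed k s (ExB t p) \<longleftrightarrow> closed_tm k t \<and> closed (Suc k) s p"
  by (auto simp: ExB_def)

lemma Delta0_bf: "Delta0 p \<Longrightarrow> closed k s p \<Longrightarrow> s \<le> 1 \<Longrightarrow> \<exists>b. bfm b = p \<and> bcl b k \<and> (s = 0 \<longrightarrow> memfree b)"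
proof (induct p arbitrary: k rule: Delta0.induct)
  case (1 t u) then show ?case by (intro exI[of _ "BEq t u"]) auto
next
  case (2 t u) then show ?case by (intro exI[of _ "BLess t u"]) auto
next
  case (3 t n) then show ?case by (intro exI[of _ "BMem t"]) auto
next
  case 4 then show ?case by (intro exI[of _ BFls]) auto
next
  case (5 p q)
  then obtain b b' where "bfm b = p \<and> bcl b k \<and> (s = 0 \<longrightarrow> memfree b)" "bfm b' = q \<and> bcl b' k \<and> (s = 0 \<longrightarrow> memfree b')"
    by fastforce
  then show ?case by (intro exI[of _ "BImp b b'"]) auto
next
  case (6 p t)
  then obtain b where "bfm b = p \<and> bcl b (Suc k) \<and> (s = 0 \<longrightarrow> memfree b)" by fastforce
  then show ?case using 6 by (intro exI[of _ "BAll t b"]) auto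
qed

primrec tcomp :: "tm \<Rightarrow> 'a::{zero,one,plus,times}" where
  "tcomp (Var i) = pid i"
| "tcomp Zero = cZ"
| "tcomp One = pOne"
| "tcomp (Plus s t) = cCn pAdd (lst [tcomp s, tcomp t])"
| "tcomp (Times s t) = cCn pMul (lst [tcomp s, tcomp t])"

text \<open>Characteristic functions on inputs of length \<open>k\<close>. Equality is the vanishing
  of both truncated differences. A bounded quantifier is the product of the values of its body,
  accumulated by recursion on the bound: in the recursion step, input 0 is the bound variable and
  input 1 the product so far.\<close>

primrec bcomp :: "bf \<Rightarrow> nat \<Rightarrow> 'a::{zero,one,plus,times}" where
  "bcomp (BEq s t) k = cCn pIsz (lst [cCn pAdd (lst [cCn pSub (lst [tcomp s, tcomp t]), cCn pSub (lst [tcomp t, tcomp s])])])"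
| "bcomp (BLess s t) k = cCn pIsz (lst [cCn pIsz (lst [cCn pSub (lst [tcomp s, tcomp t])])])"
| "bcomp (BMem t) k = cCn cOracle (lst [tcomp t])"
| "bcomp BFls k = cZ"
| "bcomp (BImp p q) k = cCn pIsz (lst [cCn pMul (lst [bcomp p k, cCn pIsz (lst [bcomp q k])])])"
| "bcomp (BAll t p) k = cCn (cPr pOne
    (cCn pMul (lst [pid 1, cCn (bcomp p (Suc k)) (lst (pid 0 # map (\<lambda>i. pid (Suc (Suc i))) [0..<k]))])))
      (lst (tcomp t # map pid [0..<k]))"

definition lenv :: "'a::zero list \<Rightarrow> nat \<Rightarrow> 'a" where "lenv xs n = (if n < length xs then xs ! n else 0)"

lemma lenv_Cons: "case_nat x (lenv xs) = lenv (x # xs)"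
  by (auto simp: lenv_def fun_eq_iff split: nat.splits)

context
  fixes R and Z :: "'a::arith set" assumes R: "alg_rules R" and Z: "Z \<in> SS"
begin

lemma vals_Cn1: "vals R Z f xs y \<Longrightarrow> vals R Z g [y] w \<Longrightarrow> vals R Z (cCn g (lst [f])) xs w"
  by (rule vals_Cn[OF R]) auto
lemma vals_Cn2: "vals R Z f xs y \<Longrightarrow> vals R Z f' xs y' \<Longrightarrow> vals R Z g [y, y'] w \<Longrightarrow> vals R Z (cCn g (lst [f, f'])) xs w"
  by (rule vals_Cn[OF R]) auto

lemma vals_tcomp: "closed_tm (length xs) t \<Longrightarrow> vals R Z (tcomp t) xs (hval (lenv xs) t)"
  by (induct t) (auto simp del: lst_simps simp: lenv_def vals_pid[OF R] vals_Z[OF R] vals_One[OF R]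
      intro: vals_Cn2 vals_Add[OF R Z] vals_Mul[OF R Z])

lemma vals_bcomp:
  assumes "bcl b (length xs)" "memfree b \<or> R = oracle_rules"
  shows "vals R Z (bcomp b (length xs)) xs (tv (hsat (bfm b) (lenv xs) (\<lambda>_. Z)))"
  using assms
proof (induct b arbitrary: xs)
  case (BEq s t)
  let ?s = "hval (lenv xs) s" and ?t = "hval (lenv xs) t"
  have "?s - ?t + (?t - ?s) = 0 \<longleftrightarrow> ?s = ?t"
  proof -
    have "x - y = 0 \<Longrightarrow> x \<le> y" for x y :: 'a by (metis le_add_diff_inverse2 add_0_left nle_le order.refl)
    moreover have "x + y = 0 \<longleftrightarrow> x = 0 \<and> y = 0" for x y :: 'a by (simp add: add_nonneg_eq_0_iff)
    ultimately show ?thesis by (auto simp: diff_zero intro: order.antisym)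
  qed
  moreover have "vals R Z (bcomp (BEq s t) (length xs)) xs (tv (?t - ?s + (?s - ?t) = 0))"
    unfolding bcomp.simps using BEq
      vals_Cn1[OF vals_Cn2[OF vals_Cn2[OF vals_tcomp[of xs s] vals_tcomp[of xs t] vals_Sub[OF R Z]]
        vals_Cn2[OF vals_tcomp[of xs t] vals_tcomp[of xs s] vals_Sub[OF R Z]] vals_Add[OF R Z]] vals_Isz[OF R Z]]
    by (simp del: lst_simps)
  ultimately show ?case by (simp add: add.commute)
next
  case (BLess s t)
  let ?s = "hval (lenv xs) s" and ?t = "hval (lenv xs) t"
  have "?t - ?s = 0 \<longleftrightarrow> \<not> ?s < ?t"
    by (metis diff_zero le_add_diff_inverse2 add_0_left less_le not_less order.refl)
  then have "tv (tv (?t - ?s = 0) = (0::'a)) = (tv (?s < ?t) :: 'a)" by (auto simp: tv_def)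
  moreover have "vals R Z (bcomp (BLess s t) (length xs)) xs (tv (tv (?t - ?s = 0) = (0::'a)))"
    unfolding bcomp.simps using BLess
      vals_Cn1[OF vals_Cn1[OF vals_Cn2[OF vals_tcomp[of xs s] vals_tcomp[of xs t] vals_Sub[OF R Z]] vals_Isz[OF R Z]]
          vals_Isz[OF R Z]]
    by (simp del: lst_simps)
  ultimately show ?case by simp
next
  case (BMem t)
  then have "R = oracle_rules" by simp
  then have "vals R Z cOracle [hval (lenv xs) t] (tv (hval (lenv xs) t \<in> Z))"
    by (simp add: vals_def ev_Oracle tv_def)
  then show ?case using vals_Cn1[OF vals_tcomp[of xs t], of cOracle "tv (hval (lenv xs) t \<in> Z)"] BMem
    by (simp del: lst_simps)
next
  case BFls
  then show ?case by (simp add: vals_Z[OF R] tv_def)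
next
  case (BImp p q)
  have "(tv a * (tv (tv b = (0::'a))) = (0::'a)) \<longleftrightarrow> (a \<longrightarrow> b)" for a b by (auto simp: tv_def)
  moreover have "vals R Z (bcomp (BImp p q) (length xs)) xs
      (tv (tv (hsat (bfm p) (lenv xs) (\<lambda>_. Z)) * (tv (tv (hsat (bfm q) (lenv xs) (\<lambda>_. Z)) = (0::'a))) = (0::'a)))"
    unfolding bcomp.simps using BImp.prems
      vals_Cn1[OF vals_Cn2[OF BImp.hyps(1)[of xs] vals_Cn1[OF BImp.hyps(2)[of xs] vals_Isz[OF R Z]] vals_Mul[OF R Z]]
          vals_Isz[OF R Z]]
    by (simp del: lst_simps) blast
  ultimately show ?case by simp
next
  case (BAll t p)
  let ?k = "length xs"
  let ?P = "\<lambda>z. hsat (bfm p) (case_nat z (lenv xs)) (\<lambda>_. Z)"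
  let ?F = "\<lambda>y. tv (\<forall>z<y. ?P z) :: 'a"
  let ?g = "cCn pMul (lst [pid 1, cCn (bcomp p (Suc ?k)) (lst (pid 0 # map (\<lambda>i. pid (Suc (Suc i))) [0..<?k]))])"
  have Pr: "vals R Z (cPr pOne ?g) (y # xs) (?F y)" for y
  proof (rule vals_Pr[OF R Z])
    have "(v = ?F y) \<longleftrightarrow> ((\<forall>z. z < y \<longrightarrow> ?P z) \<and> v = 1) \<or> (\<not> (\<forall>z. z < y \<longrightarrow> ?P z) \<and> v = 0)" for y v by (auto simp: tv_def)
    moreover have "arithmetical (bfm p)" by (induct p) auto
    ultimately show "d (\<lambda>e. e 1 = ?F (e 0))"
      by (simp only:) (intro d_disj d_conj d_not d_all d_imp d_less d_eq dts d_hsat dt_case Z)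
    show "vals R Z pOne xs (?F 0)" using vals_One[OF R] by (simp add: tv_def)
    fix y
    have 1: "vals R Z (pid 1) (y # ?F y # xs) (?F y)" using vals_pid[OF R, of 1 "y # ?F y # xs" Z] by simp
    have 2: "vals R Z (cCn (bcomp p (Suc ?k)) (lst (pid 0 # map (\<lambda>i. pid (Suc (Suc i))) [0..<?k]))) (y # ?F y # xs) (tv (?P y))"
    proof (rule vals_Cn[OF R])
      show "list_all2 (\<lambda>f z. vals R Z f (y # ?F y # xs) z) (pid 0 # map (\<lambda>i. pid (Suc (Suc i))) [0..<?k]) (y # xs)"
        using vals_pid[OF R, of 0 "y # ?F y # xs" Z] vals_pid[OF R, of "Suc (Suc i)" "y # ?F y # xs" Z for i]
        unfolding list_all2_Cons by (simp add: list_all2_conv_all_nth)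
      show "vals R Z (bcomp p (Suc ?k)) (y # xs) (tv (?P y))"
        using BAll.hyps[of "y # xs"] BAll.prems by (simp add: lenv_Cons)
    qed
    have "?F y * tv (?P y) = ?F (y + 1)" by (auto simp: tv_def less_suc)
    then show "vals R Z ?g (y # ?F y # xs) (?F (y + 1))"
      using vals_Cn2[OF 1 2] vals_Mul[OF R Z, of "?F y" "tv (?P y)"] by (simp del: lst_simps)
  qed
  have "list_all2 (\<lambda>f z. vals R Z f xs z) (tcomp t # map pid [0..<?k]) (hval (lenv xs) t # xs)"
    using vals_tcomp[of xs t] BAll.prems vals_pid[OF R, of _ xs Z]
    unfolding list_all2_Cons by (simp add: list_all2_conv_all_nth)
  from vals_Cn[OF R this Pr] show ?case by simp
qed

end

section \<open>Programs with standard codes\<close>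

lemma cst_hom: "cst (pair a b) = pair (cst a) (cst b :: 'a::arith)" "cst (tag k a) = tag k (cst a :: 'a)"
  "cst (cCons a b) = cCons (cst a) (cst b :: 'a)" "cst (cNil) = (cNil :: 'a)" "cst (cst i :: nat) = (cst i :: 'a)"
  by (simp_all add: cst_of_nat pair_def tag_def cCons_def cNil_def add.commute[of 1])

lemma cst_lst: "cst (lst xs) = (lst (map cst xs) :: 'a::arith)"
  by (induct xs) (simp_all add: cst_hom)

lemma cst_0_1: "cst (0::nat) = (0::'a::arith)" "cst (1::nat) = (1::'a)" "cst (Suc 0) = (1::'a)"
  by (simp_all add: cst_of_nat)

lemma cst_pid: "cst (pid i) = (pid i :: 'a::arith)" by (simp add: pid_def cId_def cst_hom)
lemma cst_cCn: "cst (cCn g fs) = cCn (cst g) (cst fs :: 'a::arith)" by (simp add: cCn_def cst_hom)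
lemma cst_cPr: "cst (cPr g fs) = cPr (cst g) (cst fs :: 'a::arith)" by (simp add: cPr_def cst_hom)
lemma cst_alg: "cst cZ = (cZ :: 'a::arith)" "cst cS = (cS :: 'a)" "cst cOracle = (cOracle :: 'a)"
    by (simp_all add: alg_defs cst_hom cst_0_1)
lemmas cst_progs = cst_cCn cst_cPr cst_alg cst_pid cst_lst
lemma cst_basic_progs: "cst pOne = (pOne :: 'a::arith)" "cst pAdd = (pAdd :: 'a::arith)" "cst pMul = (pMul :: 'a::arith)"
   "cst pPred = (pPred :: 'a::arith)" "cst pSub = (pSub :: 'a::arith)" "cst pIsz = (pIsz :: 'a::arith)"
  by (simp_all add: pOne_def pAdd_def pMul_def pPred_def pSub_def pIsz_def cst_progs cst_hom)

lemma cst_tcomp: "cst (tcomp t) = (tcomp t :: 'a::arith)"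
  by (induct t) (simp_all add: cst_progs cst_basic_progs cst_hom)
text \<open>A formula mentions a program through the numeral of its standard code. Its value in a
  model is the polymorphic program itself, to which the correctness proof applies.\<close>

lemma cst_bcomp: "cst (bcomp b k) = (bcomp b k :: 'a::arith)"
  by (induct b arbitrary: k) (simp_all add: cst_progs cst_basic_progs cst_tcomp cst_hom comp_def)

text \<open>The compiler yields codes, whereas \<open>WF\<close> and \<open>pr_rel\<close> speak of
  elements of \<open>prim_fun\<close>; this predicate connects them.\<close>

definition prim_code :: "nat \<Rightarrow> nat \<Rightarrow> bool" where
  "prim_code n c \<longleftrightarrow> (\<exists>f. code_prim f = c \<and> arity n f)"

lemma prim_code_pid: "i < n \<Longrightarrow> prim_code n (pid i)"
  unfolding prim_code_def by (intro exI[of _ "PId i"]) (simp add: pid_def cst_of_nat arity.intros)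
lemma prim_code_Z: "prim_code n cZ"
  unfolding prim_code_def by (intro exI[of _ PZ]) (simp add: arity.intros)
lemma prim_code_S: "prim_code 1 cS"
  unfolding prim_code_def using arity.intros(2) code_prim.simps(2) by blast
lemma prim_code_Cn: "prim_code (length fs) g \<Longrightarrow> \<forall>f\<in>set fs. prim_code n f \<Longrightarrow> prim_code n (cCn g (lst fs))"
proof -
  assume g: "prim_code (length fs) g" and fs: "\<forall>f\<in>set fs. prim_code n f"
  obtain g' where g': "code_prim g' = g" "arity (length fs) g'" using g unfolding prim_code_def by blast
  define h where "h f = (SOME f'. code_prim f' = f \<and> arity n f')" for f
  have h: "code_prim (h f) = f \<and> arity n (h f)" if "f \<in> set fs" for f
    unfolding h_def using fs that someI_ex[of "\<lambda>f'. code_prim f' = f \<and> arity n f'"] unfolding prim_code_def by blast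
  then have "map code_prim (map h fs) = fs" by (simp add: map_idI)
  then have "code_prim (PCn g' (map h fs)) = cCn g (lst fs)" by (simp add: lst_def g'(1) del: map_map)
  moreover have "arity n (PCn g' (map h fs))" using g'(2) h by (intro arity.intros) auto
  ultimately show ?thesis unfolding prim_code_def by blast
qed
lemma prim_code_Pr: "prim_code n f \<Longrightarrow> prim_code (n + 2) g \<Longrightarrow> prim_code (n + 1) (cPr f g)"
  unfolding prim_code_def using arity.intros(5) code_prim.simps(5) by metis

lemma prim_code_basic: "prim_code n pOne" "prim_code 2 pAdd" "prim_code 2 pMul" "prim_code 1 pPred" "prim_code 2 pSub"
    "prim_code 1 pIsz"
proof -
  show 1: "prim_code n pOne" for n unfolding pOne_def by (rule prim_code_Cn) (simp_all add: prim_code_Z prim_code_S[simplified])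
  show 2: "prim_code 2 pAdd" unfolding pAdd_def
    using prim_code_Pr[of 1 "pid 0" "cCn cS (lst [pid 1])"] prim_code_pid[of 0 1]
      prim_code_Cn[of "[pid 1]" cS 3] prim_code_S prim_code_pid[of 1 3] by (simp add: numeral_eq_Suc)
  show "prim_code 2 pMul" unfolding pMul_def
    using prim_code_Pr[of 1 cZ "cCn pAdd (lst [pid 1, pid 2])"] prim_code_Z[of 1]
      prim_code_Cn[of "[pid 1, pid 2]" pAdd 3] 2 prim_code_pid[of 1 3] prim_code_pid[of 2 3] by (simp add: numeral_eq_Suc)
  show 4: "prim_code 1 pPred" unfolding pPred_def
    using prim_code_Pr[of 0 cZ "pid 0"] prim_code_Z prim_code_pid[of 0 2] by (simp add: numeral_2_eq_2)
  show "prim_code 2 pSub" unfolding pSub_def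
    using prim_code_Pr[of 1 "pid 0" "cCn pPred (lst [pid 1])"] prim_code_pid[of 0 1]
      prim_code_Cn[of "[pid 1]" pPred 3] 4 prim_code_pid[of 1 3] by (simp add: numeral_eq_Suc)
  show "prim_code 1 pIsz" unfolding pIsz_def
    using prim_code_Pr[of 0 pOne cZ] 1 prim_code_Z by simp
qed

lemma prim_code_tcomp: "closed_tm n t \<Longrightarrow> prim_code n (tcomp t)"
  by (induct t) (auto simp del: lst_simps simp: prim_code_pid prim_code_Z prim_code_basic numeral_2_eq_2[symmetric] intro!:
      prim_code_Cn)

lemma prim_code_bcomp: "bcl b n \<Longrightarrow> memfree b \<Longrightarrow> prim_code n (bcomp b n)"
proof (induct b arbitrary: n)
  case (BAll t p)
  have "prim_code (n + 2) (cCn pMul (lst [pid 1, cCn (bcomp p (Suc n)) (lst (pid 0 # map (\<lambda>i. pid (Suc (Suc i))) [0..<n]))]))"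
    using BAll by (intro prim_code_Cn) (auto simp: numeral_2_eq_2[symmetric] prim_code_basic intro!: prim_code_pid prim_code_Cn
        simp del: lst_simps)
  then have "prim_code (n + 1) (cPr pOne
      (cCn pMul (lst [pid 1, cCn (bcomp p (Suc n)) (lst (pid 0 # map (\<lambda>i. pid (Suc (Suc i))) [0..<n]))])))"
    by (intro prim_code_Pr prim_code_basic)
  then show ?case unfolding bcomp.simps using BAll
    by (intro prim_code_Cn) (auto intro: prim_code_pid prim_code_tcomp simp del: lst_simps)
qed (auto simp del: lst_simps simp: prim_code_tcomp prim_code_Z prim_code_basic prim_code_basic[simplified]
    numeral_2_eq_2[symmetric] intro!: prim_code_Cn)

lemma vals_peval: "arity n f \<Longrightarrow> length xs = n \<Longrightarrow> vals pr_rules Z (code_prim f) xs (peval f xs)"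
proof (induct arbitrary: xs rule: arity.induct)
  case (1 n) then show ?case by (simp add: vals_Z)
next
  case 2 then show ?case using vals_S[OF alg_rules_simps(1), of Z "hd xs" "tl xs"] by (cases xs) auto
next
  case (3 i n) then show ?case using vals_pid[OF alg_rules_simps(1), of i xs Z] by (simp add: pid_def cst_of_nat)
next
  case (4 fs g n)
  have "vals pr_rules Z (cCn (code_prim g) (lst (map code_prim fs))) xs (peval g (map (\<lambda>f. peval f xs) fs))"
    by (rule vals_Cn[OF alg_rules_simps(1), of _ _ _ "map (\<lambda>f. peval f xs) fs"]) (use 4 in \<open>auto simp: list_all2_conv_all_nth\<close>)
  then show ?case by (simp add: lst_def)
next
  case (5 n f g)
  then obtain x ys where xs: "xs = x # ys" "length ys = n" by (cases xs) auto
  \<comment> \<open>In the standard model every set is in \<open>SS\<close>, so the graph of any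
    function is definable, with itself as a parameter.\<close>
  have gr: "d (\<lambda>e. e 1 = F (e 0))" for F :: "nat \<Rightarrow> nat"
  proof -
    have "d (\<lambda>e. pair (e 0) (e 1) \<in> {pair x (F x) | x. True})" by (intro d_mem dts) (simp add: SS_nat_def)
    then show ?thesis by simp
  qed
  have "vals pr_rules Z (cPr (code_prim f) (code_prim g)) (x # ys) (rec_nat (peval f ys) (\<lambda>x r. peval g (x # r # ys)) x)"
    by (rule vals_Pr[OF alg_rules_simps(1) _ gr]) (use 5 xs(2) in \<open>simp_all add: SS_nat_def\<close>)
  then show ?case using xs by simp
qed

section \<open>The jump\<close>

definition jumpM :: "'a::arith set \<Rightarrow> 'a \<Rightarrow> bool" where
  "jumpM Z x \<longleftrightarrow> (\<exists>v. ev oracle_rules Z x (lst [x]) v)"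

lemma oracle_rules_closed: "\<forall>r\<in>set oracle_rules. closed 8 1 (side r)"
  by (simp add: pr_rules_def mu_rules_def Let_def infer_def infer_if_def)

lemma hsat_jump:
  assumes "\<And>n. E n \<in> SS" shows "hsat (jump x) e E \<longleftrightarrow> jumpM (E 0) (hval e x :: 'a::arith)"
proof -
  have "der oracle_rules e' E = der oracle_rules (\<lambda>_. 0) (\<lambda>_. E 0)" for e' :: "nat \<Rightarrow> 'a"
    by (rule der_closed[OF oracle_rules_closed]) simp
  then show ?thesis
    by (simp add: jump_def jumpM_def ev_def hsat_Der[OF alg_rules_ok[OF alg_rules_simps(2)]] assms jEv_def)
qed

definition cJ :: "'a \<Rightarrow> 'a \<Rightarrow> 'a::{zero,one,plus,times}" where
  "cJ q z = cCn (cPr q z) (cCons cZ (cCons (cId 0) cNil))"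

lemma ev_cJ: "ev oracle_rules Z (cJ q z) (lst [x]) v \<longleftrightarrow> ev oracle_rules Z q (lst [x]) (v::'a::arith)"
  by (auto simp: cJ_def ev_Cn evs_Cons evs_Nil ev_Z ev_Id0 ev_Pr0)

text \<open>
  The program \<open>cJ q z\<close> on a one-element input runs \<open>q\<close> on that input; \<open>z\<close> is inert data. As the jump
  applies a program to its own code, \<open>q\<close> can read \<open>z\<close> off its input; this replaces the s-m-n theorem.
\<close>

lemma jump_complete:
  fixes Z :: "'a::arith set"
  assumes Z: "Z \<in> SS" and dA: "d (\<lambda>e. A (e 0))"
    and q: "\<And>y. vals oracle_rules Z q [y, cJ (cMu q) z] (tv (A y))"
  shows "jumpM Z (cJ (cMu q) z) \<longleftrightarrow> (\<exists>y. \<not> A y)"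
proof -
  let ?x = "cJ (cMu q) z"
  let ?R = oracle_rules
  have ev: "ev ?R Z q (cCons y (cCons ?x cNil)) v \<longleftrightarrow> v = tv (A y)" for y v
    using q[of y] by (simp add: vals_def)
  have "jumpM Z ?x \<longleftrightarrow> (\<exists>v. ev ?R Z (cMu q) (lst [?x]) v)" unfolding jumpM_def ev_cJ ..
  also have "\<dots> \<longleftrightarrow> (\<exists>v. evp ?R Z q (lst [?x]) v \<and> \<not> A v)"
    by (auto simp: ev_Mu ev tv_def)
  also have "\<dots> \<longleftrightarrow> (\<exists>v. \<not> A v)"
  proof
    assume "\<exists>v. \<not> A v"
    \<comment> \<open>The search halts at the least counterexample. That it passes all earlier
      values is again an induction inside the model, restricted to arguments up to
      \<open>y\<close>.\<close>
    then obtain y where y: "\<not> A y" "\<forall>z<y. A z" using least[OF d_not[OF dA]] by blast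
    have "x \<le> y \<longrightarrow> evp ?R Z q (lst [?x]) x" for x
    proof (rule ind[of "\<lambda>x. x \<le> y \<longrightarrow> evp ?R Z q (lst [?x]) x"])
      show "d (\<lambda>e. e 0 \<le> y \<longrightarrow> evp ?R Z q (lst [?x]) (e 0))" by (intro d_imp d_le d_evp alg_rules_simps Z dts)
      fix x assume "x \<le> y \<longrightarrow> evp ?R Z q (lst [?x]) x"
      moreover have "A x" if "x + 1 \<le> y" using y(2) that less_iff_Suc_le by blast
      ultimately show "x + 1 \<le> y \<longrightarrow> evp ?R Z q (lst [?x]) (x + 1)"
        using less_iff_Suc_le[of x y] by (auto simp: evp_S ev tv_def)
    qed (simp add: evp_0)
    then show "\<exists>v. evp ?R Z q (lst [?x]) v \<and> \<not> A v" using y(1) by blast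
  qed blast
  finally show ?thesis .
qed

lemma Delta0_simps [simp, intro]:
  "Delta0 p \<Longrightarrow> Delta0 (Neg p)" "Delta0 p \<Longrightarrow> Delta0 q \<Longrightarrow> Delta0 (Conj p q)" "Delta0 p \<Longrightarrow> Delta0 q \<Longrightarrow> Delta0 (Disj p q)"
  "Delta0 p \<Longrightarrow> Delta0 (ExB t p)"
  by (auto simp: Neg_def Conj_def Disj_def ExB_def intro!: Delta0.intros)

lemma Delta0_conjs [simp]: "\<forall>p\<in>set qs. Delta0 p \<Longrightarrow> Delta0 (conjs qs)"
  by (induct qs) (auto intro!: Delta0.intros)
lemma Delta0_disjs [simp]: "\<forall>p\<in>set qs. Delta0 p \<Longrightarrow> Delta0 (disjs qs)"
  by (induct qs) (auto intro!: Delta0.intros)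

lemma closed_conjs [simp]: "closed k s (conjs qs) \<longleftrightarrow> (\<forall>p\<in>set qs. closed k s p)"
  by (induct qs) auto
lemma closed_disjs [simp]: "closed k s (disjs qs) \<longleftrightarrow> (\<forall>p\<in>set qs. closed k s p)"
  by (induct qs) auto

section \<open>Iterating an arithmetical operator along the omega-jump\<close>

text \<open>
  A clause \<open>(ps, q, h)\<close> defines membership of \<open>h\<close> in the next set by: for all \<open>y\<close>, if the \<open>ps\<close> are in the
  current set, then so is \<open>q\<close>. Its parameters are \<open>Var 0\<close>, \<open>Var 1\<close>, \<open>Var 2\<close>, and \<open>y\<close> is \<open>Var 6\<close>.
  The first three clauses are Tarski's for truth in a coded omega-model; the other ones (tags 13, 15, 16)
  generate the sets of an omega-model, with tag 14 for the values of terms.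
\<close>

definition clauses :: "(tm list \<times> tm \<times> tm) list" where
  "clauses = (let a = Var 0; b = Var 1; c = Var 2; y = Var 6 in
    [([pair a c], pair b c, pair (cImp a b) c),
     ([], pair a (pair (cCons y b) c), pair (cAllN a) (pair b c)),
     ([], pair a (pair b (cCons y c)), pair (cAllS a) (pair b c)),
     ([], pair a (cCons y c), pair (tag 13 (pair a b)) c),
     ([pair (tag 14 0) (pair c (pair b y))], pair a y, pair (tag 15 (pair a b)) c),
     ([], pair a (cCons c b), pair (tag 16 (pair a b)) c)])"

text \<open>Membership in stage \<open>n\<close>, read off the section at \<open>n\<close>. Stage 0
  is the section itself. Stage \<open>m + 1\<close> is defined by a universal quantifier, so
  \<open>t\<close> belongs to it if the search for a counterexample, with data
  \<open>(m, t)\<close>, is not in this section, which is a jump.\<close>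

definition qry :: "tm \<Rightarrow> tm \<Rightarrow> tm \<Rightarrow> fm" where
  "qry n P t = Disj (Conj (Eq n 0) (Mem t 0))
     (ExB n (Conj (Eq (up 1 n) (Var 0 + 1)) (Neg (Mem (cJ (up 1 P) (pair (Var 0) (up 1 t))) 0))))"

definition for3 :: "fm \<Rightarrow> fm" where
  "for3 p = AllB (Var 0 + 1) (AllB (Var 1 + 1) (AllB (Var 2 + 1) p))"

definition opbody :: fm where
  "opbody = Conj (conjs (map (\<lambda>(ps, q, h). for3 (Imp (Eq (Var 3) h)
           (Imp (conjs (map (qry (Var 4) (Var 5)) ps)) (qry (Var 4) (Var 5) q)))) clauses))
         (Imp (conjs (map (\<lambda>(ps, q, h). for3 (Neg (Eq (Var 3) h))) clauses))
           (qry (Var 1) (Var 2) (Var 0)))"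

text \<open>\<open>Var 0\<close> is a possible counterexample and \<open>Var 1\<close> the input.
  The program, the stage and the candidate are all decoded from the input, which gives the program
  access to its own code, as the recursion theorem would.\<close>

definition opf :: fm where
  "opf = AllB (Var 1 + 1) (AllB (Var 2 + 1) (AllB (Var 3 + 1)
     (Imp (Eq (Var 4) (cJ (Var 2) (pair (Var 1) (Var 0))))
       opbody)))"

lemma closed_tm_up [simp]: "closed_tm (Suc m) (up (Suc 0) t) = closed_tm m t"
  by (simp add: up_def)
lemma closed_tm_cJ [simp]: "closed_tm m (cJ q z) \<longleftrightarrow> closed_tm m q \<and> closed_tm m z"
  by (auto simp: cJ_def alg_defs)
lemma hval_cJ [simp]: "hval e (cJ q z) = cJ (hval e q) (hval e z)"
  by (simp add: cJ_def alg_defs)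
lemma closed_qry [simp]: "closed m (Suc 0) (qry n P t) \<longleftrightarrow> closed_tm m n \<and> closed_tm m P \<and> closed_tm m t"
  by (auto simp: qry_def)
lemma Delta0_qry [simp]: "Delta0 (qry n P t)"
  by (auto simp: qry_def intro!: Delta0.intros)
lemma closed_for3 [simp]: "0 < m \<Longrightarrow> closed m s (for3 p) \<longleftrightarrow> closed (Suc (Suc (Suc m))) s p"
  by (auto simp: for3_def)
lemma Delta0_for3 [simp]: "Delta0 p \<Longrightarrow> Delta0 (for3 p)"
  by (auto simp: for3_def intro!: Delta0.intros)

lemma closed_opf: "closed 2 1 opf"
  by (auto simp: opf_def opbody_def clauses_def Let_def code_defs)
lemma Delta0_opf: "Delta0 opf"
  unfolding opf_def opbody_def by (intro Delta0.intros Delta0_simps Delta0_conjs) (auto intro!: Delta0.intros Delta0_for3)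

definition query :: "'a::arith set \<Rightarrow> 'a \<Rightarrow> 'a \<Rightarrow> 'a \<Rightarrow> bool" where
  "query Z P n t \<longleftrightarrow> (n = 0 \<and> t \<in> Z) \<or> (\<exists>m. n = m + 1 \<and> cJ P (pair m t) \<notin> Z)"

lemma hsat_qry [simp]: "hsat (qry n P t) e E \<longleftrightarrow> query (E 0) (hval e P) (hval e n) (hval e t :: 'a::arith)"
  unfolding query_def qry_def by (auto simp: less_plus1)

definition opM :: "('a::arith \<Rightarrow> bool) \<Rightarrow> 'a \<Rightarrow> 'a \<Rightarrow> bool" where
  "opM G y z \<longleftrightarrow>
     (\<forall>a b c. z = pair (cImp a b) c \<longrightarrow> G (pair a c) \<longrightarrow> G (pair b c)) \<and>
     (\<forall>a b c. z = pair (cAllN a) (pair b c) \<longrightarrow> G (pair a (pair (cCons y b) c))) \<and>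
     (\<forall>a b c. z = pair (cAllS a) (pair b c) \<longrightarrow> G (pair a (pair b (cCons y c)))) \<and>
     (\<forall>a b c. z = pair (tag 13 (pair a b)) c \<longrightarrow> G (pair a (cCons y c))) \<and>
     (\<forall>a b c. z = pair (tag 15 (pair a b)) c \<longrightarrow> G (pair (tag 14 0) (pair c (pair b y))) \<longrightarrow> G (pair a y)) \<and>
     (\<forall>a b c. z = pair (tag 16 (pair a b)) c \<longrightarrow> G (pair a (cCons c b))) \<and>
     ((\<forall>a b c. z \<noteq> pair (cImp a b) c \<and> z \<noteq> pair (cAllN a) (pair b c) \<and> z \<noteq> pair (cAllS a) (pair b c) \<and>
        z \<noteq> pair (tag 13 (pair a b)) c \<and> z \<noteq> pair (tag 15 (pair a b)) c \<and> z \<noteq> pair (tag 16 (pair a b)) c) \<longrightarrow> G z)"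

lemma le_tag: "x \<le> y \<Longrightarrow> 0 < k \<Longrightarrow> x \<le> tag k (y::'a::arith)"
  using less_tag[of k y] by auto
lemma le_pair1: "x \<le> y \<Longrightarrow> x \<le> pair y (z::'a::arith)" using le_pair(1)[of y z] by auto
lemma le_pair2: "x \<le> z \<Longrightarrow> x \<le> pair y (z::'a::arith)" using le_pair(2)[of z y] by auto

lemma hsat_for3:
  assumes "\<And>p0 p1 p2. z = h p0 p1 p2 \<Longrightarrow> p0 \<le> z \<and> p1 \<le> z \<and> p2 \<le> z"
    "\<And>p0 p1 p2. hsat p (case_nat p0 (case_nat p1 (case_nat p2 (case_nat z e)))) E = (z = h p0 p1 p2 \<longrightarrow> F p0 p1 p2)"
  shows "hsat (for3 p) (case_nat z e) E \<longleftrightarrow> (\<forall>p0 p1 p2. z = h p0 p1 p2 \<longrightarrow> F p0 p1 (p2::'a::arith))"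
  using assms(1) by (auto simp: for3_def assms(2) less_plus1)

lemma hsat_opf:
  fixes x y :: "'a::arith"
  shows "hsat opf (lenv [y, x]) (\<lambda>_. Z) \<longleftrightarrow>
    (\<forall>P\<le>x. \<forall>n\<le>x. \<forall>z\<le>x. x = cJ P (pair n z) \<longrightarrow> opM (query Z P n) y z)"
proof -
  let ?e = "\<lambda>x z n P. case_nat z (case_nat n (case_nat P (lenv [y, x])))"
  have c: "hsat (for3 (Imp (Eq (Var 3) h) p)) (?e x z n P) (\<lambda>_. Z) \<longleftrightarrow>
    (\<forall>p0 p1 p2. z = hval (case_nat p0 (case_nat p1 (case_nat p2 (?e x z n P)))) h \<longrightarrow>
       hsat p (case_nat p0 (case_nat p1 (case_nat p2 (?e x z n P)))) (\<lambda>_. Z))"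
    if "\<And>p0 p1 p2. p0 \<le> hval (case_nat p0 (case_nat p1 (case_nat p2 (?e x z n P)))) h \<and>
       p1 \<le> hval (case_nat p0 (case_nat p1 (case_nat p2 (?e x z n P)))) h \<and>
       p2 \<le> hval (case_nat p0 (case_nat p1 (case_nat p2 (?e x z n P)))) h" for h p z n P x
  proof (rule hsat_for3)
    fix p0 p1 p2 assume eq: "z = hval (case_nat p0 (case_nat p1 (case_nat p2 (?e x z n P)))) h"
    show "p0 \<le> z \<and> p1 \<le> z \<and> p2 \<le> z" using that[of p0 p1 p2] unfolding eq[symmetric] .
  qed simp
  note c' = c[unfolded lenv_Cons]
  have N: "for3 (Neg p) = for3 (Imp p Fls)" for p by (simp add: Neg_def)
  have op: "hsat opbody (lenv [z, n, P, y, x]) (\<lambda>_. Z) \<longleftrightarrow> opM (query Z P n) y z" for z n P x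
    unfolding opbody_def clauses_def Let_def opM_def N
    by (simp add: c' code_defs le_pair1 le_pair2 le_tag lenv_def) (simp add: all_conj_distrib)
  have l: "lenv [z, n, P, y, x] (Suc (Suc 0)) = P" "lenv [z, n, P, y, x] (Suc 0) = n" "lenv [z, n, P, y, x] 0 = z"
    "lenv [z, n, P, y, x] 4 = x" "lenv [y, x] (Suc 0) = x" "lenv [P, y, x] (Suc (Suc 0)) = x" "lenv [n, P, y, x] 3 = x"
        for z n P x :: 'a
    by (simp_all add: lenv_def)
  show ?thesis unfolding opf_def by (simp add: op less_plus1 lenv_Cons l numeral_2_eq_2)
qed

definition omega_jump :: "'a::arith set \<Rightarrow> 'a set \<Rightarrow> bool" where
  "omega_jump X Y \<longleftrightarrow> (\<forall>x. pair 0 x \<in> Y \<longleftrightarrow> x \<in> X) \<and>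
     (\<forall>n x. pair (n + 1) x \<in> Y \<longleftrightarrow> jumpM {x. pair n x \<in> Y} x)"

lemma cJ_inject [simp]: "cJ P z = cJ P' (z'::'a::arith) \<longleftrightarrow> P = P' \<and> z = z'"
  by (simp add: cJ_def alg_defs)

lemma le_cJ: "P \<le> cJ P (z::'a::arith)" "z \<le> cJ P z"
proof -
  show "P \<le> cJ P z" unfolding cJ_def alg_defs by (intro le_tag le_pair1) auto
  show "z \<le> cJ P z" unfolding cJ_def alg_defs by (rule le_tag, rule le_pair1, rule le_tag, rule le_pair2) auto
qed

text \<open>All stages use one program \<open>P\<close> with the stage number among its data, and
  membership in stage \<open>n\<close> is one membership question about the section of
  \<open>Y\<close> at \<open>n\<close>. By this uniformity the whole hierarchy is definable from
  \<open>Y\<close>.\<close>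

lemma hierarchy_exists:
  fixes X :: "'a::arith set"
  assumes oj: "omega_jump X Y" and Y: "Y \<in> SS"
  shows "\<exists>G. (\<forall>z. G 0 z \<longleftrightarrow> z \<in> X) \<and> (\<forall>n z. G (n + 1) z \<longleftrightarrow> (\<forall>y. opM (G n) y z)) \<and> d (\<lambda>e. G (e 0) (e 1))"
proof -
  obtain b where b: "bfm b = opf" "bcl b 2" using Delta0_bf[OF Delta0_opf closed_opf] by auto
  define P :: 'a where "P = cMu (bcomp b 2)"
  define G where "G n z \<longleftrightarrow> (n = 0 \<and> pair 0 z \<in> Y) \<or> (\<exists>m. n = m + 1 \<and> pair (m + 1) (cJ P (pair m z)) \<notin> Y)" for n z
  have Yn: "{x. pair n x \<in> Y} \<in> SS" for n by (intro SS_Collect d_mem dts Y)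
  have GZ: "query {x. pair n x \<in> Y} P n = G n" for n
    by (auto simp: fun_eq_iff query_def G_def)
  have GS: "G (n + 1) z \<longleftrightarrow> (\<forall>y. opM (G n) y z)" for n z
  proof -
    let ?x = "cJ P (pair n z)" let ?Z = "{x. pair n x \<in> Y}"
    let ?A = "\<lambda>y. hsat opf (lenv [y, ?x]) (\<lambda>_. ?Z)"
    have "G (n + 1) z \<longleftrightarrow> \<not> jumpM ?Z ?x"
      using oj suc_neq[of n] by (auto simp: G_def omega_jump_def)
    also have "jumpM ?Z ?x \<longleftrightarrow> (\<exists>y. \<not> ?A y)"
      unfolding P_def
    proof (rule jump_complete[OF Yn])
      have "dt (\<lambda>e. lenv [e 0, c] n)" for c :: 'a and n
        unfolding lenv_Cons[symmetric] by (intro dt_case dts)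
      then show "d (\<lambda>e. hsat opf (lenv [e 0, cJ (cMu (bcomp b 2)) (pair n z)]) (\<lambda>_. ?Z))"
        using Yn Delta0_bf[OF Delta0_opf closed_opf]
        by (intro d_hsat) (auto simp: opf_def opbody_def clauses_def Let_def for3_def qry_def)
      fix y
      show "vals oracle_rules ?Z (bcomp b 2) [y, cJ (cMu (bcomp b 2)) (pair n z)]
          (tv (hsat opf (lenv [y, cJ (cMu (bcomp b 2)) (pair n z)]) (\<lambda>_. ?Z)))"
        using vals_bcomp[OF alg_rules_simps(2) Yn[of n], of b "[y, cJ (cMu (bcomp b 2)) (pair n z)]"] b
        by (simp add: numeral_2_eq_2)
    qed
    also have "(\<not> (\<exists>y. \<not> ?A y)) \<longleftrightarrow> (\<forall>y. opM (G n) y z)"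
    proof -
      have "?A y \<longleftrightarrow> opM (G n) y z" for y
      proof -
        have "P \<le> ?x" "n \<le> ?x" "z \<le> ?x"
            by (auto intro: le_cJ order.trans[OF le_pair(1) le_cJ(2)] order.trans[OF le_pair(2) le_cJ(2)])
        then show ?thesis unfolding hsat_opf using GZ by auto
      qed
      then show ?thesis by simp
    qed
    finally show ?thesis .
  qed
  have "d (\<lambda>e. G (e 0) (e 1))"
    unfolding G_def cJ_def alg_defs by (intro d_disj d_conj d_eq d_mem d_ex d_not dts Y)
  moreover have "G 0 z \<longleftrightarrow> z \<in> X" for z using oj suc_neq[symmetric] by (auto simp: G_def omega_jump_def)
  ultimately show ?thesis using GS by blast
qed

text \<open>A code \<open>i\<close> settles at stage \<open>i\<close>: each clause refers to codes
  strictly smaller than \<open>i\<close> or to atoms, which never change. The stages run through all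
  elements of the model, so nonstandard codes settle too, and the diagonal of the hierarchy
  satisfies all clauses at once.\<close>

theorem sat_exists:
  fixes X :: "'a::arith set"
  assumes "omega_jump X Y" "Y \<in> SS"
  shows "\<exists>S\<in>SS.
    (\<forall>a b c. pair (cImp a b) c \<in> S \<longleftrightarrow> (pair a c \<in> S \<longrightarrow> pair b c \<in> S)) \<and>
    (\<forall>a l s. pair (cAllN a) (pair l s) \<in> S \<longleftrightarrow> (\<forall>y. pair a (pair (cCons y l) s) \<in> S)) \<and>
    (\<forall>a l s. pair (cAllS a) (pair l s) \<in> S \<longleftrightarrow> (\<forall>y. pair a (pair l (cCons y s)) \<in> S)) \<and>
    (\<forall>a b l. pair (tag 13 (pair a b)) l \<in> S \<longleftrightarrow> (\<forall>y. pair a (cCons y l) \<in> S)) \<and>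
    (\<forall>a t l. pair (tag 15 (pair a t)) l \<in> S \<longleftrightarrow> (\<forall>y. pair (tag 14 0) (pair l (pair t y)) \<in> S \<longrightarrow> pair a y \<in> S)) \<and>
    (\<forall>a l x. pair (tag 16 (pair a l)) x \<in> S \<longleftrightarrow> pair a (cCons x l) \<in> S) \<and>
    (\<forall>k x c. k \<notin> {10, 11, 12, 13, 15, 16} \<longrightarrow> (pair (tag k x) c \<in> S \<longleftrightarrow> pair (tag k x) c \<in> X))"
proof -
  from hierarchy_exists[OF assms] obtain G where G0: "\<And>z. G 0 z \<longleftrightarrow> z \<in> X"
    and GS: "\<And>n z. G (n + 1) z \<longleftrightarrow> (\<forall>y. opM (G n) y z)" and dG0: "d (\<lambda>e. G (e 0) (e 1))" by blast
  have dG: "d (\<lambda>e. G (n e) (z e))" if "dt n" "dt z" for n z using d_subst2[of G, OF dG0 that] .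
  have atom: "G n (pair (tag k x) c) \<longleftrightarrow> pair (tag k x) c \<in> X" if "k \<notin> {10, 11, 12, 13, 15, 16}" for n k x c
  proof (rule ind[of "\<lambda>n. G n (pair (tag k x) c) = (pair (tag k x) c \<in> X)"])
    show "d (\<lambda>e. G (e 0) (pair (tag k x) c) = (pair (tag k x) c \<in> X))"
      by (intro d_iff dG d_const dts)
    fix n assume "G n (pair (tag k x) c) = (pair (tag k x) c \<in> X)"
    then show "G (n + 1) (pair (tag k x) c) = (pair (tag k x) c \<in> X)"
      unfolding GS opM_def using that by (simp add: code_defs)
  qed (simp add: G0)
  have imp: "G (n + 1) (pair (cImp a b) c) \<longleftrightarrow> (G n (pair a c) \<longrightarrow> G n (pair b c))" for n a b c
    unfolding GS opM_def by (simp add: code_defs)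
  have alln: "G (n + 1) (pair (cAllN a) (pair l s)) \<longleftrightarrow> (\<forall>y. G n (pair a (pair (cCons y l) s)))" for n a l s
    unfolding GS opM_def by (simp add: code_defs)
  have alls: "G (n + 1) (pair (cAllS a) (pair l s)) \<longleftrightarrow> (\<forall>y. G n (pair a (pair l (cCons y s))))" for n a l s
    unfolding GS opM_def by (simp add: code_defs)
  have t13: "G (n + 1) (pair (tag 13 (pair a b)) l) \<longleftrightarrow> (\<forall>y. G n (pair a (cCons y l)))" for n a b l
    unfolding GS opM_def by (simp add: code_defs)
  have t15: "G (n + 1) (pair (tag 15 (pair a t)) l) \<longleftrightarrow> (\<forall>y. G n (pair (tag 14 0) (pair l (pair t y))) \<longrightarrow> G n (pair a y))"
      for n a t l
    unfolding GS opM_def by (simp add: code_defs)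
  have t16: "G (n + 1) (pair (tag 16 (pair a l)) x) \<longleftrightarrow> G n (pair a (cCons x l))" for n a l x
    unfolding GS opM_def by (simp add: code_defs)
  have pred: "\<exists>n. i = n + 1 \<and> a \<le> n" if "a < i" for a i :: 'a
    by (rule suc_cases[of i]) (use that less_plus1 in auto)
  have stab: "\<forall>L m n. i \<le> m \<longrightarrow> i \<le> n \<longrightarrow> G m (pair i L) = G n (pair i L)" for i
  proof (rule strong_ind[of "\<lambda>i. \<forall>L m n. i \<le> m \<longrightarrow> i \<le> n \<longrightarrow> G m (pair i L) = G n (pair i L)"])
    show "d (\<lambda>e. \<forall>L m n. e 0 \<le> m \<longrightarrow> e 0 \<le> n \<longrightarrow> G m (pair (e 0) L) = G n (pair (e 0) L))"
      by (intro d_all d_imp d_le d_iff dG dts)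
    fix i assume IH: "\<And>j. j < i \<Longrightarrow> \<forall>L m n. j \<le> m \<longrightarrow> j \<le> n \<longrightarrow> G m (pair j L) = G n (pair j L)"
    show "\<forall>L m n. i \<le> m \<longrightarrow> i \<le> n \<longrightarrow> G m (pair i L) = G n (pair i L)"
    proof (intro allI impI)
      fix L m n assume mn: "i \<le> m" "i \<le> n"
      have step: "\<exists>m' n'. m = m' + 1 \<and> n = n' + 1 \<and> (\<forall>j c. j \<le> a \<longrightarrow> G m' (pair j c) = G n' (pair j c))" if lt: "a < i" for a
      proof -
        obtain m' n' where 1: "m = m' + 1" "a \<le> m'" "n = n' + 1" "a \<le> n'"
          using pred[OF order.strict_trans2[OF lt mn(1)]] pred[OF order.strict_trans2[OF lt mn(2)]] by blast
        have "G m' (pair j c) = G n' (pair j c)" if "j \<le> a" for j c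
          using IH[OF order.strict_trans1[OF that \<open>a < i\<close>]] order.trans[OF that 1(2)] order.trans[OF that 1(4)] by blast
        with 1 show ?thesis by blast
      qed
      consider a b where "i = cImp a b" | a l s where "i = cAllN a" "L = pair l s" | a l s where "i = cAllS a" "L = pair l s"
        | a b where "i = tag 13 (pair a b)" | a b where "i = tag 15 (pair a b)" | a b where "i = tag 16 (pair a b)"
        | "\<And>a b c. pair i L \<noteq> pair (cImp a b) c \<and> pair i L \<noteq> pair (cAllN a) (pair b c) \<and> pair i L \<noteq> pair (cAllS a) (pair b c) \<and>
          pair i L \<noteq> pair (tag 13 (pair a b)) c \<and> pair i L \<noteq> pair (tag 15 (pair a b)) c \<and> pair i L \<noteq> pair (tag 16 (pair a b)) c"
        unfolding pair_inject by blast
      then show "G m (pair i L) = G n (pair i L)"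
      proof cases
        case (1 a b)
        obtain m' n' where "m = m' + 1" "n = n' + 1" "\<And>j c. j \<le> pair a b \<Longrightarrow> G m' (pair j c) = G n' (pair j c)"
          using step[of "pair a b"] 1 less_tag[of 10 "pair a b"] by (auto simp: code_defs)
        then show ?thesis using 1 imp le_pair[where x=a and y=b] by simp
      next
        case (2 a l s)
        obtain m' n' where "m = m' + 1" "n = n' + 1" "\<And>j c. j \<le> a \<Longrightarrow> G m' (pair j c) = G n' (pair j c)"
          using step[of a] 2 less_tag[of 11 a] by (auto simp: code_defs)
        then show ?thesis using 2 alln by simp
      next
        case (3 a l s)
        obtain m' n' where "m = m' + 1" "n = n' + 1" "\<And>j c. j \<le> a \<Longrightarrow> G m' (pair j c) = G n' (pair j c)"
          using step[of a] 3 less_tag[of 12 a] by (auto simp: code_defs)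
        then show ?thesis using 3 alls by simp
      next
        case (4 a b)
        obtain m' n' where "m = m' + 1" "n = n' + 1" "\<And>j c. j \<le> pair a b \<Longrightarrow> G m' (pair j c) = G n' (pair j c)"
          using step[of "pair a b"] 4 less_tag[of 13 "pair a b"] by auto
        then show ?thesis using 4 t13 le_pair[where x=a and y=b] by simp
      next
        case (5 a b)
        obtain m' n' where "m = m' + 1" "n = n' + 1" "\<And>j c. j \<le> pair a b \<Longrightarrow> G m' (pair j c) = G n' (pair j c)"
          using step[of "pair a b"] 5 less_tag[of 15 "pair a b"] by auto
        then show ?thesis using 5 t15 le_pair[where x=a and y=b] by (simp add: atom)
      next
        case (6 a b)
        obtain m' n' where "m = m' + 1" "n = n' + 1" "\<And>j c. j \<le> pair a b \<Longrightarrow> G m' (pair j c) = G n' (pair j c)"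
          using step[of "pair a b"] 6 less_tag[of 16 "pair a b"] by auto
        then show ?thesis using 6 t16 le_pair[where x=a and y=b] by simp
      next
        case 7
        have "G (n + 1) (pair i L) \<longleftrightarrow> G n (pair i L)" for n
          by (simp add: 7 GS opM_def del: pair_inject)
        then have *: "G (n + 1) (pair i L) \<longleftrightarrow> G n (pair i L)" for n .
        have "G n (pair i L) = G 0 (pair i L)" for n
        proof (rule ind[of "\<lambda>n. G n (pair i L) = G 0 (pair i L)"])
          show "d (\<lambda>e. G (e 0) (pair i L) = G 0 (pair i L))" by (intro d_iff dG dts)
        qed (simp_all only: *)
        then show ?thesis by metis
      qed
    qed
  qed
  \<comment> \<open>The diagonal: a pair with first component \<open>i\<close> is taken at stage
    \<open>i\<close>, where it has become stable.\<close>
  define S where "S = {z. \<exists>i L. z = pair i L \<and> G i z}"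
  have Sm: "pair i c \<in> S \<longleftrightarrow> G i (pair i c)" for i c unfolding S_def mem_Collect_eq pair_inject by blast
  have mem: "G n (pair a c) \<longleftrightarrow> pair a c \<in> S" if "a \<le> n" for a n c
    unfolding Sm using stab[rule_format, OF that order.refl] .
  have SS: "S \<in> SS" unfolding S_def by (intro SS_Collect d_ex d_conj d_eq dG dts)
  show ?thesis
  proof (intro bexI[OF _ SS] conjI allI impI)
    fix a b c :: 'a
    obtain n where n: "cImp a b = n + 1" "pair a b \<le> n"
      using pred[of "pair a b" "cImp a b"] less_tag[of 10 "pair a b"] by (auto simp: code_defs)
    have "a \<le> n" "b \<le> n" by (rule order.trans[OF le_pair(1) n(2)], rule order.trans[OF le_pair(2) n(2)])
    then show "pair (cImp a b) c \<in> S \<longleftrightarrow> (pair a c \<in> S \<longrightarrow> pair b c \<in> S)"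
      using imp[of n a b c] mem[of a n c] mem[of b n c] Sm[of "cImp a b" c] n(1) by simp
  next
    fix a l s :: 'a
    obtain n where "cAllN a = n + 1" "a \<le> n"
      using pred[of a "cAllN a"] less_tag[of 11 a] by (auto simp: code_defs)
    then show "pair (cAllN a) (pair l s) \<in> S \<longleftrightarrow> (\<forall>y. pair a (pair (cCons y l) s) \<in> S)"
      using alln[of n a l s] mem[of a n] Sm[of "cAllN a"] by simp
  next
    fix a l s :: 'a
    obtain n where "cAllS a = n + 1" "a \<le> n"
      using pred[of a "cAllS a"] less_tag[of 12 a] by (auto simp: code_defs)
    then show "pair (cAllS a) (pair l s) \<in> S \<longleftrightarrow> (\<forall>y. pair a (pair l (cCons y s)) \<in> S)"
      using alls[of n a l s] mem[of a n] Sm[of "cAllS a"] by simp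
  next
    fix a b l :: 'a
    obtain n where n: "tag 13 (pair a b) = n + 1" "pair a b \<le> n"
      using pred[of "pair a b" "tag 13 (pair a b)"] less_tag[of 13 "pair a b"] by auto
    have "a \<le> n" by (rule order.trans[OF le_pair(1) n(2)])
    then show "pair (tag 13 (pair a b)) l \<in> S \<longleftrightarrow> (\<forall>y. pair a (cCons y l) \<in> S)"
      using t13[of n a b l] mem[of a n] Sm[of "tag 13 (pair a b)"] n(1) by simp
  next
    fix a t l :: 'a
    obtain n where n: "tag 15 (pair a t) = n + 1" "pair a t \<le> n"
      using pred[of "pair a t" "tag 15 (pair a t)"] less_tag[of 15 "pair a t"] by auto
    have "a \<le> n" by (rule order.trans[OF le_pair(1) n(2)])
    then show "pair (tag 15 (pair a t)) l \<in> S \<longleftrightarrow> (\<forall>y. pair (tag 14 0) (pair l (pair t y)) \<in> S \<longrightarrow> pair a y \<in> S)"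
      using t15[of n a t l] mem[of a n] Sm[of "tag 15 (pair a t)"] Sm[of "tag 14 0"] n(1) by (simp add: atom)
  next
    fix a l x :: 'a
    obtain n where n: "tag 16 (pair a l) = n + 1" "pair a l \<le> n"
      using pred[of "pair a l" "tag 16 (pair a l)"] less_tag[of 16 "pair a l"] by auto
    have "a \<le> n" by (rule order.trans[OF le_pair(1) n(2)])
    then show "pair (tag 16 (pair a l)) x \<in> S \<longleftrightarrow> pair a (cCons x l) \<in> S"
      using t16[of n a l x] mem[of a n] Sm[of "tag 16 (pair a l)"] n(1) by simp
  next
    fix k :: nat and x c :: 'a assume "k \<notin> {10, 11, 12, 13, 15, 16}"
    then show "pair (tag k x) c \<in> S \<longleftrightarrow> pair (tag k x) c \<in> X" using atom Sm by blast
  qed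
qed

section \<open>Lists as environments, and values of terms\<close>

lemma val_rules_ok: "rules_ok val_rules"
  by (simp add: val_rules_def Let_def jLook_def jVal_def code_defs)

definition look :: "'a::arith \<Rightarrow> 'a \<Rightarrow> 'a \<Rightarrow> bool" where
  "look l n v \<longleftrightarrow> der val_rules (\<lambda>_. 0) (\<lambda>_. {}) (jLook l n v)"
definition valr :: "'a::arith \<Rightarrow> 'a \<Rightarrow> 'a \<Rightarrow> bool" where
  "valr l t v \<longleftrightarrow> der val_rules (\<lambda>_. 0) (\<lambda>_. {}) (jVal l t v)"

definition "valD = der val_rules (\<lambda>_. 0) (\<lambda>_. {})"

lemma valD_iff: "valD z \<longleftrightarrow> (\<exists>r\<in>set val_rules. fires r (\<lambda>_. 0) (\<lambda>_. {}) {y. valD y} (z::'a::arith))"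
  unfolding valD_def by (rule der_iff[OF val_rules_ok])

lemmas val_expand = val_rules_def Let_def jLook_def jVal_def code_defs

lemma look_iff: "look l n (v::'a::arith) \<longleftrightarrow>
    (\<exists>x l'. l = cCons x l' \<and> ((n = 0 \<and> v = x) \<or> (\<exists>m. n = m + 1 \<and> look l' m v)))"
  unfolding look_def valD_def[symmetric] valD_iff[of "jLook l n v"]
  by (auto simp: val_expand)

lemma look_simps [simp]:
  "look (cCons x l) 0 v \<longleftrightarrow> v = (x::'a::arith)" "look (cCons x l) (n + 1) v \<longleftrightarrow> look l n (v::'a)"
  "\<not> look cNil n (v::'a)"
proof -
  show "look (cCons x l) 0 v \<longleftrightarrow> v = x" by (subst look_iff) (use suc_neq[symmetric] in auto)
  show "look (cCons x l) (n + 1) v \<longleftrightarrow> look l n v" by (subst look_iff) (use suc_neq in auto)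
  show "\<not> look cNil n v" by (subst look_iff) auto
qed

lemma valr_simps [simp]:
  fixes l :: "'a::arith"
  shows "valr l (cVar n) v \<longleftrightarrow> look l n v" "valr l cZero v \<longleftrightarrow> v = 0" "valr l cOne v \<longleftrightarrow> v = 1"
    "valr l (cPlus x y) v \<longleftrightarrow> (\<exists>a b. valr l x a \<and> valr l y b \<and> v = a + b)"
    "valr l (cTimes x y) v \<longleftrightarrow> (\<exists>a b. valr l x a \<and> valr l y b \<and> v = a * b)"
  unfolding valr_def look_def valD_def[symmetric]
    valD_iff[of "jVal l (cVar n) v"] valD_iff[of "jVal l cZero v"] valD_iff[of "jVal l cOne v"]
    valD_iff[of "jVal l (cPlus x y) v"] valD_iff[of "jVal l (cTimes x y) v"]
  by (auto simp: val_expand)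

lemma d_look: "dt s \<Longrightarrow> dt t \<Longrightarrow> dt u \<Longrightarrow> d (\<lambda>e. look (s e) (t e) (u e :: 'a::arith))"
  unfolding look_def jLook_def by (intro d_der val_rules_ok dts) (use SS_Collect[of "\<lambda>_. False", OF d_False] in simp)
lemma d_valr: "dt s \<Longrightarrow> dt t \<Longrightarrow> dt u \<Longrightarrow> d (\<lambda>e. valr (s e) (t e) (u e :: 'a::arith))"
  unfolding valr_def jVal_def by (intro d_der val_rules_ok dts) (use SS_Collect[of "\<lambda>_. False", OF d_False] in simp)

lemma hsat_Val: 
  assumes "\<And>n. E n \<in> SS" shows "hsat (Val l t v) e E \<longleftrightarrow> valr (hval e l) (hval e t) (hval e v :: 'a::arith)"
proof -
  have "der val_rules e' E = der val_rules (\<lambda>_. 0) (\<lambda>_. {})" for e' :: "nat \<Rightarrow> 'a"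
    by (rule der_closed[of _ 0]) (simp_all add: val_rules_def Let_def infer_def)
  then show ?thesis by (simp add: Val_def valr_def hsat_Der[OF val_rules_ok] assms jVal_def)
qed

lemma look_unique: "look l n v \<Longrightarrow> look l n v' \<Longrightarrow> v = (v'::'a::arith)"
proof -
  have "\<forall>l v v'. look l n v \<longrightarrow> look l n v' \<longrightarrow> v = v'"
  proof (rule ind[of "\<lambda>n. \<forall>l v v'. look l n v \<longrightarrow> look l n v' \<longrightarrow> v = v'"])
    show "d (\<lambda>e. \<forall>l v v'. look l (e 0) v \<longrightarrow> look l (e 0) v' \<longrightarrow> v = (v'::'a))"
      by (intro d_all d_imp d_look d_eq dts)
    show "\<forall>l v v'. look l 0 v \<longrightarrow> look l 0 v' \<longrightarrow> v = (v'::'a)"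
      using look_iff[of _ 0] look_simps(1) by metis
    fix n :: 'a assume IH: "\<forall>l v v'. look l n v \<longrightarrow> look l n v' \<longrightarrow> v = v'"
    show "\<forall>l v v'. look l (n + 1) v \<longrightarrow> look l (n + 1) v' \<longrightarrow> v = v'"
    proof (intro allI impI)
      fix l v v' assume l: "look l (n + 1) v" "look l (n + 1) v'"
      then obtain x l' where "l = cCons x l'" by (subst (asm) look_iff) auto
      then show "v = v'" using l IH by simp
    qed
  qed
  then show "look l n v \<Longrightarrow> look l n v' \<Longrightarrow> v = v'" by blast
qed

definition lk :: "'a::arith \<Rightarrow> 'a \<Rightarrow> 'a" where
  "lk l n = (if \<exists>v. look l n v then (THE v. look l n v) else 0)"

lemma lk_eq: "lk l n = v \<longleftrightarrow> look l n v \<or> (\<not> (\<exists>v. look l n v) \<and> v = 0)"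
proof (cases "\<exists>v. look l n v")
  case True
  then obtain w where w: "look l n w" by blast
  have "(THE v. look l n v) = w" using w look_unique[OF _ w] by (rule the_equality)
  then have "lk l n = w" using True by (simp add: lk_def)
  moreover have "look l n v \<longleftrightarrow> v = w" using w look_unique[OF w, of v] by blast
  ultimately show ?thesis using True by auto
qed (auto simp: lk_def)

lemma d_lk: "dt s \<Longrightarrow> dt t \<Longrightarrow> dt u \<Longrightarrow> d (\<lambda>e. lk (s e) (t e) = (u e :: 'a::arith))"
proof -
  assume "dt s" "dt t" "dt u"
  have 1: "d (\<lambda>e. lk (e 0) (e 1) = (e 2::'a))"
    unfolding lk_eq by (intro d_disj d_conj d_not d_ex d_look d_eq dts)
  then show ?thesis using d_subst4[of "\<lambda>a b c _. lk a b = c", OF 1 \<open>dt s\<close> \<open>dt t\<close> \<open>dt u\<close> \<open>dt u\<close>] by simp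
qed

lemma lk_simps [simp]: "lk (cCons x l) 0 = (x::'a::arith)" "lk (cCons x l) (n + 1) = lk l (n::'a)" "lk cNil n = (0::'a)"
proof -
  have 1: "look (cCons x l) 0 = (\<lambda>v. v = x)" "look (cCons x l) (n + 1) = look l n" by (simp_all add: fun_eq_iff)
  show "lk (cCons x l) 0 = x" "lk (cCons x l) (n + 1) = lk l n" "lk cNil n = 0" by (simp_all add: lk_def 1)
qed

section \<open>Values with respect to the default environment\<close>

text \<open>
  \<open>V\<close> differs from \<open>valr\<close> in that variables beyond the end of an environment have the value 0. So every term has a
  value, and the lemmas on substitution need no conditions on the lengths of environments.
\<close>

definition dval_rules :: "rule list" where
  "dval_rules =
    (let l = Var 0; n = Var 1; u = Var 2; v = Var 3; x = Var 4; y = Var 5 in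
     [infer_if (Mem (pair l (pair n v)) 0) [] (jVal l (cVar n) v),
      [] \<leadsto> jVal l cZero 0,
      [] \<leadsto> jVal l cOne 1,
      [jVal l x u, jVal l y v] \<leadsto> jVal l (cPlus x y) (u + v),
      [jVal l x u, jVal l y v] \<leadsto> jVal l (cTimes x y) (u * v)])"

lemma dval_rules_ok: "rules_ok dval_rules"
  by (simp add: dval_rules_def Let_def jVal_def code_defs rule_ok_infer_if[of 1])

text \<open>The failure of a lookup is a negative condition, which rules cannot derive. The rule for
  variables therefore consults the graph of \<open>lk\<close> as an oracle.\<close>

definition LK :: "'a::arith set" where "LK = {z. \<exists>l n. z = pair l (pair n (lk l n))}"

lemma LK_SS: "LK \<in> SS"
proof -
  have "LK = {z::'a. \<exists>l n v. lk l n = v \<and> z = pair l (pair n v)}" by (auto simp: LK_def)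
  also have "\<dots> \<in> SS" by (intro SS_Collect d_ex d_conj d_lk d_eq dts)
  finally show ?thesis .
qed

definition V :: "'a::arith \<Rightarrow> 'a \<Rightarrow> 'a \<Rightarrow> bool" where
  "V l t v \<longleftrightarrow> der dval_rules (\<lambda>_. 0) (\<lambda>_. LK) (jVal l t v)"

definition "dvalD = der dval_rules (\<lambda>_. 0) (\<lambda>_. LK)"

lemma dvalD_iff: "dvalD z \<longleftrightarrow> (\<exists>r\<in>set dval_rules. fires r (\<lambda>_. 0) (\<lambda>_. LK) {y. dvalD y} (z::'a::arith))"
  unfolding dvalD_def by (rule der_iff[OF dval_rules_ok])

lemmas dval_expand = dval_rules_def Let_def jVal_def code_defs penv_def

lemma V_simps [simp]:
  fixes l :: "'a::arith"
  shows "V l (cVar n) v \<longleftrightarrow> v = lk l n" "V l cZero v \<longleftrightarrow> v = 0" "V l cOne v \<longleftrightarrow> v = 1"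
    "V l (cPlus x y) v \<longleftrightarrow> (\<exists>a b. V l x a \<and> V l y b \<and> v = a + b)"
    "V l (cTimes x y) v \<longleftrightarrow> (\<exists>a b. V l x a \<and> V l y b \<and> v = a * b)"
  unfolding V_def dvalD_def[symmetric]
    dvalD_iff[of "jVal l (cVar n) v"] dvalD_iff[of "jVal l cZero v"] dvalD_iff[of "jVal l cOne v"]
    dvalD_iff[of "jVal l (cPlus x y) v"] dvalD_iff[of "jVal l (cTimes x y) v"]
  by (auto simp: dval_expand LK_def)

lemma d_V: "dt s \<Longrightarrow> dt t \<Longrightarrow> dt u \<Longrightarrow> d (\<lambda>e. V (s e) (t e) (u e :: 'a::arith))"
  unfolding V_def jVal_def by (intro d_der dval_rules_ok dts LK_SS)

lemma V_cases:
  assumes "V l t (v::'a::arith)"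
  shows "(\<exists>n. t = cVar n) \<or> t = cZero \<or> t = cOne \<or> (\<exists>x y. t = cPlus x y) \<or> (\<exists>x y. t = cTimes x y)"
  using assms unfolding V_def dvalD_def[symmetric] dvalD_iff[of "jVal l t v"]
  by (auto simp: dval_expand LK_def)

lemma term_less: "x < cPlus x (y::'a::arith)" "y < cPlus x y" "x < cTimes x y" "y < cTimes x y"
  using less_tag[of 4 "pair x y"] less_tag[of 5 "pair x y"] le_pair(1)[of x y] le_pair(2)[of y x]
  unfolding code_defs by (auto intro: order.strict_trans1)

lemma V_unique: "V l t v \<Longrightarrow> V l t v' \<Longrightarrow> v = (v'::'a::arith)"
proof -
  have "\<forall>v v'. V l t v \<longrightarrow> V l t v' \<longrightarrow> v = v'"
  proof (rule strong_ind[of "\<lambda>t. \<forall>v v'. V l t v \<longrightarrow> V l t v' \<longrightarrow> v = v'"])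
    show "d (\<lambda>e. \<forall>v v'. V l (e 0) v \<longrightarrow> V l (e 0) v' \<longrightarrow> v = v')" by (intro d_all d_imp d_V d_eq dts)
    fix t assume IH: "\<And>u. u < t \<Longrightarrow> \<forall>v v'. V l u v \<longrightarrow> V l u v' \<longrightarrow> v = v'"
    show "\<forall>v v'. V l t v \<longrightarrow> V l t v' \<longrightarrow> v = v'"
    proof (intro allI impI)
      fix v v' assume v: "V l t v" "V l t v'"
      from V_cases[OF v(1)] show "v = v'"
      proof (elim disjE exE)
        fix x y assume t: "t = cPlus x y"
        obtain a b a' b' where ab: "V l x a" "V l y b" "V l x a'" "V l y b'" and vv: "v = a + b" "v' = a' + b'"
          using v unfolding t V_simps by blast
        have "a = a'" using IH[OF term_less(1)[of x y, folded t]] ab(1,3) by simp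
        moreover have "b = b'" using IH[OF term_less(2)[of y x, folded t]] ab(2,4) by simp
        ultimately show ?thesis using vv by simp
      next
        fix x y assume t: "t = cTimes x y"
        obtain a b a' b' where ab: "V l x a" "V l y b" "V l x a'" "V l y b'" and vv: "v = a * b" "v' = a' * b'"
          using v unfolding t V_simps by blast
        have "a = a'" using IH[OF term_less(3)[of x y, folded t]] ab(1,3) by simp
        moreover have "b = b'" using IH[OF term_less(4)[of y x, folded t]] ab(2,4) by simp
        ultimately show ?thesis using vv by simp
      qed (use v in simp_all)
    qed
  qed
  then show "V l t v \<Longrightarrow> V l t v' \<Longrightarrow> v = v'" by blast
qed

lemma valr_cases:
  assumes "valr l t (v::'a::arith)"
  shows "(\<exists>n. t = cVar n) \<or> t = cZero \<or> t = cOne \<or> (\<exists>x y. t = cPlus x y) \<or> (\<exists>x y. t = cTimes x y)"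
  using assms unfolding valr_def valD_def[symmetric] valD_iff[of "jVal l t v"]
  by (auto simp: val_expand)

lemma look_lk: "look l n v \<Longrightarrow> v = lk l n"
  using lk_eq[of l n v] by simp

lemma valr_V: "valr l t v \<Longrightarrow> V l t (v::'a::arith)"
proof -
  have "\<forall>v. valr l t v \<longrightarrow> V l t v"
  proof (rule strong_ind[of "\<lambda>t. \<forall>v. valr l t v \<longrightarrow> V l t v"])
    show "d (\<lambda>e. \<forall>v. valr l (e 0) v \<longrightarrow> V l (e 0) v)" by (intro d_all d_imp d_V d_valr dts)
    fix t assume IH: "\<And>u. u < t \<Longrightarrow> \<forall>v. valr l u v \<longrightarrow> V l u v"
    show "\<forall>v. valr l t v \<longrightarrow> V l t v"
    proof (intro allI impI)
      fix v assume v: "valr l t v"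
      from valr_cases[OF this] show "V l t v"
      proof (elim disjE exE)
        fix x y assume t: "t = cPlus x y"
        obtain a b where ab: "valr l x a" "valr l y b" "v = a + b"
          using v unfolding t valr_simps by blast
        have "V l x a" using IH[OF term_less(1)[of x y, folded t]] ab(1) by simp
        moreover have "V l y b" using IH[OF term_less(2)[of y x, folded t]] ab(2) by simp
        ultimately show ?thesis using ab(3) unfolding t V_simps by blast
      next
        fix x y assume t: "t = cTimes x y"
        obtain a b where ab: "valr l x a" "valr l y b" "v = a * b"
          using v unfolding t valr_simps by blast
        have "V l x a" using IH[OF term_less(3)[of x y, folded t]] ab(1) by simp
        moreover have "V l y b" using IH[OF term_less(4)[of y x, folded t]] ab(2) by simp
        ultimately show ?thesis using ab(3) unfolding t V_simps by blast
      qed (use v look_lk in \<open>simp_all\<close>)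
    qed
  qed
  then show "valr l t v \<Longrightarrow> V l t v" by blast
qed

section \<open>Coded omega-models and their satisfaction classes\<close>

text \<open>The full satisfaction class of the omega-model whose sets are the sections of
  \<open>W\<close>. A set environment \<open>s\<close> is a list of indices of sections, so that a
  set quantifier becomes a number quantifier.\<close>

definition is_sat :: "'a::arith set \<Rightarrow> 'a set \<Rightarrow> bool" where
  "is_sat W S \<longleftrightarrow>
    (\<forall>x y l s. pair (cEq x y) (pair l s) \<in> S \<longleftrightarrow> (\<exists>v. V l x v \<and> V l y v)) \<and>
    (\<forall>x y l s. pair (cLess x y) (pair l s) \<in> S \<longleftrightarrow> (\<exists>v w. V l x v \<and> V l y w \<and> v < w)) \<and>
    (\<forall>x n l s. pair (cMem x n) (pair l s) \<in> S \<longleftrightarrow> (\<exists>v. V l x v \<and> pair (lk s n) v \<in> W)) \<and>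
    (\<forall>l s. pair cFls (pair l s) \<notin> S) \<and>
    (\<forall>x y l s. pair (cImp x y) (pair l s) \<in> S \<longleftrightarrow> (pair x (pair l s) \<in> S \<longrightarrow> pair y (pair l s) \<in> S)) \<and>
    (\<forall>x l s. pair (cAllN x) (pair l s) \<in> S \<longleftrightarrow> (\<forall>a. pair x (pair (cCons a l) s) \<in> S)) \<and>
    (\<forall>x l s. pair (cAllS x) (pair l s) \<in> S \<longleftrightarrow> (\<forall>i. pair x (pair l (cCons i s)) \<in> S))"

text \<open>Operations on sets of environments that generate the arithmetically definable sets: for
  the atoms, for implication, for the number quantifier and, last, for the fixing of a parameter.
  \<open>closure_axioms\<close> is the counterpart in the object language.\<close>

definition om_closed :: "'a::arith set \<Rightarrow> bool" where
  "om_closed W \<longleftrightarrow>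
    (\<forall>t u. \<exists>k. \<forall>l. pair k l \<in> W \<longleftrightarrow> (\<exists>v. valr l t v \<and> valr l u v)) \<and>
    (\<forall>t u. \<exists>k. \<forall>l. pair k l \<in> W \<longleftrightarrow> (\<exists>v w. valr l t v \<and> valr l u w \<and> v < w)) \<and>
    (\<forall>i t. \<exists>k. \<forall>l. pair k l \<in> W \<longleftrightarrow> (\<forall>v. valr l t v \<longrightarrow> pair i v \<in> W)) \<and>
    (\<forall>i j. \<exists>k. \<forall>l. pair k l \<in> W \<longleftrightarrow> (pair i l \<in> W \<longrightarrow> pair j l \<in> W)) \<and>
    (\<forall>i. \<exists>k. \<forall>l. pair k l \<in> W \<longleftrightarrow> (\<forall>y. pair i (cCons y l) \<in> W)) \<and>
    (\<forall>i l. \<exists>k. \<forall>x. pair k x \<in> W \<longleftrightarrow> pair i (cCons x l) \<in> W)"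

definition omega_jumps :: "'a::arith itself \<Rightarrow> bool" where
  "omega_jumps _ \<longleftrightarrow> (\<forall>X\<in>SS. \<exists>Y\<in>SS. omega_jump (X::'a set) Y)"

lemma is_sat_exists:
  fixes W :: "'a::arith set"
  assumes "omega_jumps TYPE('a)" and W: "W \<in> SS"
  shows "\<exists>S\<in>SS. is_sat W S"
proof -
  define A where "A z \<longleftrightarrow> (\<exists>x y l s v. z = pair (cEq x y) (pair l s) \<and> V l x v \<and> V l y v) \<or>
    (\<exists>x y l s v w. z = pair (cLess x y) (pair l s) \<and> V l x v \<and> V l y w \<and> v < w) \<or>
    (\<exists>x n l s v i. z = pair (cMem x n) (pair l s) \<and> V l x v \<and> lk s n = i \<and> pair i v \<in> W)" for z
  have "{z. A z} \<in> SS"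
    unfolding A_def code_defs
    by (intro SS_Collect d_ex d_disj d_conj) ((intro d_V d_lk d_mem d_less d_eq dts W)+)
  then obtain Y where "Y \<in> SS" "omega_jump {z. A z} Y" using assms(1) unfolding omega_jumps_def by blast
  from sat_exists[OF this(2,1)] obtain S where S: "S \<in> SS" and
    c: "\<And>a b c. pair (cImp a b) c \<in> S \<longleftrightarrow> (pair a c \<in> S \<longrightarrow> pair b c \<in> S)"
     "\<And>a l s. pair (cAllN a) (pair l s) \<in> S \<longleftrightarrow> (\<forall>y. pair a (pair (cCons y l) s) \<in> S)"
     "\<And>a l s. pair (cAllS a) (pair l s) \<in> S \<longleftrightarrow> (\<forall>y. pair a (pair l (cCons y s)) \<in> S)" and
    at: "\<And>k x c. k \<notin> {10, 11, 12, 13, 15, 16} \<Longrightarrow> (pair (tag k x) c \<in> S \<longleftrightarrow> pair (tag k x) c \<in> {z. A z})"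
    by (elim bexE conjE) blast
  have "pair (cEq x y) c \<in> S \<longleftrightarrow> A (pair (cEq x y) c)" "pair (cLess x y) c \<in> S \<longleftrightarrow> A (pair (cLess x y) c)"
    "pair (cMem x y) c \<in> S \<longleftrightarrow> A (pair (cMem x y) c)" "pair cFls c \<in> S \<longleftrightarrow> A (pair cFls c)" for x y c
    using at unfolding code_defs by simp_all
  note at' = this[unfolded A_def]
  have "is_sat W S" unfolding is_sat_def
    by (intro conjI allI c) (unfold at', simp_all add: code_defs)
  then show ?thesis using S by blast
qed

text \<open>Names of sets take the place of formulas: \<open>cEq\<close> and \<open>cLess\<close>
  name the atomic sets, \<open>cImp\<close> and the tags 13, 15, 16 the results of operations, and
  \<open>tag 17 0\<close> names \<open>X\<close>. The class \<open>S\<close> of true memberships is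
  itself the model, each name being the index of a section.\<close>

lemma omega_model_exists:
  fixes X :: "'a::arith set"
  assumes "omega_jumps TYPE('a)" and X: "X \<in> SS"
  shows "\<exists>W\<in>SS. om_closed W \<and> (\<exists>i. \<forall>x. pair i x \<in> W \<longleftrightarrow> x \<in> X)"
proof -
  define A where "A z \<longleftrightarrow> (\<exists>x y l v. z = pair (cEq x y) l \<and> valr l x v \<and> valr l y v) \<or>
    (\<exists>x y l v w. z = pair (cLess x y) l \<and> valr l x v \<and> valr l y w \<and> v < w) \<or>
    (\<exists>l t v. z = pair (tag 14 0) (pair l (pair t v)) \<and> valr l t v) \<or>
    (\<exists>x. z = pair (tag 17 0) x \<and> x \<in> X)" for z
  have "{z. A z} \<in> SS"
    unfolding A_def code_defs
    by (intro SS_Collect d_ex d_disj d_conj) ((intro d_valr d_mem d_less d_eq dts X)+)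
  then obtain Y where "Y \<in> SS" "omega_jump {z. A z} Y" using assms(1) unfolding omega_jumps_def by blast
  from sat_exists[OF this(2,1)] obtain S where S: "S \<in> SS" and
    c: "\<And>a b c. pair (cImp a b) c \<in> S \<longleftrightarrow> (pair a c \<in> S \<longrightarrow> pair b c \<in> S)"
     "\<And>a b l. pair (tag 13 (pair a b)) l \<in> S \<longleftrightarrow> (\<forall>y. pair a (cCons y l) \<in> S)"
     "\<And>a t l. pair (tag 15 (pair a t)) l \<in> S \<longleftrightarrow> (\<forall>y. pair (tag 14 0) (pair l (pair t y)) \<in> S \<longrightarrow> pair a y \<in> S)"
     "\<And>a l x. pair (tag 16 (pair a l)) x \<in> S \<longleftrightarrow> pair a (cCons x l) \<in> S" and
    at: "\<And>k x c. k \<notin> {10, 11, 12, 13, 15, 16} \<Longrightarrow> (pair (tag k x) c \<in> S \<longleftrightarrow> pair (tag k x) c \<in> {z. A z})"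
    by (elim bexE conjE) blast
  have at': "pair (cEq x y) c \<in> S \<longleftrightarrow> A (pair (cEq x y) c)" "pair (cLess x y) c \<in> S \<longleftrightarrow> A (pair (cLess x y) c)"
    "pair (tag 14 0) c \<in> S \<longleftrightarrow> A (pair (tag 14 0) c)" "pair (tag 17 0) c \<in> S \<longleftrightarrow> A (pair (tag 17 0) c)" for x y c
    using at unfolding code_defs by simp_all
  have "pair (cEq t u) l \<in> S \<longleftrightarrow> (\<exists>v. valr l t v \<and> valr l u v)"
    "pair (cLess t u) l \<in> S \<longleftrightarrow> (\<exists>v w. valr l t v \<and> valr l u w \<and> v < w)"
    "pair (tag 14 0) (pair l (pair t v)) \<in> S \<longleftrightarrow> valr l t v"
    "pair (tag 17 0) x \<in> S \<longleftrightarrow> x \<in> X" for t u l v x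
    by (unfold at' A_def) (simp_all add: code_defs)
  note e = this
  have "om_closed W" if "W = S" for W
    unfolding om_closed_def that
  proof (intro conjI allI)
    fix t u show "\<exists>k. \<forall>l. pair k l \<in> S \<longleftrightarrow> (\<exists>v. valr l t v \<and> valr l u v)" using e(1) by blast
    show "\<exists>k. \<forall>l. pair k l \<in> S \<longleftrightarrow> (\<exists>v w. valr l t v \<and> valr l u w \<and> v < w)" using e(2) by blast
  next
    fix i t show "\<exists>k. \<forall>l. pair k l \<in> S \<longleftrightarrow> (\<forall>v. valr l t v \<longrightarrow> pair i v \<in> S)"
      by (rule exI[of _ "tag 15 (pair i t)"]) (simp add: c e)
  next
    fix i j show "\<exists>k. \<forall>l. pair k l \<in> S \<longleftrightarrow> (pair i l \<in> S \<longrightarrow> pair j l \<in> S)"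
      by (rule exI[of _ "cImp i j"]) (simp add: c)
  next
    fix i show "\<exists>k. \<forall>l. pair k l \<in> S \<longleftrightarrow> (\<forall>y. pair i (cCons y l) \<in> S)"
      by (rule exI[of _ "tag 13 (pair i 0)"]) (simp add: c)
  next
    fix i l show "\<exists>k. \<forall>x. pair k x \<in> S \<longleftrightarrow> pair i (cCons x l) \<in> S"
      by (rule exI[of _ "tag 16 (pair i l)"]) (simp add: c)
  qed
  then show ?thesis using S e(4) by blast
qed

section \<open>Truth of standard formulas in a coded omega-model\<close>

primrec fsat :: "'a set set \<Rightarrow> fm \<Rightarrow> (nat \<Rightarrow> 'a::so_structure) \<Rightarrow> (nat \<Rightarrow> 'a set) \<Rightarrow> bool" where
  "fsat F (Eq s t) e E = (hval e s = hval e t)"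
| "fsat F (Less s t) e E = (hval e s < hval e t)"
| "fsat F (Mem s n) e E = (hval e s \<in> E n)"
| "fsat F Fls e E = False"
| "fsat F (Imp p q) e E = (fsat F p e E \<longrightarrow> fsat F q e E)"
| "fsat F (AllN p) e E = (\<forall>x. fsat F p (case_nat x e) E)"
| "fsat F (AllS p) e E = (\<forall>X\<in>F. fsat F p e (case_nat X E))"

lemma fsat_connectives [simp]:
  "fsat F (Neg p) e E = (\<not> fsat F p e E)"
  "fsat F (Conj p q) e E = (fsat F p e E \<and> fsat F q e E)"
  "fsat F (Disj p q) e E = (fsat F p e E \<or> fsat F q e E)"
  "fsat F (Iff p q) e E = (fsat F p e E = fsat F q e E)"
  "fsat F (ExN p) e E = (\<exists>x. fsat F p (case_nat x e) E)"
  "fsat F (ExS p) e E = (\<exists>X\<in>F. fsat F p e (case_nat X E))"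
  by (auto simp: Neg_def Conj_def Disj_def Iff_def ExN_def ExS_def)

lemma fsat_conjs [simp]: "fsat F (conjs qs) e E = (\<forall>p\<in>set qs. fsat F p e E)"
  by (induct qs) auto

lemma fsat_arithmetical: "arithmetical p \<Longrightarrow> fsat F p e E = hsat p e E"
  by (induct p arbitrary: e E) auto

lemma fsat_SS: "fsat SS p e E = hsat p e E"
  by (induct p arbitrary: e E) auto

primrec mc_tm :: "tm \<Rightarrow> 'a::{zero,one,plus,times}" where
  "mc_tm (Var n) = cVar (cst n)"
| "mc_tm Zero = cZero"
| "mc_tm One = cOne"
| "mc_tm (Plus s t) = cPlus (mc_tm s) (mc_tm t)"
| "mc_tm (Times s t) = cTimes (mc_tm s) (mc_tm t)"

primrec mc :: "fm \<Rightarrow> 'a::{zero,one,plus,times}" where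
  "mc (Eq s t) = cEq (mc_tm s) (mc_tm t)"
| "mc (Less s t) = cLess (mc_tm s) (mc_tm t)"
| "mc (Mem s n) = cMem (mc_tm s) (cst n)"
| "mc Fls = cFls"
| "mc (Imp p q) = cImp (mc p) (mc q)"
| "mc (AllN p) = cAllN (mc p)"
| "mc (AllS p) = cAllS (mc p)"

lemma cst_nat [simp]: "cst n = (n::nat)" by (simp add: cst_of_nat)

lemma cst_codes:
  "cst (cVar x) = (cVar (cst x) :: 'a::arith)" "cst (cZero) = (cZero :: 'a)" "cst (cOne) = (cOne :: 'a)"
  "cst (cPlus x y) = (cPlus (cst x) (cst y) :: 'a)" "cst (cTimes x y) = (cTimes (cst x) (cst y) :: 'a)"
  "cst (cEq x y) = (cEq (cst x) (cst y) :: 'a)" "cst (cLess x y) = (cLess (cst x) (cst y) :: 'a)"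
  "cst (cMem x y) = (cMem (cst x) (cst y) :: 'a)" "cst cFls = (cFls :: 'a)"
  "cst (cImp x y) = (cImp (cst x) (cst y) :: 'a)" "cst (cAllN x) = (cAllN (cst x) :: 'a)"
      "cst (cAllS x) = (cAllS (cst x) :: 'a)"
  unfolding code_defs by (simp_all add: cst_hom)

lemma cst_code_tm: "cst (code_tm t) = (mc_tm t :: 'a::arith)"
  by (induct t) (simp_all add: cst_codes)
lemma cst_code: "cst (code p) = (mc p :: 'a::arith)"
  by (induct p) (simp_all add: cst_codes cst_code_tm)

definition lke :: "'a::arith \<Rightarrow> nat \<Rightarrow> 'a" where "lke l n = lk l (cst n)"
lemma lke_Cons [simp]: "lke (cCons x l) = case_nat x (lke l)"
  by (auto simp: lke_def fun_eq_iff split: nat.splits)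

definition sec :: "'a::arith set \<Rightarrow> 'a \<Rightarrow> 'a set" where "sec W i = {x. pair i x \<in> W}"

lemma sec_SS: "W \<in> SS \<Longrightarrow> sec W i \<in> SS" unfolding sec_def by (intro SS_Collect d_mem dts)

lemma V_mc: "V l (mc_tm t) v \<longleftrightarrow> v = hval (lke l) t"
  by (induct t arbitrary: v) (auto simp: lke_def)

text \<open>An external induction, hence for standard formulas; on the other codes of the model,
  \<open>S\<close> itself serves as the notion of truth.\<close>

theorem truth_omega:
  assumes "is_sat W S"
  shows "pair (mc p) (pair l s) \<in> S \<longleftrightarrow> fsat (range (sec W)) p (lke l) (\<lambda>n. sec W (lke s n))"
proof (induct p arbitrary: l s)
  case (AllS p)
  have "(\<lambda>n. sec W (case_nat i (lke s) n)) = case_nat (sec W i) (\<lambda>n. sec W (lke s n))" for i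
    by (auto simp: fun_eq_iff split: nat.splits)
  then show ?case using AllS assms by (simp add: is_sat_def)
next
  case (Mem t n)
  then show ?case using assms by (simp add: is_sat_def V_mc sec_def lke_def[of s])
qed (use assms in \<open>simp_all add: is_sat_def V_mc\<close>)

section \<open>Soundness of provability with respect to coded omega-models\<close>

lemma hval_codes [simp]:
  "hval e (cVar t) = cVar (hval e t)" "hval e cZero = cZero" "hval e cOne = cOne"
  "hval e (cPlus t u) = cPlus (hval e t) (hval e u)" "hval e (cTimes t u) = cTimes (hval e t) (hval e u)"
  "hval e (cEq t u) = cEq (hval e t) (hval e u)" "hval e (cLess t u) = cLess (hval e t) (hval e u)"
  "hval e (cMem t u) = cMem (hval e t) (hval e u)" "hval e cFls = cFls"
  "hval e (cImp t u) = cImp (hval e t) (hval e u)" "hval e (cAllN t) = cAllN (hval e t)" "hval e (cAllS t) = cAllS (hval e t)"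
  by (simp_all add: code_defs)

lemma fires_syntax: "j \<noteq> 1 \<Longrightarrow> j \<noteq> 2 \<Longrightarrow> (\<exists>r\<in>set syntax_rules. fires r e E J (tag j (x::'a::arith))) \<longleftrightarrow> False"
  by (auto simp: syntax_rules_def Let_def judgement_defs)
lemma fires_lift_subst: "j \<noteq> 3 \<Longrightarrow> j \<noteq> 4 \<Longrightarrow> j \<noteq> 5 \<Longrightarrow> j \<noteq> 6 \<Longrightarrow>
    (\<exists>r\<in>set lift_subst_rules. fires r e E J (tag j (x::'a::arith))) \<longleftrightarrow> False"
  by (auto simp: lift_subst_rules_def Let_def judgement_defs)
lemma fires_set_lift_subst: "j \<noteq> 7 \<Longrightarrow> j \<noteq> 8 \<Longrightarrow>
    (\<exists>r\<in>set set_lift_subst_rules. fires r e E J (tag j (x::'a::arith))) \<longleftrightarrow> False"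
  by (auto simp: set_lift_subst_rules_def Let_def judgement_defs)
lemma fires_proof: "j \<noteq> 9 \<Longrightarrow> (\<exists>r\<in>set (proof_rules T). fires r e E J (tag j (x::'a::arith))) \<longleftrightarrow> False"
  by (auto simp: proof_rules_def Let_def judgement_defs)

definition all_rules :: "fm \<Rightarrow> rule list" where
  "all_rules T = syntax_rules @ lift_subst_rules @ set_lift_subst_rules @ proof_rules T"

lemma syntax_rules_ok: "rules_ok syntax_rules"
  by (simp add: syntax_rules_def Let_def judgement_defs code_defs)
lemma all_rules_ok: "noslot (matrix T) \<Longrightarrow> arithmetical (matrix T) \<Longrightarrow> rules_ok (all_rules T)"
  by (simp add: all_rules_def syntax_rules_def lift_subst_rules_def set_lift_subst_rules_def proof_rules_def
      Let_def judgement_defs code_defs)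
     (simp add: rule_ok_def infer_if_def)

text \<open>\<open>l'\<close> is \<open>l\<close> with \<open>a\<close> inserted at position
  \<open>k\<close>, as far as lookups tell. The detour through \<open>v\<close> yields the form
  \<open>lk l n = v\<close>, for which definability is known (\<open>d_lk\<close>).\<close>

definition Ins :: "'a::arith \<Rightarrow> 'a \<Rightarrow> 'a \<Rightarrow> 'a \<Rightarrow> bool" where
  "Ins k a l l' \<longleftrightarrow> lk l' k = a \<and> (\<forall>n v. (n < k \<longrightarrow> (lk l n = v \<longleftrightarrow> lk l' n = v)) \<and> (\<not> n < k \<longrightarrow> (lk l n = v \<longleftrightarrow> lk l' (n + 1) = v)))"

lemma d_Ins: "dt s \<Longrightarrow> dt t \<Longrightarrow> dt u \<Longrightarrow> dt v \<Longrightarrow> d (\<lambda>e. Ins (s e) (t e) (u e) (v e :: 'a::arith))"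
proof (rule d_subst4)
  show "d (\<lambda>e. Ins (e 0) (e 1) (e 2) (e 3 :: 'a))"
    unfolding Ins_def by (intro d_all d_conj d_imp d_not d_less d_iff d_lk dts)
qed

lemma Ins_lk: assumes "Ins k a l l'" shows "lk l' k = a" "n < k \<Longrightarrow> lk l' n = lk l n" "\<not> n < k \<Longrightarrow> lk l' (n + 1) = lk l n"
  using assms unfolding Ins_def by blast+

lemma Ins_0: "Ins 0 a l (cCons a l)" by (simp add: Ins_def)

lemma Ins_Suc: assumes "Ins k a l l'" shows "Ins (k + 1) a (cCons y l) (cCons y (l'::'a::arith))"
  unfolding Ins_def
proof (intro conjI allI impI)
  show "lk (cCons y l') (k + 1) = a" using assms by (simp add: Ins_lk)
  fix n v
  show "lk (cCons y l) n = v \<longleftrightarrow> lk (cCons y l') n = v" if "n < k + 1"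
    by (rule suc_cases[of n]) (use that Ins_lk(2)[OF assms] in auto)
  show "lk (cCons y l) n = v \<longleftrightarrow> lk (cCons y l') (n + 1) = v" if "\<not> n < k + 1"
    by (rule suc_cases[of n]) (use that Ins_lk(3)[OF assms] less_plus1[of 0 k] in auto)
qed

lemma Ins_Suc': "Ins k (lk s m) s s' \<Longrightarrow> Ins (k + 1) (lk (cCons y s) (m + 1)) (cCons y s) (cCons y (s'::'a::arith))"
  using Ins_Suc by simp

text \<open>All judgements are derived by one rule system and differ in their tags. A predicate that
  is vacuous on the other tags gives each judgement an induction of its own.\<close>

lemma judge_induct:
  fixes Q :: "'a::arith \<Rightarrow> bool"
  assumes ok: "rules_ok R" and dQ: "d (\<lambda>\<epsilon>. Q (\<epsilon> 0))"
    and step: "\<And>x. (\<exists>r\<in>set R. fires r e E {y. der R e E y \<and> (\<forall>x'. y = tag j x' \<longrightarrow> Q x')} (tag j x)) \<Longrightarrow> Q x"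
    and der: "der R e E (tag j x)"
  shows "Q x"
proof -
  have "\<forall>x'. tag j x = tag j x' \<longrightarrow> Q x'"
  proof (rule der_induct[OF _ _ der, of "\<lambda>z. \<forall>x'. z = tag j x' \<longrightarrow> Q x'"])
    show "d (\<lambda>\<epsilon>. \<forall>x'. \<epsilon> 0 = tag j x' \<longrightarrow> Q x')"
      by (intro d_all d_imp d_eq dts) (rule d_subst1[of Q, OF dQ], rule dts)
    fix z assume i: "inst R e E {y. der R e E y \<and> (\<forall>x'. y = tag j x' \<longrightarrow> Q x')} z"
    show "\<forall>x'. z = tag j x' \<longrightarrow> Q x'"
      using step i unfolding inst_fires[OF ok] by blast
  qed
  then show ?thesis by simp
qed

context
  fixes R :: "rule list" and e :: "nat \<Rightarrow> 'a::arith" and E :: "nat \<Rightarrow> 'a set" and T :: fm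
  assumes RT: "R = all_rules T" and ok: "rules_ok R" and ESS: "\<And>n. E n \<in> SS"
begin

lemma group:
  "(\<exists>r\<in>set R. fires r e E J (tag 1 x)) \<longleftrightarrow> (\<exists>r\<in>set syntax_rules. fires r e E J (tag 1 (x::'a)))"
  "j \<in> {3, 4, 5, 6} \<Longrightarrow> (\<exists>r\<in>set R. fires r e E J (tag j x)) \<longleftrightarrow> (\<exists>r\<in>set lift_subst_rules. fires r e E J (tag j (x::'a)))"
  "j \<in> {7, 8} \<Longrightarrow> (\<exists>r\<in>set R. fires r e E J (tag j x)) \<longleftrightarrow> (\<exists>r\<in>set set_lift_subst_rules. fires r e E J (tag j (x::'a)))"
  "(\<exists>r\<in>set R. fires r e E J (tag 9 x)) \<longleftrightarrow> (\<exists>r\<in>set (proof_rules T). fires r e E J (tag 9 (x::'a)))"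
  unfolding RT all_rules_def set_append bex_Un
  using fires_syntax[of j e E J x] fires_lift_subst[of j e E J x] fires_set_lift_subst[of j e E J x] fires_proof[of j T e E J x]
    fires_syntax[of 9 e E J x] fires_lift_subst[of 1 e E J x] fires_lift_subst[of 9 e E J x]
    fires_set_lift_subst[of 1 e E J x] fires_set_lift_subst[of 9 e E J x] fires_proof[of 1 T e E J x]
  by auto

lemma tm_total:
  assumes "der R e E (jTm m t)" shows "\<exists>v. V l t v"
proof -
  have "\<forall>m t. pair m t = pair m' t' \<longrightarrow> (\<exists>v. V l t v)" if "der R e E (tag 1 (pair m' t'))" for m' t'
  proof (rule judge_induct[OF ok _ _ that, of "\<lambda>x. \<forall>m t. pair m t = x \<longrightarrow> (\<exists>v. V l t v)"])
    show "d (\<lambda>\<epsilon>. \<forall>m t. pair m t = \<epsilon> 0 \<longrightarrow> (\<exists>v. V l t v))" by (intro d_all d_ex d_imp d_eq d_V dts)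
    fix x assume "\<exists>r\<in>set R. fires r e E {y. der R e E y \<and> (\<forall>x'. y = tag 1 x' \<longrightarrow> (\<forall>m t. pair m t = x' \<longrightarrow> (\<exists>v. V l t v)))}
        (tag 1 x)"
    then show "\<forall>m t. pair m t = x \<longrightarrow> (\<exists>v. V l t v)"
      unfolding group by (auto simp: syntax_rules_def Let_def judgement_defs) blast+
  qed
  then show ?thesis using assms by (auto simp: jTm_def)
qed

lemma liftT_sound:
  assumes "der R e E (jLiftT k t t')" "Ins k a l l'" shows "V l t v \<longleftrightarrow> V l' t' v"
proof -
  let ?Q = "\<lambda>x. \<forall>k t t'. pair k (pair t t') = x \<longrightarrow> (\<forall>a l l'. Ins k a l l' \<longrightarrow> (\<forall>v. V l t v = V l' t' v))"
  have "?Q x" if "der R e E (tag 3 x)" for x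
  proof (rule judge_induct[OF ok _ _ that, of ?Q])
    show "d (\<lambda>\<epsilon>. ?Q (\<epsilon> 0))" by (intro d_all d_imp d_eq d_V d_Ins d_iff dts)
    fix x assume "\<exists>r\<in>set R. fires r e E {y. der R e E y \<and> (\<forall>x'. y = tag 3 x' \<longrightarrow> ?Q x')} (tag 3 x)"
    then show "?Q x"
      by (subst (asm) group) (auto simp: lift_subst_rules_def Let_def judgement_defs penv_def Ins_lk)
  qed
  then show ?thesis using assms by (auto simp: jLiftT_def)
qed

lemma substT_sound:
  assumes "der R e E (jSubstT k u t t')" "V l u a" "Ins k a l l'" shows "V l' t v \<longleftrightarrow> V l t' v"
proof -
  let ?Q = "\<lambda>x. \<forall>k u t t'. pair k (pair u (pair t t')) = x \<longrightarrow>
    (\<forall>a l l'. V l u a \<longrightarrow> Ins k a l l' \<longrightarrow> (\<forall>v. V l' t v = V l t' v))"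
  have "?Q x" if "der R e E (tag 4 x)" for x
  proof (rule judge_induct[OF ok _ _ that, of ?Q])
    show "d (\<lambda>\<epsilon>. ?Q (\<epsilon> 0))" by (intro d_all d_imp d_eq d_V d_Ins d_iff dts)
    fix x assume "\<exists>r\<in>set R. fires r e E {y. der R e E y \<and> (\<forall>x'. y = tag 4 x' \<longrightarrow> ?Q x')} (tag 4 x)"
    then show "?Q x"
      by (subst (asm) group) (auto simp: lift_subst_rules_def Let_def judgement_defs penv_def Ins_lk less_plus1,
          (metis V_unique Ins_lk(1))+)
  qed
  then show ?thesis using assms by (auto simp: jSubstT_def)
qed

context
  fixes W S :: "'a set" assumes sat: "is_sat W S" and S: "S \<in> SS"
begin

lemma satS:
  "pair (cEq x y) (pair l s) \<in> S \<longleftrightarrow> (\<exists>v. V l x v \<and> V l y v)"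
  "pair (cLess x y) (pair l s) \<in> S \<longleftrightarrow> (\<exists>v w. V l x v \<and> V l y w \<and> v < w)"
  "pair (cMem x n) (pair l s) \<in> S \<longleftrightarrow> (\<exists>v. V l x v \<and> pair (lk s n) v \<in> W)"
  "pair cFls (pair l s) \<notin> S"
  "pair (cImp x y) (pair l s) \<in> S \<longleftrightarrow> (pair x (pair l s) \<in> S \<longrightarrow> pair y (pair l s) \<in> S)"
  "pair (cAllN x) (pair l s) \<in> S \<longleftrightarrow> (\<forall>a. pair x (pair (cCons a l) s) \<in> S)"
  "pair (cAllS x) (pair l s) \<in> S \<longleftrightarrow> (\<forall>i. pair x (pair l (cCons i s)) \<in> S)"
  using sat unfolding is_sat_def by (simp_all only: not_False_eq_True)

lemma dS: "dt s \<Longrightarrow> d (\<lambda>e. s e \<in> S)" using S by (rule d_mem[rotated])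

lemma lift_sound:
  assumes "der R e E (jLift k t t')" "Ins k a l l'" shows "pair t (pair l s) \<in> S \<longleftrightarrow> pair t' (pair l' s) \<in> S"
proof -
  let ?Q = "\<lambda>x. \<forall>k t t'. pair k (pair t t') = x \<longrightarrow> (\<forall>a l l'. Ins k a l l' \<longrightarrow> (\<forall>s. pair t (pair l s) \<in> S \<longleftrightarrow>
      pair t' (pair l' s) \<in> S))"
  have "?Q x" if "der R e E (tag 5 x)" for x
  proof (rule judge_induct[OF ok _ _ that, of ?Q])
    show "d (\<lambda>\<epsilon>. ?Q (\<epsilon> 0))" by (intro d_all d_imp d_eq dS d_Ins d_iff dts)
    fix x assume "\<exists>r\<in>set R. fires r e E {y. der R e E y \<and> (\<forall>x'. y = tag 5 x' \<longrightarrow> ?Q x')} (tag 5 x)"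
    moreover note liftT_sound[unfolded jLiftT_def]
    ultimately show "?Q x"
      by (subst (asm) group) (auto simp: lift_subst_rules_def Let_def judgement_defs satS, (metis Ins_Suc)+)
  qed
  then show ?thesis using assms by (auto simp: jLift_def)
qed

lemma subst_sound:
  assumes "der R e E (jSubst k u t t')" "V l u a" "Ins k a l l'" shows "pair t (pair l' s) \<in> S \<longleftrightarrow> pair t' (pair l s) \<in> S"
proof -
  let ?Q = "\<lambda>x. \<forall>k u t t'. pair k (pair u (pair t t')) = x \<longrightarrow> (\<forall>a l l'. V l u a \<longrightarrow> Ins k a l l' \<longrightarrow> (\<forall>s. pair t (pair l' s) \<in> S \<longleftrightarrow>
      pair t' (pair l s) \<in> S))"
  have "?Q x" if "der R e E (tag 6 x)" for x
  proof (rule judge_induct[OF ok _ _ that, of ?Q])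
    show "d (\<lambda>\<epsilon>. ?Q (\<epsilon> 0))" by (intro d_all d_imp d_eq dS d_V d_Ins d_iff dts)
    fix x assume "\<exists>r\<in>set R. fires r e E {y. der R e E y \<and> (\<forall>x'. y = tag 6 x' \<longrightarrow> ?Q x')} (tag 6 x)"
    moreover note substT_sound[unfolded jSubstT_def]
    moreover have "V (cCons y l) u' a" if "der R e E (tag 3 (pair 0 (pair u u')))" "V l u a" for u u' l a y
      using liftT_sound[unfolded jLiftT_def, OF that(1) Ins_0] that(2) by simp
    ultimately show "?Q x"
      by (subst (asm) group) (auto simp: lift_subst_rules_def Let_def judgement_defs satS, (metis Ins_Suc)+)
  qed
  then show ?thesis using assms by (auto simp: jSubst_def)
qed

lemma liftS_sound:
  assumes "der R e E (jLiftS k t t')" "Ins k a s s'" shows "pair t (pair l s) \<in> S \<longleftrightarrow> pair t' (pair l s') \<in> S"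
proof -
  let ?Q = "\<lambda>x. \<forall>k t t'. pair k (pair t t') = x \<longrightarrow> (\<forall>a s s'. Ins k a s s' \<longrightarrow> (\<forall>l. pair t (pair l s) \<in> S \<longleftrightarrow>
      pair t' (pair l s') \<in> S))"
  have "?Q x" if "der R e E (tag 7 x)" for x
  proof (rule judge_induct[OF ok _ _ that, of ?Q])
    show "d (\<lambda>\<epsilon>. ?Q (\<epsilon> 0))" by (intro d_all d_imp d_eq dS d_Ins d_iff dts)
    fix x assume "\<exists>r\<in>set R. fires r e E {y. der R e E y \<and> (\<forall>x'. y = tag 7 x' \<longrightarrow> ?Q x')} (tag 7 x)"
    then show "?Q x"
      by (subst (asm) group) (auto simp: set_lift_subst_rules_def Let_def judgement_defs penv_def satS Ins_lk, (metis Ins_Suc)+)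
  qed
  then show ?thesis using assms by (auto simp: jLiftS_def)
qed

lemma substS_sound:
  assumes "der R e E (jSubstS k m t t')" "Ins k (lk s m) s s'" shows "pair t (pair l s') \<in> S \<longleftrightarrow> pair t' (pair l s) \<in> S"
proof -
  let ?Q = "\<lambda>x. \<forall>k m t t'. pair k (pair m (pair t t')) = x \<longrightarrow> (\<forall>a s s'. lk s m = a \<longrightarrow> Ins k a s s' \<longrightarrow> (\<forall>l. pair t (pair l s') \<in> S \<longleftrightarrow>
      pair t' (pair l s) \<in> S))"
  have "?Q x" if "der R e E (tag 8 x)" for x
  proof (rule judge_induct[OF ok _ _ that, of ?Q])
    show "d (\<lambda>\<epsilon>. ?Q (\<epsilon> 0))" by (intro d_all d_imp d_eq dS d_lk d_Ins d_iff dts)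
    fix x assume "\<exists>r\<in>set R. fires r e E {y. der R e E y \<and> (\<forall>x'. y = tag 8 x' \<longrightarrow> ?Q x')} (tag 8 x)"
    then show "?Q x"
      by (subst (asm) group) (auto simp: set_lift_subst_rules_def Let_def judgement_defs penv_def satS Ins_lk less_plus1,
          (metis Ins_Suc')+)
  qed
  then show ?thesis using assms by (auto simp: jSubstS_def)
qed

text \<open>Soundness is proved inside the model, for derivations of any length there. The induction
  statement, truth in all environments, is definable because the satisfaction class \<open>S\<close>
  is a set of the model.\<close>

theorem provable_sound:
  assumes ax: "\<And>x0 x1 x2 x3 x4 x5 x6 x7 l s. hsat (matrix T) (penv (nth [x0, x1, x2, x3, x4, x5, x6, x7]) e) E \<Longrightarrow>
      der R e E (jFm 1 0 0 x1) \<Longrightarrow> pair x1 (pair l s) \<in> S"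
    and "der R e E (jPr x)"
  shows "pair x (pair l s) \<in> S"
proof -
  let ?Q = "\<lambda>x. \<forall>l s. pair x (pair l s) \<in> S"
  note js = judgement_defs
  have "?Q x" if "der R e E (tag 9 x)" for x
  proof (rule judge_induct[OF ok _ _ that, of ?Q])
    show "d (\<lambda>\<epsilon>. ?Q (\<epsilon> 0))" by (intro d_all dS dts)
    fix x assume h: "\<exists>r\<in>set R. fires r e E {y. der R e E y \<and> (\<forall>x'. y = tag 9 x' \<longrightarrow> ?Q x')} (tag 9 x)"
    have sub: "pair t (pair (cCons a l) s) \<in> S \<longleftrightarrow> pair t' (pair l s) \<in> S" if "der R e E (tag 6 (pair 0 (pair u (pair t t'))))"
        "V l u a" for u t t' a l s
      using subst_sound[unfolded js, OF that Ins_0] .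
    have lif: "pair t (pair l s) \<in> S \<longleftrightarrow> pair t' (pair (cCons a l) s) \<in> S" if "der R e E (tag 5 (pair 0 (pair t t')))"
        for t t' a l s
      using lift_sound[unfolded js, OF that Ins_0] .
    have lifS: "pair t (pair l s) \<in> S \<longleftrightarrow> pair t' (pair l (cCons a s)) \<in> S" if "der R e E (tag 7 (pair 0 (pair t t')))"
        for t t' a l s
      using liftS_sound[unfolded js, OF that Ins_0] .
    have subS: "pair t (pair l (cCons (lk s m) s)) \<in> S \<longleftrightarrow> pair t' (pair l s) \<in> S"
        if "der R e E (tag 8 (pair 0 (pair m (pair t t'))))" for t t' m l s
      using substS_sound[unfolded js, OF that Ins_0] .
    have tot: "\<exists>v. V l t v" if "der R e E (tag (Suc 0) (pair m t))" for m t l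
      using tm_total[unfolded js] that by simp
    from h show "?Q x"
      unfolding group
      apply (simp only: proof_rules_def Let_def list.set ball_simps bex_simps fires_infer fires_infer_if)
      apply (simp add: js)
      apply (elim disjE exE conjE)
      subgoal using ax[unfolded js] by auto
      subgoal by (simp add: satS)
      subgoal by (simp add: satS)
      subgoal by (simp add: satS)
      subgoal using tot sub by (auto simp: satS) blast
      subgoal by (simp add: satS)
      subgoal using lif by (simp add: satS)
      subgoal using subS by (simp add: satS) blast
      subgoal by (simp add: satS)
      subgoal using lifS by (simp add: satS)
      subgoal using tot by (simp add: satS)
      subgoal using sub by (simp add: satS) metis
      subgoal by (simp add: satS)
      subgoal by (simp add: satS)
      subgoal by (simp add: satS)
      done
  qed
  then show ?thesis using assms(2) by (simp add: jPr_def)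
qed

end

end

section \<open>The reflection principle in a model\<close>

definition tarskiM :: "'a::arith set \<Rightarrow> 'a set \<Rightarrow> 'a set \<Rightarrow> bool" where
  "tarskiM X D S \<longleftrightarrow>
    (\<forall>x y. cEq x y \<in> D \<longrightarrow> (\<forall>l. pair (cEq x y) l \<in> S \<longleftrightarrow> (\<exists>v. valr l x v \<and> valr l y v))) \<and>
    (\<forall>x y. cLess x y \<in> D \<longrightarrow> (\<forall>l. pair (cLess x y) l \<in> S \<longleftrightarrow> (\<exists>v w. v < w \<and> valr l x v \<and> valr l y w))) \<and>
    (\<forall>x n. cMem x n \<in> D \<longrightarrow> (\<forall>l. pair (cMem x n) l \<in> S \<longleftrightarrow> (\<exists>v. v \<in> X \<and> valr l x v))) \<and>
    (cFls \<in> D \<longrightarrow> (\<forall>l. pair cFls l \<notin> S)) \<and>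
    (\<forall>x y. cImp x y \<in> D \<longrightarrow> (x \<in> D \<and> y \<in> D) \<and> (\<forall>l. pair (cImp x y) l \<in> S \<longleftrightarrow> (pair x l \<in> S \<longrightarrow> pair y l \<in> S))) \<and>
    (\<forall>x. cAllN x \<in> D \<longrightarrow> x \<in> D \<and> (\<forall>l. pair (cAllN x) l \<in> S \<longleftrightarrow> (\<forall>a. pair x (cCons a l) \<in> S)))"

lemma hsat_Tarski:
  assumes "\<And>n. E n \<in> SS"
  shows "hsat Tarski e E \<longleftrightarrow> tarskiM (E 2) (E 1) (E 0 :: 'a::arith set)"
  by (simp add: Tarski_def tarskiM_def hsat_Val assms all_conj_distrib numeral_2_eq_2 conj_assoc)

lemma arithmetical_Val [simp]: "arithmetical (Val l t v)"
  by (simp add: Val_def val_rules_ok)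
lemma arithmetical_Tarski: "arithmetical Tarski"
  by (simp add: Tarski_def)

definition trM :: "'a::arith set set \<Rightarrow> 'a \<Rightarrow> bool" where
  "trM F x \<longleftrightarrow> (\<forall>\<theta>. x = cAllS \<theta> \<longrightarrow> (\<forall>X\<in>F. \<forall>D\<in>F. \<forall>S\<in>F. \<theta> \<in> D \<longrightarrow> tarskiM X D S \<longrightarrow> pair \<theta> cNil \<in> S))"

lemma fsat_Tr:
  assumes "F \<subseteq> SS" "\<And>n. E n \<in> SS"
  shows "fsat F (Tr x) e E \<longleftrightarrow> trM F (hval e x :: 'a::arith)"
proof -
  have "fsat F Tarski e' (case_nat S (case_nat D (case_nat X E))) \<longleftrightarrow> tarskiM X D S"
    if "X \<in> F" "D \<in> F" "S \<in> F" for e' X D S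
  proof -
    have "\<And>n. case_nat S (case_nat D (case_nat X E)) n \<in> SS" using assms that by (auto split: nat.splits)
    then show ?thesis by (simp add: fsat_arithmetical[OF arithmetical_Tarski] hsat_Tarski)
  qed
  then show ?thesis unfolding Tr_def trM_def by (simp add: imp_conjL cong: ball_cong)
qed

definition pi11M :: "'a::arith \<Rightarrow> bool" where
  "pi11M z \<longleftrightarrow> (\<exists>\<theta>. z = cAllS \<theta> \<and> der syntax_rules (\<lambda>_. 0) (\<lambda>_. {}) (jFm 0 0 1 \<theta>))"

lemma syntax_rules_closed: "\<forall>r\<in>set syntax_rules. closed 8 0 (side r)"
  by (simp add: syntax_rules_def Let_def infer_def infer_if_def)

lemma hsat_Pi11_code:
  assumes "\<And>n. E n \<in> SS"
  shows "hsat (Pi11_code x) e E \<longleftrightarrow> pi11M (hval e x :: 'a::arith)"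
proof -
  have "der syntax_rules e' E = der syntax_rules (\<lambda>_. 0) (\<lambda>_. {})" for e' :: "nat \<Rightarrow> 'a"
    by (rule der_closed[OF syntax_rules_closed]) simp
  then show ?thesis by (simp add: Pi11_code_def pi11M_def hsat_Der[OF syntax_rules_ok] assms jFm_def)
qed

lemma arithmetical_Pi11_code: "arithmetical (Pi11_code x)"
  by (simp add: Pi11_code_def syntax_rules_ok)

lemma Prov_all_rules: "Prov T x = Der (all_rules T) (jPr x)"
  by (simp add: Prov_def all_rules_def)

lemma fsat_RFN:
  assumes T: "noslot (matrix T)" "arithmetical (matrix T)" and F: "F \<subseteq> SS" and E: "\<And>n. E n \<in> SS"
  shows "fsat F (RFN T) e E \<longleftrightarrow>
    (\<forall>z. pi11M z \<longrightarrow> der (all_rules T) (case_nat z e) E (jPr z) \<longrightarrow> trM F (z :: 'a::arith))"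
  using hsat_Der[OF all_rules_ok[OF T] E] all_rules_ok[OF T]
  by (simp add: RFN_def fsat_Tr[OF F E] fsat_arithmetical arithmetical_Pi11_code hsat_Pi11_code[OF E] Prov_all_rules jPr_def)

text \<open>On such environments \<open>valr\<close> and \<open>V\<close> agree for terms with
  variables below \<open>m\<close> (\<open>V_valr\<close>). The truth definition works with
  \<open>valr\<close>, the satisfaction class of an omega-model with \<open>V\<close>.\<close>

definition good :: "'a::arith \<Rightarrow> 'a \<Rightarrow> bool" where
  "good m l \<longleftrightarrow> (\<forall>n. n < m \<longrightarrow> (\<exists>v. look l n v))"

lemma good_Suc: "good m l \<Longrightarrow> good (m + 1) (cCons a (l::'a::arith))"
  unfolding good_def
proof (intro allI impI)
  fix n assume g: "\<forall>n. n < m \<longrightarrow> (\<exists>v. look l n v)" and n: "n < m + 1"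
  show "\<exists>v. look (cCons a l) n v" by (rule suc_cases[of n]) (use g n in auto)
qed

lemma d_good: "dt s \<Longrightarrow> dt t \<Longrightarrow> d (\<lambda>e. good (s e) (t e :: 'a::arith))"
proof (rule d_subst2)
  show "d (\<lambda>e. good (e 0) (e 1 :: 'a))" unfolding good_def by (intro d_all d_imp d_ex d_less d_look dts)
qed

lemma valr_total:
  assumes "der syntax_rules e E (jTm m t)" "good m (l::'a::arith)" shows "\<exists>v. valr l t v"
proof -
  let ?Q = "\<lambda>x. \<forall>m t. pair m t = x \<longrightarrow> good m l \<longrightarrow> (\<exists>v. valr l t v)"
  have "?Q x" if "der syntax_rules e E (tag 1 x)" for x
  proof (rule judge_induct[OF syntax_rules_ok _ _ that, of ?Q])
    show "d (\<lambda>\<epsilon>. ?Q (\<epsilon> 0))" by (intro d_all d_ex d_imp d_eq d_valr d_good dts)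
    fix x assume "\<exists>r\<in>set syntax_rules. fires r e E {y. der syntax_rules e E y \<and> (\<forall>x'. y = tag 1 x' \<longrightarrow> ?Q x')} (tag 1 x)"
    then show "?Q x"
      by (auto simp: syntax_rules_def Let_def judgement_defs penv_def good_def) blast+
  qed
  then show ?thesis using assms by (auto simp: jTm_def)
qed

lemma V_valr:
  assumes "der syntax_rules e E (jTm m t)" "good m (l::'a::arith)" shows "V l t v \<longleftrightarrow> valr l t v"
  using valr_total[OF assms] valr_V V_unique by metis

lemma fm_cases:
  assumes "\<exists>r\<in>set syntax_rules. fires r e E J (tag 2 (pair 0 (pair m (pair 1 (x::'a::arith)))))"
  shows "(\<exists>t u. x = cEq t u \<and> tag 1 (pair m t) \<in> J \<and> tag 1 (pair m u) \<in> J) \<or>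
    (\<exists>t u. x = cLess t u \<and> tag 1 (pair m t) \<in> J \<and> tag 1 (pair m u) \<in> J) \<or>
    (\<exists>t. x = cMem t 0 \<and> tag 1 (pair m t) \<in> J) \<or> x = cFls \<or>
    (\<exists>y w. x = cImp y w \<and> tag 2 (pair 0 (pair m (pair 1 y))) \<in> J \<and> tag 2 (pair 0 (pair m (pair 1 w))) \<in> J) \<or>
    (\<exists>y. x = cAllN y \<and> tag 2 (pair 0 (pair (m + 1) (pair 1 y))) \<in> J)"
proof -
  have "n < 1 \<longleftrightarrow> n = 0" for n :: 'a using less_plus1[of n 0] by simp
  then show ?thesis using assms by (auto simp: syntax_rules_def Let_def judgement_defs penv_def)
qed

text \<open>Uniqueness of satisfaction, by induction on the derivation that \<open>x\<close> is a
  formula; this covers nonstandard arithmetical formulas. So truth in the omega-model passes to the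
  classes over which \<open>Tr\<close> quantifies.\<close>

lemma sat_agree:
  fixes S :: "'a::arith set"
  assumes tk: "tarskiM (sec W i) D S" and sat: "is_sat W S'" and SS: "D \<in> SS" "S \<in> SS" "S' \<in> SS"
    and fm: "der syntax_rules e E (jFm 0 m 1 x)" "x \<in> D" "good m l"
  shows "pair x l \<in> S \<longleftrightarrow> pair x (pair l (cCons i s)) \<in> S'"
proof -
  let ?Q = "\<lambda>z. \<forall>m x. pair 0 (pair m (pair 1 x)) = z \<longrightarrow> x \<in> D \<longrightarrow> (\<forall>l. good m l \<longrightarrow> (pair x l \<in> S \<longleftrightarrow>
      pair x (pair l (cCons i s)) \<in> S'))"
  have "?Q x" if "der syntax_rules e E (tag 2 x)" for x
  proof (rule judge_induct[OF syntax_rules_ok _ _ that, of ?Q])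
    show "d (\<lambda>\<epsilon>. ?Q (\<epsilon> 0))" by (intro d_all d_ex d_imp d_iff d_eq d_mem d_good SS dts)
    fix z assume "\<exists>r\<in>set syntax_rules. fires r e E {y. der syntax_rules e E y \<and> (\<forall>x'. y = tag 2 x' \<longrightarrow> ?Q x')} (tag 2 z)"
    note h = this
    show "?Q z"
    proof (intro allI impI)
      fix m x l assume z: "pair 0 (pair m (pair 1 x)) = z" and x: "x \<in> D" and g: "good m l"
      have V: "V l t v \<longleftrightarrow> valr l t v" if "der syntax_rules e E (tag 1 (pair m t))" for t v
        using V_valr[unfolded jTm_def, OF that g] .
      note st = sat[unfolded is_sat_def] and tk = tk[unfolded tarskiM_def]
      note tk1 = tk[THEN conjunct1, rule_format] and tk2 = tk[THEN conjunct2, THEN conjunct1, rule_format]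
        and tk3 = tk[THEN conjunct2, THEN conjunct2, THEN conjunct1, rule_format]
        and tk4 = tk[THEN conjunct2, THEN conjunct2, THEN conjunct2, THEN conjunct1, rule_format]
        and tk5 = tk[THEN conjunct2, THEN conjunct2, THEN conjunct2, THEN conjunct2, THEN conjunct1, rule_format]
        and tk6 = tk[THEN conjunct2, THEN conjunct2, THEN conjunct2, THEN conjunct2, THEN conjunct2, rule_format]
      from fm_cases[OF h[folded z]] consider
        t u where "x = cEq t u" "der syntax_rules e E (tag 1 (pair m t))" "der syntax_rules e E (tag 1 (pair m u))"
      | t u where "x = cLess t u" "der syntax_rules e E (tag 1 (pair m t))" "der syntax_rules e E (tag 1 (pair m u))"
      | t where "x = cMem t 0" "der syntax_rules e E (tag 1 (pair m t))"
      | "x = cFls"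
      | y w where "x = cImp y w" "?Q (pair 0 (pair m (pair 1 y)))" "?Q (pair 0 (pair m (pair 1 w)))"
      | y where "x = cAllN y" "?Q (pair 0 (pair (m + 1) (pair 1 y)))" by (elim disjE exE conjE) simp_all
      then show "pair x l \<in> S \<longleftrightarrow> pair x (pair l (cCons i s)) \<in> S'"
      proof cases
        case (1 t u)
        then show ?thesis using tk1[of t u l] x by (simp add: V st del: V_simps valr_simps)
      next
        case (2 t u)
        have "pair x l \<in> S \<longleftrightarrow> (\<exists>v w. v < w \<and> valr l t v \<and> valr l u w)" using tk2[of t u l] x 2(1) by simp
        also have "\<dots> \<longleftrightarrow> (\<exists>v w. V l t v \<and> V l u w \<and> v < w)" unfolding V[OF 2(2)] V[OF 2(3)] by blast
        finally show ?thesis using 2(1) st by simp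
      next
        case (3 t)
        have "pair x l \<in> S \<longleftrightarrow> (\<exists>v. v \<in> sec W i \<and> valr l t v)" using tk3[of t 0 l] x 3(1) by simp
        also have "\<dots> \<longleftrightarrow> (\<exists>v. V l t v \<and> pair i v \<in> W)" unfolding V[OF 3(2)] sec_def by blast
        finally show ?thesis using 3(1) st by simp
      next
        case 4 then show ?thesis using tk4[of l] x st by simp
      next
        case (5 y w)
        have "y \<in> D" "w \<in> D" and eq: "pair (cImp y w) l \<in> S \<longleftrightarrow> (pair y l \<in> S \<longrightarrow> pair w l \<in> S)"
          using tk5[of y w] x 5(1) by simp_all
        then have "pair y l \<in> S \<longleftrightarrow> pair y (pair l (cCons i s)) \<in> S'" "pair w l \<in> S \<longleftrightarrow> pair w (pair l (cCons i s)) \<in> S'"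
          using 5(2,3) g by simp_all
        then show ?thesis unfolding 5(1) eq using st by simp
      next
        case (6 y)
        have "y \<in> D" and eq: "pair (cAllN y) l \<in> S \<longleftrightarrow> (\<forall>a. pair y (cCons a l) \<in> S)" using tk6[of y] x 6(1) by simp_all
        then have "pair y (cCons a l) \<in> S \<longleftrightarrow> pair y (pair (cCons a l) (cCons i s)) \<in> S'" for a
          using 6(2) good_Suc[OF g] by simp
        then show ?thesis unfolding 6(1) eq using st by simp
      qed
    qed
  qed
  then show ?thesis using fm by (auto simp: jFm_def)
qed

section \<open>Free variables of derivability formulas\<close>

lemma closed_tm_up_n: "closed_tm m t \<Longrightarrow> closed_tm (m + n) (up n t)"
  by (induct n) (auto simp: up_def)

lemma closed_beta: "closed m s (beta a b i y) \<longleftrightarrow> closed_tm m a \<and> closed_tm m b \<and> closed_tm m i \<and> closed_tm m y"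
  by (auto simp: beta_def)

lemma closed_ExBs: "closed_tm m t \<Longrightarrow> closed (m + n) s p \<Longrightarrow> closed m s (ExBs n t p)"
  by (induct n arbitrary: m t) auto

lemma closed_step:
  assumes "closed (13 + m) s (side r)" "closed_tm 8 (concl r)" "\<forall>q\<in>set (prems r). closed_tm 8 q"
  shows "closed (5 + m) s (step r)"
proof -
  have "closed_tm 8 q \<Longrightarrow> closed_tm (13 + m) q" for q by (rule closed_tm_mono) auto
  moreover have "closed_tm 8 q \<Longrightarrow> closed_tm (Suc (13 + m)) (up (Suc 0) q)" for q
    using closed_tm_up_n[of 8 q 1] closed_tm_mono[of 9 "up (Suc 0) q" "Suc (13 + m)"] by simp
  ultimately show ?thesis unfolding step_def using assms
    by (intro closed_ExBs) (auto simp: closed_beta numeral_eq_Suc)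
qed

lemma closed_Der:
  assumes "closed_tm m x" "\<forall>r\<in>set R. closed (13 + m) s (side r) \<and> closed_tm 8 (concl r) \<and> (\<forall>q\<in>set (prems r). closed_tm 8 q)"
  shows "closed m s (Der R x)"
proof -
  have "closed_tm (5 + m) (up 5 x)" using closed_tm_up_n[OF assms(1), of 5] by (simp add: add.commute)
  moreover have "closed (5 + m) s (step r)" if "r \<in> set R" for r using assms(2) that by (intro closed_step) auto
  ultimately show ?thesis by (auto simp: Der_def closed_beta numeral_eq_Suc)
qed

lemma closed_Val [simp]: "closed_tm m l \<Longrightarrow> closed_tm m t \<Longrightarrow> closed_tm m v \<Longrightarrow> closed m s (Val l t v)"
  unfolding Val_def
  by (rule closed_Der) (auto simp: val_rules_def Let_def infer_def jVal_def jLook_def code_defs)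

lemma hsat_Der_cong:
  assumes "\<forall>r\<in>set R. closed 5 0 (step r)" "hval e x = hval e' x'"
  shows "hsat (Der R x) e E = hsat (Der R x') e' E'"
proof -
  have "hsat (step r) (case_nat i (case_nat n (case_nat b (case_nat a (case_nat w e))))) E =
    hsat (step r) (case_nat i (case_nat n (case_nat b (case_nat a (case_nat w e'))))) E'" if "r \<in> set R" for r i n b a w
    using assms(1) that by (intro hsat_cong[of 5 0]) (auto simp: numeral_eq_Suc split: nat.split)
  then show ?thesis using assms(2) by (simp add: Der_def beta_def)
qed

text \<open>In a structure not yet known to satisfy comprehension, derivations cannot be analyzed.
  There \<open>Val\<close> is just some relation, and all information about it comes from
  \<open>val_axioms\<close>.\<close>

definition Vl :: "'a::so_structure \<Rightarrow> 'a \<Rightarrow> 'a \<Rightarrow> bool" where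
  "Vl l t v \<longleftrightarrow> hsat (Val (Var 0) (Var 1) (Var 2)) (case_nat l (case_nat t (\<lambda>_. v))) (\<lambda>_. {})"

lemma hsat_Val_Vl: "hsat (Val l t v) e E \<longleftrightarrow> Vl (hval e l) (hval e t) (hval e v)"
  unfolding Vl_def Val_def
proof (rule hsat_Der_cong)
  show "\<forall>r\<in>set val_rules. closed 5 0 (step r)"
    using closed_step[of 0 0] by (auto simp: val_rules_def Let_def infer_def jVal_def jLook_def code_defs)
qed (simp add: jVal_def numeral_2_eq_2)

lemma Vl_valr: "Vl l t v = valr l t (v::'a::arith)"
  using hsat_Val[of "\<lambda>_. {x. False}" "Var 0" "Var 1" "Var 2" "case_nat l (case_nat t (\<lambda>_. v))"]
    hsat_Val_Vl[of "Var 0" "Var 1" "Var 2" "case_nat l (case_nat t (\<lambda>_. v))"] SS_Collect[of "\<lambda>_. False", OF d_False]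
  by (simp add: numeral_2_eq_2)

section \<open>A finite axiomatization\<close>

definition basic_list :: "fm list" where
  "basic_list = (let m = Var 0; n = Var 1 in
     [Neg (Eq (n + 1) 0), Imp (Eq (m + 1) (n + 1)) (Eq m n), Eq (m + 0) m, Eq (m + (n + 1)) ((m + n) + 1),
      Eq (m * 0) 0, Eq (m * (n + 1)) (m * n + m), Neg (Less m 0), Iff (Less m (n + 1)) (Disj (Less m n) (Eq m n))])"

text \<open>Models of \<open>Bsent\<close> are yet to be shown to satisfy comprehension. The
  recursion equations for the values of terms, whose proof uses comprehension, are therefore among
  the axioms.\<close>

definition val_axioms :: "fm list" where
  "val_axioms = [
     AllN (AllN (Iff (Val (Var 1) cZero (Var 0)) (Eq (Var 0) 0))),
     AllN (AllN (Iff (Val (Var 1) cOne (Var 0)) (Eq (Var 0) 1))),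
     AllN (AllN (AllN (AllN (Iff (Val (Var 3) (cPlus (Var 2) (Var 1)) (Var 0))
       (ExN (ExN (Conj (Val (Var 5) (Var 4) (Var 1)) (Conj (Val (Var 5) (Var 3) (Var 0)) (Eq (Var 2) (Var 1 + Var 0)))))))))),
     AllN (AllN (AllN (AllN (Iff (Val (Var 3) (cTimes (Var 2) (Var 1)) (Var 0))
       (ExN (ExN (Conj (Val (Var 5) (Var 4) (Var 1)) (Conj (Val (Var 5) (Var 3) (Var 0)) (Eq (Var 2) (Var 1 * Var 0)))))))))),
     AllN (AllN (AllN (Iff (Val (cCons (Var 2) (Var 1)) (cVar 0) (Var 0)) (Eq (Var 0) (Var 2))))),
     AllN (AllN (AllN (AllN (Iff (Val (cCons (Var 3) (Var 2)) (cVar (Var 1 + 1)) (Var 0)) (Val (Var 2) (cVar (Var 1))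
         (Var 0))))))]"

text \<open>Arithmetical comprehension follows from these by induction on formulas, the sets
  involved being sets of coded environments (\<open>B_definable\<close>).\<close>

definition closure_axioms :: "fm list" where
  "closure_axioms = [
     AllN (AllN (ExS (AllN (Iff (Mem (Var 0) 0) (ExN (Conj (Val (Var 1) (Var 3) (Var 0)) (Val (Var 1) (Var 2) (Var 0)))))))),
     AllN (AllN (ExS (AllN (Iff (Mem (Var 0) 0)
       (ExN (ExN (Conj (Val (Var 2) (Var 4) (Var 1)) (Conj (Val (Var 2) (Var 3) (Var 0)) (Less (Var 1) (Var 0)))))))))),
     AllS (AllN (ExS (AllN (Iff (Mem (Var 0) 0) (AllN (Imp (Val (Var 1) (Var 2) (Var 0)) (Mem (Var 0) 1))))))),
     AllS (AllS (ExS (AllN (Iff (Mem (Var 0) 0) (Imp (Mem (Var 0) 2) (Mem (Var 0) 1)))))),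
     AllS (ExS (AllN (Iff (Mem (Var 0) 0) (AllN (Mem (cCons (Var 0) (Var 1)) 1))))),
     AllS (AllN (ExS (AllN (Iff (Mem (Var 0) 0) (Mem (cCons (Var 0) (Var 1)) 1)))))]"

definition Bsent :: fm where
  "Bsent = conjs (map (\<lambda>p. AllN (AllN p)) basic_list @ [induction_axiom] @ val_axioms @ closure_axioms)"

lemma sentence_Bsent: "sentence Bsent"
  by (auto simp: Bsent_def basic_list_def Let_def induction_axiom_def val_axioms_def closure_axioms_def code_defs)

lemma basic_list: "set basic_list = basic_axioms"
  by (simp add: basic_list_def basic_axioms_def Let_def)

lemma fsat_Val: "fsat F (Val l t v) e E \<longleftrightarrow> valr (hval e l) (hval e t) (hval e v :: 'a::arith)"
  by (simp add: fsat_arithmetical hsat_Val_Vl Vl_valr)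

lemma ex_sec: "(\<exists>X\<in>range (sec W). P X) \<longleftrightarrow> (\<exists>k. P (sec W k))" "(\<forall>X\<in>range (sec W). P X) \<longleftrightarrow> (\<forall>k. P (sec W k))"
  by auto

text \<open>Stated for an arbitrary family \<open>F\<close>, to cover both the sections of a coded
  model and all sets of the ambient model.\<close>

theorem fsat_Bsent_gen:
  fixes F :: "'a::arith set set"
  assumes F: "F \<subseteq> SS" and oc: "\<And>t u. \<exists>Z\<in>F. \<forall>l. l \<in> Z \<longleftrightarrow> (\<exists>v. valr l t v \<and> valr l u v)"
    "\<And>t u. \<exists>Z\<in>F. \<forall>l. l \<in> Z \<longleftrightarrow> (\<exists>v. valr l t v \<and> (\<exists>w. valr l u w \<and> v < w))"
    "\<And>X t. X \<in> F \<Longrightarrow> \<exists>Z\<in>F. \<forall>l. l \<in> Z \<longleftrightarrow> (\<forall>v. valr l t v \<longrightarrow> v \<in> X)"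
    "\<And>X Y. X \<in> F \<Longrightarrow> Y \<in> F \<Longrightarrow> \<exists>Z\<in>F. \<forall>l. l \<in> Z \<longleftrightarrow> (l \<in> X \<longrightarrow> l \<in> Y)"
    "\<And>X. X \<in> F \<Longrightarrow> \<exists>Z\<in>F. \<forall>l. l \<in> Z \<longleftrightarrow> (\<forall>y. cCons y l \<in> X)"
    "\<And>X l. X \<in> F \<Longrightarrow> \<exists>Z\<in>F. \<forall>x. x \<in> Z \<longleftrightarrow> cCons x l \<in> X"
  shows "fsat F Bsent e E"
proof -
  have "fsat F (AllN (AllN p)) e E" if "p \<in> set basic_list" for p
  proof -
    have "\<And>(x::'a) (y::'a). x + 1 \<noteq> 0" "\<And>(x::'a) (y::'a). x + 1 = y + 1 \<longleftrightarrow> x = y" "\<And>(x::'a) (y::'a). x + 0 = x"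
        "\<And>(x::'a) (y::'a). x + (y + 1) = x + y + 1"
      "\<And>(x::'a) (y::'a). x * 0 = 0" "\<And>(x::'a) (y::'a). x * (y + 1) = x * y + x" "\<And>(x::'a) (y::'a). \<not> x < 0"
          "\<And>(x::'a) (y::'a). x < y + 1 \<longleftrightarrow> x < y \<or> x = y"
      using suc_neq suc_inj add_suc mult_suc less_suc by simp_all
    note ax = this
    show ?thesis using that unfolding basic_list_def Let_def set_simps insert_iff empty_iff
      by (elim disjE FalseE) (simp_all only: fsat.simps fsat_connectives hval.simps hval_ops nat.case ax simp_thms One_nat_def)
  qed
  moreover have "fsat F induction_axiom e E"
    unfolding induction_axiom_def using SS_ind[OF subsetD[OF F]] by (auto simp: zero_tm_def[symmetric])
  moreover have "fsat F p e E" if "p \<in> set val_axioms" for p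
    using that unfolding val_axioms_def by (auto simp: fsat_Val)
  moreover have "fsat F p e E" if "p \<in> set closure_axioms" for p
    using that unfolding closure_axioms_def
    by (auto simp: fsat_Val oc numeral_2_eq_2)
  ultimately show ?thesis unfolding Bsent_def by auto
qed

corollary fsat_Bsent:
  fixes W :: "'a::arith set"
  assumes W: "W \<in> SS" "om_closed W"
  shows "fsat (range (sec W)) Bsent e E"
proof -
  have oc: "\<And>t u. \<exists>k. \<forall>l. l \<in> sec W k \<longleftrightarrow> (\<exists>v. valr l t v \<and> valr l u v)"
    "\<And>t u. \<exists>k. \<forall>l. l \<in> sec W k \<longleftrightarrow> (\<exists>v w. valr l t v \<and> valr l u w \<and> v < w)"
    "\<And>i t. \<exists>k. \<forall>l. l \<in> sec W k \<longleftrightarrow> (\<forall>v. valr l t v \<longrightarrow> v \<in> sec W i)"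
    "\<And>i j. \<exists>k. \<forall>l. l \<in> sec W k \<longleftrightarrow> (l \<in> sec W i \<longrightarrow> l \<in> sec W j)"
    "\<And>i. \<exists>k. \<forall>l. l \<in> sec W k \<longleftrightarrow> (\<forall>y. cCons y l \<in> sec W i)"
    "\<And>i l. \<exists>k. \<forall>x. x \<in> sec W k \<longleftrightarrow> cCons x l \<in> sec W i"
    using W(2) unfolding om_closed_def sec_def mem_Collect_eq by (simp_all only: simp_thms)
  show ?thesis
  proof (rule fsat_Bsent_gen)
  show "range (sec W) \<subseteq> SS" using sec_SS[OF W(1)] by blast
  fix t u show "\<exists>Z\<in>range (sec W). \<forall>l. l \<in> Z \<longleftrightarrow> (\<exists>v. valr l t v \<and> valr l u v)" unfolding ex_sec by (rule oc)
  show "\<exists>Z\<in>range (sec W). \<forall>l. l \<in> Z \<longleftrightarrow> (\<exists>v. valr l t v \<and> (\<exists>w. valr l u w \<and> v < w))" unfolding ex_sec using oc(2)[of t u] by simp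
next
  fix X t assume "X \<in> range (sec W)"
  then obtain i where X: "X = sec W i" by blast
  show "\<exists>Z\<in>range (sec W). \<forall>l. l \<in> Z \<longleftrightarrow> (\<forall>v. valr l t v \<longrightarrow> v \<in> X)" unfolding ex_sec X by (rule oc)
next
  fix X Y assume "X \<in> range (sec W)" "Y \<in> range (sec W)"
  then obtain i j where X: "X = sec W i" "Y = sec W j" by blast
  show "\<exists>Z\<in>range (sec W). \<forall>l. l \<in> Z \<longleftrightarrow> (l \<in> X \<longrightarrow> l \<in> Y)" unfolding ex_sec X by (rule oc)
next
  fix X assume "X \<in> range (sec W)"
  then obtain i where X: "X = sec W i" by blast
  show "\<exists>Z\<in>range (sec W). \<forall>l. l \<in> Z \<longleftrightarrow> (\<forall>y. cCons y l \<in> X)" unfolding ex_sec X by (rule oc)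
  fix l show "\<exists>Z\<in>range (sec W). \<forall>x. x \<in> Z \<longleftrightarrow> cCons x l \<in> X" unfolding ex_sec X by (rule oc)
qed
qed

corollary hsat_Bsent: "hsat Bsent (e :: nat \<Rightarrow> 'a::arith) E"
proof -
  have c: "\<exists>Z\<in>SS. \<forall>x. x \<in> Z \<longleftrightarrow> P x" if "d (\<lambda>e. P (e 0))" for P :: "'a \<Rightarrow> bool"
    by (rule bexI[OF _ SS_Collect[OF that]]) simp
  have "fsat SS Bsent e E"
  proof (rule fsat_Bsent_gen)
    fix t u show "\<exists>Z\<in>SS. \<forall>l::'a. l \<in> Z \<longleftrightarrow> (\<exists>v. valr l t v \<and> valr l u v)" by (intro c d_ex d_conj d_valr dts)
    show "\<exists>Z\<in>SS. \<forall>l::'a. l \<in> Z \<longleftrightarrow> (\<exists>v. valr l t v \<and> (\<exists>w. valr l u w \<and> v < w))" by (intro c d_ex d_conj d_less d_valr dts)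
  next
    fix X :: "'a set" and t assume "X \<in> SS" then show "\<exists>Z\<in>SS. \<forall>l::'a. l \<in> Z \<longleftrightarrow> (\<forall>v. valr l t v \<longrightarrow> v \<in> X)"
        by (intro c d_all d_imp d_mem d_valr dts)
  next
    fix X Y :: "'a set" assume "X \<in> SS" "Y \<in> SS" then show "\<exists>Z\<in>SS. \<forall>l::'a. l \<in> Z \<longleftrightarrow> (l \<in> X \<longrightarrow> l \<in> Y)" by (intro c d_imp d_mem dts)
  next
    fix X :: "'a set" assume X: "X \<in> SS" then show "\<exists>Z\<in>SS. \<forall>l::'a. l \<in> Z \<longleftrightarrow> (\<forall>y. cCons y l \<in> X)" by (intro c d_all d_mem dts)
    fix l show "\<exists>Z\<in>SS. \<forall>x::'a. x \<in> Z \<longleftrightarrow> cCons x l \<in> X" by (intro c d_mem X dts)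
  qed simp
  then show ?thesis by (simp only: fsat_SS)
qed


section \<open>Arithmetical comprehension in models of the finite axiomatization\<close>

context
  fixes e0 :: "nat \<Rightarrow> 'a::so_structure" and E0
  assumes B: "hsat Bsent e0 E0"
begin

lemma B_basic: "p \<in> basic_axioms \<Longrightarrow> hsat p (e :: nat \<Rightarrow> 'a) E"
proof -
  assume "p \<in> basic_axioms"
  then have p: "p \<in> set basic_list" by (simp add: basic_list)
  then have cl: "closed 2 0 p" by (auto simp: basic_list_def Let_def)
  have "hsat (AllN (AllN p)) e0 E0" using B p unfolding Bsent_def hsat_conjs set_append set_map by blast
  then have "hsat p (case_nat (e 0) (case_nat (e 1) e0)) E0" by simp
  moreover have "hsat p (case_nat (e 0) (case_nat (e 1) e0)) E0 = hsat p e E"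
    by (rule hsat_cong[OF cl]) (auto simp: numeral_2_eq_2 less_Suc_eq)
  ultimately show ?thesis by simp
qed

lemma B_induction: "hsat induction_axiom (e :: nat \<Rightarrow> 'a) E"
proof -
  have "hsat induction_axiom e0 E0" using B by (simp add: Bsent_def)
  moreover have "hsat induction_axiom e0 E0 = hsat induction_axiom e E"
    by (rule hsat_cong[of 0 0]) (auto simp: induction_axiom_def)
  ultimately show ?thesis by simp
qed

lemma B_val:
  "Vl l cZero v \<longleftrightarrow> v = (0::'a)" "Vl l cOne v \<longleftrightarrow> v = (1::'a)"
  "Vl l (cPlus x y) v \<longleftrightarrow> (\<exists>a b. Vl l x a \<and> Vl l y b \<and> v = a + (b::'a))"
  "Vl l (cTimes x y) v \<longleftrightarrow> (\<exists>a b. Vl l x a \<and> Vl l y b \<and> v = a * (b::'a))"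
  "Vl (cCons x l) (cVar 0) v \<longleftrightarrow> v = x" "Vl (cCons x l) (cVar (n + 1)) v \<longleftrightarrow> Vl l (cVar n) v"
  using B unfolding Bsent_def val_axioms_def by (simp_all add: hsat_Val_Vl)

lemma B_closure:
  "\<exists>Z\<in>SS. \<forall>l::'a. l \<in> Z \<longleftrightarrow> (\<exists>v. Vl l t v \<and> Vl l u v)"
  "\<exists>Z\<in>SS. \<forall>l::'a. l \<in> Z \<longleftrightarrow> (\<exists>v w. Vl l t v \<and> Vl l u w \<and> v < w)"
  "X \<in> SS \<Longrightarrow> \<exists>Z\<in>SS. \<forall>l::'a. l \<in> Z \<longleftrightarrow> (\<forall>v. Vl l t v \<longrightarrow> v \<in> X)"
  "X \<in> SS \<Longrightarrow> Y \<in> SS \<Longrightarrow> \<exists>Z\<in>SS. \<forall>l::'a. l \<in> Z \<longleftrightarrow> (l \<in> X \<longrightarrow> l \<in> Y)"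
  "X \<in> SS \<Longrightarrow> \<exists>Z\<in>SS. \<forall>l::'a. l \<in> Z \<longleftrightarrow> (\<forall>y. cCons y l \<in> X)"
  "X \<in> SS \<Longrightarrow> \<exists>Z\<in>SS. \<forall>x::'a. x \<in> Z \<longleftrightarrow> cCons x l \<in> X"
  using B unfolding Bsent_def closure_axioms_def by (simp_all add: hsat_Val_Vl numeral_2_eq_2)

lemma B_Vl_mc:
  fixes xs :: "'a list"
  shows "closed_tm (length xs) t \<Longrightarrow> Vl (lst xs) (mc_tm t) v \<longleftrightarrow> v = hval (\<lambda>n. xs ! n) t"
proof (induct t arbitrary: v)
  case (Var n)
  have "n < length xs \<Longrightarrow> Vl (lst xs) (cVar (cst n)) v \<longleftrightarrow> v = xs ! n" for xs :: "'a list"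
  proof (induct n arbitrary: xs)
    case 0 then show ?case by (cases xs) (auto simp: B_val)
  next
    case (Suc n) then show ?case by (cases xs) (auto simp: B_val)
  qed
  then show ?case using Var by simp
qed (auto simp: B_val)

text \<open>Environments are coded lists of a fixed standard length \<open>k\<close>, and the
  induction on \<open>p\<close> is external. Passing under a number quantifier increases the length
  by one.\<close>

lemma B_definable:
  fixes E :: "nat \<Rightarrow> 'a set"
  assumes "arithmetical p" "closed k s p" "\<And>n. E n \<in> SS"
  shows "\<exists>Z\<in>SS. \<forall>xs. length xs = k \<longrightarrow> (lst xs \<in> Z \<longleftrightarrow> hsat p (\<lambda>n. xs ! n) E)"
  using assms
proof (induct p arbitrary: k)
  case (Eq t u)
  obtain Z where Z: "Z \<in> SS" "\<forall>l::'a. l \<in> Z \<longleftrightarrow> (\<exists>v. Vl l (mc_tm t) v \<and> Vl l (mc_tm u) v)"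
      using B_closure(1)[of "mc_tm t" "mc_tm u"] by blast
  show ?case by (rule bexI[OF _ Z(1)]) (use Eq B_Vl_mc in \<open>auto simp: Z(2)\<close>)
next
  case (Less t u)
  obtain Z where Z: "Z \<in> SS" "\<forall>l::'a. l \<in> Z \<longleftrightarrow> (\<exists>v w. Vl l (mc_tm t) v \<and> Vl l (mc_tm u) w \<and> v < w)"
      using B_closure(2)[of "mc_tm t" "mc_tm u"] by blast
  show ?case by (rule bexI[OF _ Z(1)]) (use Less B_Vl_mc in \<open>auto simp: Z(2)\<close>)
next
  case (Mem t n)
  obtain Z where Z: "Z \<in> SS" "\<forall>l::'a. l \<in> Z \<longleftrightarrow> (\<forall>v. Vl l (mc_tm t) v \<longrightarrow> v \<in> E n)"
      using B_closure(3)[OF Mem(3)[of n], of "mc_tm t"] by blast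
  show ?case by (rule bexI[OF _ Z(1)]) (use Mem B_Vl_mc in \<open>auto simp: Z(2)\<close>)
next
  case Fls
  \<comment> \<open>The empty set is obtained as the set of environments in which 0 is less than
    0.\<close>
  obtain Z where Z: "Z \<in> SS" "\<forall>l::'a. l \<in> Z \<longleftrightarrow> (\<exists>v w. Vl l cZero v \<and> Vl l cZero w \<and> v < w)" using B_closure(2)[of cZero cZero]
      by blast
  have "hsat (Neg (Less (Var 0) 0)) (\<lambda>_. 0 :: 'a) E" by (rule B_basic) (simp add: basic_axioms_def Let_def)
  then have "\<not> (0::'a) < 0" by simp
  then show ?case by (intro bexI[OF _ Z(1)]) (simp add: Z(2) B_val)
next
  case (Imp p q)
  obtain X Y where X: "X \<in> SS" "\<forall>xs. length xs = k \<longrightarrow> (lst xs \<in> X \<longleftrightarrow> hsat p (\<lambda>n. xs ! n) E)"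
      "Y \<in> SS" "\<forall>xs. length xs = k \<longrightarrow> (lst xs \<in> Y \<longleftrightarrow> hsat q (\<lambda>n. xs ! n) E)"
    using Imp.hyps(1)[of k] Imp.hyps(2)[of k] Imp.prems by auto
  obtain Z where Z: "Z \<in> SS" "\<forall>l. l \<in> Z \<longleftrightarrow> (l \<in> X \<longrightarrow> l \<in> Y)" using B_closure(4)[OF X(1,3)] by blast
  show ?case by (rule bexI[OF _ Z(1)]) (use X in \<open>auto simp: Z(2)\<close>)
next
  case (AllN p)
  obtain X where X: "X \<in> SS" "\<forall>xs. length xs = Suc k \<longrightarrow> (lst xs \<in> X \<longleftrightarrow> hsat p (\<lambda>n. xs ! n) E)"
    using AllN.hyps[of "Suc k"] AllN.prems by auto
  obtain Z where Z: "Z \<in> SS" "\<forall>l. l \<in> Z \<longleftrightarrow> (\<forall>y. cCons y l \<in> X)" using B_closure(5)[OF X(1)] by blast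
  have "(lst xs \<in> Z) = hsat (AllN p) (\<lambda>n. xs ! n) E" if "length xs = k" for xs
  proof -
    have "(cCons y (lst xs) \<in> X) = hsat p (case_nat y (\<lambda>n. xs ! n)) E" for y
    proof -
      have "(\<lambda>n. (y # xs) ! n) = case_nat y (\<lambda>n. xs ! n)" by (auto simp: fun_eq_iff split: nat.split)
      then show ?thesis using X(2)[rule_format, of "y # xs"] that by simp
    qed
    then show ?thesis by (simp add: Z(2))
  qed
  then show ?case using Z(1) by blast
qed auto

theorem B_comprehension:
  fixes e :: "nat \<Rightarrow> 'a"
  assumes "arithmetical p" "\<And>n. E n \<in> SS" shows "{x. hsat p (case_nat x e) E} \<in> SS"
proof -
  obtain k where k: "closed k k p" using closed_ex by blast
  then have k': "closed (Suc k) k p" by (rule closed_mono) auto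
  from B_definable[where E = E, OF assms(1) k' assms(2)] obtain X where X: "X \<in> SS"
    "\<forall>xs. length xs = Suc k \<longrightarrow> (lst xs \<in> X \<longleftrightarrow> hsat p (\<lambda>n. xs ! n) E)" by (elim bexE)
  \<comment> \<open>The parameters are put into one list, which the last closure operation removes
    again, leaving a set of numbers.\<close>
  let ?l = "lst (map e [0..<k])"
  obtain Z where Z: "Z \<in> SS" "\<forall>x. x \<in> Z \<longleftrightarrow> cCons x ?l \<in> X" using B_closure(6)[OF X(1)] by blast
  have "cCons x ?l \<in> X \<longleftrightarrow> hsat p (case_nat x e) E" for x
  proof -
    have "cCons x ?l \<in> X \<longleftrightarrow> hsat p (\<lambda>n. (x # map e [0..<k]) ! n) E" using X(2)[rule_format, of "x # map e [0..<k]"] by simp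
    also have "\<dots> = hsat p (case_nat x e) E" by (rule hsat_cong[OF k]) (auto simp: nth_Cons split: nat.splits)
    finally show ?thesis .
  qed
  then have "Z = {x. hsat p (case_nat x e) E}" using Z(2) by auto
  then show ?thesis using Z(1) by simp
qed

end

section \<open>Numerals inside a model\<close>

definition jNum :: "'a \<Rightarrow> 'a \<Rightarrow> 'a :: {zero, one, plus, times}" where
  "jNum n t = tag 1 (pair n t)"

definition num_rules :: "rule list" where
  "num_rules = [[] \<leadsto> jNum 0 cZero, [jNum (Var 0) (Var 1)] \<leadsto> jNum (Var 0 + 1) (cPlus (Var 1) cOne)]"

lemma num_rules_ok: "rules_ok num_rules"
  by (simp add: num_rules_def jNum_def code_defs)

text \<open>For a nonstandard \<open>n\<close> the numeral is a nonstandard code, so it is given by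
  a derivation instead of recursion on \<open>n\<close>.\<close>

definition numr :: "'a::arith \<Rightarrow> 'a \<Rightarrow> bool" where
  "numr n t \<longleftrightarrow> der num_rules (\<lambda>_. 0) (\<lambda>_. {}) (jNum n t)"

lemma empty_SS [simp]: "{} \<in> (SS :: 'a::arith set set)"
  using SS_Collect[of "\<lambda>_. False :: bool", OF d_False] by simp

lemma d_numr: "dt s \<Longrightarrow> dt t \<Longrightarrow> d (\<lambda>e. numr (s e) (t e :: 'a::arith))"
  unfolding numr_def jNum_def by (intro d_der num_rules_ok dts empty_SS)

lemma numr_0 [simp]: "numr 0 t \<longleftrightarrow> t = (cZero :: 'a::arith)"
proof -
  have "numr 0 t \<longleftrightarrow> (\<exists>r\<in>set num_rules. fires r (\<lambda>_. 0) (\<lambda>_. {}) {y. der num_rules (\<lambda>_. 0) (\<lambda>_. {}) y} (jNum 0 t))"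
    unfolding numr_def by (rule der_iff[OF num_rules_ok])
  also have "\<dots> \<longleftrightarrow> t = cZero" using suc_neq[symmetric] by (auto simp: num_rules_def jNum_def code_defs)
  finally show ?thesis .
qed

lemma numr_Suc [simp]: "numr (n + 1) t \<longleftrightarrow> (\<exists>u. numr n u \<and> t = cPlus u (cOne :: 'a::arith))"
proof -
  have "numr (n + 1) t \<longleftrightarrow> (\<exists>r\<in>set num_rules. fires r (\<lambda>_. 0) (\<lambda>_. {}) {y. der num_rules (\<lambda>_. 0) (\<lambda>_. {}) y} (jNum (n + 1) t))"
    unfolding numr_def by (rule der_iff[OF num_rules_ok])
  also have "\<dots> \<longleftrightarrow> (\<exists>u. numr n u \<and> t = cPlus u (cOne :: 'a::arith))"
    unfolding numr_def using suc_neq by (auto simp: num_rules_def jNum_def code_defs)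
  finally show ?thesis .
qed

lemma numr_V: "numr n t \<Longrightarrow> V l t v \<longleftrightarrow> v = (n::'a::arith)"
proof -
  have "\<forall>t v. numr n t \<longrightarrow> (V l t v \<longleftrightarrow> v = n)"
  proof (rule ind[of "\<lambda>n. \<forall>t v. numr n t \<longrightarrow> (V l t v \<longleftrightarrow> v = n)"])
    show "d (\<lambda>e. \<forall>t v. numr (e 0) t \<longrightarrow> (V l t v \<longleftrightarrow> v = e 0))" by (intro d_all d_imp d_iff d_eq d_V d_numr dts)
  qed auto
  then show "numr n t \<Longrightarrow> V l t v \<longleftrightarrow> v = n" by blast
qed

primrec num :: "nat \<Rightarrow> tm" where
  "num 0 = Zero" | "num (Suc n) = Plus (num n) One"

lemma num_simps [simp]: "hval e (num n) = cst n" "closed_tm m (num n)"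
  by (induct n) simp_all

lemma numr_num: "numr (cst n) t \<longleftrightarrow> t = (mc_tm (num n) :: 'a::arith)"
  by (induct n arbitrary: t) auto

section \<open>Theories of iterated reflection\<close>

definition dbody :: "rule list \<Rightarrow> tm \<Rightarrow> fm" where
  "dbody R x = ExB (Var 0) (ExB (Var 1) (ExB (Var 2)
     (Conj (ExB (Var 0) (beta (Var 3) (Var 2) (Var 0) (up 5 x)))
           (AllB (Var 0) (disjs (map step R))))))"

lemma Der_dbody: "Der R x = ExN (dbody R x)" by (simp add: Der_def dbody_def)

text \<open>Says that \<open>f\<close> holds when its variable 0 has the value of \<open>t\<close>.
  This expresses the substitution of \<open>t\<close> into \<open>f\<close> by a polynomial in the
  codes.\<close>

definition AX :: "'a \<Rightarrow> 'a \<Rightarrow> 'a :: {zero, one, plus, times}" where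
  "AX t f = cAllN (cImp (cEq (cVar 0) t) f)"

text \<open>
  The variables 0 and 1 of \<open>itax e q\<close> are a bound for the existential quantifiers and the code of an axiom; \<open>q\<close> denotes a
  pair \<open>(y, f)\<close>, where \<open>f\<close> is the code of a formula \<open>\<phi>\<close>. The axioms say that \<open>\<phi>\<close> holds for the pairs \<open>(y', f)\<close> with \<open>y'\<close>
  below \<open>y\<close>. In the scope of the quantifier of \<open>RFN\<close> and of the thirteen quantifiers of \<open>Der\<close>, the variable 14 is the free
  variable 0 of \<open>itrefl e\<close>. Hence with \<open>f = code (itrefl e)\<close> the axioms are instances of reflection for the theories
  themselves, and no diagonal lemma is needed.
\<close>

definition itax :: "prim_fun \<Rightarrow> tm \<Rightarrow> fm" where
  "itax e q = Disj (Eq (Var 1) (cst (code Bsent)))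
    (ExB (Var 0) (ExB (Var 1) (ExB (Var 2) (ExB (Var 3) (conjs [
      Eq (up 4 q) (pair (Var 3) (Var 2)), Neg (Eq (Var 1) (Var 3)),
      ExB (Var 4) (dbody pr_rules (jEv (cst (code_prim e)) (cCons (Var 1) (cCons (Var 3) cNil)) 1)),
      ExB (Var 4) (dbody num_rules (jNum (pair (Var 1) (Var 2)) (Var 0))),
      Eq (Var 5) (AX (Var 0) (Var 2))])))))"

definition "itrefl e = RFN (ExN (itax e (Var 14)))"
definition "itth e y = ExN (itax e (cst (pair y (code (itrefl e)))))"

definition leM :: "prim_fun \<Rightarrow> 'a::arith \<Rightarrow> 'a \<Rightarrow> bool" where
  "leM e x y \<longleftrightarrow> ev pr_rules {} (cst (code_prim e)) (cCons x (cCons y cNil)) 1"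

lemma pr_rules_closed: "\<forall>r\<in>set pr_rules. closed 8 0 (side r)"
  by (simp add: pr_rules_def Let_def infer_def)
lemma num_rules_closed: "\<forall>r\<in>set num_rules. closed 8 0 (side r)"
  by (simp add: num_rules_def infer_def)

lemma hsat_Der_pr:
  assumes "\<And>n. E n \<in> SS" shows "hsat (Der pr_rules (jEv c l v)) \<epsilon> E \<longleftrightarrow>
      ev pr_rules {} (hval \<epsilon> c) (hval \<epsilon> l) (hval \<epsilon> v :: 'a::arith)"
  using hsat_Der[OF pr_rules_ok assms] der_closed[OF pr_rules_closed, of E "\<lambda>_. {}" \<epsilon> "\<lambda>_. 0"] by (simp add: ev_def jEv_def)

lemma hsat_Der_num:
  assumes "\<And>n. E n \<in> SS" shows "hsat (Der num_rules (jNum n t)) \<epsilon> E \<longleftrightarrow> numr (hval \<epsilon> n) (hval \<epsilon> t :: 'a::arith)"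
  using hsat_Der[OF num_rules_ok assms] der_closed[OF num_rules_closed, of E "\<lambda>_. {}" \<epsilon> "\<lambda>_. 0"]
      by (simp add: numr_def jNum_def)

lemma hsat_pr_le: "(\<And>n. E n \<in> SS) \<Longrightarrow> hsat (pr_le e x y) \<epsilon> E \<longleftrightarrow> leM e (hval \<epsilon> x) (hval \<epsilon> y :: 'a::arith)"
  by (simp add: pr_le_def hsat_Der_pr leM_def)

definition itaxM :: "prim_fun \<Rightarrow> 'a::arith \<Rightarrow> 'a \<Rightarrow> bool" where
  "itaxM e q z \<longleftrightarrow> z = mc Bsent \<or>
    (\<exists>y f y' t. q = pair y f \<and> y' \<noteq> y \<and> leM e y' y \<and> numr (pair y' f) t \<and> z = AX t f)"

lemma hval_AX [simp]: "hval e (AX s t) = AX (hval e s) (hval e t)" by (simp add: AX_def)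

lemma itax_sound:
  assumes E: "\<And>n. E n \<in> SS" and h: "hsat (itax e q) \<epsilon> E"
  shows "itaxM e (hval \<epsilon> q) (\<epsilon> 1 :: 'a::arith)"
proof (cases "\<epsilon> 1 = cst (code Bsent)")
  case True then show ?thesis by (simp add: itaxM_def cst_code)
next
  case False
  then obtain t y' f y w w' where eq: "hval \<epsilon> q = pair y f" "y' \<noteq> y" "\<epsilon> 1 = AX t f" and
    w: "hsat (dbody pr_rules (jEv (cst (code_prim e)) (cCons (Var 1) (cCons (Var 3) cNil)) 1))
      (case_nat w (case_nat t (case_nat y' (case_nat f (case_nat y \<epsilon>))))) E"
    "hsat (dbody num_rules (jNum (pair (Var 1) (Var 2)) (Var 0)))
      (case_nat w' (case_nat t (case_nat y' (case_nat f (case_nat y \<epsilon>))))) E"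
    using h unfolding itax_def by (auto simp: numeral_eq_Suc)
  have "hsat (Der pr_rules (jEv (cst (code_prim e)) (cCons (Var 1) (cCons (Var 3) cNil)) 1))
      (case_nat t (case_nat y' (case_nat f (case_nat y \<epsilon>)))) E"
    "hsat (Der num_rules (jNum (pair (Var 1) (Var 2)) (Var 0)))
      (case_nat t (case_nat y' (case_nat f (case_nat y \<epsilon>)))) E"
    using w by (auto simp: Der_dbody)
  then have "leM e y' y" "numr (pair y' f) t"
    by (simp_all add: hsat_Der_pr[OF E] hsat_Der_num[OF E] leM_def numeral_eq_Suc)
  then show ?thesis using eq unfolding itaxM_def by blast
qed

lemma closed_dbodies:
  "closed 5 0 (dbody pr_rules (jEv (cst (code_prim e)) (cCons (Var 1) (cCons (Var 3) cNil)) 1))"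
  "closed 5 0 (dbody num_rules (jNum (pair (Var 1) (Var 2)) (Var 0)))"
proof -
  have "closed 4 0 (Der pr_rules (jEv (cst (code_prim e)) (cCons (Var 1) (cCons (Var 3) cNil)) 1))"
    by (rule closed_Der) (auto simp: pr_rules_def Let_def infer_def ev_defs alg_defs)
  then show "closed 5 0 (dbody pr_rules (jEv (cst (code_prim e)) (cCons (Var 1) (cCons (Var 3) cNil)) 1))"
    by (simp add: Der_dbody)
  have "closed 4 0 (Der num_rules (jNum (pair (Var 1) (Var 2)) (Var 0)))"
    by (rule closed_Der) (auto simp: num_rules_def Let_def infer_def jNum_def code_defs)
  then show "closed 5 0 (dbody num_rules (jNum (pair (Var 1) (Var 2)) (Var 0)))"
    by (simp add: Der_dbody)
qed

lemma itax_complete: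
  assumes E: "\<And>n. E n \<in> SS" and q: "\<And>v. hval (case_nat v \<epsilon>) q = a" and h: "itaxM e a (\<epsilon> 0 :: 'a::arith)"
  shows "\<exists>v. hsat (itax e q) (case_nat v \<epsilon>) E"
proof (cases "\<epsilon> 0 = cst (code Bsent)")
  case True then show ?thesis by (simp add: itax_def)
next
  case False
  then obtain y f y' t where eq: "a = pair y f" "y' \<noteq> y" "leM e y' y" "numr (pair y' f) t" "\<epsilon> 0 = AX t f"
    using h unfolding itaxM_def cst_code by blast
  have "hsat (Der pr_rules (jEv (cst (code_prim e)) (cCons (Var 1) (cCons (Var 3) cNil)) 1))
      (case_nat t (case_nat y' (case_nat f (case_nat y (case_nat v \<epsilon>))))) E"
    "hsat (Der num_rules (jNum (pair (Var 1) (Var 2)) (Var 0)))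
      (case_nat t (case_nat y' (case_nat f (case_nat y (case_nat v \<epsilon>))))) E" for v
    using eq by (simp_all add: hsat_Der_pr[OF E] hsat_Der_num[OF E] leM_def numeral_eq_Suc)
  note D = this
  \<comment> \<open>The derivation bodies do not depend on the outermost variable \<open>v\<close>.
    So their witnesses are found with 0 in its place, and \<open>v\<close> is chosen afterwards,
    above them.\<close>
  have cg: "hsat (dbody R x) (case_nat w (case_nat t (case_nat y' (case_nat f (case_nat y (case_nat v \<epsilon>)))))) E"
    if "hsat (dbody R x) (case_nat w (case_nat t (case_nat y' (case_nat f (case_nat y (case_nat 0 \<epsilon>)))))) E"
      "closed 5 0 (dbody R x)" for R x w v
  proof -
    have "hsat (dbody R x) (case_nat w (case_nat t (case_nat y' (case_nat f (case_nat y (case_nat 0 \<epsilon>)))))) E =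
      hsat (dbody R x) (case_nat w (case_nat t (case_nat y' (case_nat f (case_nat y (case_nat v \<epsilon>)))))) E"
      by (rule hsat_cong[OF that(2)]) (auto simp: less_Suc_eq numeral_eq_Suc)
    then show ?thesis using that(1) by simp
  qed
  obtain w w' where w: "hsat (dbody pr_rules (jEv (cst (code_prim e)) (cCons (Var 1) (cCons (Var 3) cNil)) 1))
      (case_nat w (case_nat t (case_nat y' (case_nat f (case_nat y (case_nat 0 \<epsilon>)))))) E"
    "hsat (dbody num_rules (jNum (pair (Var 1) (Var 2)) (Var 0)))
      (case_nat w' (case_nat t (case_nat y' (case_nat f (case_nat y (case_nat 0 \<epsilon>)))))) E"
    using D unfolding Der_dbody hsat_connectives by blast
  define v where "v = t + (y' + (f + (y + (w + w')))) + 1"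
  have le: "x < v" if "t + (y' + (f + (y + (w + w')))) = x + r" for x r
    unfolding v_def that less_plus1 by (rule self_le_add)
  have lt: "t < v" "y' < v" "f < v" "y < v" "w < v" "w' < v"
    using le[of t "y' + (f + (y + (w + w')))"] le[of y' "t + (f + (y + (w + w')))"] le[of f "t + (y' + (y + (w + w')))"]
      le[of y "t + (y' + (f + (w + w')))"] le[of w "t + (y' + (f + (y + w')))"] le[of w' "t + (y' + (f + (y + w)))"]
    by (simp_all add: ac_simps)
  have qv: "hval (case_nat t (case_nat y' (case_nat f (case_nat y (case_nat v \<epsilon>))))) (up 4 q) = a"
    using q by simp
  show ?thesis unfolding itax_def
    apply (rule exI[of _ v])
    apply (simp add: qv eq(5))
    apply (rule disjI2)
    apply (rule exI[of _ y], simp add: lt)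
    apply (rule exI[of _ f], simp add: lt)
    apply (rule exI[of _ y'], simp add: lt)
    apply (rule exI[of _ t], simp add: lt q eq(1,2) numeral_eq_Suc)
    using cg[OF w(1) closed_dbodies(1), of v] cg[OF w(2) closed_dbodies(2), of v] lt(5,6) by (auto simp: numeral_eq_Suc)
qed


section \<open>Syntax of the iterated theories, and their reflection principles in a model\<close>

lemma ps_closed_id:
  assumes "closed m s p" "\<And>n. n < m \<Longrightarrow> f n = Var n" "\<And>n. n < s \<Longrightarrow> g n = n" shows "ps p f g = p"
  by (rule trans[OF ps_cong[OF assms(1)] ps_id]) (use assms in auto)

lemma Delta0_beta [simp]: "Delta0 (beta a b i y)"
  by (auto simp: beta_def intro!: Delta0.intros Delta0_simps)
lemma Delta0_ExBs [simp]: "Delta0 p \<Longrightarrow> Delta0 (ExBs n t p)"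
  by (induct n arbitrary: t) auto
lemma Delta0_dbody: "\<forall>r\<in>set R. Delta0 (side r) \<Longrightarrow> Delta0 (dbody R x)"
  by (auto simp: dbody_def step_def intro!: Delta0.intros Delta0_simps Delta0_conjs Delta0_disjs Delta0_ExBs)

lemma Delta0_itax: "Delta0 (itax e q)"
proof -
  have "Delta0 (dbody pr_rules x)" "Delta0 (dbody num_rules x)" for x
    by (rule Delta0_dbody; auto simp: pr_rules_def num_rules_def Let_def infer_def intro!: Delta0.intros)+
  then show ?thesis by (simp add: itax_def Delta0.intros)
qed

lemma arithmetical_Delta0: "Delta0 p \<Longrightarrow> arithmetical p"
  by (induct rule: Delta0.induct) auto

lemma closed_itax: "closed_tm (m + 2) q \<Longrightarrow> closed (m + 2) 0 (itax e q)"
proof -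
  assume q: "closed_tm (m + 2) q"
  have "closed_tm (m + 6) (up 4 q)" using closed_tm_up_n[OF q, of 4] by (simp add: add.commute)
  moreover have "closed (m + 7) 0 (dbody pr_rules (jEv (cst (code_prim e)) (cCons (Var 1) (cCons (Var 3) cNil)) 1))"
    by (rule closed_mono[OF closed_dbodies(1)]) simp_all
  moreover have "closed (m + 7) 0 (dbody num_rules (jNum (pair (Var 1) (Var 2)) (Var 0)))"
    by (rule closed_mono[OF closed_dbodies(2)]) simp_all
  ultimately show ?thesis by (auto simp: itax_def AX_def code_defs closed_conjs numeral_eq_Suc)
qed

lemma ps_tm_ops [simp]:
  "ps_tm f (s + t) = ps_tm f s + ps_tm f t" "ps_tm f (s * t) = ps_tm f s * ps_tm f t" "ps_tm f 0 = 0" "ps_tm f 1 = 1"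
  "ps_tm f (cst n) = cst n"
  by (simp_all add: plus_tm_def times_tm_def zero_tm_def one_tm_def) (induct n; simp add: plus_tm_def zero_tm_def one_tm_def)
lemma ps_tm_codes [simp]:
  "ps_tm f (pair s t) = pair (ps_tm f s) (ps_tm f t)" "ps_tm f (tag k s) = tag k (ps_tm f s)"
      "ps_tm f (AX s t) = AX (ps_tm f s) (ps_tm f t)"
  by (simp_all add: AX_def code_defs tag_def pair_def)
lemma upN_simps: "upN f 0 = Var 0" "upN f (Suc n) = lift_tm 0 (f n)" "upN f (numeral k) = lift_tm 0 (f (pred_numeral k))"
  by (simp_all add: upN_def numeral_eq_Suc)
lemma up_Var [simp]: "up n (Var k) = Var (n + k)"
  by (induct n) (simp_all add: up_def)
lemma ps_connectives [simp]:
  "ps (Neg p) f g = Neg (ps p f g)" "ps (Conj p q) f g = Conj (ps p f g) (ps q f g)"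
      "ps (Disj p q) f g = Disj (ps p f g) (ps q f g)"
  by (simp_all add: Neg_def Conj_def Disj_def)

lemma noslot_itax14: "noslot (itax e (Var 14))"
proof -
  let ?F = "\<lambda>n. if 8 \<le> n \<and> n < 13 then Zero else Var n"
  let ?G = "upN (upN (upN (upN (upN ?F))))"
  have G: "n < 5 \<Longrightarrow> ?G n = Var n" for n
    by (auto simp: upN_simps numeral_eq_Suc less_Suc_eq)
  have "ps (dbody pr_rules (jEv (cst (code_prim e)) (cCons (Var 1) (cCons (Var 3) cNil)) 1)) ?G (\<lambda>n. n) =
      dbody pr_rules (jEv (cst (code_prim e)) (cCons (Var 1) (cCons (Var 3) cNil)) 1)"
    by (rule ps_closed_id[OF closed_dbodies(1)]) (use G in auto)
  moreover have "ps (dbody num_rules (jNum (pair (Var 1) (Var 2)) (Var 0))) ?G (\<lambda>n. n) = dbody num_rules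
      (jNum (pair (Var 1) (Var 2)) (Var 0))"
    by (rule ps_closed_id[OF closed_dbodies(2)]) (use G in auto)
  ultimately show ?thesis
    by (simp add: noslot_def itax_def ExB_def AllB_def upN_simps numeral_eq_Suc)
qed

lemma noslot_itth: "noslot (itax e (cst n))"
  by (rule noslot_closed[of 0]) (rule closed_mono[OF closed_itax[of 0]], simp_all)

lemma itax_cong:
  assumes "\<epsilon> 0 = \<epsilon>' 0" "\<epsilon> 1 = \<epsilon>' 1" "hval \<epsilon> q = hval \<epsilon>' q'"
  shows "hsat (itax e q) \<epsilon> E = hsat (itax e q') \<epsilon>' E'"
proof -
  have cg: "hsat p (case_nat w (case_nat t (case_nat y' (case_nat f (case_nat y \<epsilon>))))) E =
      hsat p (case_nat w (case_nat t (case_nat y' (case_nat f (case_nat y \<epsilon>'))))) E'"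
    if "closed 5 0 p" for p w t y' f y
    by (rule hsat_cong[OF that]) (auto simp: less_Suc_eq numeral_eq_Suc)
  show ?thesis unfolding itax_def
    using assms cg[OF closed_dbodies(1)[of e]] cg[OF closed_dbodies(2)] by (simp add: numeral_eq_Suc)
qed

text \<open>Theories whose axioms agree under their respective parameters have the same derivations.
  This identifies \<open>itth\<close>, where the parameter is a numeral, with the theory inside
  \<open>itrefl\<close>, where it is a free variable.\<close>

lemma der_all_cong:
  assumes "\<And>p. hsat (matrix T) (penv p e) E = hsat (matrix T') (penv p e') E'"
  shows "der (all_rules T) e E = der (all_rules T') e' E'"
proof -
  define r where "r T = infer_if (matrix T) [jFm 1 0 0 (Var 1)] (jPr (Var 1))" for T
  define R where "R = syntax_rules @ lift_subst_rules @ set_lift_subst_rules @ tl (proof_rules T)"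
  have R: "set (all_rules T) = insert (r T) (set R)" "set (all_rules T') = insert (r T') (set R)"
    by (simp_all add: all_rules_def R_def r_def proof_rules_def Let_def insert_commute)
  have cl: "closed 8 0 (side r)" if "r \<in> set R" for r
    using that by (auto simp: R_def syntax_rules_def lift_subst_rules_def set_lift_subst_rules_def proof_rules_def Let_def
        infer_def infer_if_def)
  have "hsat (side r) (penv p e) E = hsat (side r) (penv p e') E'" if "r \<in> set R" for r p
    by (rule hsat_cong[OF cl[OF that]]) (auto simp: penv_def)
  then have "inst (all_rules T) e E J z = inst (all_rules T') e' E' J z" for J z
    unfolding inst_def R by (simp add: r_def infer_if_def assms)
  then show ?thesis by (simp add: fun_eq_iff der_def valid_def)
qed

lemma fsat_itrefl:
  assumes F: "F \<subseteq> SS" and E: "\<And>n. E n \<in> SS"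
  shows "fsat F (itrefl e) (case_nat q \<epsilon>) E \<longleftrightarrow>
    (\<forall>z. pi11M z \<longrightarrow> der (all_rules (ExN (itax e (Var 14)))) (case_nat z (case_nat q \<epsilon>)) E (jPr z) \<longrightarrow> trM F (z :: 'a::arith))"
  unfolding itrefl_def
  by (rule fsat_RFN[OF _ _ F E]) (simp_all add: noslot_itax14 arithmetical_Delta0 Delta0_itax)

lemma hsat_itth:
  assumes E: "\<And>n. E n \<in> (SS :: 'a::arith set set)"
  shows "hsat (RFN (itth e y)) \<epsilon> E \<longleftrightarrow> hsat (itrefl e) (case_nat (cst (pair y (code (itrefl e)))) \<epsilon>') E"
proof -
  have eq: "der (all_rules (itth e y)) (case_nat z \<epsilon>) E =
      der (all_rules (ExN (itax e (Var 14)))) (case_nat z (case_nat (cst (pair y (code (itrefl e)))) \<epsilon>')) E" for z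
    by (rule der_all_cong) (unfold itth_def matrix_ExN, rule itax_cong, simp_all add: penv_def)
  have "hsat (RFN (itth e y)) \<epsilon> E \<longleftrightarrow> fsat SS (RFN (itth e y)) \<epsilon> E" by (simp only: fsat_SS)
  also have "\<dots> \<longleftrightarrow> (\<forall>z. pi11M z \<longrightarrow> der (all_rules (itth e y)) (case_nat z \<epsilon>) E (jPr z) \<longrightarrow> trM SS z)"
    by (rule fsat_RFN[OF _ _ subset_refl E]) (simp_all add: itth_def noslot_itth arithmetical_Delta0 Delta0_itax)
  also have "\<dots> \<longleftrightarrow> fsat SS (itrefl e) (case_nat (cst (pair y (code (itrefl e)))) \<epsilon>') E"
    unfolding fsat_itrefl[OF subset_refl E] eq ..
  finally show ?thesis by (simp only: fsat_SS)
qed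

section \<open>Iterated reflection in models with omega-jumps\<close>

definition wfM :: "prim_fun \<Rightarrow> 'a::arith itself \<Rightarrow> bool" where
  "wfM e _ \<longleftrightarrow> (\<forall>X\<in>SS. X \<noteq> {} \<longrightarrow> (\<exists>x\<in>X. \<forall>y\<in>X. leM e y x \<longrightarrow> y = (x::'a)))"

lemma hsat_WF:
  assumes "\<And>n. E n \<in> (SS :: 'a::arith set set)" shows "hsat (WF e) \<epsilon> E \<longleftrightarrow> wfM e TYPE('a)"
proof -
  have "X \<in> SS \<Longrightarrow> case_nat X E n \<in> SS" for X n using assms by (cases n) auto
  then show ?thesis unfolding WF_def wfM_def by (auto simp: hsat_pr_le Bex_def Ball_def)
qed

context
  fixes e :: prim_fun and W S :: "'a::arith set" and f :: 'a
  assumes W: "W \<in> SS" "om_closed W" "is_sat W S" "S \<in> SS" and f: "f = mc (itrefl e)"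
begin

text \<open>As \<open>f\<close> is the code of \<open>itrefl e\<close>, this is the truth of the
  axioms for \<open>y\<close> in the coded model. It is definable from the set \<open>S\<close>,
  which makes the well-foundedness of \<open>e\<close> applicable to it.\<close>

definition Pit :: "'a \<Rightarrow> bool" where
  "Pit y \<longleftrightarrow> (\<forall>t. numr (pair y f) t \<longrightarrow> (\<forall>l s. pair (AX t f) (pair l s) \<in> S))"

lemma it_provable:
  assumes ih: "\<And>y'. y' \<noteq> y \<Longrightarrow> leM e y' y \<Longrightarrow> Pit y'" and E: "\<And>n. E n \<in> SS"
    and der: "der (all_rules (ExN (itax e (Var 14)))) (case_nat z (case_nat (pair y f) \<epsilon>)) E (jPr x)"
  shows "pair x (pair l s) \<in> S"
proof (rule provable_sound[OF refl _ E W(3,4) _ der])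
  show "rules_ok (all_rules (ExN (itax e (Var 14))))"
    by (rule all_rules_ok) (simp_all add: noslot_itax14 arithmetical_Delta0 Delta0_itax)
  fix x0 x1 x2 x3 x4 x5 x6 x7 l s
  assume "hsat (matrix (ExN (itax e (Var 14)))) (penv ((!) [x0, x1, x2, x3, x4, x5, x6, x7])
      (case_nat z (case_nat (pair y f) \<epsilon>))) E"
  then have "itaxM e (pair y f) x1"
    using itax_sound[OF E, of e "Var 14" "penv ((!) [x0, x1, x2, x3, x4, x5, x6, x7]) (case_nat z (case_nat (pair y f) \<epsilon>))"]
    by (simp add: penv_def)
  then consider "x1 = mc Bsent" | y' t where "y' \<noteq> y" "leM e y' y" "numr (pair y' f) t" "x1 = AX t f"
    unfolding itaxM_def by auto
  then show "pair x1 (pair l s) \<in> S"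
  proof cases
    case 1
    then show ?thesis using truth_omega[OF W(3)] fsat_Bsent[OF W(1,2)] by simp
  next
    case (2 y' t)
    then show ?thesis using ih[of y'] unfolding Pit_def by blast
  qed
qed

text \<open>By soundness the sentence is true in the coded model, in particular with the section at
  \<open>i\<close> as its set, and \<open>sat_agree\<close> transfers this to \<open>S'\<close>.
  Here \<open>D\<close> and \<open>S'\<close> are arbitrary sets of the ambient model; only the set
  that interprets the variable is a section of \<open>W\<close>.\<close>

lemma it_tr:
  assumes ih: "\<And>y'. y' \<noteq> y \<Longrightarrow> leM e y' y \<Longrightarrow> Pit y'" and E: "\<And>n. E n \<in> SS" and pi: "pi11M x"
    and der: "der (all_rules (ExN (itax e (Var 14)))) (case_nat z (case_nat (pair y f) \<epsilon>)) E (jPr x)"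
    and x: "x = cAllS \<theta>" "D \<in> SS" "S' \<in> SS" "\<theta> \<in> D" "tarskiM (sec W i) D S'"
  shows "pair \<theta> cNil \<in> S'"
proof -
  have syn: "der syntax_rules (\<lambda>_. 0) (\<lambda>_. {}) (jFm 0 0 1 \<theta>)" using pi x(1) unfolding pi11M_def by (auto simp: code_defs)
  have "pair (cAllS \<theta>) (pair cNil cNil) \<in> S" using it_provable[OF ih E der] x(1) by simp
  then have "pair \<theta> (pair cNil (cCons i cNil)) \<in> S" using W(3) unfolding is_sat_def by blast
  moreover have "pair \<theta> cNil \<in> S' \<longleftrightarrow> pair \<theta> (pair cNil (cCons i cNil)) \<in> S"
    by (rule sat_agree[OF x(5) W(3) x(2,3) W(4) syn x(4)]) (simp add: good_def)
  ultimately show ?thesis by simp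
qed

text \<open>The failures of \<open>Pit\<close> form a set. At a minimal failure \<open>y\<close> all
  axioms of the theory at \<open>y\<close> are true in the coded model; then soundness gives the
  reflection principle for this theory there, which is what the axiom for \<open>y\<close>
  asserts.\<close>

lemma it_all: assumes "wfM e TYPE('a)" shows "Pit y"
proof (rule ccontr)
  assume n: "\<not> Pit y"
  have "{y. \<not> Pit y} \<in> SS" unfolding Pit_def AX_def code_defs
    by (intro SS_Collect d_not d_all d_imp d_numr d_mem W dts)
  moreover have "{y. \<not> Pit y} \<noteq> {}" using n by blast
  ultimately have "\<exists>x\<in>{y. \<not> Pit y}. \<forall>y\<in>{y. \<not> Pit y}. leM e y x \<longrightarrow> y = x"
    by (rule assms[unfolded wfM_def, rule_format])
  then obtain y where y: "\<not> Pit y" and "\<forall>y'\<in>{y. \<not> Pit y}. leM e y' y \<longrightarrow> y' = y" by auto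
  then have ih: "\<And>y'. y' \<noteq> y \<Longrightarrow> leM e y' y \<Longrightarrow> Pit y'" by auto
  from y obtain t l s where t: "numr (pair y f) t" "pair (AX t f) (pair l s) \<notin> S" unfolding Pit_def by blast
  note st = W(3)[unfolded is_sat_def]
  have "\<exists>a. pair (cEq (cVar 0) t) (pair (cCons a l) s) \<in> S \<and> pair f (pair (cCons a l) s) \<notin> S"
    using t(2) st by (simp add: AX_def)
  then obtain a where a: "pair (cEq (cVar 0) t) (pair (cCons a l) s) \<in> S" "pair f (pair (cCons a l) s) \<notin> S" by blast
  have "\<exists>v. V (cCons a l) (cVar 0) v \<and> V (cCons a l) t v" using a(1) st by simp
  then obtain v where "V (cCons a l) (cVar 0) v" "V (cCons a l) t v" by blast
  \<comment> \<open>The premise of the axiom equates the variable 0 with the numeral of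
    \<open>pair y f\<close>; this is how the pair becomes the value of the free variable of
    \<open>itrefl e\<close>.\<close>
  then have av: "a = pair y f" using numr_V[OF t(1)] by simp
  have Es: "\<And>n. sec W (lke s n) \<in> SS" by (rule sec_SS[OF W(1)])
  have Fs: "range (sec W) \<subseteq> SS" using sec_SS[OF W(1)] by blast
  have "fsat (range (sec W)) (itrefl e) (case_nat (pair y f) (lke l)) (\<lambda>n. sec W (lke s n))"
    unfolding fsat_itrefl[OF Fs Es]
  proof (intro allI impI)
    fix z assume z: "pi11M z" "der (all_rules (ExN (itax e (Var 14)))) (case_nat z (case_nat (pair y f) (lke l)))
           (\<lambda>n. sec W (lke s n)) (jPr z)"
    show "trM (range (sec W)) z" unfolding trM_def
    proof (intro allI impI ballI)
      fix \<theta> X D S' assume h: "z = cAllS \<theta>" "X \<in> range (sec W)" "D \<in> range (sec W)" "S' \<in> range (sec W)" "\<theta> \<in> D" "tarskiM X D S'"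
      then obtain i where i: "X = sec W i" by blast
      show "pair \<theta> cNil \<in> S'"
        by (rule it_tr[OF ih Es z(1) z(2) h(1) subsetD[OF Fs h(3)] subsetD[OF Fs h(4)] h(5) h(6)[unfolded i]])
    qed
  qed
  then have "pair f (pair (cCons a l) s) \<in> S" unfolding f truth_omega[OF W(3)] lke_Cons av by (simp add: f)
  then show False using a(2) by simp
qed

end

text \<open>Truth of a sentence with one leading set quantifier is verified for one \<open>X\<close>
  at a time, so the coded model may depend on \<open>X\<close> and is chosen to have
  \<open>X\<close> as a section.\<close>

theorem itrefl_holds:
  fixes y :: "'a::arith"
  assumes oj: "omega_jumps TYPE('a)" and wf: "wfM e TYPE('a)" and E: "\<And>n. E n \<in> (SS :: 'a set set)"
  shows "hsat (itrefl e) (case_nat (pair y (mc (itrefl e))) \<epsilon>) E"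
proof -
  have "fsat SS (itrefl e) (case_nat (pair y (mc (itrefl e))) \<epsilon>) E"
    unfolding fsat_itrefl[OF subset_refl E]
  proof (intro allI impI)
    fix z assume z: "pi11M z" "der (all_rules (ExN (itax e (Var 14)))) (case_nat z (case_nat (pair y (mc (itrefl e))) \<epsilon>)) E
        (jPr z)"
    show "trM SS z" unfolding trM_def
    proof (intro allI impI ballI)
      fix \<theta> X D S' assume h: "z = cAllS \<theta>" "X \<in> SS" "D \<in> SS" "S' \<in> SS" "\<theta> \<in> D" "tarskiM X D S'"
      obtain W i where W: "W \<in> SS" "om_closed W" "\<forall>x. pair i x \<in> W \<longleftrightarrow> x \<in> X"
        using omega_model_exists[OF oj h(2)] by blast
      obtain S where S: "S \<in> SS" "is_sat W S" using is_sat_exists[OF oj W(1)] by blast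
      have X: "X = sec W i" using W(3) by (auto simp: sec_def)
      show "pair \<theta> cNil \<in> S'"
        by (rule it_tr[OF W(1,2) S(2,1) refl it_all[OF W(1,2) S(2,1) refl wf] E z(1) z(2) h(1,3,4,5) h(6)[unfolded X]])
    qed
  qed
  then show ?thesis by (simp only: fsat_SS)
qed

corollary RFN_itth:
  assumes "omega_jumps TYPE('a::arith)" "wfM e TYPE('a)" "\<And>n. E n \<in> (SS :: 'a set set)"
  shows "hsat (RFN (itth e y)) \<epsilon> E"
proof -
  have "hsat (itrefl e) (case_nat (pair (cst y) (mc (itrefl e))) \<epsilon>) E" by (rule itrefl_holds[OF assms])
  then show ?thesis unfolding hsat_itth[where \<epsilon>' = \<epsilon> and E = E, OF assms(3)] by (simp add: cst_hom cst_code)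
qed


section \<open>The iterated theories in the standard model\<close>

lemma mc_nat [simp]: "mc p = code p" using cst_code[of p, where 'a=nat] by simp
lemma mc_tm_nat [simp]: "mc_tm t = code_tm t" using cst_code_tm[of t, where 'a=nat] by simp

lemma code_tm_inject [simp]: "code_tm s = code_tm t \<longleftrightarrow> s = t"
  by (induct s arbitrary: t; case_tac t; simp add: code_defs)

lemma code_inject [simp]: "code p = code q \<longleftrightarrow> p = q"
  by (induct p arbitrary: q; case_tac q; simp add: code_defs)

definition AXs :: "prim_fun \<Rightarrow> nat \<Rightarrow> fm" where
  "AXs e y = AllN (Imp (Eq (Var 0) (num (pair y (code (itrefl e))))) (itrefl e))"

lemma closed_Pi11_code: "closed_tm m x \<Longrightarrow> closed m s (Pi11_code x)"
proof -
  assume x: "closed_tm m x"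
  have "closed (Suc m) s (Der syntax_rules (jFm 0 0 1 (Var 0)))"
    by (rule closed_Der) (auto simp: syntax_rules_def Let_def infer_def infer_if_def judgement_defs code_defs)
  then show ?thesis using closed_tm_up_n[OF x, of 1] by (simp add: Pi11_code_def code_defs)
qed

lemma closed_Tarski: "closed 0 3 Tarski"
  by (auto simp: Tarski_def code_defs)

lemma closed_Tr: "closed_tm m x \<Longrightarrow> closed m s (Tr x)"
proof -
  assume x: "closed_tm m x"
  have "closed (Suc m) (Suc (Suc (Suc s))) Tarski" by (rule closed_mono[OF closed_Tarski]) auto
  then show ?thesis using closed_tm_up_n[OF x, of 1] by (simp add: Tr_def code_defs cNil_def)
qed

lemma closed_RFN: "closed (14 + m) 0 (matrix T) \<Longrightarrow> closed m 0 (RFN T)"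
proof -
  assume T: "closed (14 + m) 0 (matrix T)"
  have "closed (Suc m) 0 (Prov T (Var 0))" unfolding Prov_def
    by (rule closed_Der)
      (use T in \<open>auto simp: syntax_rules_def lift_subst_rules_def set_lift_subst_rules_def proof_rules_def
        Let_def infer_def infer_if_def judgement_defs code_defs\<close>)
  then show ?thesis by (simp add: RFN_def closed_Tr closed_Pi11_code)
qed

lemma closed_itrefl: "closed 1 0 (itrefl e)"
  unfolding itrefl_def by (rule closed_RFN) (use closed_itax[of 13 "Var 14" e] in simp)

lemma sentence_AXs: "sentence (AXs e y)"
  using closed_itrefl[of e] by (simp add: AXs_def)

lemma AX_code: "AX (code_tm (num (pair y (code (itrefl e))))) (code (itrefl e)) = code (AXs e y)"
  by (simp add: AX_def AXs_def)

lemma is_axiom_itth: "is_axiom (itth e y) n \<longleftrightarrow> n = code Bsent \<or> (\<exists>y'. y' \<noteq> y \<and> leM e y' y \<and> n = code (AXs e y'))"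
proof -
  have E: "\<And>n. (\<lambda>_. {}) n \<in> (SS :: nat set set)" by (simp add: SS_nat_def)
  let ?q = "cst (pair y (code (itrefl e))) :: tm"
  have "is_axiom (itth e y) n \<longleftrightarrow> (\<exists>v. hsat (itax e ?q) (case_nat v (case_nat n (\<lambda>_. 0))) (\<lambda>_. {}))"
    by (simp add: is_axiom_def itth_def flip: hsat_nat)
  also have "\<dots> \<longleftrightarrow> itaxM e (pair y (code (itrefl e))) n"
    using itax_sound[OF E, of e ?q "case_nat _ (case_nat n (\<lambda>_. 0))"]
      itax_complete[OF E, of "case_nat n (\<lambda>_. 0)" ?q "pair y (code (itrefl e))" e] by fastforce
  also have "\<dots> \<longleftrightarrow> n = code Bsent \<or> (\<exists>y'. y' \<noteq> y \<and> leM e y' y \<and> n = code (AXs e y'))"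
    using numr_num[where 'a=nat] by (auto simp: itaxM_def AX_code)
  finally show ?thesis .
qed

lemma re_theory_itth: "re_theory (itth e y)"
proof -
  have "closed 2 0 (itax e (cst (pair y (code (itrefl e)))))" using closed_itax[of 0] by (simp add: numeral_2_eq_2)
  then show ?thesis unfolding re_theory_def is_axiom_itth
    using sentence_Bsent sentence_AXs[of e] Delta0_itax by (auto simp: itth_def Sigma1_def numeral_2_eq_2)
qed

lemma axioms_itth: "axioms (itth e y) = insert Bsent {AXs e y' | y'. y' \<noteq> y \<and> leM e y' y}"
  using sentence_Bsent sentence_AXs[of e] by (auto simp: axioms_def is_axiom_itth)

lemma sentence_RFN_itth: "sentence (RFN (itth e y))"
  by (rule closed_RFN) (use closed_itax[of 12 "cst (pair y (code (itrefl e)))" e] in \<open>simp add: itth_def\<close>)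

lemma hsat_sentence: "sentence p \<Longrightarrow> hsat p e E = hsat p (e' :: nat \<Rightarrow> 'a) E'" for e :: "nat \<Rightarrow> 'a::arith"
  using hsat_cong[of 0 0 p e e' E E'] by simp

lemma hsat_AXs: "hsat (AXs e y) (\<epsilon> :: nat \<Rightarrow> 'a::arith) E \<longleftrightarrow> hsat (RFN (itth e y)) (\<epsilon>' :: nat \<Rightarrow> 'a) E'"
proof -
  let ?E = "\<lambda>_. {} :: 'a set"
  have "hsat (AXs e y) \<epsilon> E \<longleftrightarrow> hsat (AXs e y) \<epsilon> ?E" by (rule hsat_sentence[OF sentence_AXs])
  also have "\<dots> \<longleftrightarrow> hsat (itrefl e) (case_nat (cst (pair y (code (itrefl e)))) \<epsilon>) ?E" by (simp add: AXs_def)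
  also have "\<dots> \<longleftrightarrow> hsat (RFN (itth e y)) \<epsilon>' ?E" by (rule hsat_itth[symmetric]) simp
  also have "\<dots> \<longleftrightarrow> hsat (RFN (itth e y)) \<epsilon>' E'" by (rule hsat_sentence[OF sentence_RFN_itth])
  finally show ?thesis .
qed

lemma leM_nat: assumes "arity 2 e" shows "leM e x y \<longleftrightarrow> (x, y) \<in> pr_rel e"
proof -
  have "vals pr_rules {} (code_prim e) [x, y] (peval e [x, y])" by (rule vals_peval[OF assms]) simp
  then have "ev pr_rules {} (code_prim e) (lst [x, y]) 1 \<longleftrightarrow> 1 = peval e [x, y]" unfolding vals_def by (rule spec)
  then show ?thesis unfolding leM_def pr_rel_def cst_nat lst_simps mem_Collect_eq prod.case by (rule trans) (rule eq_commute)
qed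

section \<open>Instances of the reflection principle with nonstandard numerals\<close>

text \<open>
  Formulas of standard shape that contain arbitrary elements of a model in place of terms. They include the codes of
  instances with a nonstandard numeral, and still have a definable satisfaction class.
\<close>

datatype 'a gfm = GEq 'a 'a | GLess 'a 'a | GMem 'a 'a | GFls | GImp "'a gfm" "'a gfm" | GAllN "'a gfm"

primrec gc :: "'a gfm \<Rightarrow> 'a::arith" where
  "gc (GEq x y) = cEq x y"
| "gc (GLess x y) = cLess x y"
| "gc (GMem x n) = cMem x n"
| "gc GFls = cFls"
| "gc (GImp g h) = cImp (gc g) (gc h)"
| "gc (GAllN g) = cAllN (gc g)"

primrec gsat :: "'a set \<Rightarrow> 'a gfm \<Rightarrow> 'a::arith \<Rightarrow> bool" where
  "gsat X (GEq x y) l \<longleftrightarrow> (\<exists>v. valr l x v \<and> valr l y v)"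
| "gsat X (GLess x y) l \<longleftrightarrow> (\<exists>v w. v < w \<and> valr l x v \<and> valr l y w)"
| "gsat X (GMem x n) l \<longleftrightarrow> (\<exists>v. v \<in> X \<and> valr l x v)"
| "gsat X GFls l \<longleftrightarrow> False"
| "gsat X (GImp g h) l \<longleftrightarrow> (gsat X g l \<longrightarrow> gsat X h l)"
| "gsat X (GAllN g) l \<longleftrightarrow> (\<forall>a. gsat X g (cCons a l))"

primrec subs :: "'a gfm \<Rightarrow> 'a gfm list" where
  "subs (GEq x y) = [GEq x y]"
| "subs (GLess x y) = [GLess x y]"
| "subs (GMem x n) = [GMem x n]"
| "subs GFls = [GFls]"
| "subs (GImp g h) = GImp g h # subs g @ subs h"
| "subs (GAllN g) = GAllN g # subs g"

lemma subs_refl: "g \<in> set (subs g)" by (cases g) auto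
lemma subs_closed:
  "GImp g h \<in> set (subs G) \<Longrightarrow> g \<in> set (subs G) \<and> h \<in> set (subs G)"
  "GAllN g \<in> set (subs G) \<Longrightarrow> g \<in> set (subs G)"
  by (induct G) (auto simp: subs_refl)

lemma gc_inject [simp]: "gc g = gc h \<longleftrightarrow> g = h"
  by (induct g arbitrary: h; case_tac h; simp add: code_defs)

lemma d_gsat: "X \<in> SS \<Longrightarrow> dt t \<Longrightarrow> d (\<lambda>e. gsat X g (t e :: 'a::arith))"
proof -
  assume X: "X \<in> SS"
  have "d (\<lambda>e. gsat X g (e 0))"
  proof (induct g)
    case (GAllN g)
    show ?case unfolding gsat.simps by (rule d_all) (rule d_subst1[of "gsat X g", OF GAllN], intro dts)
  qed (unfold gsat.simps; intro d_ex d_conj d_imp d_less d_valr d_mem X d_False dts; assumption)+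
  then show "dt t \<Longrightarrow> d (\<lambda>e. gsat X g (t e))" by (rule d_subst1)
qed

text \<open>A formula of standard shape has finitely many subformulas, so \<open>?D\<close> and
  \<open>?S\<close> are finite unions of definable sets and exist by arithmetical comprehension.
  They form one of the satisfaction classes over which the truth definition quantifies.\<close>

lemma trM_gsat:
  assumes tr: "trM SS (cAllS (gc G))" and X: "X \<in> SS" shows "gsat X G (cNil::'a::arith)"
proof -
  let ?D = "{x. \<exists>g\<in>set (subs G). x = gc g}" and ?S = "{z. \<exists>g\<in>set (subs G). \<exists>l. z = pair (gc g) l \<and> gsat X g l}"
  have D: "gc g \<in> ?D \<longleftrightarrow> g \<in> set (subs G)" for g by auto
  have S: "pair (gc g) l \<in> ?S \<longleftrightarrow> g \<in> set (subs G) \<and> gsat X g l" for g l by auto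
  have DSS: "?D \<in> SS" by (intro SS_Collect d_bex_list d_eq dts)
  have SSS: "?S \<in> SS" by (intro SS_Collect d_bex_list d_eq d_ex d_conj d_gsat X dts)
  have inv: "cEq x y \<in> ?D \<longleftrightarrow> GEq x y \<in> set (subs G)" "cLess x y \<in> ?D \<longleftrightarrow> GLess x y \<in> set (subs G)"
    "cMem x y \<in> ?D \<longleftrightarrow> GMem x y \<in> set (subs G)" "cFls \<in> ?D \<longleftrightarrow> GFls \<in> set (subs G)" for x y
    using D[of "GEq x y"] D[of "GLess x y"] D[of "GMem x y"] D[of GFls] by (simp_all del: mem_Collect_eq)
  have inv2: "cImp x y \<in> ?D \<Longrightarrow> \<exists>g h. x = gc g \<and> y = gc h \<and> GImp g h \<in> set (subs G)" for x y
  proof -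
    assume "cImp x y \<in> ?D"
    then obtain k where "k \<in> set (subs G)" "gc k = cImp x y" by auto
    then show ?thesis by (cases k rule: gfm.exhaust; simp add: code_defs) blast?
  qed
  have inv3: "cAllN x \<in> ?D \<Longrightarrow> \<exists>g. x = gc g \<and> GAllN g \<in> set (subs G)" for x
  proof -
    assume "cAllN x \<in> ?D"
    then obtain k where "k \<in> set (subs G)" "gc k = cAllN x" by auto
    then show ?thesis by (cases k rule: gfm.exhaust; simp add: code_defs) blast?
  qed
  have "tarskiM X ?D ?S" unfolding tarskiM_def
  proof (intro conjI allI impI)
    fix x y l assume "cEq x y \<in> ?D" then show "pair (cEq x y) l \<in> ?S \<longleftrightarrow> (\<exists>v. valr l x v \<and> valr l y v)"
      using S[of "GEq x y" l] unfolding inv gc.simps gsat.simps by simp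
  next
    fix x y l assume "cLess x y \<in> ?D" then show "pair (cLess x y) l \<in> ?S \<longleftrightarrow> (\<exists>v w. v < w \<and> valr l x v \<and> valr l y w)"
      using S[of "GLess x y" l] unfolding inv gc.simps gsat.simps by simp
  next
    fix x n l assume "cMem x n \<in> ?D" then show "pair (cMem x n) l \<in> ?S \<longleftrightarrow> (\<exists>v. v \<in> X \<and> valr l x v)"
      using S[of "GMem x n" l] unfolding inv gc.simps gsat.simps by simp
  next
    fix l show "pair cFls l \<notin> ?S"
      using S[of GFls l] unfolding gc.simps gsat.simps by simp
  next
    fix x y assume "cImp x y \<in> ?D" from inv2[OF this] obtain g h where g: "x = gc g" "y = gc h" "GImp g h \<in> set (subs G)"
        by blast
    note sc = subs_closed(1)[OF g(3)]
    show "x \<in> ?D" "y \<in> ?D" using sc D g by (simp_all del: mem_Collect_eq)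
    fix l show "pair (cImp x y) l \<in> ?S \<longleftrightarrow> (pair x l \<in> ?S \<longrightarrow> pair y l \<in> ?S)"
      using S[of "GImp g h" l] S[of g l] S[of h l] sc g by (simp del: mem_Collect_eq)
  next
    fix x assume "cAllN x \<in> ?D" from inv3[OF this] obtain g where g: "x = gc g" "GAllN g \<in> set (subs G)" by blast
    note sc = subs_closed(2)[OF g(2)]
    show "x \<in> ?D" using sc D g by (simp del: mem_Collect_eq)
    fix l show "pair (cAllN x) l \<in> ?S \<longleftrightarrow> (\<forall>a. pair x (cCons a l) \<in> ?S)"
      using S[of "GAllN g" l] S[of g] sc g by (simp del: mem_Collect_eq)
  qed
  note tk = this
  have "gc G \<in> ?D" unfolding D by (rule subs_refl)
  then have "pair (gc G) cNil \<in> ?S"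
    by (rule tr[unfolded trM_def, rule_format, OF refl X DSS SSS _ tk])
  then show ?thesis unfolding S by (rule conjunct2)
qed


section \<open>Standard arithmetical formulas among the formulas with elements of the model\<close>

primrec g_of :: "fm \<Rightarrow> 'a::arith gfm" where
  "g_of (Eq s t) = GEq (mc_tm s) (mc_tm t)"
| "g_of (Less s t) = GLess (mc_tm s) (mc_tm t)"
| "g_of (Mem t n) = GMem (mc_tm t) (cst n)"
| "g_of Fls = GFls"
| "g_of (Imp p q) = GImp (g_of p) (g_of q)"
| "g_of (AllN p) = GAllN (g_of p)"
| "g_of (AllS p) = GFls"

lemma gc_g_of: "arithmetical p \<Longrightarrow> gc (g_of p) = mc p"
  by (induct p) auto

lemma valr_mc:
  fixes xs :: "'a::arith list"
  shows "closed_tm (length xs) t \<Longrightarrow> valr (lst xs) (mc_tm t) v \<longleftrightarrow> v = hval (\<lambda>n. xs ! n) t"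
proof (induct t arbitrary: v)
  case (Var n)
  have "n < length xs \<Longrightarrow> look (lst xs) (cst n) v \<longleftrightarrow> v = xs ! n" for xs :: "'a list"
  proof (induct n arbitrary: xs)
    case 0 then show ?case by (cases xs) auto
  next
    case (Suc n) then show ?case by (cases xs) auto
  qed
  then show ?case using Var by simp
qed auto

lemma gsat_g_of:
  fixes xs :: "'a::arith list"
  shows "arithmetical p \<Longrightarrow> closed (length xs) 1 p \<Longrightarrow> gsat X (g_of p) (lst xs) \<longleftrightarrow> hsat p (\<lambda>n. xs ! n) (\<lambda>_. X)"
proof (induct p arbitrary: xs)
  case (Less s t) then show ?case by (auto simp: valr_mc)
next
  case (AllN p)
  have "gsat X (g_of p) (cCons a (lst xs)) = hsat p (case_nat a (\<lambda>n. xs ! n)) (\<lambda>_. X)" for a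
  proof -
    have "(\<lambda>n. (a # xs) ! n) = case_nat a (\<lambda>n. xs ! n)" by (auto simp: fun_eq_iff split: nat.split)
    then show ?thesis using AllN.hyps[of "a # xs"] AllN.prems by simp
  qed
  then show ?case by simp
qed (auto simp: valr_mc)

lemma numr_valr: "numr n t \<Longrightarrow> valr l t v \<longleftrightarrow> v = (n::'a::arith)"
proof -
  have "\<forall>t v. numr n t \<longrightarrow> (valr l t v \<longleftrightarrow> v = n)"
  proof (rule ind[of "\<lambda>n. \<forall>t v. numr n t \<longrightarrow> (valr l t v \<longleftrightarrow> v = n)"])
    show "d (\<lambda>e. \<forall>t v. numr (e 0) t \<longrightarrow> (valr l t v \<longleftrightarrow> v = e 0))" by (intro d_all d_imp d_iff d_eq d_valr d_numr dts)
  qed auto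
  then show "numr n t \<Longrightarrow> valr l t v \<longleftrightarrow> v = n" by blast
qed

section \<open>Codes that a model recognizes as formulas\<close>

definition syn :: "'a::arith \<Rightarrow> bool" where "syn = der syntax_rules (\<lambda>_. 0) (\<lambda>_. {})"

lemma syn_iff: "syn z \<longleftrightarrow> (\<exists>r\<in>set syntax_rules. fires r (\<lambda>_. 0) (\<lambda>_. {}) {y. syn y} z)"
  unfolding syn_def by (rule der_iff[OF syntax_rules_ok])

lemmas syn_expand = syntax_rules_def Let_def judgement_defs code_defs penv_def

lemma syn_tm:
  "n < m \<Longrightarrow> syn (jTm m (cVar n))" "syn (jTm m cZero)" "syn (jTm m cOne)"
  "syn (jTm m x) \<Longrightarrow> syn (jTm m y) \<Longrightarrow> syn (jTm m (cPlus x y))"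
  "syn (jTm m x) \<Longrightarrow> syn (jTm m y) \<Longrightarrow> syn (jTm m (cTimes x (y::'a::arith)))"
  by (subst syn_iff, simp add: syn_expand)+

lemma syn_fm:
  "syn (jTm m x) \<Longrightarrow> syn (jTm m y) \<Longrightarrow> syn (jFm q m s (cEq x y))"
  "syn (jTm m x) \<Longrightarrow> syn (jTm m y) \<Longrightarrow> syn (jFm q m s (cLess x y))"
  "syn (jTm m x) \<Longrightarrow> n < s \<Longrightarrow> syn (jFm q m s (cMem x n))"
  "syn (jFm q m s cFls)"
  "syn (jFm q m s x) \<Longrightarrow> syn (jFm q m s y) \<Longrightarrow> syn (jFm q m s (cImp x y))"
  "syn (jFm q (m + 1) s x) \<Longrightarrow> syn (jFm q m s (cAllN x))"
  "syn (jFm 1 m (s + 1) x) \<Longrightarrow> syn (jFm 1 m s (cAllS (x::'a::arith)))"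
  by (subst syn_iff, simp add: syn_expand)+

lemma cst_less: "n < m \<Longrightarrow> cst n < (cst m :: 'a::arith)" by (simp add: cst_of_nat)

lemma syn_code_tm: "closed_tm m t \<Longrightarrow> syn (jTm (cst m) (mc_tm t :: 'a::arith))"
  by (induct t) (auto intro: syn_tm cst_less)

lemma syn_code: "closed m s p \<Longrightarrow> arithmetical p \<or> q = 1 \<Longrightarrow> syn (jFm q (cst m) (cst s) (mc p :: 'a::arith))"
proof (induct p arbitrary: m s)
  case (AllN p)
  then have "syn (jFm q (cst m + 1) (cst s) (mc p :: 'a))" using AllN.hyps[of "Suc m" s] by simp
  then show ?case by (simp add: syn_fm)
next
  case (AllS p)
  then have "syn (jFm 1 (cst m) (cst s + 1) (mc p :: 'a))" using AllS.hyps[of m "Suc s"] by simp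
  then show ?case using AllS.prems by (simp add: syn_fm)
qed (auto intro!: syn_fm syn_code_tm cst_less)

lemma syn_numr: "numr n t \<Longrightarrow> syn (jTm m (t::'a::arith))"
proof -
  have "\<forall>t. numr n t \<longrightarrow> syn (jTm m t)"
  proof (rule ind[of "\<lambda>n. \<forall>t. numr n t \<longrightarrow> syn (jTm m t)"])
    show "d (\<lambda>e. \<forall>t. numr (e 0) t \<longrightarrow> syn (jTm m t))" unfolding syn_def jTm_def
      by (intro d_all d_imp d_numr d_der syntax_rules_ok empty_SS dts)
  qed (auto simp: syn_tm)
  then show "numr n t \<Longrightarrow> syn (jTm m t)" by blast
qed

section \<open>Well-foundedness of a possibly nonstandard program\<close>

definition wf_body :: "tm \<Rightarrow> fm" where
  "wf_body c = Imp (ExN (Mem (Var 0) 0))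
     (ExN (Conj (Mem (Var 0) 0)
       (AllN (Imp (Mem (Var 0) 0) (Imp (Der pr_rules (jEv c (cCons (Var 0) (cCons (Var 1) cNil)) 1)) (Eq (Var 0) (Var 1)))))))"

text \<open>
  \<open>Wrap c\<close> is equivalent to \<open>WF e\<close> if \<open>c\<close> is the code of \<open>e\<close>; its code is \<open>wrapc\<close> of the code of the numeral of \<open>c\<close>.
  So it makes sense for a program \<open>c\<close> in a model.
\<close>

definition Wrap :: "nat \<Rightarrow> fm" where
  "Wrap c = AllS (AllN (Imp (Eq (Var 0) (num c)) (wf_body (Var 2))))"

definition wrapc :: "'a \<Rightarrow> 'a::{zero,one,plus,times}" where
  "wrapc t = cAllS (cAllN (cImp (cEq (cVar 0) t) (mc (wf_body (Var 2)))))"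

lemma mc_Wrap: "mc (Wrap c) = wrapc (mc_tm (num c))"
  by (simp add: Wrap_def wrapc_def)

lemma WF_body: "WF e = AllS (wf_body (cst (code_prim e)))"
  by (simp add: WF_def wf_body_def pr_le_def)

definition wfG :: "'a::arith \<Rightarrow> bool" where
  "wfG c \<longleftrightarrow> (\<forall>X\<in>SS. X \<noteq> {} \<longrightarrow> (\<exists>x\<in>X. \<forall>y\<in>X. ev pr_rules {} c (cCons y (cCons x cNil)) 1 \<longrightarrow> y = (x::'a)))"

lemma arithmetical_wf_body: "arithmetical (wf_body c)"
  by (simp add: wf_body_def pr_rules_ok)

lemma closed_wf_body: "closed 1 1 (wf_body (Var 2))"
proof -
  have "closed 3 1 (Der pr_rules (jEv (Var 2) (cCons (Var 0) (cCons (Var 1) cNil)) 1))"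
    by (rule closed_Der) (auto simp: pr_rules_def Let_def infer_def ev_defs alg_defs)
  then show ?thesis by (simp add: wf_body_def numeral_eq_Suc)
qed

lemma hsat_wf_body:
  assumes X: "X \<in> SS" and E: "\<And>n. E n \<in> SS" "E 0 = X" and c: "\<And>x y. hval (case_nat y (case_nat x \<epsilon>)) c = c'"
  shows "hsat (wf_body c) \<epsilon> E \<longleftrightarrow> (X \<noteq> {} \<longrightarrow> (\<exists>x\<in>X. \<forall>y\<in>X. ev pr_rules {} c' (cCons y (cCons x cNil)) 1 \<longrightarrow> y = (x::'a::arith)))"
  unfolding wf_body_def by (simp add: hsat_Der_pr[OF E(1)] E(2) c Bex_def Ball_def) blast

definition provM :: "fm \<Rightarrow> 'a::arith \<Rightarrow> bool" where
  "provM T x \<longleftrightarrow> der (all_rules T) (\<lambda>_. 0) (\<lambda>_. {}) (jPr x)"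

lemma re_theory_matrix:
  assumes "re_theory T"
  shows "T = ExN (matrix T)" "Delta0 (matrix T)" "closed 2 0 (matrix T)" "noslot (matrix T)" "arithmetical (matrix T)"
proof -
  obtain q where q: "Delta0 q" "T = ExN q" using assms unfolding re_theory_def Sigma1_def by blast
  then show 1: "T = ExN (matrix T)" "Delta0 (matrix T)" by simp_all
  show 2: "closed 2 0 (matrix T)" using assms q unfolding re_theory_def by (simp add: numeral_2_eq_2)
  show "noslot (matrix T)" by (rule noslot_closed[of 0]) (rule closed_mono[OF 2], simp_all)
  show "arithmetical (matrix T)" by (rule arithmetical_Delta0) (rule 1)
qed

lemma der_provM: assumes "re_theory T" shows "der (all_rules T) e E (jPr x) \<longleftrightarrow> provM T (x::'a::arith)"
proof -
  have "closed 8 0 (matrix T)" by (rule closed_mono[OF re_theory_matrix(3)[OF assms]]) simp_all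
  then have "\<forall>r\<in>set (all_rules T). closed 8 0 (side r)"
    by (simp add: all_rules_def syntax_rules_def lift_subst_rules_def set_lift_subst_rules_def proof_rules_def Let_def infer_def
        infer_if_def)
  then have "der (all_rules T) e E = der (all_rules T) (\<lambda>_. 0) (\<lambda>_. {})" by (rule der_closed) simp
  then show ?thesis by (simp add: provM_def)
qed

text \<open>\<open>c\<close> may be nonstandard, but apart from its numeral \<open>wrapc t\<close>
  has the standard shape of \<open>Wrap\<close>. So the truth definition can be evaluated on it by
  \<open>trM_gsat\<close>.\<close>

lemma RFN_wfG:
  fixes \<epsilon> :: "nat \<Rightarrow> 'a::arith"
  assumes T: "re_theory T" and E: "\<And>n. E n \<in> SS" and rfn: "hsat (RFN T) \<epsilon> E"
    and p: "numr c t" "provM T (wrapc t)"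
  shows "wfG (c::'a)"
  unfolding wfG_def
proof (intro ballI)
  fix X :: "'a set" assume X: "X \<in> SS"
  let ?G = "GAllN (GImp (GEq (cVar 0) t) (g_of (wf_body (Var 2))))"
  have wc: "wrapc t = cAllS (gc ?G)" by (simp add: wrapc_def gc_g_of arithmetical_wf_body)
  have "syn (jFm 0 (0 + 1) 1 (mc (wf_body (Var 2)) :: 'a))"
    using syn_code[OF closed_wf_body, of 0] arithmetical_wf_body by simp
  then have "syn (jFm 0 0 1 (gc ?G))"
    using syn_tm(1)[of 0 1] syn_numr[OF p(1)]
        by (auto intro!: syn_fm simp: gc_g_of arithmetical_wf_body less_plus1[of 0 0, simplified])
  then have "pi11M (wrapc t)" unfolding pi11M_def wc syn_def by blast
  moreover have "\<forall>z. pi11M z \<longrightarrow> der (all_rules T) (case_nat z \<epsilon>) E (jPr z) \<longrightarrow> trM SS z"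
    using rfn fsat_RFN[OF re_theory_matrix(4,5)[OF T] subset_refl E, of \<epsilon>] by (simp add: fsat_SS)
  ultimately have "trM SS (wrapc t)" using p(2) der_provM[OF T] by blast
  then have "gsat X ?G cNil" unfolding wc using X by (rule trM_gsat)
  then have "gsat X (g_of (wf_body (Var 2))) (lst [c])"
    using numr_valr[OF p(1)] by simp
  then have "hsat (wf_body (Var 2)) (\<lambda>n. [c] ! n) (\<lambda>_. X)"
    using gsat_g_of[OF arithmetical_wf_body, of "[c]" "Var 2" X] closed_wf_body by simp
  then show "X \<noteq> {} \<longrightarrow> (\<exists>x\<in>X. \<forall>y\<in>X. ev pr_rules {} c (cCons y (cCons x cNil)) 1 \<longrightarrow> y = x)"
    by (subst (asm) hsat_wf_body[of X _ _ _ c]) (simp_all add: X numeral_2_eq_2)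
qed

lemma hsat_Wrap:
  assumes "\<And>n. E n \<in> (SS :: 'a::arith set set)" shows "hsat (Wrap (code_prim e)) \<epsilon> E \<longleftrightarrow> wfM e TYPE('a)"
proof -
  have E': "X \<in> SS \<Longrightarrow> case_nat X E n \<in> SS" for X n using assms by (cases n) auto
  have "hsat (Wrap (code_prim e)) \<epsilon> E \<longleftrightarrow> (\<forall>X\<in>SS. hsat (wf_body (Var 2)) (case_nat (cst (code_prim e)) \<epsilon>) (case_nat X E))"
    by (simp add: Wrap_def)
  also have "\<dots> \<longleftrightarrow> wfM e TYPE('a)"
    unfolding wfM_def leM_def
    by (intro ball_cong refl hsat_wf_body) (simp_all add: E' numeral_2_eq_2)
  finally show ?thesis .
qed

section \<open>Sums of well-orders\<close>

lemma pr_fires: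
  assumes "\<exists>r\<in>set pr_rules. fires r e E J (z::'a::arith)"
  shows "(\<exists>l. z = jEv cZ l 0) \<or> (\<exists>x l. z = jEv cS (cCons x l) (x + 1)) \<or> (\<exists>x l. z = jEv (cId 0) (cCons x l) x) \<or>
    (\<exists>i x l v. z = jEv (cId (i + 1)) (cCons x l) v \<and> jEv (cId i) l v \<in> J) \<or>
    (\<exists>g fs l vs v. z = jEv (cCn g fs) l v \<and> jEvs fs l vs \<in> J \<and> jEv g vs v \<in> J) \<or>
    (\<exists>l. z = jEvs cNil l cNil) \<or>
    (\<exists>f fs l v vs. z = jEvs (cCons f fs) l (cCons v vs) \<and> jEv f l v \<in> J \<and> jEvs fs l vs \<in> J) \<or>
    (\<exists>f g l v. z = jEv (cPr f g) (cCons 0 l) v \<and> jEv f l v \<in> J) \<or>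
    (\<exists>f g l x i v. z = jEv (cPr f g) (cCons (x + 1) l) v \<and> jEv (cPr f g) (cCons x l) i \<in> J \<and> jEv g (cCons x (cCons i l)) v \<in> J)"
  using assms unfolding pr_rules_def Let_def set_simps bex_simps fires_infer
  apply (elim disjE)
          apply (auto simp: alg_defs ev_defs)
  done

lemma ev_inject [simp]: "jEv c l v = jEv c' l' v' \<longleftrightarrow> c = c' \<and> l = l' \<and> v = (v'::'a::arith)"
  "jEvs c l v = jEvs c' l' v' \<longleftrightarrow> c = c' \<and> l = l' \<and> v = v'" "jEv c l v \<noteq> jEvs c' l' v'" "jEvs c' l' v' \<noteq> jEv c l v"
  by (auto simp: ev_defs)

text \<open>Code and arguments determine the last rule of a derivation, so outputs are unique by
  induction on the derivation. It follows that a comparison decided in the sense of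
  \<open>bdec\<close> has been decided correctly.\<close>

lemma ev_unique:
  fixes c :: "'a::arith"
  assumes "ev pr_rules {} c l v" "ev pr_rules {} c l v'" shows "v = v'"
proof -
  let ?D = "der pr_rules (\<lambda>_. 0) (\<lambda>_. {} :: 'a set)"
  let ?Q = "\<lambda>z. \<forall>c l v v'. (z = jEv c l v \<longrightarrow> ?D (jEv c l v') \<longrightarrow> v = v') \<and> (z = jEvs c l v \<longrightarrow> ?D (jEvs c l v') \<longrightarrow> v = v')"
  have "?Q (jEv c l v)"
  proof (rule der_induct[of ?Q])
    show "d (\<lambda>\<epsilon>. ?Q (\<epsilon> 0))" unfolding ev_defs
      by (intro d_all d_conj d_imp d_eq d_der pr_rules_ok empty_SS dts)
    show "?D (jEv c l v)" using assms(1) by (simp add: ev_def)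
    fix z assume "inst pr_rules (\<lambda>_. 0) (\<lambda>_. {}) {y. ?D y \<and> ?Q y} z"
    then have f: "\<exists>r\<in>set pr_rules. fires r (\<lambda>_. 0) (\<lambda>_. {}) {y. ?D y \<and> ?Q y} z" by (simp only: inst_fires[OF pr_rules_ok])
    note E = ev_Z ev_S ev_Id0 ev_IdS ev_Cn evs_Nil evs_Cons ev_Pr0 ev_PrS
    note E = E[OF alg_rules_simps(1), of "{} :: 'a set", unfolded ev_def evs_def]
    from pr_fires[OF f] show "?Q z"
      apply (elim disjE exE conjE)
              apply (simp_all add: E)
        apply (blast, blast, blast)
      done
  qed
  then show ?thesis using assms by (simp add: ev_def)
qed


section \<open>Derivability with an explicit bound\<close>

definition closed_rules :: "rule list \<Rightarrow> bool" where
  "closed_rules R \<longleftrightarrow> (\<forall>r\<in>set R. closed 8 0 (side r) \<and> closed_tm 8 (concl r) \<and> (\<forall>q\<in>set (prems r). closed_tm 8 q))"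

lemma closed_step8: "closed 8 0 (side r) \<Longrightarrow> closed_tm 8 (concl r) \<Longrightarrow> \<forall>q\<in>set (prems r). closed_tm 8 q \<Longrightarrow> closed 5 0 (step r)"
  using closed_step[of 0 0 r] closed_mono[of 8 0 "side r" 13 0] by simp

text \<open>With the outermost quantifier of \<open>Der\<close> bounded, derivability becomes a
  bounded formula, so that the sum order can be compiled to a primitive recursive program.\<close>

definition bder :: "rule list \<Rightarrow> 'a::arith \<Rightarrow> 'a \<Rightarrow> bool" where
  "bder R u x \<longleftrightarrow> (\<exists>w<u. hsat (dbody R (Var 0)) (case_nat w (\<lambda>_. x)) (\<lambda>_. {}))"

lemma dbody_cong:
  assumes "closed_rules R" "hval e x = hval e' x'"
  shows "hsat (dbody R x) (case_nat w e) E = hsat (dbody R x') (case_nat w e') E'"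
proof -
  have "hsat (step r) (case_nat i (case_nat n (case_nat b (case_nat a (case_nat w e))))) E =
    hsat (step r) (case_nat i (case_nat n (case_nat b (case_nat a (case_nat w e'))))) E'" if "r \<in> set R" for r i n b a w
  proof (rule hsat_cong)
    show "closed 5 0 (step r)" using assms(1) that by (intro closed_step8) (auto simp: closed_rules_def)
  qed (auto simp: numeral_eq_Suc split: nat.split)
  then show ?thesis using assms(2) by (simp add: dbody_def beta_def)
qed

definition bder_fm :: "rule list \<Rightarrow> tm \<Rightarrow> tm \<Rightarrow> fm" where "bder_fm R u x = ExB u (dbody R x)"

lemma hsat_bder: "closed_rules R \<Longrightarrow> hsat (bder_fm R u x) \<epsilon> E \<longleftrightarrow> bder R (hval \<epsilon> u) (hval \<epsilon> x)"
  unfolding bder_fm_def hsat_ExB bder_def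
  using dbody_cong[of R \<epsilon> x "\<lambda>_. hval \<epsilon> x" "Var 0" _ E "\<lambda>_. {}"] by simp

lemma bder_iff:
  assumes "closed_rules R" "rules_ok R"
  shows "der R (\<lambda>_. 0) (\<lambda>_. {}) (x::'a::arith) \<longleftrightarrow> (\<exists>u. bder R u x)"
proof -
  have "der R (\<lambda>_. 0) (\<lambda>_. {}) x = der R (\<lambda>_. x) (\<lambda>_. {}) x"
    using assms(1) by (subst der_closed[of R 0 _ "\<lambda>_. {}" "\<lambda>_. 0" "\<lambda>_. x"]) (auto simp: closed_rules_def)
  also have "\<dots> \<longleftrightarrow> hsat (Der R (Var 0)) (\<lambda>_. x) (\<lambda>_. {})"
    by (simp add: hsat_Der[OF assms(2)])
  also have "\<dots> \<longleftrightarrow> (\<exists>w. hsat (dbody R (Var 0)) (case_nat w (\<lambda>_. x)) (\<lambda>_. {}))"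
    by (simp add: Der_dbody)
  also have "\<dots> \<longleftrightarrow> (\<exists>u. bder R u x)" unfolding bder_def using less_plus1 by blast
  finally show ?thesis .
qed

lemma bder_mono: "bder R u x \<Longrightarrow> u \<le> u' \<Longrightarrow> bder R u' (x::'a::arith)"
  unfolding bder_def using order.strict_trans2 by blast

lemma closed_rules_simps [simp]: "closed_rules []" "closed_rules (r # R) \<longleftrightarrow> closed 8 0 (side r) \<and> closed_tm 8 (concl r) \<and>
    (\<forall>q\<in>set (prems r). closed_tm 8 q) \<and> closed_rules R"
  "closed_rules (R @ R') \<longleftrightarrow> closed_rules R \<and> closed_rules R'"
  by (auto simp: closed_rules_def)

lemma closed_pr_rules: "closed_rules pr_rules"
  by (simp add: pr_rules_def Let_def infer_def ev_defs alg_defs)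
lemma closed_num_rules: "closed_rules num_rules"
  by (simp add: num_rules_def Let_def infer_def jNum_def code_defs)
lemma closed_all_rules: assumes "re_theory S" shows "closed_rules (all_rules S)"
proof -
  have "closed 8 0 (matrix S)" by (rule closed_mono[OF re_theory_matrix(3)[OF assms]]) simp_all
  then show ?thesis
    by (simp add: all_rules_def syntax_rules_def lift_subst_rules_def set_lift_subst_rules_def proof_rules_def Let_def
        infer_def infer_if_def judgement_defs code_defs)
qed

text \<open>
  The elements of the sum, other than the greatest element 0, are the pairs \<open>((w, c, t), (a, u))\<close> such that there is a
  derivation below \<open>w\<close> of the well-foundedness of the order with program \<open>c\<close>, and \<open>a\<close> belongs to this order. Evaluation of
  \<open>c\<close> is not primitive recursive in \<open>c\<close>, so \<open>u\<close> has to bound the computations for all arguments up to \<open>a\<close>. The order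
  is lexicographic in \<open>(w, c, t)\<close>, \<open>a\<close> and \<open>u\<close>. By \<open>lin_fm\<close>, it is linear even if \<open>c\<close> does not define a linear order.
\<close>

definition le_fm :: "tm \<Rightarrow> tm \<Rightarrow> tm \<Rightarrow> tm \<Rightarrow> fm" where
  "le_fm u c b a = bder_fm pr_rules u (jEv c (cCons b (cCons a cNil)) 1)"
definition dec_fm :: "tm \<Rightarrow> tm \<Rightarrow> tm \<Rightarrow> tm \<Rightarrow> fm" where
  "dec_fm u c b a = ExB u (bder_fm pr_rules (up 1 u) (jEv (up 1 c) (cCons (up 1 b) (cCons (up 1 a) cNil)) (Var 0)))"

definition lin_fm :: "tm \<Rightarrow> tm \<Rightarrow> tm \<Rightarrow> fm" where
  "lin_fm u c a = AllB (a + 1) (AllB (up 1 a + 1) (conjs [dec_fm (up 2 u) (up 2 c) (Var 1) (Var 0),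
     Imp (le_fm (up 2 u) (up 2 c) (Var 1) (Var 0)) (Conj (le_fm (up 2 u) (up 2 c) (Var 1) (Var 1)) (le_fm (up 2 u) (up 2 c)
         (Var 0) (Var 0))),
     Imp (Conj (le_fm (up 2 u) (up 2 c) (Var 1) (Var 1)) (le_fm (up 2 u) (up 2 c) (Var 0) (Var 0)))
       (Disj (le_fm (up 2 u) (up 2 c) (Var 1) (Var 0)) (le_fm (up 2 u) (up 2 c) (Var 0) (Var 1))),
     Imp (Conj (le_fm (up 2 u) (up 2 c) (Var 1) (Var 0)) (le_fm (up 2 u) (up 2 c) (Var 0) (Var 1))) (Eq (Var 1) (Var 0)),
     AllB (up 2 a + 1) (Imp (Conj (le_fm (up 3 u) (up 3 c) (Var 2) (Var 1)) (le_fm (up 3 u) (up 3 c) (Var 1) (Var 0)))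
       (le_fm (up 3 u) (up 3 c) (Var 2) (Var 0)))]))"

definition elem_fm :: "fm \<Rightarrow> tm \<Rightarrow> fm" where
  "elem_fm S x = ExBs 5 (x + 1) (conjs [
     Eq (up 5 x) (pair (pair (Var 4) (pair (Var 3) (Var 2))) (pair (Var 1) (Var 0))),
     bder_fm (all_rules S) (Var 4) (jPr (wrapc (Var 2))),
     bder_fm num_rules (Var 4) (jNum (Var 3) (Var 2)),
     lin_fm (Var 0) (Var 3) (Var 1), le_fm (Var 0) (Var 3) (Var 1) (Var 1)])"

definition sum_fm :: "fm \<Rightarrow> fm" where
  "sum_fm S = (let x = Var 0; y = Var 1 in Disj (Conj (Eq y 0) (Disj (Eq x 0) (elem_fm S x)))
     (conjs [elem_fm S x, elem_fm S y, ExBs 8 (x + y + 1) (conjs [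
       Eq (Var 8) (pair (pair (Var 7) (pair (Var 6) (Var 5))) (pair (Var 4) (Var 3))),
       Eq (Var 9) (pair (Var 2) (pair (Var 1) (Var 0))),
       Disj (Less (pair (Var 7) (pair (Var 6) (Var 5))) (Var 2)) (Conj (Eq (pair (Var 7) (pair (Var 6) (Var 5))) (Var 2))
         (Disj (Conj (Neg (Eq (Var 4) (Var 1))) (le_fm (Var 3 + Var 0) (Var 6) (Var 4) (Var 1)))
           (Conj (Eq (Var 4) (Var 1)) (Less (Var 3) (Var 0 + 1)))))])]))"

definition bev :: "'a::arith \<Rightarrow> 'a \<Rightarrow> 'a \<Rightarrow> 'a \<Rightarrow> bool" where
  "bev u c b a \<longleftrightarrow> bder pr_rules u (jEv c (cCons b (cCons a cNil)) 1)"
definition bdec :: "'a::arith \<Rightarrow> 'a \<Rightarrow> 'a \<Rightarrow> 'a \<Rightarrow> bool" where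
  "bdec u c b a \<longleftrightarrow> (\<exists>v<u. bder pr_rules u (jEv c (cCons b (cCons a cNil)) v))"

definition linM :: "'a::arith \<Rightarrow> 'a \<Rightarrow> 'a \<Rightarrow> bool" where
  "linM u c a \<longleftrightarrow> (\<forall>x\<le>a. \<forall>y\<le>a. bdec u c x y \<and> (bev u c x y \<longrightarrow> bev u c x x \<and> bev u c y y) \<and>
     (bev u c x x \<and> bev u c y y \<longrightarrow> bev u c x y \<or> bev u c y x) \<and> (bev u c x y \<and> bev u c y x \<longrightarrow> x = y) \<and>
     (\<forall>z\<le>a. bev u c x y \<and> bev u c y z \<longrightarrow> bev u c x z))"

definition elemM :: "fm \<Rightarrow> 'a::arith \<Rightarrow> 'a \<Rightarrow> 'a \<Rightarrow> 'a \<Rightarrow> 'a \<Rightarrow> bool" where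
  "elemM S w c t a u \<longleftrightarrow> bder (all_rules S) w (jPr (wrapc t)) \<and> bder num_rules w (jNum c t) \<and> linM u c a \<and> bev u c a a"

definition sumM :: "fm \<Rightarrow> 'a::arith \<Rightarrow> 'a \<Rightarrow> bool" where
  "sumM S x y \<longleftrightarrow> (y = 0 \<and> (x = 0 \<or> (\<exists>w c t a u. x = pair (pair w (pair c t)) (pair a u) \<and> elemM S w c t a u))) \<or>
     (\<exists>w c t a u w' c' t' a' u'. x = pair (pair w (pair c t)) (pair a u) \<and> elemM S w c t a u \<and>
        y = pair (pair w' (pair c' t')) (pair a' u') \<and> elemM S w' c' t' a' u' \<and>
        (pair w (pair c t) < pair w' (pair c' t') \<or> w = w' \<and> c = c' \<and> t = t' \<and>
          (a \<noteq> a' \<and> bev (u + u') c a a' \<or> a = a' \<and> u \<le> u')))"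

lemma hsat_le_fm [simp]: "hsat (le_fm u c b a) \<epsilon> E \<longleftrightarrow> bev (hval \<epsilon> u) (hval \<epsilon> c) (hval \<epsilon> b) (hval \<epsilon> a)"
  unfolding le_fm_def bev_def by (simp only: hsat_bder[OF closed_pr_rules]) (simp add: ev_defs)
lemma hsat_dec_fm [simp]: "hsat (dec_fm u c b a) \<epsilon> E \<longleftrightarrow> bdec (hval \<epsilon> u) (hval \<epsilon> c) (hval \<epsilon> b) (hval \<epsilon> a)"
  unfolding dec_fm_def bdec_def by (subst hsat_ExB) (simp only: hsat_bder[OF closed_pr_rules], simp add: ev_defs)
lemma hsat_lin_fm [simp]: "hsat (lin_fm u c a) \<epsilon> E \<longleftrightarrow> linM (hval \<epsilon> u) (hval \<epsilon> c) (hval \<epsilon> a)"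
  unfolding lin_fm_def linM_def by (simp add: less_plus1 numeral_2_eq_2 numeral_3_eq_3)


lemma hval_mc [simp]: "hval e (mc_tm t) = mc_tm t" "hval e (mc p) = mc p"
proof -
  show 1: "hval e (mc_tm t) = mc_tm t" for t by (induct t) simp_all
  show "hval e (mc p) = mc p" by (induct p) (simp_all add: 1)
qed
lemma hval_wrapc [simp]: "hval e (wrapc t) = wrapc (hval e t)" by (simp add: wrapc_def)
lemma hval_jPr [simp]: "hval e (jPr t) = jPr (hval e t)" by (simp add: jPr_def)
lemma hval_jNum [simp]: "hval e (jNum s t) = jNum (hval e s) (hval e t)" by (simp add: jNum_def)

context fixes S :: fm assumes S: "re_theory S"
begin

lemma hsat_elem_fm: "hsat (elem_fm S x) \<epsilon> E \<longleftrightarrow>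
    (\<exists>w c t a u. hval \<epsilon> x = pair (pair w (pair c t)) (pair a u) \<and> elemM S w c t a (u::'a::arith))"
proof -
  have b: "hval \<epsilon> x = pair (pair w (pair c t)) (pair a u) \<Longrightarrow>
      w < hval \<epsilon> x + 1 \<and> c < hval \<epsilon> x + 1 \<and> t < hval \<epsilon> x + 1 \<and> a < hval \<epsilon> x + 1 \<and> u < hval \<epsilon> x + 1" for w c t a u
    unfolding less_plus1 by (auto intro: le_pair1 le_pair2 order_trans[OF le_pair1 le_pair1] order_trans[OF le_pair2 le_pair1]
        order_trans[OF le_pair1 order_trans[OF le_pair2 le_pair1]] order_trans[OF le_pair2 order_trans[OF le_pair2 le_pair1]]
        order_trans[OF le_pair1 le_pair2] order_trans[OF le_pair2 le_pair2])
  have "hsat (elem_fm S x) \<epsilon> E \<longleftrightarrow> (\<exists>w<hval \<epsilon> x + 1. \<exists>c<hval \<epsilon> x + 1. \<exists>t<hval \<epsilon> x + 1. \<exists>a<hval \<epsilon> x + 1. \<exists>u<hval \<epsilon> x + 1.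
      hval \<epsilon> x = pair (pair w (pair c t)) (pair a u) \<and> elemM S w c t a u)"
    unfolding elem_fm_def elemM_def
    by (simp add: hsat_bder closed_all_rules[OF S] closed_num_rules numeral_eq_Suc)
  also have "\<dots> \<longleftrightarrow> (\<exists>w c t a u. hval \<epsilon> x = pair (pair w (pair c t)) (pair a u) \<and> elemM S w c t a u)"
    using b by blast
  finally show ?thesis .
qed

lemma bounded_ex8:
  assumes "\<And>w c t a u k a' u'. P w c t a u k a' u' \<Longrightarrow> w < b \<and> c < b \<and> t < b \<and> a < b \<and> u < b \<and> k < b \<and> a' < b \<and>
      u' < (b::'a::arith)"
  shows "(\<exists>w<b. \<exists>c<b. \<exists>t<b. \<exists>a<b. \<exists>u<b. \<exists>k<b. \<exists>a'<b. \<exists>u'<b. P w c t a u k a' u') \<longleftrightarrow> (\<exists>w c t a u k a' u'. P w c t a u k a' u')"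
  using assms by meson

lemma hsat_sum_fm: "hsat (sum_fm S) \<epsilon> E \<longleftrightarrow> sumM S (\<epsilon> 0) (\<epsilon> 1 :: 'a::arith)"
proof -
  let ?x = "\<epsilon> 0" and ?y = "\<epsilon> 1" let ?b = "?x + ?y + 1"
  let ?P = "\<lambda>w c t a u k a' u'. ?x = pair (pair w (pair c t)) (pair a u) \<and> ?y = pair k (pair a' u') \<and>
      (pair w (pair c t) < k \<or> pair w (pair c t) = k \<and> (a \<noteq> a' \<and> bev (u + u') c a a' \<or> a = a' \<and> u \<le> u'))"
  let ?el = "\<lambda>x. \<exists>w c t a u. x = pair (pair w (pair c t)) (pair a u) \<and> elemM S w c t a u"
  have "hsat (sum_fm S) \<epsilon> E \<longleftrightarrow> ?y = 0 \<and> (?x = 0 \<or> ?el ?x) \<or> ?el ?x \<and> ?el ?y \<and>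
      (\<exists>w<?b. \<exists>c<?b. \<exists>t<?b. \<exists>a<?b. \<exists>u<?b. \<exists>k<?b. \<exists>a'<?b. \<exists>u'<?b. ?P w c t a u k a' u')"
    unfolding sum_fm_def Let_def
    by (simp add: hsat_elem_fm numeral_eq_Suc less_plus1)
  also have "(\<exists>w<?b. \<exists>c<?b. \<exists>t<?b. \<exists>a<?b. \<exists>u<?b. \<exists>k<?b. \<exists>a'<?b. \<exists>u'<?b. ?P w c t a u k a' u') \<longleftrightarrow>
      (\<exists>w c t a u k a' u'. ?P w c t a u k a' u')"
  proof -
    have x: "?x \<le> ?x + ?y" and y: "?y \<le> ?x + ?y" using self_le_add[of ?x ?y] self_le_add[of ?y ?x]
        by (simp_all add: add.commute)
    have b: "w < ?b \<and> c < ?b \<and> t < ?b \<and> a < ?b \<and> u < ?b \<and> k < ?b \<and> a' < ?b \<and> u' < ?b" if "?P w c t a u k a' u'"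
        for w c t a u k a' u'
    proof -
      have "w \<le> ?x" "c \<le> ?x" "t \<le> ?x" "a \<le> ?x" "u \<le> ?x" "k \<le> ?y" "a' \<le> ?y" "u' \<le> ?y"
        using that by (simp_all add: le_pair1 le_pair2)
      then show ?thesis unfolding less_plus1 by - (intro conjI; rule order.trans, assumption, rule x y)
    qed
    show ?thesis by (rule bounded_ex8[of ?P, OF b])
  qed
  also have "(?y = 0 \<and> (?x = 0 \<or> ?el ?x) \<or> ?el ?x \<and> ?el ?y \<and> (\<exists>w c t a u k a' u'. ?P w c t a u k a' u')) \<longleftrightarrow> sumM S ?x ?y"
    unfolding sumM_def by (intro disj_cong refl) auto
  finally show ?thesis .
qed

lemma Delta0_sum_fm: "Delta0 (sum_fm S)"
proof -
  have D: "Delta0 (bder_fm pr_rules u x)" "Delta0 (bder_fm num_rules u x)" "Delta0 (bder_fm (all_rules S) u x)" for u x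
    unfolding bder_fm_def using re_theory_matrix(2)[OF S]
    by (intro Delta0_simps Delta0_dbody; auto simp: all_rules_def syntax_rules_def lift_subst_rules_def set_lift_subst_rules_def
      proof_rules_def pr_rules_def num_rules_def Let_def infer_def infer_if_def intro!: Delta0.intros)+
  note D = D Delta0_simps Delta0_conjs Delta0_ExBs Delta0.intros
  show ?thesis
    by (simp add: sum_fm_def elem_fm_def lin_fm_def le_fm_def dec_fm_def Let_def D)
qed

lemma closed_bder_fm: "closed_tm m u \<Longrightarrow> closed_tm m x \<Longrightarrow> closed_rules R \<Longrightarrow> closed m 0 (bder_fm R u x)"
proof -
  assume h: "closed_tm m u" "closed_tm m x" "closed_rules R"
  have "closed m 0 (Der R x)" using h(2)
    by (rule closed_Der) (use h(3) in \<open>auto simp: closed_rules_def intro: closed_mono[of 8 0]\<close>)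
  then show ?thesis using h(1) by (simp add: bder_fm_def Der_dbody)
qed

lemma closed_sum_fm: "closed 2 0 (sum_fm S)"
proof -
  have c: "closed_tm m (mc_tm t)" "closed_tm m (mc p)" for m t p
  proof -
    show 1: "closed_tm m (mc_tm t)" for t by (induct t) (simp_all add: code_defs)
    show "closed_tm m (mc p)" by (induct p) (simp_all add: 1 code_defs)
  qed
  have u: "closed_tm m t \<Longrightarrow> closed_tm (Suc m) (up (Suc 0) t)" "closed_tm m t \<Longrightarrow> closed_tm (Suc (Suc m)) (up 2 t)"
    "closed_tm m t \<Longrightarrow> closed_tm (Suc (Suc (Suc m))) (up 3 t)" for m t
    using closed_tm_up_n[of m t 1] closed_tm_up_n[of m t 2] closed_tm_up_n[of m t 3]
        by (simp_all add: numeral_2_eq_2 numeral_3_eq_3)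
  have le: "closed_tm m s \<Longrightarrow> closed_tm m t \<Longrightarrow> closed_tm m x \<Longrightarrow> closed_tm m y \<Longrightarrow> closed m 0 (le_fm s t x y)" for m s t x y
    unfolding le_fm_def by (rule closed_bder_fm) (simp_all add: closed_pr_rules ev_defs)
  have dec: "closed_tm m s \<Longrightarrow> closed_tm m t \<Longrightarrow> closed_tm m x \<Longrightarrow> closed_tm m y \<Longrightarrow> closed m 0 (dec_fm s t x y)" for m s t x y
    unfolding dec_fm_def closed_ExB by (intro conjI closed_bder_fm) (simp_all add: closed_pr_rules ev_defs u)
  have lin: "closed_tm m s \<Longrightarrow> closed_tm m t \<Longrightarrow> closed_tm m x \<Longrightarrow> closed m 0 (lin_fm s t x)" for m s t x
    unfolding lin_fm_def by (simp add: u le dec)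
  have el: "closed 2 0 (elem_fm S x)" if "closed_tm 2 x" for x
  proof -
    have "closed_tm 7 (up 5 x)" using closed_tm_up_n[OF that, of 5] by simp
    then have "closed (2 + 5) 0 (conjs [
     Eq (up 5 x) (pair (pair (Var 4) (pair (Var 3) (Var 2))) (pair (Var 1) (Var 0))),
     bder_fm (all_rules S) (Var 4) (jPr (wrapc (Var 2))),
     bder_fm num_rules (Var 4) (jNum (Var 3) (Var 2)),
     lin_fm (Var 0) (Var 3) (Var 1), le_fm (Var 0) (Var 3) (Var 1) (Var 1)])"
      by (simp add: lin le closed_bder_fm closed_all_rules[OF S] closed_num_rules wrapc_def jPr_def jNum_def c code_defs)
    then show ?thesis unfolding elem_fm_def using that by (intro closed_ExBs) simp_all
  qed
  show ?thesis unfolding sum_fm_def Let_def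
    by (simp add: el) (rule closed_ExBs; simp add: le)
qed

text \<open>Chosen such that its code is the output of the compiler. As the compiled program is
  correct in every model, \<open>sumo\<close> defines \<open>sumM\<close> in nonstandard models
  too.\<close>

definition sumo :: prim_fun where
  "sumo = (SOME f. arity 2 f \<and> (\<exists>b. bfm b = sum_fm S \<and> bcl b 2 \<and> memfree b \<and> code_prim f = bcomp b 2))"

lemma sumo: "arity 2 sumo" "leM sumo x y \<longleftrightarrow> sumM S x (y::'a::arith)"
proof -
  obtain b where "bfm b = sum_fm S" "bcl b 2" "memfree b" using Delta0_bf[OF Delta0_sum_fm closed_sum_fm] by auto
  moreover then obtain f where "code_prim f = bcomp b 2" "arity 2 f" using prim_code_bcomp[of b 2] unfolding prim_code_def
      by blast
  ultimately have "\<exists>f. arity 2 f \<and> (\<exists>b. bfm b = sum_fm S \<and> bcl b 2 \<and> memfree b \<and> code_prim f = bcomp b 2)" by blast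
  from someI_ex[OF this] obtain b where f: "arity 2 sumo"
      and b: "bfm b = sum_fm S" "bcl b 2" "memfree b" "code_prim sumo = bcomp b 2"
    unfolding sumo_def by blast
  show "arity 2 sumo" by (rule f)
  have "vals pr_rules {} (bcomp b 2) [x, y] (tv (hsat (sum_fm S) (lenv [x, y]) (\<lambda>_. {})))"
    using vals_bcomp[of pr_rules "{}" b "[x, y]"] b by (simp add: numeral_2_eq_2)
  then have "ev pr_rules {} (bcomp b 2) (lst [x, y]) 1 \<longleftrightarrow> 1 = (tv (sumM S x y) :: 'a)"
    unfolding vals_def hsat_sum_fm by (simp add: lenv_def)
  then show "leM sumo x y \<longleftrightarrow> sumM S x y"
    unfolding leM_def b(4) cst_bcomp by (simp add: tv_def)
qed

section \<open>Reflection implies the well-foundedness of the sum\<close>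

definition el :: "'a::arith \<Rightarrow> bool" where
  "el z \<longleftrightarrow> (\<exists>w c t a u. z = pair (pair w (pair c t)) (pair a u) \<and> elemM S w c t a u)"

lemma el_pair: "el (pair (pair w (pair c t)) (pair a u)) \<longleftrightarrow> elemM S w c t a u"
  unfolding el_def by auto

text \<open>The component \<open>w\<close> is a strict bound on a derivation, hence positive, and so
  is every element. This leaves 0 free to be the greatest element.\<close>

lemma el_0: "\<not> el 0"
proof
  assume "el (0::'a)"
  then obtain w c t a u :: 'a where "0 = pair (pair w (pair c t)) (pair a u)" "elemM S w c t a u" unfolding el_def by blast
  moreover have "w \<le> pair (pair w (pair c t)) (pair a u)" by (simp add: le_pair1)
  ultimately have "w = 0" "elemM S w c t a u" by simp_all
  then show False by (simp add: elemM_def bder_def)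
qed

lemma d_el: "dt s \<Longrightarrow> d (\<lambda>e. el (s e :: 'a::arith))"
proof (rule d_subst1)
  have "d (\<lambda>e. hsat (elem_fm S (Var 0)) (case_nat (e 0) (\<lambda>_. 0)) (\<lambda>_. {} :: 'a set))"
    by (rule d_hsat) (use arithmetical_Delta0[OF Delta0_sum_fm] in \<open>auto simp: sum_fm_def Let_def intro!: dt_case dts\<close>)
  then show "d (\<lambda>e. el (e 0 :: 'a))" by (simp add: hsat_elem_fm el_def)
qed

lemma elemM_D:
  assumes "elemM S w c t a (u::'a::arith)"
  shows "numr c t" "provM S (wrapc t)" "linM u c a" "bev u c a a"
  using assms bder_iff[OF closed_num_rules num_rules_ok, of "jNum c t"]
    bder_iff[OF closed_all_rules[OF S] all_rules_ok[OF re_theory_matrix(4,5)[OF S]], of "jPr (wrapc t)"]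
  unfolding elemM_def numr_def provM_def by auto

lemma bev_ev: "bev u c x y \<Longrightarrow> ev pr_rules {} c (cCons x (cCons y cNil)) (1::'a::arith)"
  unfolding bev_def ev_def using bder_iff[OF closed_pr_rules pr_rules_ok] by blast

text \<open>Three minimizations follow the lexicographic order: the least index
  \<open>k = (w, c, t)\<close>, then a minimal \<open>a\<close> in the order of \<open>c\<close>,
  then the least \<open>u\<close>. The first and the last are instances of the least number
  principle; the second comes from reflection.\<close>

theorem RFN_wf_sumo:
  fixes \<epsilon> :: "nat \<Rightarrow> 'a::arith"
  assumes E: "\<And>n. E n \<in> SS" and rfn: "hsat (RFN S) \<epsilon> E"
  shows "wfM sumo TYPE('a)"
  unfolding wfM_def
proof (intro ballI impI)
  fix X :: "'a set" assume X: "X \<in> SS" "X \<noteq> {}"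
  show "\<exists>x\<in>X. \<forall>y\<in>X. leM sumo y x \<longrightarrow> y = x"
  proof (cases "\<exists>x\<in>X. el x")
    case False
    then have "leM sumo y x \<longrightarrow> y = x" if "x \<in> X" "y \<in> X" for x y
      using that unfolding sumo(2) sumM_def el_def by metis
    then show ?thesis using X(2) by blast
  next
    case True
    let ?K = "\<lambda>k. \<exists>a u. pair k (pair a u) \<in> X \<and> el (pair k (pair a u))"
    have "\<exists>k. ?K k" using True unfolding el_def by blast
    moreover have "d (\<lambda>e. ?K (e 0))" by (intro d_ex d_conj d_mem X d_el dts)
    ultimately obtain k where k: "?K k" and kmin: "\<And>j. j < k \<Longrightarrow> \<not> ?K j" using least[of ?K] by blast
    from k obtain w c t where kw: "k = pair w (pair c t)" "provM S (wrapc t)" "numr c t"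
      unfolding el_def using elemM_D by fastforce
    \<comment> \<open>The derivation below \<open>w\<close> may be nonstandard, and so may
      \<open>c\<close>. Reflection applies all the same, since it speaks of derivability in the
      sense of the model.\<close>
    have wf: "wfG c" by (rule RFN_wfG[OF S E rfn kw(3,2)])
    let ?A = "{a. \<exists>u. pair k (pair a u) \<in> X \<and> el (pair k (pair a u))}"
    have "?A \<in> SS" by (intro SS_Collect d_ex d_conj d_mem X d_el dts)
    moreover have "?A \<noteq> {}" using k by blast
    ultimately have "\<exists>x\<in>?A. \<forall>y\<in>?A. ev pr_rules {} c (cCons y (cCons x cNil)) 1 \<longrightarrow> y = x"
      by (rule wf[unfolded wfG_def, rule_format])
    then obtain a where a: "a \<in> ?A" and amin: "\<And>b. b \<in> ?A \<Longrightarrow> ev pr_rules {} c (cCons b (cCons a cNil)) 1 \<Longrightarrow> b = a" by blast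
    let ?U = "\<lambda>u. pair k (pair a u) \<in> X \<and> el (pair k (pair a u))"
    have "\<exists>u. ?U u" using a by blast
    moreover have "d (\<lambda>e. ?U (e 0))" by (intro d_conj d_mem X d_el dts)
    ultimately obtain u where u: "?U u" and umin: "\<And>j. j < u \<Longrightarrow> \<not> ?U j" using least[of ?U] by blast
    have "y = pair k (pair a u)" if y: "y \<in> X" "leM sumo y (pair k (pair a u))" for y
    proof -
      have "pair k (pair a u) \<noteq> 0" using u el_0 by metis
      with y(2) obtain w1 c1 t1 a1 u1 where y1: "y = pair (pair w1 (pair c1 t1)) (pair a1 u1)" "elemM S w1 c1 t1 a1 u1"
        and le: "pair w1 (pair c1 t1) < k \<or> pair w1 (pair c1 t1) = k \<and> (a1 \<noteq> a \<and> bev (u1 + u) c a1 a \<or> a1 = a \<and> u1 \<le> u)"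
        unfolding sumo(2) sumM_def kw(1) by (elim disjE exE conjE; simp)
      have el1: "el y" unfolding y1(1) el_pair by (rule y1(2))
      have "?K (pair w1 (pair c1 t1))" using y(1) el1 y1(1) by blast
      then have k1: "pair w1 (pair c1 t1) = k" using le kmin by blast
      have a1: "a1 \<in> ?A" using y(1) el1 y1(1) k1 by auto
      have aa: "a1 = a" using le k1 kmin amin[OF a1 bev_ev] by blast
      then have "u1 \<le> u" using le k1 by auto
      moreover have "\<not> u1 < u" using umin[of u1] y(1) el1 y1(1) k1 aa by auto
      ultimately have "u1 = u" by simp
      then show ?thesis using y1(1) k1 aa by simp
    qed
    then show ?thesis using u by blast
  qed
qed

end

section \<open>Universal closures\<close>

definition vld :: "'a::so_structure itself \<Rightarrow> fm \<Rightarrow> bool" where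
  "vld _ p \<longleftrightarrow> (\<forall>(e :: nat \<Rightarrow> 'a) E. range E \<subseteq> SS \<longrightarrow> hsat p e E)"

lemma vld_AllN [simp]: "vld T (AllN p) = vld T p"
proof
  show "vld T p \<Longrightarrow> vld T (AllN p)" by (simp add: vld_def)
  assume v: "vld T (AllN p)"
  have "hsat p e E" if "range E \<subseteq> SS" for e :: "nat \<Rightarrow> 'a" and E
  proof -
    have "hsat (AllN p) (\<lambda>n. e (Suc n)) E" using v that by (simp only: vld_def)
    then have "hsat p (case_nat (e 0) (\<lambda>n. e (Suc n))) E" by simp
    also have "case_nat (e 0) (\<lambda>n. e (Suc n)) = e" by (auto simp: fun_eq_iff split: nat.split)
    finally show ?thesis .
  qed
  then show "vld T p" by (simp add: vld_def)
qed

lemma vld_AllS [simp]: "vld T (AllS p) = vld T p"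
proof
  show "vld T p \<Longrightarrow> vld T (AllS p)" by (simp add: vld_def range_case_nat)
  assume v: "vld T (AllS p)"
  have "hsat p e E" if "range E \<subseteq> SS" for e :: "nat \<Rightarrow> 'a" and E
  proof -
    have "range (\<lambda>n. E (Suc n)) \<subseteq> SS" using that by auto
    then have "hsat (AllS p) e (\<lambda>n. E (Suc n))" by (rule v[unfolded vld_def, rule_format])
    then have "hsat p e (case_nat (E 0) (\<lambda>n. E (Suc n)))" unfolding hsat.simps by (rule bspec) (use that in auto)
    also have "case_nat (E 0) (\<lambda>n. E (Suc n)) = E" by (auto simp: fun_eq_iff split: nat.split)
    finally show ?thesis .
  qed
  then show "vld T p" by (simp add: vld_def)
qed

text \<open>Completeness was proved for sets of sentences, whereas \<open>ACA0\<close> contains open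
  formulas.\<close>

definition cl :: "fm \<Rightarrow> fm" where
  "cl p = (let k = SOME k. closed k k p in (AllS ^^ k) ((AllN ^^ k) p))"

lemma vld_cl [simp]: "vld T (cl p) = vld T p"
proof -
  have "vld T ((AllS ^^ k) q) = vld T q" "vld T ((AllN ^^ k) q) = vld T q" for k q by (induct k) simp_all
  then show ?thesis by (simp add: cl_def Let_def)
qed

lemma sentence_cl: "sentence (cl p)"
proof -
  define k where "k = (SOME k. closed k k p)"
  have "closed k k p" unfolding k_def using closed_ex[of p] by (rule someI_ex)
  moreover have "closed m s ((AllS ^^ k) q) = closed m (k + s) q" "closed m s ((AllN ^^ k) q) = closed (k + m) s q" for k m s q
    by (induct k arbitrary: m s) simp_all
  ultimately show ?thesis by (simp add: cl_def k_def[symmetric])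
qed

lemma derives_cl: "A \<turnstile> p \<Longrightarrow> A \<turnstile> cl p"
proof -
  assume p: "A \<turnstile> p"
  have "A \<turnstile> (AllN ^^ k) p" for k by (induct k) (auto intro: p GenN)
  then have "A \<turnstile> (AllS ^^ j) ((AllN ^^ k) p)" for j k by (induct j) (auto intro: GenS)
  then show ?thesis by (simp add: cl_def Let_def)
qed

lemma derives_trans: "A \<turnstile> p \<Longrightarrow> (\<And>a. a \<in> A \<Longrightarrow> B \<turnstile> a) \<Longrightarrow> B \<turnstile> p"
  by (induct rule: deriv.induct) (auto intro: deriv.intros)

definition clACA0 :: "fm set" where "clACA0 = cl ` ACA0"

lemma clACA0: "clACA0 \<turnstile> p \<Longrightarrow> ACA0 \<turnstile> p"
  by (erule derives_trans) (auto simp: clACA0_def intro: derives_cl deriv.Ax)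

definition base :: "fm set \<Rightarrow> bool" where "base A \<longleftrightarrow> A = clACA0 \<or> A = {Bsent}"

lemma base_sentence: "base A \<Longrightarrow> \<forall>a\<in>A. sentence a"
  by (auto simp: base_def clACA0_def sentence_cl sentence_Bsent)

text \<open>The object-level derivations on which the theorem rests, each with the axioms from which
  it is derived. They are gathered in one set so that one model can serve for all of them.\<close>

definition to_prove :: "(fm set \<times> fm) set" where
  "to_prove = {({Bsent}, p) | p. p \<in> ACA0} \<union> {(clACA0, Imp omega_jump_axiom (Imp (WF e) (RFN (itth e y)))) | e y. True} \<union>
     {(clACA0, Imp (AXs e y) (RFN (itth e y))) | e y. True} \<union> {(clACA0, Imp (RFN S) (WF (sumo S))) | S. re_theory S} \<union>
     {(clACA0, Imp (WF e) (Wrap (code_prim e))) | e. True}"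

lemma base_to_prove: "(A, p) \<in> to_prove \<Longrightarrow> base A"
  by (auto simp: to_prove_def base_def)

definition bad :: "fm set \<Rightarrow> bool" where
  "bad G \<longleftrightarrow> (\<exists>A p. (A, p) \<in> to_prove \<and> henkin A G \<and> p \<notin> G)"

text \<open>
  One cannot quantify over types. Therefore the single type \<open>tmodel\<close> is made a counterexample to one of the statements
  \<open>to_prove\<close>, provided that any of them is not derivable.
\<close>

definition G0 :: "fm set" where
  "G0 = (if \<exists>G. bad G then SOME G. bad G else SOME G. henkin {Bsent} G)"

lemma henkin_G0: "\<exists>A. base A \<and> henkin A G0"
proof (cases "\<exists>G. bad G")
  case True
  then have "bad G0" unfolding G0_def by (simp add: someI_ex)
  then show ?thesis unfolding bad_def using base_to_prove by blast
next
  case False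
  have "\<not> {Bsent} \<turnstile> Fls"
  proof
    assume "{Bsent} \<turnstile> Fls"
    then have "hsat Fls (\<lambda>_. 0 :: nat) (\<lambda>_. {})" by (rule soundness) (auto simp: hsat_Bsent SS_nat_def)
    then show False by simp
  qed
  then obtain G where "henkin {Bsent} G" using henkin_exists[of "{Bsent}" Fls] sentence_Bsent by auto
  then have "henkin {Bsent} (SOME G. henkin {Bsent} G)" by (rule someI)
  then show ?thesis using False by (auto simp: G0_def base_def)
qed

lemma not_bad: assumes "\<not> bad G0" "(A, p) \<in> to_prove" shows "A \<turnstile> p"
proof (rule ccontr)
  assume "\<not> A \<turnstile> p"
  then obtain G where "henkin A G" "p \<notin> G" using henkin_exists[OF base_sentence[OF base_to_prove[OF assms(2)]]] by blast
  then have "bad G" unfolding bad_def using assms(2) by blast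
  then have "bad G0" unfolding G0_def by (auto intro: someI)
  then show False using assms(1) by simp
qed

section \<open>A term model\<close>

quotient_type tmodel = tm / "teq G0"
  using henkin_G0 teq_equivp by blast

instantiation tmodel :: so_structure
begin
lift_definition zero_tmodel :: tmodel is Zero .
lift_definition one_tmodel :: tmodel is One .
lift_definition plus_tmodel :: "tmodel \<Rightarrow> tmodel \<Rightarrow> tmodel" is Plus
  using henkin_G0 teq_cong(1) by blast
lift_definition times_tmodel :: "tmodel \<Rightarrow> tmodel \<Rightarrow> tmodel" is Times
  using henkin_G0 teq_cong(2) by blast
lift_definition less_tmodel :: "tmodel \<Rightarrow> tmodel \<Rightarrow> bool" is "\<lambda>s t. Less s t \<in> G0"
proof -
  fix s s' t t' assume h: "teq G0 s s'" "teq G0 t t'"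
  obtain A where A: "henkin A G0" using henkin_G0 by blast
  have "teq G0 s' s" "teq G0 t' t" using h teq_equivp[OF A] by (meson equivp_symp)+
  then show "(Less s t \<in> G0) = (Less s' t' \<in> G0)" using h teq_cong(3)[OF A] by blast
qed
definition "x \<le> (y::tmodel) \<longleftrightarrow> x < y \<or> x = y"
definition SS_tmodel :: "tmodel set set" where "SS_tmodel = range (\<lambda>n. {abs_tmodel t | t. Mem t n \<in> G0})"
instance ..
end

lemma truth_tmodel: "hsat p (\<lambda>n. abs_tmodel (f n)) (\<lambda>n. {abs_tmodel t | t. Mem t (g n) \<in> G0}) \<longleftrightarrow> ps p f g \<in> G0"
proof -
  obtain A where A: "henkin A G0" using henkin_G0 by blast
  show ?thesis
  proof (rule truth_lemma[OF A])
    show "surj abs_tmodel" by (metis Quotient3_abs_rep Quotient3_tmodel surjI)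
    show "abs_tmodel s = abs_tmodel t \<longleftrightarrow> teq G0 s t" for s t by (rule tmodel.abs_eq_iff)
  qed (simp_all add: zero_tmodel.abs_eq one_tmodel.abs_eq plus_tmodel.abs_eq times_tmodel.abs_eq less_tmodel.abs_eq
      SS_tmodel_def)
qed

lemma truth_tmodel_id: "hsat p (\<lambda>n. abs_tmodel (Var n)) (\<lambda>n. {abs_tmodel t | t. Mem t n \<in> G0}) \<longleftrightarrow> p \<in> G0"
  using truth_tmodel[of p Var "\<lambda>n. n"] ps_id[of p] by simp

lemma vld_tmodel_sentence: "sentence p \<Longrightarrow> p \<in> G0 \<Longrightarrow> vld TYPE(tmodel) p"
  unfolding vld_def
proof (intro allI impI)
  fix e E assume "sentence p" "p \<in> G0"
  then show "hsat p e (E :: nat \<Rightarrow> tmodel set)"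
    using hsat_cong[of 0 0 p e "\<lambda>n. abs_tmodel (Var n)" E "\<lambda>n. {abs_tmodel t | t. Mem t n \<in> G0}"] truth_tmodel_id[of p] by simp
qed

text \<open>\<open>G0\<close> extends either the closed form of \<open>ACA0\<close> or
  \<open>{Bsent}\<close>. The term model has to satisfy the axioms of the class \<open>aca\<close>
  in both cases, which the following lemmas distinguish.\<close>

lemma base_tmodel: "(\<forall>p\<in>ACA0. vld TYPE(tmodel) p) \<or> vld TYPE(tmodel) Bsent"
proof -
  obtain A where A: "base A" "henkin A G0" using henkin_G0 by blast
  have "vld TYPE(tmodel) a" if "a \<in> A" for a
    using vld_tmodel_sentence base_sentence[OF A(1)] that hk_ax[OF A(2) deriv.Ax[OF that]] by blast
  note v = this
  show ?thesis
  proof (cases "A = clACA0")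
    case True
    then have "vld TYPE(tmodel) p" if "p \<in> ACA0" for p using v[of "cl p"] that unfolding clACA0_def vld_cl by blast
    then show ?thesis by blast
  next
    case False
    then show ?thesis using A(1) v unfolding base_def by blast
  qed
qed

lemma SS_tmodel_ne: "\<exists>E :: nat \<Rightarrow> _. range E \<subseteq> (SS :: tmodel set set)"
  by (rule exI[of _ "\<lambda>n. {abs_tmodel t | t. Mem t n \<in> G0}"]) (auto simp: SS_tmodel_def)

lemma basic_tmodel: assumes p: "p \<in> basic_axioms" and E: "range E \<subseteq> SS" shows "hsat p (e :: nat \<Rightarrow> tmodel) E"
  using base_tmodel
proof
  assume "\<forall>p\<in>ACA0. vld TYPE(tmodel) p"
  then have "vld TYPE(tmodel) p" using p by (simp add: ACA0_def)
  then show ?thesis using E by (simp add: vld_def)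
next
  assume "vld TYPE(tmodel) Bsent"
  then have "hsat Bsent e E" using E by (simp add: vld_def)
  then show ?thesis using p by (rule B_basic)
qed

lemma induction_tmodel: assumes E: "range E \<subseteq> SS" shows "hsat induction_axiom (e :: nat \<Rightarrow> tmodel) E"
  using base_tmodel
proof
  assume "\<forall>p\<in>ACA0. vld TYPE(tmodel) p"
  then have "vld TYPE(tmodel) induction_axiom" by (simp add: ACA0_def)
  then show ?thesis using E by (simp add: vld_def)
next
  assume "vld TYPE(tmodel) Bsent"
  then have "hsat Bsent e E" using E by (simp add: vld_def)
  then show ?thesis by (rule B_induction)
qed

lemma comprehension_tmodel:
  assumes p: "arithmetical p" and E: "range E \<subseteq> SS" shows "{x. hsat p (case_nat x (e :: nat \<Rightarrow> tmodel)) E} \<in> SS"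
  using base_tmodel
proof
  assume "\<forall>p\<in>ACA0. vld TYPE(tmodel) p"
  then have "vld TYPE(tmodel) (comprehension p)" using p by (auto simp: ACA0_def)
  then have "hsat (comprehension p) e E" using E by (auto simp: vld_def)
  then obtain X where X: "X \<in> SS" "\<And>x. x \<in> X \<longleftrightarrow> hsat p (case_nat x e) E"
    unfolding comprehension_def by (auto simp: hsat_liftS0)
  then have "{x. hsat p (case_nat x e) E} = X" by auto
  then show ?thesis using X by simp
next
  assume "vld TYPE(tmodel) Bsent"
  then have "hsat Bsent e E" using E by (auto simp: vld_def)
  then show ?thesis by (rule B_comprehension) (use p E in auto)
qed

lemma ind_tmodel:
  assumes "X \<in> SS" "0 \<in> X" "\<And>x. x \<in> X \<Longrightarrow> x + 1 \<in> X" shows "(x::tmodel) \<in> X"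
proof -
  obtain E :: "nat \<Rightarrow> tmodel set" where E: "range E \<subseteq> SS" using SS_tmodel_ne by blast
  have "hsat induction_axiom (\<lambda>_. x) E \<longleftrightarrow> (\<forall>X\<in>SS. 0 \<in> X \<and> (\<forall>x. x \<in> X \<longrightarrow> x + 1 \<in> X) \<longrightarrow> (\<forall>x::tmodel. x \<in> X))"
    by (simp add: induction_axiom_def)
  from iffD1[OF this induction_tmodel[OF E]] have "0 \<in> X \<and> (\<forall>x. x \<in> X \<longrightarrow> x + 1 \<in> X) \<longrightarrow> (\<forall>x::tmodel. x \<in> X)"
    using assms(1) by (rule bspec)
  moreover have "0 \<in> X \<and> (\<forall>x. x \<in> X \<longrightarrow> x + 1 \<in> X)" using assms(2,3) by (intro conjI allI impI)
  ultimately show ?thesis by (rule mp[THEN spec])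
qed

lemma comp_tmodel:
  assumes "d P" shows "{x. P (case_nat x (e :: nat \<Rightarrow> tmodel))} \<in> SS"
proof -
  obtain E :: "nat \<Rightarrow> tmodel set" where E: "range E \<subseteq> SS" using SS_tmodel_ne by blast
  have "E 0 \<in> SS" using E by blast
  from d_formula[OF assms this] obtain p c E' where p: "arithmetical p" "range E' \<subseteq> SS"
    "\<forall>e. P e = hsat p (\<lambda>n. if even n then e (n div 2) else c (n div 2)) E'" by (elim exE conjE)
  \<comment> \<open>The interleaved environment of \<open>p\<close> from index 1 on; its slot 0 is
    taken by the element that comprehension ranges over.\<close>
  define e2 where "e2 n = (if even (Suc n) then e (Suc n div 2 - 1) else c (Suc n div 2))" for n
  have "(\<lambda>n. if even n then case_nat x e (n div 2) else c (n div 2)) = case_nat x e2" for x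
  proof
    fix n show "(if even n then case_nat x e (n div 2) else c (n div 2)) = case_nat x e2 n"
    proof (cases n)
      case (Suc m)
      show ?thesis
      proof (cases "even n")
        case True
        then obtain k where "n div 2 = Suc k" using Suc by (cases "n div 2") (auto elim!: evenE)
        then show ?thesis using Suc True by (simp add: e2_def)
      qed (simp add: Suc e2_def)
    qed simp
  qed
  then have "{x. P (case_nat x e)} = {x. hsat p (case_nat x e2) E'}" using p(3) by simp
  then show ?thesis using comprehension_tmodel[OF p(1,2), of e2] by simp
qed

instance tmodel :: aca
proof
  obtain E :: "nat \<Rightarrow> tmodel set" where E: "range E \<subseteq> SS" using SS_tmodel_ne by blast
  fix m n x :: tmodel and X :: "tmodel set" and P and e :: "nat \<Rightarrow> tmodel"
  have b: "p \<in> basic_axioms \<Longrightarrow> hsat p (case_nat m (case_nat n e)) E" for p m n using basic_tmodel[OF _ E] by blast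
  note b = b[unfolded basic_axioms_def Let_def]
  show "n + 1 \<noteq> 0" using b[of "Neg (Eq (Var 1 + 1) 0)" m n] by simp
  show "m + 1 = n + 1 \<Longrightarrow> m = n" using b[of "Imp (Eq (Var 0 + 1) (Var 1 + 1)) (Eq (Var 0) (Var 1))" m n] by simp
  show "m + 0 = m" using b[of "Eq (Var 0 + 0) (Var 0)" m n] by simp
  show "m + (n + 1) = (m + n) + 1" using b[of "Eq (Var 0 + (Var 1 + 1)) ((Var 0 + Var 1) + 1)" m n] by simp
  show "m * 0 = 0" using b[of "Eq (Var 0 * 0) 0" m n] by simp
  show "m * (n + 1) = m * n + m" using b[of "Eq (Var 0 * (Var 1 + 1)) (Var 0 * Var 1 + Var 0)" m n] by simp
  show "\<not> m < 0" using b[of "Neg (Less (Var 0) 0)" m n] by simp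
  show "m < n + 1 \<longleftrightarrow> m < n \<or> m = n"
      using b[of "Iff (Less (Var 0) (Var 1 + 1)) (Disj (Less (Var 0) (Var 1)) (Eq (Var 0) (Var 1)))" m n] by simp
  show "m \<le> n \<longleftrightarrow> m < n \<or> m = n" by (rule less_eq_tmodel_def)
  show "X \<in> SS \<Longrightarrow> 0 \<in> X \<Longrightarrow> (\<And>x. x \<in> X \<Longrightarrow> x + 1 \<in> X) \<Longrightarrow> x \<in> X" by (rule ind_tmodel)
  show "d P \<Longrightarrow> {x. P (case_nat x e)} \<in> SS" by (rule comp_tmodel)
qed

instantiation tmodel :: arith
begin
definition "(x::tmodel) - y = (if y \<le> x then THE z. x = y + z else 0)"

instance
proof
  fix a b c :: tmodel
  note le = aca_le_iff
  show "a < b \<longleftrightarrow> a \<le> b \<and> \<not> b \<le> a"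
    using aca_irrefl[of a] aca_trans[of a b a] by (auto simp: le_iff)
  show "a \<le> a" by (simp add: le_iff)
  show "a \<le> b \<Longrightarrow> b \<le> c \<Longrightarrow> a \<le> c" using aca_trans[of a b c] by (auto simp: le_iff)
  show "a \<le> b \<Longrightarrow> b \<le> a \<Longrightarrow> a = b" using aca_trans[of a b a] aca_irrefl[of a] by (auto simp: le_iff)
  show "a \<le> b \<or> b \<le> a" using aca_linear[of a b] by (auto simp: le_iff)
  show "a + b + c = a + (b + c)" by (rule aca_add_assoc)
  show "a + b = b + a" by (rule aca_add_commute)
  show "0 + a = a" by (rule aca_add_0_left)
  show "a * b * c = a * (b * c)" by (rule aca_mult_assoc)
  show "a * b = b * a" by (rule aca_mult_commute)
  show one: "1 * a = a" by (subst aca_mult_commute) (rule aca_mult_1)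
  show "(a + b) * c = a * c + b * c" using aca_distrib[of c a b] by (simp add: aca_mult_commute[of c])
  show "a * (b + c) = a * b + a * c" by (rule aca_distrib)
  show "0 * a = 0" by (rule aca_mult_0_left)
  show "a * 0 = 0" by (rule mult_zero)
  have diff: "x + y - x = y" for x y :: tmodel
  proof -
    have "x \<le> x + y" unfolding le by blast
    moreover have "(THE z. x + y = x + z) = y"
      by (rule the_equality) (use aca_add_cancel aca_add_commute in metis)+
    ultimately show ?thesis by (simp add: minus_tmodel_def)
  qed
  have diff0: "x \<le> y \<Longrightarrow> x - y = 0" for x y :: tmodel
  proof -
    assume xy: "x \<le> y"
    show ?thesis
    proof (cases "y \<le> x")
      case True
      then have "x = y" using xy aca_trans[of x y x] aca_irrefl[of x] by (auto simp: le_iff)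
      then show ?thesis using diff[of y 0] by (simp add: add_zero)
    next
      case False then show ?thesis by (simp add: minus_tmodel_def)
    qed
  qed
  show "a + b - a = b" by (rule diff)
  show "x \<le> y \<Longrightarrow> x - y = 0" for x y :: tmodel by (rule diff0)
  have tot: "x \<le> y \<or> y \<le> x" for x y :: tmodel using aca_linear[of x y] by (auto simp: le_iff)
  have z0: "0 \<le> x" for x :: tmodel unfolding le by (rule exI[of _ x]) (simp add: aca_add_0_left)
  show "a - b - c = a - (b + c)"
  proof (cases "b + c \<le> a")
    case True
    then obtain k where k: "a = b + c + k" unfolding le by blast
    then have "a - b = c + k" using diff[of b "c + k"] by (simp add: aca_add_assoc)
    then show ?thesis using diff[of c k] diff[of "b + c" k] k by simp
  next
    case False
    then have R: "a - (b + c) = 0" using tot diff0 by blast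
    show ?thesis
    proof (cases "b \<le> a")
      case True
      then obtain k where k: "a = b + k" unfolding le by blast
      have "\<not> c \<le> k" using False k by (metis le aca_add_assoc)
      then have "k - c = 0" using tot diff0 by blast
      then show ?thesis using R k diff[of b k] by simp
    next
      case False
      then have "a - b = 0" using tot diff0 by blast
      then show ?thesis using R diff0[OF z0[of c]] by simp
    qed
  qed
  have "(1::tmodel) = 0 + 1" by (simp add: aca_add_0_left)
  then show "(0::tmodel) \<noteq> 1" using suc_neq[of "0::tmodel"] by metis
  show "a * (b - c) = a * b - a * c"
  proof (cases "c \<le> b")
    case True
    then obtain k where k: "b = c + k" unfolding le by blast
    then show ?thesis using diff[of c k] diff[of "a * c" "a * k"] by (simp add: aca_distrib)
  next
    case False
    then have bc: "b \<le> c" using tot by blast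
    then have "a * b \<le> a * c" unfolding le using aca_distrib by metis
    then show ?thesis using diff0[OF bc] diff0 mult_zero by simp
  qed
  have pos: "x \<noteq> 0 \<Longrightarrow> 0 < x" for x :: tmodel using z0[of x] by (auto simp: le_iff)
  show "a \<noteq> 0 \<Longrightarrow> b \<noteq> 0 \<Longrightarrow> a * b \<noteq> 0"
    using aca_mult_mono[OF pos[of b] pos[of a]] aca_irrefl[of 0] by (auto simp: mult_zero)
  show "a \<le> b \<Longrightarrow> c + a \<le> c + b" unfolding le using aca_add_assoc by metis
  show "a < b \<Longrightarrow> 0 < c \<Longrightarrow> c * a < c * b" by (rule aca_mult_mono)
  show "(0::tmodel) < 1" using \<open>(0::tmodel) \<noteq> 1\<close> pos by metis
  show "b \<le> a \<Longrightarrow> a - b + b = a"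
  proof -
    assume "b \<le> a"
    then obtain k where k: "a = b + k" unfolding le by blast
    then show ?thesis using diff[of b k] by (simp add: aca_add_commute)
  qed
qed
end

section \<open>Derivability from truth in all models\<close>

lemma hsat_omega_jump_axiom:
  assumes E: "\<And>n. E n \<in> (SS :: 'a::arith set set)" and h: "hsat omega_jump_axiom \<epsilon> E"
  shows "omega_jumps TYPE('a)"
  unfolding omega_jumps_def
proof
  fix X :: "'a set" assume X: "X \<in> SS"
  have E': "A \<in> SS \<Longrightarrow> B \<in> SS \<Longrightarrow> C \<in> SS \<Longrightarrow> case_nat A (case_nat B (case_nat C E)) n \<in> SS" for A B C n
    using E by (auto split: nat.split)
  obtain Y where Y: "Y \<in> SS" "\<forall>x. pair 0 x \<in> Y \<longleftrightarrow> x \<in> X"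
    "\<forall>n. \<forall>Z\<in>SS. (\<forall>x. x \<in> Z \<longleftrightarrow> pair n x \<in> Y) \<longrightarrow> (\<forall>x. pair (n + 1) x \<in> Y \<longleftrightarrow> jumpM Z x)"
    using h X unfolding omega_jump_axiom_def by (auto simp: hsat_jump E')
  have "{x. pair n x \<in> Y} \<in> SS" for n by (intro SS_Collect d_mem Y dts)
  then have "\<forall>n x. pair (n + 1) x \<in> Y \<longleftrightarrow> jumpM {x. pair n x \<in> Y} x" using Y(3) by simp
  then show "\<exists>Y\<in>SS. omega_jump X Y" using Y(1,2) unfolding omega_jump_def by blast
qed

lemma vld_ACA0: "p \<in> ACA0 \<Longrightarrow> vld TYPE('a::arith) p"
  unfolding vld_def
proof (intro allI impI)
  fix e :: "nat \<Rightarrow> 'a" and E :: "nat \<Rightarrow> 'a set" assume p: "p \<in> ACA0" and E: "range E \<subseteq> SS"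
  have B: "hsat Bsent e E" by (rule hsat_Bsent)
  from p consider "p \<in> basic_axioms" | "p = induction_axiom" | q where "arithmetical q" "p = comprehension q"
    unfolding ACA0_def by blast
  then show "hsat p e E"
  proof cases
    case 1 then show ?thesis by (rule B_basic[OF B])
  next
    case 2 then show ?thesis using B_induction[OF B] by simp
  next
    case (3 q)
    have "{x. hsat q (case_nat x e) E} \<in> SS" by (rule B_comprehension[OF B 3(1)]) (use E in auto)
    then show ?thesis unfolding 3(2) comprehension_def
      by (simp add: hsat_liftS0) (rule bexI[of _ "{x. hsat q (case_nat x e) E}"], simp_all)
  qed
qed

lemma vld_to_prove: assumes "(A, p) \<in> to_prove" shows "vld TYPE('a::arith) p"
  unfolding vld_def
proof (intro allI impI)
  fix e :: "nat \<Rightarrow> 'a" and E :: "nat \<Rightarrow> 'a set" assume E: "range E \<subseteq> SS"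
  then have E': "\<And>n. E n \<in> SS" by blast
  from assms consider "p \<in> ACA0" | f y where "p = Imp omega_jump_axiom (Imp (WF f) (RFN (itth f y)))"
    | f y where "p = Imp (AXs f y) (RFN (itth f y))" | S where "re_theory S" "p = Imp (RFN S) (WF (sumo S))"
    | f where "p = Imp (WF f) (Wrap (code_prim f))"
    unfolding to_prove_def by blast
  then show "hsat p e E"
  proof cases
    case 1 then show ?thesis using vld_ACA0[of p, where 'a='a] E by (simp add: vld_def)
  next
    case (2 f y) then show ?thesis using RFN_itth[OF hsat_omega_jump_axiom[OF E'] _ E'] by (simp add: hsat_WF[OF E'])
  next
    case (3 f y) then show ?thesis using hsat_AXs[of f y e E e E] by simp
  next
    case (4 S) then show ?thesis using RFN_wf_sumo[OF 4(1) E', of e] by (simp add: hsat_WF[OF E'])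
  next
    case (5 f) then show ?thesis by (simp add: hsat_WF[OF E'] hsat_Wrap[OF E'])
  qed
qed

text \<open>The statements in \<open>to_prove\<close> are valid in every type of class
  \<open>arith\<close>, in particular in \<open>tmodel\<close>. If one of them were underivable,
  then \<open>tmodel\<close> would refute one of them, by the choice of \<open>G0\<close>.\<close>

lemma to_prove_derives: assumes "(A, p) \<in> to_prove" shows "A \<turnstile> p"
proof (rule not_bad[OF _ assms])
  show "\<not> bad G0"
  proof
    assume "bad G0"
    then obtain A p where p: "(A, p) \<in> to_prove" "p \<notin> G0" unfolding bad_def by blast
    from vld_to_prove[OF p(1), where 'a=tmodel]
    have "hsat p (\<lambda>n. abs_tmodel (Var n)) (\<lambda>n. {abs_tmodel t | t. Mem t n \<in> G0})"
      unfolding vld_def by (rule allE, elim allE impE) (auto simp: SS_tmodel_def)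
    then show False using p(2) truth_tmodel_id by simp
  qed
qed

theorem ACA0_derives:
  "ACA0 \<turnstile> Imp omega_jump_axiom (Imp (WF e) (RFN (itth e y)))" "ACA0 \<turnstile> Imp (AXs e y) (RFN (itth e y))"
  "re_theory S \<Longrightarrow> ACA0 \<turnstile> Imp (RFN S) (WF (sumo S))" "ACA0 \<turnstile> Imp (WF e) (Wrap (code_prim e))"
  by (rule clACA0, rule to_prove_derives, auto simp: to_prove_def)+

theorem Bsent_derives: "p \<in> ACA0 \<Longrightarrow> {Bsent} \<turnstile> p"
  by (rule to_prove_derives) (auto simp: to_prove_def)

section \<open>Derivations are represented in the standard model\<close>

lemma der_mono: "set R \<subseteq> set R' \<Longrightarrow> der R e E z \<Longrightarrow> der R' e E z"
proof -
  assume R: "set R \<subseteq> set R'"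
  have "inst R e E J z \<Longrightarrow> inst R' e E J z" for J z unfolding inst_def using R by blast
  then have "valid R e E a b n \<Longrightarrow> valid R' e E a b n" for a b n unfolding valid_def by blast
  then show "der R e E z \<Longrightarrow> der R' e E z" unfolding der_def by blast
qed

definition der_ls :: "'a::arith \<Rightarrow> bool" where "der_ls = der lift_subst_rules (\<lambda>_. 0) (\<lambda>_. {})"
definition der_set :: "'a::arith \<Rightarrow> bool" where "der_set = der set_lift_subst_rules (\<lambda>_. 0) (\<lambda>_. {})"

lemma der_ls_iff: "der_ls z \<longleftrightarrow> (\<exists>r\<in>set lift_subst_rules. fires r (\<lambda>_. 0) (\<lambda>_. {}) {y. der_ls y} z)"
  unfolding der_ls_def by (rule der_iff) (simp add: lift_subst_rules_def Let_def judgement_defs code_defs)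
lemma der_set_iff: "der_set z \<longleftrightarrow> (\<exists>r\<in>set set_lift_subst_rules. fires r (\<lambda>_. 0) (\<lambda>_. {}) {y. der_set y} z)"
  unfolding der_set_def by (rule der_iff) (simp add: set_lift_subst_rules_def Let_def judgement_defs code_defs)

lemmas der_ls_expand = lift_subst_rules_def Let_def judgement_defs code_defs penv_def
lemmas der_set_expand = set_lift_subst_rules_def Let_def judgement_defs code_defs penv_def

lemma der_ls_lift_tm:
  "n < k \<Longrightarrow> der_ls (jLiftT k (cVar n) (cVar n))" "\<not> n < k \<Longrightarrow> der_ls (jLiftT k (cVar n) (cVar (n + 1)))"
  "der_ls (jLiftT k cZero cZero)" "der_ls (jLiftT k cOne cOne)"
  "der_ls (jLiftT k x x') \<Longrightarrow> der_ls (jLiftT k y y') \<Longrightarrow> der_ls (jLiftT k (cPlus x y) (cPlus x' y'))"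
  "der_ls (jLiftT k x x') \<Longrightarrow> der_ls (jLiftT k y y') \<Longrightarrow> der_ls (jLiftT k (cTimes x y) (cTimes x' (y'::'a::arith)))"
  by (subst der_ls_iff, simp add: der_ls_expand)+

lemma der_ls_subst_tm:
  "n < k \<Longrightarrow> der_ls (jSubstT k u (cVar n) (cVar n))" "der_ls (jSubstT k u (cVar k) u)"
  "k < n + 1 \<Longrightarrow> der_ls (jSubstT k u (cVar (n + 1)) (cVar n))"
  "der_ls (jSubstT k u cZero cZero)" "der_ls (jSubstT k u cOne cOne)"
  "der_ls (jSubstT k u x x') \<Longrightarrow> der_ls (jSubstT k u y y') \<Longrightarrow> der_ls (jSubstT k u (cPlus x y) (cPlus x' y'))"
  "der_ls (jSubstT k u x x') \<Longrightarrow> der_ls (jSubstT k u y y') \<Longrightarrow> der_ls (jSubstT k u (cTimes x y) (cTimes x' (y'::'a::arith)))"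
  by (subst der_ls_iff, simp add: der_ls_expand)+

lemma der_ls_lift:
  "der_ls (jLiftT k x x') \<Longrightarrow> der_ls (jLiftT k y y') \<Longrightarrow> der_ls (jLift k (cEq x y) (cEq x' y'))"
  "der_ls (jLiftT k x x') \<Longrightarrow> der_ls (jLiftT k y y') \<Longrightarrow> der_ls (jLift k (cLess x y) (cLess x' y'))"
  "der_ls (jLiftT k x x') \<Longrightarrow> der_ls (jLift k (cMem x n) (cMem x' n))"
  "der_ls (jLift k cFls cFls)"
  "der_ls (jLift k x x') \<Longrightarrow> der_ls (jLift k y y') \<Longrightarrow> der_ls (jLift k (cImp x y) (cImp x' y'))"
  "der_ls (jLift (k + 1) x x') \<Longrightarrow> der_ls (jLift k (cAllN x) (cAllN x'))"
  "der_ls (jLift k x x') \<Longrightarrow> der_ls (jLift k (cAllS x) (cAllS (x'::'a::arith)))"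
  by (subst der_ls_iff, simp add: der_ls_expand)+

lemma der_ls_subst:
  "der_ls (jSubstT k u x x') \<Longrightarrow> der_ls (jSubstT k u y y') \<Longrightarrow> der_ls (jSubst k u (cEq x y) (cEq x' y'))"
  "der_ls (jSubstT k u x x') \<Longrightarrow> der_ls (jSubstT k u y y') \<Longrightarrow> der_ls (jSubst k u (cLess x y) (cLess x' y'))"
  "der_ls (jSubstT k u x x') \<Longrightarrow> der_ls (jSubst k u (cMem x n) (cMem x' n))"
  "der_ls (jSubst k u cFls cFls)"
  "der_ls (jSubst k u x x') \<Longrightarrow> der_ls (jSubst k u y y') \<Longrightarrow> der_ls (jSubst k u (cImp x y) (cImp x' y'))"
  "der_ls (jLiftT 0 u u') \<Longrightarrow> der_ls (jSubst (k + 1) u' x x') \<Longrightarrow> der_ls (jSubst k u (cAllN x) (cAllN x'))"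
  "der_ls (jSubst k u x x') \<Longrightarrow> der_ls (jSubst k u (cAllS x) (cAllS (x'::'a::arith)))"
  by (subst der_ls_iff, simp add: der_ls_expand, blast?)+

lemma der_set_lift:
  "der_set (jLiftS k (cEq x y) (cEq x y))" "der_set (jLiftS k (cLess x y) (cLess x y))"
  "n < k \<Longrightarrow> der_set (jLiftS k (cMem x n) (cMem x n))" "\<not> n < k \<Longrightarrow> der_set (jLiftS k (cMem x n) (cMem x (n + 1)))"
  "der_set (jLiftS k cFls cFls)"
  "der_set (jLiftS k x x') \<Longrightarrow> der_set (jLiftS k y y') \<Longrightarrow> der_set (jLiftS k (cImp x y) (cImp x' y'))"
  "der_set (jLiftS k x x') \<Longrightarrow> der_set (jLiftS k (cAllN x) (cAllN x'))"
  "der_set (jLiftS (k + 1) x x') \<Longrightarrow> der_set (jLiftS k (cAllS x) (cAllS (x'::'a::arith)))"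
  by (subst der_set_iff, simp add: der_set_expand)+

lemma der_set_subst:
  "der_set (jSubstS k m (cEq x y) (cEq x y))" "der_set (jSubstS k m (cLess x y) (cLess x y))"
  "n < k \<Longrightarrow> der_set (jSubstS k m (cMem x n) (cMem x n))" "der_set (jSubstS k m (cMem x k) (cMem x m))"
  "k < n + 1 \<Longrightarrow> der_set (jSubstS k m (cMem x (n + 1)) (cMem x n))"
  "der_set (jSubstS k m cFls cFls)"
  "der_set (jSubstS k m x x') \<Longrightarrow> der_set (jSubstS k m y y') \<Longrightarrow> der_set (jSubstS k m (cImp x y) (cImp x' y'))"
  "der_set (jSubstS k m x x') \<Longrightarrow> der_set (jSubstS k m (cAllN x) (cAllN x'))"
  "der_set (jSubstS (k + 1) (m + 1) x x') \<Longrightarrow> der_set (jSubstS k m (cAllS x) (cAllS (x'::'a::arith)))"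
  by (subst der_set_iff, simp add: der_set_expand)+

lemma der_ls_lift_tm_code: "der_ls (jLiftT k (code_tm t) (code_tm (lift_tm k t)))"
proof (induct t)
  case (Var n)
  show ?case using der_ls_lift_tm(1)[of n k] der_ls_lift_tm(2)[of n k] by simp
qed (simp_all add: der_ls_lift_tm)

lemma der_ls_subst_tm_code: "der_ls (jSubstT k (code_tm u) (code_tm t) (code_tm (subst_tm k u t)))"
proof (induct t)
  case (Var n)
  consider "n < k" | "n = k" | m where "n = m + 1" "k < m + 1"
    by (metis Suc_eq_plus1 less_imp_Suc_add linorder_neqE_nat less_add_Suc1 add.commute)
  then show ?case
  proof cases
    case 1 then show ?thesis using der_ls_subst_tm(1)[of n k "code_tm u"] by simp
  next
    case 2 then show ?thesis using der_ls_subst_tm(2)[of k "code_tm u"] by simp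
  next
    case (3 m) then show ?thesis using der_ls_subst_tm(3)[of k m "code_tm u"] by simp
  qed
qed (simp_all add: der_ls_subst_tm)

lemma der_ls_lift_code: "der_ls (jLift k (code p) (code (lift k p)))"
proof (induct p arbitrary: k)
  case (AllN p) then show ?case using der_ls_lift(6)[of k "code p"] AllN[of "k + 1"] by simp
qed (simp_all add: der_ls_lift der_ls_lift_tm_code)

lemma der_ls_subst_code: "der_ls (jSubst k (code_tm u) (code p) (code (subst k u p)))"
proof (induct p arbitrary: k u)
  case (AllN p) then show ?case using der_ls_subst(6)[OF der_ls_lift_tm_code AllN[of "k + 1"]] by simp
qed (simp_all add: der_ls_subst der_ls_subst_tm_code)

lemma der_set_lift_code: "der_set (jLiftS k (code p) (code (liftS k p)))"
proof (induct p arbitrary: k)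
  case (AllS p) then show ?case using der_set_lift(8)[of k "code p"] AllS[of "k + 1"] by simp
next
  case (Mem t n) then show ?case using der_set_lift(3,4)[of n k "code_tm t"] by simp
qed (simp_all add: der_set_lift)

lemma der_set_subst_code: "der_set (jSubstS k m (code p) (code (substS k m p)))"
proof (induct p arbitrary: k m)
  case (AllS p) then show ?case using der_set_subst(9)[of k m "code p"] AllS[of "k + 1" "m + 1"] by simp
next
  case (Mem t n)
  consider "n < k" | "n = k" | j where "n = j + 1" "k < j + 1"
    by (metis Suc_eq_plus1 less_imp_Suc_add linorder_neqE_nat less_add_Suc1 add.commute)
  then show ?case
  proof cases
    case 1 then show ?thesis using der_set_subst(3)[of n k m "code_tm t"] by simp
  next
    case 2 then show ?thesis using der_set_subst(4)[of k m "code_tm t"] by simp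
  next
    case (3 j) then show ?thesis using der_set_subst(5)[of k j m "code_tm t"] by simp
  qed
qed (simp_all add: der_set_subst)

context
  fixes S :: fm assumes S: "re_theory S"
begin

definition der_all :: "nat \<Rightarrow> bool" where "der_all = der (all_rules S) (\<lambda>_. 0) (\<lambda>_. {})"

lemma der_all_syn: "syn z \<Longrightarrow> der_all z" and der_all_dls: "der_ls z \<Longrightarrow> der_all z" and der_all_dset: "der_set z \<Longrightarrow> der_all z"
  unfolding syn_def der_ls_def der_set_def der_all_def by (erule der_mono[rotated], force simp: all_rules_def)+

lemma der_all_nth:
  assumes "i < 15" "hsat (side (proof_rules S ! i)) (penv (\<lambda>n. xs ! n) (\<lambda>_. 0)) (\<lambda>_. {})"
    "\<forall>q\<in>set (prems (proof_rules S ! i)). der_all (hval (\<lambda>n. xs ! n) q)"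
  shows "der_all (hval (\<lambda>n. xs ! n) (concl (proof_rules S ! i)))"
  unfolding der_all_def
proof (rule der_rule)
  have "length (proof_rules S) = 15" by (simp add: proof_rules_def Let_def)
  then show "proof_rules S ! i \<in> set (all_rules S)" using assms(1) nth_mem[of i "proof_rules S"] by (simp add: all_rules_def)
qed (use assms in \<open>simp_all add: der_all_def\<close>)

lemmas pf_expand = proof_rules_def Let_def judgement_defs code_defs

lemma der_all_rules:
  "der_all (jFm 1 m s x) \<Longrightarrow> der_all (jFm 1 m s y) \<Longrightarrow> der_all (jPr (cImp x (cImp y x)))"
  "der_all (jFm 1 m s x) \<Longrightarrow> der_all (jFm 1 m s y) \<Longrightarrow> der_all (jFm 1 m s z) \<Longrightarrow>
      der_all (jPr (cImp (cImp x (cImp y z)) (cImp (cImp x y) (cImp x z))))"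
  "der_all (jFm 1 m s x) \<Longrightarrow> der_all (jPr (cImp (cImp (cImp x cFls) cFls) x))"
  "der_all (jFm 1 m s x) \<Longrightarrow> der_all (jTm m t) \<Longrightarrow> der_all (jSubst 0 t x y) \<Longrightarrow> der_all (jPr (cImp (cAllN x) y))"
  "der_all (jFm 1 m s x) \<Longrightarrow> der_all (jFm 1 m s y) \<Longrightarrow> der_all (jPr (cImp (cAllN (cImp x y)) (cImp (cAllN x) (cAllN y))))"
  "der_all (jFm 1 m s x) \<Longrightarrow> der_all (jLift 0 x y) \<Longrightarrow> der_all (jPr (cImp x (cAllN y)))"
  "der_all (jFm 1 m s x) \<Longrightarrow> der_all (jSubstS 0 t x y) \<Longrightarrow> der_all (jPr (cImp (cAllS x) y))"
  "der_all (jFm 1 m s x) \<Longrightarrow> der_all (jFm 1 m s y) \<Longrightarrow> der_all (jPr (cImp (cAllS (cImp x y)) (cImp (cAllS x) (cAllS y))))"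
  "der_all (jFm 1 m s x) \<Longrightarrow> der_all (jLiftS 0 x y) \<Longrightarrow> der_all (jPr (cImp x (cAllS y)))"
  "der_all (jTm m t) \<Longrightarrow> der_all (jPr (cEq t t))"
  "der_all (jFm 1 m s x) \<Longrightarrow> der_all (jTm m t) \<Longrightarrow> der_all (jTm m u) \<Longrightarrow> der_all (jSubst 0 t x y) \<Longrightarrow> der_all (jSubst 0 u x z) \<Longrightarrow>
    der_all (jPr (cImp (cEq t u) (cImp y z)))"
  "der_all (jPr (cImp x y)) \<Longrightarrow> der_all (jPr x) \<Longrightarrow> der_all (jPr y)" "der_all (jPr x) \<Longrightarrow> der_all (jPr (cAllN x))"
      "der_all (jPr x) \<Longrightarrow> der_all (jPr (cAllS x))"
proof -
  note r = der_all_nth[of _ "[0, z, x, y, t, u, m, s]"]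
  note r1 = r[of 1]
  note r2 = r[of 2]
  note r3 = r[of 3]
  note r4 = r[of 4]
  note r5 = r[of 5]
  note r6 = r[of 6]
  note r7 = r[of 7]
  note r8 = r[of 8]
  note r9 = r[of 9]
  note r10 = r[of 10]
  note r11 = r[of 11]
  note r12 = r[of 12]
  note r13 = r[of 13]
  note r14 = r[of 14]
  show "der_all (jFm 1 m s x) \<Longrightarrow> der_all (jFm 1 m s y) \<Longrightarrow> der_all (jPr (cImp x (cImp y x)))"
    using r1 by (simp add: pf_expand infer_def)
  show "der_all (jFm 1 m s x) \<Longrightarrow> der_all (jFm 1 m s y) \<Longrightarrow> der_all (jFm 1 m s z) \<Longrightarrow>
      der_all (jPr (cImp (cImp x (cImp y z)) (cImp (cImp x y) (cImp x z))))"
    using r2 by (simp add: pf_expand infer_def)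
  show "der_all (jFm 1 m s x) \<Longrightarrow> der_all (jPr (cImp (cImp (cImp x cFls) cFls) x))"
    using r3 by (simp add: pf_expand infer_def)
  show "der_all (jFm 1 m s x) \<Longrightarrow> der_all (jTm m t) \<Longrightarrow> der_all (jSubst 0 t x y) \<Longrightarrow> der_all (jPr (cImp (cAllN x) y))"
    using r4 by (simp add: pf_expand infer_def)
  show "der_all (jFm 1 m s x) \<Longrightarrow> der_all (jFm 1 m s y) \<Longrightarrow> der_all (jPr (cImp (cAllN (cImp x y)) (cImp (cAllN x) (cAllN y))))"
    using r5 by (simp add: pf_expand infer_def)
  show "der_all (jFm 1 m s x) \<Longrightarrow> der_all (jLift 0 x y) \<Longrightarrow> der_all (jPr (cImp x (cAllN y)))"
    using r6 by (simp add: pf_expand infer_def)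
  show "der_all (jFm 1 m s x) \<Longrightarrow> der_all (jSubstS 0 t x y) \<Longrightarrow> der_all (jPr (cImp (cAllS x) y))"
    using r7 by (simp add: pf_expand infer_def)
  show "der_all (jFm 1 m s x) \<Longrightarrow> der_all (jFm 1 m s y) \<Longrightarrow> der_all (jPr (cImp (cAllS (cImp x y)) (cImp (cAllS x) (cAllS y))))"
    using r8 by (simp add: pf_expand infer_def)
  show "der_all (jFm 1 m s x) \<Longrightarrow> der_all (jLiftS 0 x y) \<Longrightarrow> der_all (jPr (cImp x (cAllS y)))"
    using r9 by (simp add: pf_expand infer_def)
  show "der_all (jTm m t) \<Longrightarrow> der_all (jPr (cEq t t))"
    using r10 by (simp add: pf_expand infer_def)
  show "der_all (jFm 1 m s x) \<Longrightarrow> der_all (jTm m t) \<Longrightarrow> der_all (jTm m u) \<Longrightarrow> der_all (jSubst 0 t x y) \<Longrightarrow> der_all (jSubst 0 u x z) \<Longrightarrow>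
    der_all (jPr (cImp (cEq t u) (cImp y z)))"
    using r11 by (simp add: pf_expand infer_def)
  show "der_all (jPr (cImp x y)) \<Longrightarrow> der_all (jPr x) \<Longrightarrow> der_all (jPr y)"
    using r12 by (simp add: pf_expand infer_def)
  show "der_all (jPr x) \<Longrightarrow> der_all (jPr (cAllN x))"
    using r13 by (simp add: pf_expand infer_def)
  show "der_all (jPr x) \<Longrightarrow> der_all (jPr (cAllS x))"
    using r14 by (simp add: pf_expand infer_def)
qed

lemma der_all_axiom: "hsat (matrix S) (case_nat v (\<lambda>_. x)) (\<lambda>_. {}) \<Longrightarrow> der_all (jFm 1 0 0 x) \<Longrightarrow> der_all (jPr x)"
proof -
  assume h: "hsat (matrix S) (case_nat v (\<lambda>_. x)) (\<lambda>_. {})" and x: "der_all (jFm 1 0 0 x)"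
  have "hsat (matrix S) (case_nat v (\<lambda>_. x)) (\<lambda>_. {}) = hsat (matrix S) (penv (\<lambda>n. [v, x, 0, 0, 0, 0, 0, 0] ! n) (\<lambda>_. 0))
      (\<lambda>_. {})"
    by (rule hsat_cong[OF re_theory_matrix(3)[OF S]]) (auto simp: less_Suc_eq numeral_2_eq_2 penv_def)
  then have "hsat (matrix S) (penv (\<lambda>n. [v, x, 0, 0, 0, 0, 0, 0] ! n) (\<lambda>_. 0)) (\<lambda>_. {})" using h by simp
  then show ?thesis using der_all_nth[of 0 "[v, x, 0, 0, 0, 0, 0, 0]"] x by (simp add: pf_expand infer_if_def)
qed

lemma der_all_tm: "closed_tm m t \<Longrightarrow> der_all (jTm m (code_tm t))"
  using syn_code_tm[of m t, where 'a=nat] by (simp add: der_all_syn)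
lemma der_all_fm: "closed m s p \<Longrightarrow> der_all (jFm 1 m s (code p))"
  using syn_code[of m s p "1::nat"] by (simp add: der_all_syn)

text \<open>The rules of \<open>proof_rules\<close> bound the variables of all formulas and terms in
  an axiom scheme by the same \<open>m\<close> and \<open>s\<close>.\<close>

lemma common_closed: "\<exists>k. closed k k p \<and> closed k k q \<and> closed k k r \<and> closed_tm k t \<and> closed_tm k u"
proof -
  obtain k where "closed k k (Imp (Imp p q) (Imp r (Eq t u)))" using closed_ex by blast
  then show ?thesis by auto
qed

text \<open>Every actual derivation has a code in the standard model. This supplies the elements of
  the sum order: what \<open>S\<close> proves about an order is derivable below some
  \<open>w\<close>.\<close>

theorem derives_dal: "axioms S \<turnstile> p \<Longrightarrow> der_all (jPr (code p))"
proof (induct rule: deriv.induct)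
  case (Ax p)
  then obtain v where "sentence p" and v: "hsat (matrix S) (case_nat v (case_nat (code p) (\<lambda>_. 0))) (\<lambda>_. {})"
    unfolding axioms_def is_axiom_def by (subst (asm) re_theory_matrix(1)[OF S]) (auto simp flip: hsat_nat)
  have "hsat (matrix S) (case_nat v (\<lambda>_. code p)) (\<lambda>_. {}) = hsat (matrix S) (case_nat v (case_nat (code p) (\<lambda>_. 0))) (\<lambda>_. {})"
    by (rule hsat_cong[OF re_theory_matrix(3)[OF S]]) (auto simp: less_Suc_eq numeral_2_eq_2)
  then have "hsat (matrix S) (case_nat v (\<lambda>_. code p)) (\<lambda>_. {})" using v by simp
  then show ?case using \<open>sentence p\<close> by (intro der_all_axiom der_all_fm)
next
  case (K p q)
  obtain k where "closed k k p" "closed k k q" using common_closed by blast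
  then show ?case using der_all_rules(1)[OF der_all_fm der_all_fm] by simp
next
  case (S p q r)
  obtain k where "closed k k p" "closed k k q" "closed k k r" using common_closed by blast
  then show ?case using der_all_rules(2)[OF der_all_fm der_all_fm der_all_fm] by simp
next
  case (DN p)
  obtain k where "closed k k p" using common_closed by blast
  then show ?case using der_all_rules(3)[OF der_all_fm] by simp
next
  case (ElimN p t)
  obtain k where "closed k k p" "closed_tm k t" using common_closed by blast
  then show ?case using der_all_rules(4)[OF der_all_fm der_all_tm der_all_dls[OF der_ls_subst_code]] by simp
next
  case (DistN p q)
  obtain k where "closed k k p" "closed k k q" using common_closed by blast
  then show ?case using der_all_rules(5)[OF der_all_fm der_all_fm] by simp
next
  case (VacN p)
  obtain k where "closed k k p" using common_closed by blast
  then show ?case using der_all_rules(6)[OF der_all_fm der_all_dls[OF der_ls_lift_code]] by simp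
next
  case (ElimS p m)
  obtain k where "closed k k p" using common_closed by blast
  then show ?case using der_all_rules(7)[OF der_all_fm der_all_dset[OF der_set_subst_code]] by simp
next
  case (DistS p q)
  obtain k where "closed k k p" "closed k k q" using common_closed by blast
  then show ?case using der_all_rules(8)[OF der_all_fm der_all_fm] by simp
next
  case (VacS p)
  obtain k where "closed k k p" using common_closed by blast
  then show ?case using der_all_rules(9)[OF der_all_fm der_all_dset[OF der_set_lift_code]] by simp
next
  case (Refl t)
  obtain k where "closed_tm k t" using common_closed by blast
  then show ?case using der_all_rules(10)[OF der_all_tm] by simp
next
  case (Leibniz s t p)
  obtain k where "closed k k p" "closed_tm k s" "closed_tm k t" using common_closed by blast
  then show ?case using der_all_rules(11)[OF der_all_fm der_all_tm der_all_tm der_all_dls[OF der_ls_subst_code]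
      der_all_dls[OF der_ls_subst_code]] by simp
next
  case (MP p q) then show ?case using der_all_rules(12) by simp
next
  case (GenN p) then show ?case using der_all_rules(13) by simp
next
  case (GenS p) then show ?case using der_all_rules(14) by simp
qed

corollary proves_provM: "proves S p \<Longrightarrow> provM S (code p)"
  using derives_dal unfolding proves_def der_all_def provM_def .

end

section \<open>The sum order in the standard model\<close>

definition leC :: "nat \<Rightarrow> nat \<Rightarrow> nat \<Rightarrow> bool" where
  "leC c x y \<longleftrightarrow> ev pr_rules {} c (cCons x (cCons y cNil)) 1"

lemma bev_mono: "bev u c x y \<Longrightarrow> u \<le> u' \<Longrightarrow> bev u' c x (y::'a::arith)"
  unfolding bev_def by (rule bder_mono)

lemma bev_leC: "bev u c x y \<Longrightarrow> leC c x y"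
  unfolding bev_def ev_def leC_def using bder_iff[OF closed_pr_rules pr_rules_ok] by blast

lemma bdec_bev:
  assumes "bdec u c x y" shows "bev u c x y \<longleftrightarrow> leC c x y"
proof
  assume le: "leC c x y"
  obtain v where v: "bder pr_rules u (jEv c (cCons x (cCons y cNil)) v)" using assms unfolding bdec_def by blast
  then have "ev pr_rules {} c (cCons x (cCons y cNil)) v"
    unfolding ev_def using bder_iff[OF closed_pr_rules pr_rules_ok] by blast
  then have "v = 1" using le[unfolded leC_def] by (rule ev_unique)
  then show "bev u c x y" using v by (simp add: bev_def)
qed (rule bev_leC)

lemma linM_leC:
  assumes "linM u c a" "x \<le> a" "y \<le> a"
  shows "bev u c x y \<longleftrightarrow> leC c x y" "leC c x y \<Longrightarrow> leC c x x \<and> leC c y y"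
    "leC c x x \<Longrightarrow> leC c y y \<Longrightarrow> leC c x y \<or> leC c y x" "leC c x y \<Longrightarrow> leC c y x \<Longrightarrow> x = y"
    "z \<le> a \<Longrightarrow> leC c x y \<Longrightarrow> leC c y z \<Longrightarrow> leC c x z"
proof -
  have b: "bev u c x y \<longleftrightarrow> leC c x y" if "x \<le> a" "y \<le> a" for x y
    by (rule bdec_bev) (use assms(1) that in \<open>simp add: linM_def\<close>)
  have l: "(bev u c x y \<longrightarrow> bev u c x x \<and> bev u c y y) \<and> (bev u c x x \<and> bev u c y y \<longrightarrow> bev u c x y \<or> bev u c y x) \<and>
     (bev u c x y \<and> bev u c y x \<longrightarrow> x = y) \<and> (\<forall>z\<le>a. bev u c x y \<and> bev u c y z \<longrightarrow> bev u c x z)"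
    using assms unfolding linM_def by blast
  show "bev u c x y \<longleftrightarrow> leC c x y" using b assms by blast
  show "leC c x y \<Longrightarrow> leC c x x \<and> leC c y y" "leC c x x \<Longrightarrow> leC c y y \<Longrightarrow> leC c x y \<or> leC c y x" "leC c x y \<Longrightarrow> leC c y x \<Longrightarrow> x = y"
    using l b[of x y] b[of y x] b[of x x] b[of y y] assms(2,3) by simp_all
  assume z: "z \<le> a" then show "leC c x y \<Longrightarrow> leC c y z \<Longrightarrow> leC c x z"
    using l b[of x y] b[of y z] b[of x z] assms(2,3) by simp
qed

definition leK :: "nat \<Rightarrow> nat \<Rightarrow> nat \<Rightarrow> bool" where
  "leK k x y \<longleftrightarrow> (\<exists>w c t. k = pair w (pair c t) \<and> leC c x y)"

context
  fixes S :: fm assumes S: "re_theory S"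
begin

definition elk :: "nat \<Rightarrow> nat \<Rightarrow> nat \<Rightarrow> bool" where "elk k a u \<longleftrightarrow> el S (pair k (pair a u))"

lemma elk_elemM: "elk k a u \<longleftrightarrow> (\<exists>w c t. k = pair w (pair c t) \<and> elemM S w c t a u)"
  unfolding elk_def el_def[OF S] by auto

text \<open>Linearity is checked only up to the argument of each element, but elements with the same
  \<open>k\<close> share their program and can borrow the check of one another.\<close>

lemma elk_lin:
  assumes "elk k a u" "elk k b v" "elk k c w"
  shows "leK k a a" "leK k a b \<or> leK k b a" "leK k a b \<Longrightarrow> leK k b a \<Longrightarrow> a = b" "leK k a b \<Longrightarrow> leK k b c \<Longrightarrow> leK k a c"
proof -
  obtain p q t where k: "k = pair p (pair q t)" and e: "elemM S p q t a u" "elemM S p q t b v" "elemM S p q t c w"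
    using assms unfolding elk_elemM by auto
  have K: "leK k x y \<longleftrightarrow> leC q x y" for x y unfolding leK_def k by auto
  have L: "linM u q a" "linM v q b" "linM w q c" "leC q a a" "leC q b b" "leC q c c"
    using elemM_D[OF S e(1)] elemM_D[OF S e(2)] elemM_D[OF S e(3)] by (simp_all add: bev_leC)
  \<comment> \<open>The largest of the three arguments; the linearity that its element has checked
    covers the other two.\<close>
  obtain m s where m: "linM s q m" "a \<le> m" "b \<le> m" "c \<le> m"
    using L(1-3) by (metis linorder_le_cases order.trans)
  note l = linM_leC[OF m(1)]
  show "leK k a a" "leK k a b \<or> leK k b a" unfolding K using L l(3)[of a b] m by simp_all
  show "leK k a b \<Longrightarrow> leK k b a \<Longrightarrow> a = b" unfolding K using l(4)[of a b] m by simp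
  show "leK k a b \<Longrightarrow> leK k b c \<Longrightarrow> leK k a c" unfolding K using l(5)[of a b c] m by simp
qed

lemma sumM_nat:
  "sumM S x y \<longleftrightarrow> y = 0 \<and> (x = 0 \<or> (\<exists>k a u. x = pair k (pair a u) \<and> elk k a u)) \<or>
    (\<exists>k a u k' a' u'. x = pair k (pair a u) \<and> y = pair k' (pair a' u') \<and> elk k a u \<and> elk k' a' u' \<and>
      (k < k' \<or> k = k' \<and> (a \<noteq> a' \<and> leK k a a' \<or> a = a' \<and> u \<le> u')))"
  (is "_ \<longleftrightarrow> ?T \<or> (\<exists>k a u k' a' u'. ?P k a u k' a' u')")
proof -
  \<comment> \<open>The bound of the element with the larger argument decides the comparison, and
    \<open>u + u'\<close> is at least as large. Larger bounds introduce no false comparisons, by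
    \<open>bev_leC\<close>.\<close>
  have b: "bev (u + u') q a a' \<longleftrightarrow> leC q a a'" if e: "elemM S p q t a u" "elemM S p q t a' u'" for p q t a u a' u'
  proof (cases "a \<le> a'")
    case True
    show ?thesis using linM_leC(1)[OF elemM_D(3)[OF S e(2)], of a a'] True bev_mono[of u' q a a' "u + u'"]
        bev_leC[of "u + u'" q a a'] by auto
  next
    case False
    then show ?thesis using linM_leC(1)[OF elemM_D(3)[OF S e(1)], of a a'] bev_mono[of u q a a' "u + u'"]
        bev_leC[of "u + u'" q a a'] by auto
  qed
  have T: "(\<exists>w c t a u. x = pair (pair w (pair c t)) (pair a u) \<and> elemM S w c t a u) \<longleftrightarrow>
      (\<exists>k a u. x = pair k (pair a u) \<and> elk k a u)"
    unfolding elk_elemM by blast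
  have "(\<exists>w c t a u w' c' t' a' u'. x = pair (pair w (pair c t)) (pair a u) \<and> elemM S w c t a u \<and>
        y = pair (pair w' (pair c' t')) (pair a' u') \<and> elemM S w' c' t' a' u' \<and>
        (pair w (pair c t) < pair w' (pair c' t') \<or> w = w' \<and> c = c' \<and> t = t' \<and>
          (a \<noteq> a' \<and> bev (u + u') c a a' \<or> a = a' \<and> u \<le> u'))) \<longleftrightarrow> (\<exists>k a u k' a' u'. ?P k a u k' a' u')" (is "?L = ?R")
  proof
    assume ?L
    then obtain w c t a u w' c' t' a' u' where h: "x = pair (pair w (pair c t)) (pair a u)" "elemM S w c t a u"
        "y = pair (pair w' (pair c' t')) (pair a' u')" "elemM S w' c' t' a' u'"
        "pair w (pair c t) < pair w' (pair c' t') \<or> w = w' \<and> c = c' \<and> t = t' \<and>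
          (a \<noteq> a' \<and> bev (u + u') c a a' \<or> a = a' \<and> u \<le> u')" by (elim exE conjE)
    have "?P (pair w (pair c t)) a u (pair w' (pair c' t')) a' u'"
      using h b[of w c t a u a' u'] unfolding elk_elemM leK_def by auto
    then show ?R by blast
  next
    assume ?R
    then obtain k a u k' a' u' where P: "?P k a u k' a' u'" by (elim exE)
    then obtain w c t w' c' t' where k: "k = pair w (pair c t)" "elemM S w c t a u" "k' = pair w' (pair c' t')"
        "elemM S w' c' t' a' u'"
      unfolding elk_elemM by blast
    have "x = pair (pair w (pair c t)) (pair a u) \<and> elemM S w c t a u \<and>
        y = pair (pair w' (pair c' t')) (pair a' u') \<and> elemM S w' c' t' a' u' \<and>
        (pair w (pair c t) < pair w' (pair c' t') \<or> w = w' \<and> c = c' \<and> t = t' \<and>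
          (a \<noteq> a' \<and> bev (u + u') c a a' \<or> a = a' \<and> u \<le> u'))"
      using P k b[of w c t a u a' u'] unfolding leK_def by auto
    then show ?L by blast
  qed
  then show ?thesis unfolding sumM_def T by blast
qed

definition lexk :: "nat \<Rightarrow> nat \<Rightarrow> nat \<Rightarrow> nat \<Rightarrow> nat \<Rightarrow> nat \<Rightarrow> bool" where
  "lexk k a u k' a' u' \<longleftrightarrow> k < k' \<or> k = k' \<and> (a \<noteq> a' \<and> leK k a a' \<or> a = a' \<and> u \<le> u')"

lemma el_elk: "el S (x::nat) \<longleftrightarrow> (\<exists>k a u. x = pair k (pair a u) \<and> elk k a u)"
  unfolding elk_def el_def[OF S] by auto

lemma elk_0: "elk k a u \<Longrightarrow> pair k (pair a u) \<noteq> 0"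
  using el_0[OF S] unfolding elk_def by metis

lemma sumM_elk:
  assumes "elk k a u" "elk k' a' u'"
  shows "sumM S (pair k (pair a u)) (pair k' (pair a' u')) \<longleftrightarrow> lexk k a u k' a' u'"
  using assms elk_0[OF assms(2)] by (auto simp: sumM_nat lexk_def)

lemma sumM_0: "sumM S (x::nat) 0 \<longleftrightarrow> x = 0 \<or> el S x"
  using elk_0[symmetric] unfolding sumM_nat el_elk by blast

lemma sumM_0': "sumM S 0 (x::nat) \<longleftrightarrow> x = 0"
  using elk_0[symmetric] unfolding sumM_nat by blast

lemma sumM_field: "sumM S x (y::nat) \<Longrightarrow> (x = 0 \<or> el S x) \<and> (y = 0 \<or> el S y)"
  by (auto simp: sumM_nat el_elk)

lemma sumo_rel: "(x, y) \<in> pr_rel (sumo S) \<longleftrightarrow> sumM S x y"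
  using leM_nat[OF sumo(1)[OF S]] sumo(2)[OF S, of x y] by simp

lemma lexk_props:
  assumes "elk k a u" "elk k' a' u'" "elk k2 a2 u2"
  shows "lexk k a u k a u" "lexk k a u k' a' u' \<or> lexk k' a' u' k a u"
    "lexk k a u k' a' u' \<Longrightarrow> lexk k' a' u' k a u \<Longrightarrow> k = k' \<and> a = a' \<and> u = u'"
    "lexk k a u k' a' u' \<Longrightarrow> lexk k' a' u' k2 a2 u2 \<Longrightarrow> lexk k a u k2 a2 u2"
proof -
  show "lexk k a u k a u" by (simp add: lexk_def)
  show "lexk k a u k' a' u' \<or> lexk k' a' u' k a u"
    using elk_lin(2)[of k a u a' u'] assms unfolding lexk_def by (metis linorder_neqE_nat nat_le_linear)
  show "lexk k a u k' a' u' \<Longrightarrow> lexk k' a' u' k a u \<Longrightarrow> k = k' \<and> a = a' \<and> u = u'"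
    using elk_lin(3)[of k a u a' u'] assms unfolding lexk_def by (metis dual_order.strict_trans less_irrefl order.antisym)
  assume h: "lexk k a u k' a' u'" "lexk k' a' u' k2 a2 u2"
  show "lexk k a u k2 a2 u2"
  proof (cases "k = k' \<and> k' = k2")
    case True
    then have e: "elk k a u" "elk k a' u'" "elk k a2 u2" using assms by auto
    from h True have "a \<noteq> a' \<and> leK k a a' \<or> a = a' \<and> u \<le> u'" "a' \<noteq> a2 \<and> leK k a' a2 \<or> a' = a2 \<and> u' \<le> u2"
      by (auto simp: lexk_def)
    then have "a \<noteq> a2 \<and> leK k a a2 \<or> a = a2 \<and> u \<le> u2"
      using elk_lin(4)[OF e] elk_lin(3)[OF e(1,2,1)] by auto
    then show ?thesis using True by (simp add: lexk_def)
  next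
    case False
    then show ?thesis using h by (auto simp: lexk_def)
  qed
qed

lemma Linear_order_sumo: "Linear_order (pr_rel (sumo S))"
proof -
  let ?r = "pr_rel (sumo S)"
  have F: "x \<in> Field ?r \<longleftrightarrow> x = 0 \<or> el S x" for x
  proof
    show "x \<in> Field ?r \<Longrightarrow> x = 0 \<or> el S x" using sumM_field unfolding Field_def sumo_rel Un_iff Domain_iff Range_iff by blast
    show "x = 0 \<or> el S x \<Longrightarrow> x \<in> Field ?r" using sumM_0[of x] by (auto simp: sumo_rel FieldI1)
  qed
  have r: "(x, x) \<in> ?r" if "x \<in> Field ?r" for x
    using that unfolding F sumo_rel el_elk by (auto simp: sumM_0 sumM_elk lexk_props(1))
  have t: "(x, z) \<in> ?r" if "(x, y) \<in> ?r" "(y, z) \<in> ?r" for x y z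
  proof (cases "z = 0")
    case True then show ?thesis using sumM_field that(1)[unfolded sumo_rel] by (simp add: sumo_rel sumM_0)
  next
    case z: False
    then have y: "y \<noteq> 0" using that(2) sumM_0'[of z] unfolding sumo_rel by metis
    then have x: "x \<noteq> 0" using that(1) sumM_0'[of y] unfolding sumo_rel by metis
    have "el S x" "el S y" "el S z" using x y z that[unfolded sumo_rel] sumM_field by blast+
    then obtain k a u k' a' u' k2 a2 u2 where e: "x = pair k (pair a u)" "elk k a u" "y = pair k' (pair a' u')" "elk k' a' u'"
      "z = pair k2 (pair a2 u2)" "elk k2 a2 u2" unfolding el_elk by blast
    then show ?thesis using that lexk_props(4)[OF e(2,4,6)] by (simp add: sumo_rel sumM_elk)
  qed
  have a: "x = y" if "(x, y) \<in> ?r" "(y, x) \<in> ?r" for x y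
  proof (cases "x = 0 \<or> y = 0")
    case True then show ?thesis using that sumM_0'[of x] sumM_0'[of y] unfolding sumo_rel by metis
  next
    case False
    then have "el S x" "el S y" using that[unfolded sumo_rel] sumM_field by blast+
    then obtain k a u k' a' u' where e: "x = pair k (pair a u)" "elk k a u" "y = pair k' (pair a' u')" "elk k' a' u'"
      unfolding el_elk by blast
    then show ?thesis using that lexk_props(3)[OF e(2,4,4)] by (simp add: sumo_rel sumM_elk)
  qed
  have tot: "(x, y) \<in> ?r \<or> (y, x) \<in> ?r" if "x \<in> Field ?r" "y \<in> Field ?r" for x y
  proof (cases "x = 0 \<or> y = 0")
    case True then show ?thesis using that unfolding F by (auto simp: sumo_rel sumM_0)
  next
    case False
    then have "el S x" "el S y" using that unfolding F by auto
    then obtain k a u k' a' u' where e: "x = pair k (pair a u)" "elk k a u" "y = pair k' (pair a' u')" "elk k' a' u'"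
      unfolding el_elk by blast
    then show ?thesis using lexk_props(2)[OF e(2,4,4)] by (simp add: sumo_rel sumM_elk)
  qed
  show ?thesis
    unfolding linear_order_on_def partial_order_on_def preorder_on_def refl_on_def trans_def antisym_def total_on_def
    using r t a tot by (auto simp: FieldI1 FieldI2)
qed

lemma pr_linear_order_sumo: "pr_linear_order (sumo S)"
  unfolding pr_linear_order_def using sumo(1)[OF S] Linear_order_sumo by simp

text \<open>There are finitely many arguments up to \<open>a\<close>, and the program halts on all
  of them. The largest of the bounds serves as the last component of the element for
  \<open>a\<close>.\<close>

lemma decided_exists:
  assumes e: "arity 2 e" shows "\<exists>u. \<forall>x\<le>a. \<forall>y\<le>a. bdec u (code_prim e) x y"
proof -
  have ex: "\<exists>u. bdec u (code_prim e) x y" for x y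
  proof -
    have "vals pr_rules {} (code_prim e) [x, y] (peval e [x, y])" by (rule vals_peval[OF e]) simp
    then have "der pr_rules (\<lambda>_. 0) (\<lambda>_. {}) (jEv (code_prim e) (cCons x (cCons y cNil)) (peval e [x, y]))"
      unfolding vals_def ev_def by simp
    then obtain u where "bder pr_rules u (jEv (code_prim e) (cCons x (cCons y cNil)) (peval e [x, y]))"
      unfolding bder_iff[OF closed_pr_rules pr_rules_ok] by blast
    then have "bder pr_rules (u + peval e [x, y] + 1) (jEv (code_prim e) (cCons x (cCons y cNil)) (peval e [x, y]))"
      by (rule bder_mono) simp
    then have "bdec (u + peval e [x, y] + 1) (code_prim e) x y" unfolding bdec_def
      by (intro exI[of _ "peval e [x, y]"]) simp
    then show ?thesis by blast
  qed
  then obtain U where U: "\<And>x y. bdec (U x y) (code_prim e) x y" by metis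
  have mono: "bdec u c x y \<Longrightarrow> u \<le> u' \<Longrightarrow> bdec u' c x y" for u u' c x y :: nat
    unfolding bdec_def using bder_mono order.strict_trans2 by blast
  let ?M = "Max ((\<lambda>(x, y). U x y) ` ({..a} \<times> {..a}))"
  have "U x y \<le> ?M" if "x \<le> a" "y \<le> a" for x y
    by (rule Max_ge) (use that in force)+
  then show ?thesis using mono[OF U] by blast
qed

text \<open>The derivation in \<open>S\<close>, the program and its numeral are fixed and give the
  index \<open>k\<close>; then \<open>a\<close> is sent to \<open>(k, (a, U a))\<close>, where
  \<open>U a\<close> decides the order up to \<open>a\<close>. So the order is copied into a single
  summand, below 0.\<close>

theorem embed_sumo:
  assumes e: "pr_linear_order e" and p: "proves S (Wrap (code_prim e))"
  obtains f where "\<And>a b. (a, b) \<in> pr_rel e \<Longrightarrow> (f a, f b) \<in> pr_rel (sumo S)" "inj f"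
    "\<And>a. a \<in> Field (pr_rel e) \<Longrightarrow> f a \<noteq> 0 \<and> (f a, 0) \<in> pr_rel (sumo S)"
proof -
  let ?c = "code_prim e"
  have ar: "arity 2 e" and lin: "Linear_order (pr_rel e)" using e unfolding pr_linear_order_def by simp_all
  have le: "leC ?c x y \<longleftrightarrow> (x, y) \<in> pr_rel e" for x y
    using leM_nat[OF ar, of x y] by (simp add: leM_def leC_def)
  define t where "t = code_tm (num ?c)"
  have "provM S (wrapc t)" using proves_provM[OF S p] mc_Wrap[of ?c, where 'a=nat] by (simp add: t_def)
  then obtain w1 where w1: "bder (all_rules S) w1 (jPr (wrapc t))"
    unfolding provM_def bder_iff[OF closed_all_rules[OF S] all_rules_ok[OF re_theory_matrix(4,5)[OF S]]] by blast
  have "numr ?c t" using numr_num[of ?c t] by (simp add: t_def)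
  then obtain w2 where w2: "bder num_rules w2 (jNum ?c t)"
    unfolding numr_def bder_iff[OF closed_num_rules num_rules_ok] by blast
  define w where "w = w1 + w2"
  have w: "bder (all_rules S) w (jPr (wrapc t))" "bder num_rules w (jNum ?c t)"
    using bder_mono[OF w1, of w] bder_mono[OF w2, of w] by (simp_all add: w_def)
  define k where "k = pair w (pair ?c t)"
  obtain U where U: "\<And>a x y. x \<le> a \<Longrightarrow> y \<le> a \<Longrightarrow> bdec (U a) ?c x y" using decided_exists[OF ar] by metis
  have bev: "bev (U a) ?c x y \<longleftrightarrow> (x, y) \<in> pr_rel e" if "x \<le> a" "y \<le> a" for a x y
    using bdec_bev[OF U[OF that]] le by simp
  have L: "linM (U a) ?c a" for a
    using lin unfolding linM_def linear_order_on_def partial_order_on_def preorder_on_def refl_on_def trans_def antisym_def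
        total_on_def
    by (simp add: U bev) (metis FieldI1 FieldI2)
  have el: "elk k a (U a)" if "(a, a) \<in> pr_rel e" for a
    unfolding elk_elemM k_def elemM_def using w L[of a] bev[of a a a] that by blast
  have refl: "(a, a) \<in> pr_rel e" if "a \<in> Field (pr_rel e)" for a
    using lin that unfolding linear_order_on_def partial_order_on_def preorder_on_def refl_on_def by blast
  show thesis
  proof (rule that[of "\<lambda>a. pair k (pair a (U a))"])
    fix a b assume ab: "(a, b) \<in> pr_rel e"
    then have "elk k a (U a)" "elk k b (U b)" using el refl FieldI1 FieldI2 by metis+
    moreover have "leK k a b" unfolding leK_def using ab le k_def by blast
    ultimately show "(pair k (pair a (U a)), pair k (pair b (U b))) \<in> pr_rel (sumo S)"
      by (auto simp: sumo_rel sumM_elk lexk_def)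
  next
    show "inj (\<lambda>a. pair k (pair a (U a)))" by (rule injI) simp
  next
    fix a assume "a \<in> Field (pr_rel e)"
    then have a: "elk k a (U a)" using el refl by blast
    then have "el S (pair k (pair a (U a)))" unfolding elk_def .
    then show "pair k (pair a (U a)) \<noteq> 0 \<and> (pair k (pair a (U a)), 0) \<in> pr_rel (sumo S)"
      using elk_0[OF a] by (simp add: sumo_rel sumM_0)
  qed
qed

end

section \<open>From provable to actual well-foundedness\<close>

lemma closed_WF: "sentence (WF e)"
proof -
  have "closed 2 1 (Der pr_rules (jEv (cst (code_prim e)) (cCons (Var 0) (cCons (Var 1) cNil)) 1))"
    by (rule closed_Der) (auto simp: pr_rules_def Let_def infer_def ev_defs alg_defs)
  then show ?thesis by (simp add: WF_body wf_body_def numeral_2_eq_2)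
qed

text \<open>\<open>WF e\<close> begins with its only set quantifier, so the soundness of
  \<open>T\<close> makes it true; and in the standard model this quantifier ranges over all
  sets.\<close>

lemma Well_order_WF:
  assumes "Pi11_sound T" "proves T (WF e)" "pr_linear_order e" shows "Well_order (pr_rel e)" "wfM e TYPE(nat)"
proof -
  have "Pi11 (WF e)" unfolding Pi11_def WF_body using arithmetical_wf_body by blast
  then have "true_sentence (WF e)" using assms(1,2) closed_WF unfolding Pi11_sound_def by blast
  then have "hsat (WF e) (\<lambda>_. 0 :: nat) (\<lambda>_. {})" by (simp add: true_sentence_def hsat_nat)
  then show wf: "wfM e TYPE(nat)" by (subst (asm) hsat_WF) simp_all
  have "wf (pr_rel e - Id)"
  proof (rule wfI_min)
    fix x :: nat and Q assume "x \<in> Q"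
    then obtain z where "z \<in> Q" "\<forall>y\<in>Q. leM e y z \<longrightarrow> y = z" using wf unfolding wfM_def SS_nat_def by blast
    then show "\<exists>z\<in>Q. \<forall>y. (y, z) \<in> pr_rel e - Id \<longrightarrow> y \<notin> Q"
      using assms(3) leM_nat unfolding pr_linear_order_def by blast
  qed
  then show "Well_order (pr_rel e)" using assms(3) unfolding well_order_on_def pr_linear_order_def by blast
qed

section \<open>Countable ordinals\<close>

text \<open>Otherwise \<open>s\<close> would be isomorphic to a proper initial segment of
  \<open>r\<close>, and composition with \<open>f\<close> would be a strictly increasing self-map of
  \<open>r\<close> that sends some element below itself. A minimal such element is
  contradictory.\<close>

lemma strict_map_ordLeq:
  assumes r: "Well_order r" and s: "Well_order s"
    and f: "\<And>a b. (a, b) \<in> r \<Longrightarrow> (f a, f b) \<in> s" "inj_on f (Field r)"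
  shows "(r, s) \<in> ordLeq"
proof (rule ccontr)
  assume "(r, s) \<notin> ordLeq"
  then have "(s, r) \<in> ordLess" using not_ordLeq_iff_ordLess[OF s r] by simp
  then obtain x0 where x0: "x0 \<in> Field r" and "(s, Restr r (underS r x0)) \<in> ordIso"
    using ordLess_iff_ordIso_Restr[OF r s] by blast
  then obtain g where g: "iso s (Restr r (underS r x0)) g" unfolding ordIso_def by blast
  define h where "h x = g (f x)" for x
  have fF: "f a \<in> Field s" if "a \<in> Field r" for a
    using that f(1) unfolding Field_def by blast
  have gU: "g b \<in> underS r x0" if "b \<in> Field s" for b
    using g that Field_Restr_subset[of r "underS r x0"] unfolding iso_iff2 by (blast dest: bij_betwE)
  have ginj: "inj_on g (Field s)" using g unfolding iso_iff2 bij_betw_def by blast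
  have h_mono: "(h a, h b) \<in> r" if "(a, b) \<in> r" for a b
    using g f(1)[OF that] fF that unfolding iso_iff2 h_def by (blast intro: FieldI1 FieldI2)
  have h_inj: "h a \<noteq> h b" if "a \<in> Field r" "b \<in> Field r" "a \<noteq> b" for a b
    using inj_onD[OF ginj _ fF[OF that(1)] fF[OF that(2)]] inj_onD[OF f(2) _ that(1,2)] that(3) unfolding h_def by blast
  have hx0: "(h x0, x0) \<in> r - Id" using gU[OF fF[OF x0]] unfolding h_def underS_def by auto
  have wf: "wf (r - Id)" using r unfolding well_order_on_def by blast
  obtain m where m: "(h m, m) \<in> r - Id" and min: "\<And>y. (y, m) \<in> r - Id \<Longrightarrow> (h y, y) \<notin> r - Id"
  proof (rule wfE_min[OF wf, of x0 "{x. (h x, x) \<in> r - Id}"])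
    show "x0 \<in> {x. (h x, x) \<in> r - Id}" using hx0 by simp
    fix z assume z: "z \<in> {x. (h x, x) \<in> r - Id}" "\<And>y. (y, z) \<in> r - Id \<Longrightarrow> y \<notin> {x. (h x, x) \<in> r - Id}"
    show thesis by (rule that[of z]) (use z in auto)
  qed
  have "(h (h m), h m) \<in> r" using h_mono m by blast
  moreover have "h (h m) \<noteq> h m" using h_inj[of "h m" m] m by (auto intro: FieldI1 FieldI2)
  ultimately show False using min[OF m] by blast
qed

text \<open>The ordered sum of the given well-orders, carried by pairs. It ensures that suprema
  defined by \<open>LEAST\<close> exist for the sets that occur.\<close>

lemma countable_bound:
  assumes r: "\<And>i::nat. Well_order (r i :: nat rel)"
  shows "\<exists>s :: nat rel. Well_order s \<and> (\<forall>i. (r i, s) \<in> ordLeq)"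
proof -
  define s where "s = {(pair i x, pair j y) | i x j y. x \<in> Field (r i) \<and> y \<in> Field (r j) \<and> (i < j \<or> i = j \<and> (x, y) \<in> r i)}"
  have sI: "(pair i x, pair j y) \<in> s \<longleftrightarrow> x \<in> Field (r i) \<and> y \<in> Field (r j) \<and> (i < j \<or> i = j \<and> (x, y) \<in> r i)" for i x j y
    unfolding s_def by auto
  have sE: "\<exists>i x j y. u = pair i x \<and> v = pair j y" if "(u, v) \<in> s" for u v
    using that unfolding s_def by auto
  have lin: "(x, x) \<in> r i" if "x \<in> Field (r i)" for x i
    using r[of i] that unfolding order_on_defs refl_on_def by blast
  have tr: "(x, z) \<in> r i" if "(x, y) \<in> r i" "(y, z) \<in> r i" for x y z i
    using r[of i] that unfolding order_on_defs trans_def by blast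
  have an: "x = y" if "(x, y) \<in> r i" "(y, x) \<in> r i" for x y i
    using r[of i] that unfolding order_on_defs antisym_def by blast
  have to: "(x, y) \<in> r i \<or> (y, x) \<in> r i" if "x \<in> Field (r i)" "y \<in> Field (r i)" for x y i
    using r[of i] that lin unfolding order_on_defs total_on_def by metis
  have F: "\<exists>i x. u = pair i x \<and> x \<in> Field (r i)" if "u \<in> Field s" for u
    using that unfolding Field_def s_def by auto
  have "Linear_order s"
    unfolding linear_order_on_def partial_order_on_def preorder_on_def refl_on_def
  proof (intro conjI ballI)
    show "s \<subseteq> Field s \<times> Field s" by (auto intro: FieldI1 FieldI2)
    fix u assume "u \<in> Field s" then show "(u, u) \<in> s" using F[of u] lin by (auto simp: sI)
  next
    show "trans s"
    proof (rule transI)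
      fix u v w assume h: "(u, v) \<in> s" "(v, w) \<in> s"
      then obtain i x j y k z where "u = pair i x" "v = pair j y" "w = pair k z" using sE by metis
      then show "(u, w) \<in> s" using h tr by (auto simp: sI)
    qed
    show "antisym s"
    proof (rule antisymI)
      fix u v assume h: "(u, v) \<in> s" "(v, u) \<in> s"
      then obtain i x j y where "u = pair i x" "v = pair j y" using sE by metis
      then show "u = v" using h an by (auto simp: sI)
    qed
    show "total_on (Field s) s"
    proof (rule total_onI)
      fix u v assume "u \<in> Field s" "v \<in> Field s"
      then obtain i x j y where "u = pair i x" "v = pair j y" "x \<in> Field (r i)" "y \<in> Field (r j)" using F by metis
      then show "(u, v) \<in> s \<or> (v, u) \<in> s" using to by (auto simp: sI) (metis linorder_neqE_nat to)
    qed
  qed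
  moreover have "wf (s - Id)"
  proof (rule wfI_min)
    fix u :: nat and Q assume u: "u \<in> Q"
    show "\<exists>z\<in>Q. \<forall>y. (y, z) \<in> s - Id \<longrightarrow> y \<notin> Q"
    proof (cases "\<exists>i x. pair i x \<in> Q \<and> x \<in> Field (r i)")
      case False
      have "\<forall>y. (y, u) \<in> s - Id \<longrightarrow> y \<notin> Q" using False unfolding s_def by blast
      then show ?thesis using u by blast
    next
      case True
      define i where "i = (LEAST i. \<exists>x. pair i x \<in> Q \<and> x \<in> Field (r i))"
      have i: "\<exists>x. pair i x \<in> Q \<and> x \<in> Field (r i)" unfolding i_def by (rule LeastI_ex) (rule True)
      have imin: "\<not> (pair j y \<in> Q \<and> y \<in> Field (r j))" if "j < i" for j y
        using not_less_Least[OF that[unfolded i_def]] by blast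
      have "wf (r i - Id)" using r[of i] unfolding well_order_on_def by blast
      then obtain x where x: "pair i x \<in> Q" "x \<in> Field (r i)"
          and xmin: "\<And>y. (y, x) \<in> r i - Id \<Longrightarrow> \<not> (pair i y \<in> Q \<and> y \<in> Field (r i))"
        using wfE_min[of "r i - Id" _ "{x. pair i x \<in> Q \<and> x \<in> Field (r i)}"] i by (metis (mono_tags, lifting) mem_Collect_eq)
      have "\<forall>y. (y, pair i x) \<in> s - Id \<longrightarrow> y \<notin> Q"
      proof (intro allI impI)
        fix y assume y: "(y, pair i x) \<in> s - Id"
        then obtain j z where z: "y = pair j z" using sE by blast
        then show "y \<notin> Q" using y imin[of j z] xmin[of z] by (auto simp: sI)
      qed
      then show ?thesis using x by blast
    qed
  qed
  ultimately have s: "Well_order s" unfolding well_order_on_def by blast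
  have "(r i, s) \<in> ordLeq" for i
    by (rule strict_map_ordLeq[OF r s, of i "pair i"]) (auto simp: sI inj_on_def intro: FieldI1 FieldI2)
  then show ?thesis using s by blast
qed

lemma cord_le: "Well_order r \<Longrightarrow> Well_order s \<Longrightarrow> order_type r \<le> order_type s \<longleftrightarrow> (r, s) \<in> ordLeq"
  unfolding order_type_def by (rule less_eq_cord.abs_eq) (auto intro: ordIso_reflexive)
lemma cord_less: "Well_order r \<Longrightarrow> Well_order s \<Longrightarrow> order_type r < order_type s \<longleftrightarrow> (r, s) \<in> ordLess"
  unfolding order_type_def by (rule less_cord.abs_eq) (auto intro: ordIso_reflexive)
lemma cord_eq: "Well_order r \<Longrightarrow> Well_order s \<Longrightarrow> (r, s) \<in> ordIso \<Longrightarrow> order_type r = order_type s"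
  using cord_le[of r s] cord_le[of s r] ordIso_iff_ordLeq by (metis order.antisym)

lemma cord_cases: obtains r where "Well_order r" "a = order_type r"
proof -
  have q: "Quotient (\<lambda>r s. (r, s) \<in> ordIso) abs_cord rep_cord cr_cord" by (rule Quotient_cord)
  have "(rep_cord a, rep_cord a) \<in> ordIso" using Quotient_rep_reflp[OF q] by blast
  then have "Well_order (rep_cord a)" unfolding ordIso_def by blast
  moreover have "a = order_type (rep_cord a)" unfolding order_type_def by (rule Quotient_abs_rep[OF q, symmetric])
  ultimately show thesis by (rule that)
qed

lemma cord_less_segment:
  assumes r: "Well_order r" and a: "a < order_type r"
  shows "\<exists>x\<in>Field r. a = order_type (Restr r (underS r x))"
proof -
  obtain q where q: "Well_order q" "a = order_type q" by (rule cord_cases)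
  then have "(q, r) \<in> ordLess" using a cord_less[OF q(1) r] by simp
  then obtain x where "x \<in> Field r" "(q, Restr r (underS r x)) \<in> ordIso" using ordLess_iff_ordIso_Restr[OF r q(1)] by blast
  then show ?thesis using cord_eq[OF q(1) Well_order_Restr[OF r]] q(2) by blast
qed

lemma segment_less: "Well_order r \<Longrightarrow> x \<in> Field r \<Longrightarrow> order_type (Restr r (underS r x)) < order_type r"
  using cord_less[OF Well_order_Restr] underS_Restr_ordLess[of r x] by (metis FieldI1 empty_iff)

lemma osuc_le: "a < b \<Longrightarrow> osuc a \<le> b" unfolding osuc_def by (rule Least_le)
text \<open>\<open>osuc\<close> is a \<open>LEAST\<close>, which has its intended value only if
  something lies above \<open>a\<close>; the premise supplies such an element.\<close>

lemma less_osuc: "a < b \<Longrightarrow> a < osuc a" unfolding osuc_def by (rule LeastI)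
lemma osup_least: "(\<And>a. a \<in> A \<Longrightarrow> a \<le> b) \<Longrightarrow> osup A \<le> b" unfolding osup_def by (rule Least_le) blast
lemma osup_upper: assumes "\<And>a. a \<in> A \<Longrightarrow> a \<le> b" "x \<in> A" shows "x \<le> osup A"
proof -
  have "\<forall>a\<in>A. a \<le> osup A" unfolding osup_def by (rule LeastI[of _ b]) (use assms(1) in blast)
  then show ?thesis using assms(2) by blast
qed


section \<open>Reflection ranks and proof-theoretic ordinals\<close>

lemma extension_derives: "extension_of T A \<Longrightarrow> A \<turnstile> p \<Longrightarrow> proves T p"
  unfolding extension_of_def proves_def using derives_trans by blast

lemma proves_mp: "proves T (Imp p q) \<Longrightarrow> proves T p \<Longrightarrow> proves T q"
  unfolding proves_def by (rule MP)

lemma extension_ACA0_plus: "extension_of T ACA0_plus \<Longrightarrow> extension_of T ACA0"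
  by (simp add: extension_of_def ACA0_plus_def)

definition wo_set :: "fm \<Rightarrow> cord set" where
  "wo_set T = {order_type (pr_rel e) | e. pr_linear_order e \<and> proves T (WF e)}"

lemma WO_ordinal_wo_set: "WO_ordinal T = osup (wo_set T)"
  by (simp add: WO_ordinal_def wo_set_def)

instance prim_fun :: countable by countable_datatype

lemma wo_set_bounded: assumes "Pi11_sound T" shows "\<exists>b. \<forall>a\<in>wo_set T. a \<le> b"
proof -
  define r where "r i = (if pr_linear_order (from_nat i) \<and> proves T (WF (from_nat i)) then pr_rel (from_nat i) else {})" for i
  have "Well_order (r i)" for i
    using Well_order_WF(1)[OF assms] by (auto simp: r_def order_on_defs refl_on_def trans_def antisym_def total_on_def)
  from countable_bound[of r, OF this] obtain s :: "nat rel" where s: "Well_order s" "\<And>i. (r i, s) \<in> ordLeq" by blast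
  have "a \<le> order_type s" if a: "a \<in> wo_set T" for a
  proof -
    obtain e where e: "a = order_type (pr_rel e)" "pr_linear_order e" "proves T (WF e)" using a unfolding wo_set_def by blast
    have "r (to_nat e) = pr_rel e" using e by (simp add: r_def)
    then have "(pr_rel e, s) \<in> ordLeq" using s(2)[of "to_nat e"] by simp
    then show ?thesis using cord_le[OF Well_order_WF(1)[OF assms e(3,2)] s(1)] e(1) by simp
  qed
  then show ?thesis by blast
qed

lemma le_WO_ordinal: "Pi11_sound T \<Longrightarrow> a \<in> wo_set T \<Longrightarrow> a \<le> WO_ordinal T"
  unfolding WO_ordinal_wo_set using osup_upper wo_set_bounded by metis

lemma WO_ordinal_le: "(\<And>a. a \<in> wo_set T \<Longrightarrow> a \<le> b) \<Longrightarrow> WO_ordinal T \<le> b"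
  unfolding WO_ordinal_wo_set by (rule osup_least)

lemma WO_ordinal_less:
  assumes "(S, T) \<in> reflection_order" shows "WO_ordinal S < WO_ordinal T"
proof -
  have S: "extension_of S ACA0" "Pi11_sound S" "re_theory S" and T: "extension_of T ACA0" "Pi11_sound T"
      and rfn: "proves T (RFN S)"
    using assms by (simp_all add: reflection_order_def extension_of_def)
  let ?s = "pr_rel (sumo S)"
  have wf: "proves T (WF (sumo S))" by (rule proves_mp[OF extension_derives[OF T(1) ACA0_derives(3)[OF S(3)]] rfn])
  have lin: "pr_linear_order (sumo S)" by (rule pr_linear_order_sumo[OF S(3)])
  have W: "Well_order ?s" by (rule Well_order_WF(1)[OF T(2) wf lin])
  have "(0, 0) \<in> ?s" using sumM_0[OF S(3), of 0] by (simp add: sumo_rel[OF S(3)])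
  then have F: "0 \<in> Field ?s" by (rule FieldI1)
  let ?u = "Restr ?s (underS ?s 0)"
  have "WO_ordinal S \<le> order_type ?u"
  proof (rule WO_ordinal_le)
    fix a assume "a \<in> wo_set S"
    then obtain e where e: "a = order_type (pr_rel e)" "pr_linear_order e" "proves S (WF e)" unfolding wo_set_def by blast
    have "proves S (Wrap (code_prim e))" by (rule proves_mp[OF extension_derives[OF S(1) ACA0_derives(4)] e(3)])
    then obtain f where f: "\<And>a b. (a, b) \<in> pr_rel e \<Longrightarrow> (f a, f b) \<in> ?s" "inj f"
      "\<And>a. a \<in> Field (pr_rel e) \<Longrightarrow> f a \<noteq> 0 \<and> (f a, 0) \<in> ?s" using embed_sumo[OF S(3) e(2)] by blast
    have We: "Well_order (pr_rel e)" by (rule Well_order_WF(1)[OF S(2) e(3,2)])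
    have "(pr_rel e, ?u) \<in> ordLeq"
    proof (rule strict_map_ordLeq[OF We Well_order_Restr[OF W]])
      fix a b assume ab: "(a, b) \<in> pr_rel e"
      then show "(f a, f b) \<in> ?u" using f(1)[OF ab] f(3)[of a] f(3)[of b] by (auto simp: underS_def intro: FieldI1 FieldI2)
    qed (rule inj_on_subset[OF f(2) subset_UNIV])
    then show "a \<le> order_type ?u" using cord_le[OF We Well_order_Restr[OF W]] e(1) by simp
  qed
  also have "\<dots> < order_type ?s" by (rule segment_less[OF W F])
  also have "\<dots> \<le> WO_ordinal T" by (rule le_WO_ordinal[OF T(2)]) (use wf lin in \<open>auto simp: wo_set_def\<close>)
  finally show ?thesis .
qed

lemma wf_reflection_order: "wf reflection_order"
proof (rule wf_subset)
  show "wf (inv_image {(a, b :: cord). a < b} WO_ordinal)" by (rule wf_inv_image) (rule wf)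
  show "reflection_order \<subseteq> inv_image {(a, b). a < b} WO_ordinal" using WO_ordinal_less by (auto simp: inv_image_def)
qed

lemma reflection_rank_unfold:
  "reflection_rank T = osup {osuc (reflection_rank S) | S. (S, T) \<in> reflection_order}"
proof -
  have "rank reflection_order T = osup {osuc (cut (rank reflection_order) reflection_order T S) | S. (S, T) \<in> reflection_order}"
    unfolding rank_def by (subst wfrec[OF wf_reflection_order]) simp
  also have "{osuc (cut (rank reflection_order) reflection_order T S) | S. (S, T) \<in> reflection_order} =
      {osuc (rank reflection_order S) | S. (S, T) \<in> reflection_order}"
    by (auto simp: cut_apply) (metis cut_apply)
  finally show ?thesis by (simp add: reflection_rank_def)
qed

lemma rank_le_WO: "reflection_rank T \<le> WO_ordinal T"
proof (induct T rule: wf_induct_rule[OF wf_reflection_order])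
  case (1 T)
  show ?case unfolding reflection_rank_unfold[of T]
    by (rule osup_least) (use 1 WO_ordinal_less in \<open>auto intro!: osuc_le intro: order.strict_trans1\<close>)
qed

text \<open>For \<open>osuc\<close> and \<open>osup\<close> to have their intended values, bounds
  must exist; they come from the upper bound of ranks by proof-theoretic ordinals.\<close>

lemma rank_less: assumes "(S, T) \<in> reflection_order" shows "reflection_rank S < reflection_rank T"
proof -
  have lt: "reflection_rank S' < WO_ordinal T" if "(S', T) \<in> reflection_order" for S'
    using rank_le_WO[of S'] WO_ordinal_less[OF that] by (rule order.strict_trans1)
  have "osuc (reflection_rank S) \<le> reflection_rank T"
    unfolding reflection_rank_unfold[of T]
    by (rule osup_upper[of _ "WO_ordinal T"]) (use lt assms in \<open>auto intro: osuc_le\<close>)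
  then show ?thesis using less_osuc[OF lt[OF assms]] by (rule order.strict_trans2[rotated])
qed

lemma omega_jumps_nat: "omega_jumps TYPE(nat)"
  unfolding omega_jumps_def
proof
  fix X :: "nat set"
  let ?J = "\<lambda>Z. {x. jumpM Z x}"
  let ?Y = "{z. \<exists>n x. z = pair n x \<and> x \<in> (?J ^^ n) X}"
  have Y: "pair n x \<in> ?Y \<longleftrightarrow> x \<in> (?J ^^ n) X" for n x by auto
  have "omega_jump X ?Y" unfolding omega_jump_def Y by simp
  then show "\<exists>Y\<in>SS. omega_jump X Y" by (auto simp: SS_nat_def)
qed

section \<open>Ranks of the iterated theories\<close>

lemma itth_extension: "extension_of (itth e y) ACA0"
  unfolding extension_of_def
proof (intro conjI ballI re_theory_itth)
  fix p assume "p \<in> ACA0"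
  from Bsent_derives[OF this] show "proves (itth e y) p" unfolding proves_def
    by (rule derives_trans) (auto simp: axioms_itth intro: deriv.Ax)
qed

text \<open>The standard model has omega-jumps, so \<open>RFN_itth\<close> applies to it and makes
  all reflection axioms of the theory true there.\<close>

lemma itth_sound: assumes wf: "wfM e TYPE(nat)" shows "Pi11_sound (itth e y)"
  unfolding Pi11_sound_def
proof (intro allI impI, elim conjE)
  fix p assume "proves (itth e y) p"
  have "hsat a \<epsilon> E" if "a \<in> axioms (itth e y)" for a and \<epsilon> :: "nat \<Rightarrow> nat" and E
  proof -
    have "hsat (RFN (itth e y')) \<epsilon> E" for y' by (rule RFN_itth[OF omega_jumps_nat wf]) (simp add: SS_nat_def)
    then show ?thesis using that hsat_AXs[of e _ \<epsilon> E \<epsilon> E] by (auto simp: axioms_itth hsat_Bsent)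
  qed
  then have "hsat p (\<lambda>_. 0 :: nat) (\<lambda>_. {})"
    using \<open>proves (itth e y) p\<close> unfolding proves_def by (rule_tac soundness) (auto simp: SS_nat_def)
  then show "true_sentence p" by (simp add: true_sentence_def hsat_nat)
qed

lemma itth_step:
  assumes "wfM e TYPE(nat)" "arity 2 e" "(y', y) \<in> pr_rel e" "y' \<noteq> y"
  shows "(itth e y', itth e y) \<in> reflection_order"
proof -
  have "AXs e y' \<in> axioms (itth e y)" using assms(3,4) leM_nat[OF assms(2)] by (auto simp: axioms_itth)
  then have "proves (itth e y) (AXs e y')" unfolding proves_def by (rule deriv.Ax)
  then have "proves (itth e y) (RFN (itth e y'))"
    by (rule proves_mp[OF extension_derives[OF itth_extension ACA0_derives(2)]])
  then show ?thesis by (simp add: reflection_order_def itth_extension itth_sound[OF assms(1)])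
qed

text \<open>If the rank at \<open>y\<close> were smaller than the type of the segment below
  \<open>y\<close>, it would be the type of the segment below some \<open>x\<close> below
  \<open>y\<close>. By induction this is at most the rank at \<open>x\<close>, which is strictly
  smaller than the rank at \<open>y\<close>. The argument with segments replaces computations with
  \<open>osuc\<close> and \<open>osup\<close>.\<close>

lemma segment_rank:
  assumes wf: "wfM e TYPE(nat)" and e: "pr_linear_order e" and r: "Well_order (pr_rel e)" and y: "y \<in> Field (pr_rel e)"
  shows "order_type (Restr (pr_rel e) (underS (pr_rel e) y)) \<le> reflection_rank (itth e y)"
proof -
  have "wf (pr_rel e - Id)" using r unfolding well_order_on_def by blast
  then show ?thesis using y
proof (induct y rule: wf_induct_rule)
  case (less y)
  let ?r = "pr_rel e" let ?U = "underS ?r y"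
  have tr: "(a, c) \<in> ?r" if "(a, b) \<in> ?r" "(b, c) \<in> ?r" for a b c
    using r that unfolding order_on_defs trans_def by blast
  have an: "a = b" if "(a, b) \<in> ?r" "(b, a) \<in> ?r" for a b
    using r that unfolding order_on_defs antisym_def by blast
  show ?case
  proof (rule ccontr)
    assume "\<not> ?thesis"
    then have "reflection_rank (itth e y) < order_type (Restr ?r ?U)" by simp
    from cord_less_segment[OF Well_order_Restr[OF r] this] obtain x where x: "x \<in> Field (Restr ?r ?U)"
      "reflection_rank (itth e y) = order_type (Restr (Restr ?r ?U) (underS (Restr ?r ?U) x))" by blast
    have xU: "x \<in> ?U" using x(1) Field_Restr_subset[of ?r ?U] by blast
    have xy: "(x, y) \<in> ?r" "x \<noteq> y" using xU by (simp_all add: underS_def)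
    have "b \<in> ?U" if "b \<in> underS ?r x" for b
      using that tr[of b x y] an[of x y] xy by (auto simp: underS_def)
    then have "underS (Restr ?r ?U) x = underS ?r x" using xU by (auto simp: underS_def)
    moreover have "Restr (Restr ?r ?U) (underS ?r x) = Restr ?r (underS ?r x)"
      using \<open>\<And>b. b \<in> underS ?r x \<Longrightarrow> b \<in> ?U\<close> by blast
    ultimately have "reflection_rank (itth e y) = order_type (Restr ?r (underS ?r x))" using x(2) by simp
    also have "\<dots> \<le> reflection_rank (itth e x)" using xy by (intro less.hyps) (auto intro: FieldI1)
    also have "\<dots> < reflection_rank (itth e y)"
      by (rule rank_less[OF itth_step[OF wf _ xy]]) (use e in \<open>simp add: pr_linear_order_def\<close>)
    finally show False by simp
  qed
qed
qed

theorem theorem1p4: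
  assumes "extension_of T ACA0_plus" and "Pi11_sound T"
  shows "reflection_rank T = WO_ordinal T"
proof (rule order.antisym[OF rank_le_WO], rule WO_ordinal_le)
  fix a assume "a \<in> wo_set T"
  then obtain e where e: "a = order_type (pr_rel e)" "pr_linear_order e" "proves T (WF e)" unfolding wo_set_def by blast
  let ?r = "pr_rel e"
  note T = extension_ACA0_plus[OF assms(1)]
  have W: "Well_order ?r" "wfM e TYPE(nat)" using Well_order_WF[OF assms(2) e(3,2)] by blast+
  have step: "(itth e y, T) \<in> reflection_order" for y
  proof -
    have "proves T omega_jump_axiom" using assms(1) by (simp add: extension_of_def ACA0_plus_def)
    then have "proves T (RFN (itth e y))"
      using proves_mp[OF proves_mp[OF extension_derives[OF T ACA0_derives(1)]] e(3)] by blast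
    then show ?thesis using T assms(2) by (simp add: reflection_order_def itth_extension itth_sound[OF W(2)])
  qed
  show "a \<le> reflection_rank T"
  proof (rule ccontr)
    assume "\<not> a \<le> reflection_rank T"
    \<comment> \<open>The argument of \<open>segment_rank\<close> once more, with \<open>T\<close>
      in the place of the theory at a point above the whole order.\<close>
    then have "reflection_rank T < order_type ?r" using e(1) by simp
    then obtain x where x: "x \<in> Field ?r" "reflection_rank T = order_type (Restr ?r (underS ?r x))"
      using cord_less_segment[OF W(1)] by blast
    then have "reflection_rank T \<le> reflection_rank (itth e x)" using segment_rank[OF W(2) e(2) W(1) x(1)] by simp
    also have "\<dots> < reflection_rank T" by (rule rank_less[OF step])
    finally show False by simp
  qed
qed

end
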